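(* Assume $\mathsf{ZF} + \mathsf{AD}^+ + V = L(\mathscr{P}(\mathbb{R}))$. Let $\kappa$ be an ordinal and let $\langle E_\alpha : \alpha < \kappa\rangle$ be a sequence of equivalence relations on $\mathbb{R}$ such that for every $\alpha<\kappa$, $\mathbb{R}/E_\alpha$ is in bijection with $\mathbb{R}$ and every $E_\alpha$-class is countable. Then there is an injection of $\bigsqcup_{\alpha < \kappa} \mathbb{R}/E_\alpha$ into $\mathbb{R} \times \kappa$.
   Context: $\mathsf{AD}^+$ is the conjunction of: (1) $\mathsf{DC}_{\mathbb{R}}$; (2) every $A \subseteq \mathbb{R}$ has an $\infty$-Borel code, i.e. there are a set of ordinals $S$ and a formula $\varphi$ with $A = \{x \in \mathbb{R} : L[S,x] \models \varphi(S,x)\}$; (3) for every $\lambda < \Theta$ (the least ordinal which is not a surjective image of $\mathbb{R}$), every $A \subseteq \mathbb{R}$ and every continuous $\pi : {}^\omega\lambda \to \mathbb{R}$, the set $\pi^{-1}[A]$ is determined. $\bigsqcup_{\alpha<\kappa} \mathbb{R}/E_\alpha$ denotes the formal disjoint union $\{(\alpha, c) : \alpha < \kappa,\ c \in \mathbb{R}/E_\alpha\}$. *)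

theory Defs
  imports Main
begin

text \<open>
  HOL proves the axiom of choice, so a theorem of ZF + AD$^+$ cannot be stated about HOL's own reals
  and sets. It is stated about an arbitrary first-order structure \<open>(UNIV :: 'a set, \<in>\<^sub>M)\<close> satisfying
  the axioms. Every set-theoretic notion below is interpreted inside that structure: all quantifiers
  over sets, functions, strategies, relations etc. range over elements of \<^typ>\<open>'a\<close>.
\<close>

section \<open>First-order formulas of set theory\<close>

datatype fm =
    Mem nat nat
  | Eq nat nat
  | Neg fm
  | Conj fm fm
  | All nat fm

primrec fv :: "fm \<Rightarrow> nat set" where
  "fv (Mem i j) = {i, j}"
| "fv (Eq i j) = {i, j}"
| "fv (Neg \<phi>) = fv \<phi>"
| "fv (Conj \<phi> \<psi>) = fv \<phi> \<union> fv \<psi>"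
| "fv (All i \<phi>) = fv \<phi> - {i}"

locale set_structure =
  fixes mem :: "'a \<Rightarrow> 'a \<Rightarrow> bool"  (infix "\<in>\<^sub>M" 50)
begin

text \<open>Satisfaction in the substructure with universe \<open>C\<close>.\<close>

primrec sat :: "'a set \<Rightarrow> fm \<Rightarrow> (nat \<Rightarrow> 'a) \<Rightarrow> bool" where
  "sat C (Mem i j) e \<longleftrightarrow> e i \<in>\<^sub>M e j"
| "sat C (Eq i j) e \<longleftrightarrow> e i = e j"
| "sat C (Neg \<phi>) e \<longleftrightarrow> \<not> sat C \<phi> e"
| "sat C (Conj \<phi> \<psi>) e \<longleftrightarrow> sat C \<phi> e \<and> sat C \<psi> e"
| "sat C (All i \<phi>) e \<longleftrightarrow> (\<forall>x\<in>C. sat C \<phi> (e(i := x)))"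

definition ext :: "'a \<Rightarrow> 'a set" where
  "ext a = {x. x \<in>\<^sub>M a}"

end

section \<open>Models of ZF\<close>

text \<open>In the two schemes \<open>e\<close> supplies the parameters.\<close>

locale zf_model = set_structure +
  assumes extensionality: "\<And>a b. (\<forall>x. x \<in>\<^sub>M a \<longleftrightarrow> x \<in>\<^sub>M b) \<Longrightarrow> a = b"
    and foundation: "\<And>a. \<exists>x. x \<in>\<^sub>M a \<Longrightarrow> \<exists>x. x \<in>\<^sub>M a \<and> \<not> (\<exists>y. y \<in>\<^sub>M a \<and> y \<in>\<^sub>M x)"
    and pairing: "\<And>a b. \<exists>c. \<forall>x. x \<in>\<^sub>M c \<longleftrightarrow> x = a \<or> x = b"
    and union: "\<And>a. \<exists>u. \<forall>x. x \<in>\<^sub>M u \<longleftrightarrow> (\<exists>y. y \<in>\<^sub>M a \<and> x \<in>\<^sub>M y)"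
    and power_set: "\<And>a. \<exists>p. \<forall>x. x \<in>\<^sub>M p \<longleftrightarrow> (\<forall>y. y \<in>\<^sub>M x \<longrightarrow> y \<in>\<^sub>M a)"
    and infinity: "\<exists>w. (\<exists>z. z \<in>\<^sub>M w \<and> (\<forall>x. \<not> x \<in>\<^sub>M z)) \<and>
      (\<forall>x. x \<in>\<^sub>M w \<longrightarrow> (\<exists>y. y \<in>\<^sub>M w \<and> (\<forall>z. z \<in>\<^sub>M y \<longleftrightarrow> z \<in>\<^sub>M x \<or> z = x)))"
    and separation: "\<And>\<phi> e a. \<exists>b. \<forall>x. x \<in>\<^sub>M b \<longleftrightarrow> x \<in>\<^sub>M a \<and> sat UNIV \<phi> (e(0 := x))"
    and replacement: "\<And>\<phi> e a. (\<forall>x. x \<in>\<^sub>M a \<longrightarrow> (\<exists>!y. sat UNIV \<phi> (e(0 := x, 1 := y)))) \<Longrightarrow>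
      \<exists>b. \<forall>y. y \<in>\<^sub>M b \<longleftrightarrow> (\<exists>x. x \<in>\<^sub>M a \<and> sat UNIV \<phi> (e(0 := x, 1 := y)))"

context set_structure
begin

section \<open>Basic set theory inside the structure\<close>

text \<open>
  \<open>coll X\<close> is the element of the structure whose members are exactly those of \<open>X\<close>. It is
  meaningful only if there is such an element; in a model of ZF this is so for every use below.
\<close>

definition coll :: "'a set \<Rightarrow> 'a" where
  "coll X = (THE a. ext a = X)"

definition empty :: 'a where
  "empty = coll {}"

definition succ :: "'a \<Rightarrow> 'a" where
  "succ a = coll (insert a (ext a))"

definition pow :: "'a \<Rightarrow> 'a" where
  "pow a = coll {x. ext x \<subseteq> ext a}"

definition opair :: "'a \<Rightarrow> 'a \<Rightarrow> 'a" where
  "opair a b = coll {coll {a}, coll {a, b}}"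

definition cprod :: "'a \<Rightarrow> 'a \<Rightarrow> 'a" where
  "cprod a b = coll {opair x y | x y. x \<in> ext a \<and> y \<in> ext b}"

definition transitive :: "'a \<Rightarrow> bool" where
  "transitive a \<longleftrightarrow> (\<forall>x\<in>ext a. ext x \<subseteq> ext a)"

definition trcl :: "'a \<Rightarrow> 'a" where
  "trcl a = coll {x. \<forall>t. transitive t \<and> ext a \<subseteq> ext t \<longrightarrow> x \<in> ext t}"

definition ordinal :: "'a \<Rightarrow> bool" where
  "ordinal a \<longleftrightarrow> transitive a \<and> (\<forall>x\<in>ext a. transitive x)"

definition limit :: "'a \<Rightarrow> bool" where
  "limit a \<longleftrightarrow> ordinal a \<and> a \<noteq> empty \<and> (\<nexists>b. a = succ b)"

definition omega :: 'a where
  "omega = coll {n. ordinal n \<and> (\<forall>m\<in>ext (succ n). \<not> limit m)}"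

text \<open>Evenness for the elements of \<open>omega\<close>, which may be nonstandard.\<close>

definition even_nat :: "'a \<Rightarrow> bool" where
  "even_nat n \<longleftrightarrow> n \<in> ext omega \<and>
    (\<forall>z. empty \<in> ext z \<and> (\<forall>m\<in>ext z. succ (succ m) \<in> ext z) \<longrightarrow> n \<in> ext z)"

definition odd_nat :: "'a \<Rightarrow> bool" where
  "odd_nat n \<longleftrightarrow> n \<in> ext omega \<and> \<not> even_nat n"

definition func :: "'a \<Rightarrow> 'a \<Rightarrow> 'a \<Rightarrow> bool" where
  "func f a b \<longleftrightarrow> ext f \<subseteq> ext (cprod a b) \<and> (\<forall>x\<in>ext a. \<exists>!y. opair x y \<in> ext f)"

definition funs :: "'a \<Rightarrow> 'a \<Rightarrow> 'a" where
  "funs a b = coll {f. func f a b}"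

definition app :: "'a \<Rightarrow> 'a \<Rightarrow> 'a" where
  "app f x = (THE y. opair x y \<in> ext f)"

definition restr :: "'a \<Rightarrow> 'a \<Rightarrow> 'a" where
  "restr f a = coll {p \<in> ext f. \<exists>x\<in>ext a. \<exists>y. p = opair x y}"

definition injection :: "'a \<Rightarrow> 'a \<Rightarrow> 'a \<Rightarrow> bool" where
  "injection f a b \<longleftrightarrow> func f a b \<and> inj_on (app f) (ext a)"

definition surjection :: "'a \<Rightarrow> 'a \<Rightarrow> 'a \<Rightarrow> bool" where
  "surjection f a b \<longleftrightarrow> func f a b \<and> app f ` ext a = ext b"

definition bijection :: "'a \<Rightarrow> 'a \<Rightarrow> 'a \<Rightarrow> bool" where
  "bijection f a b \<longleftrightarrow> func f a b \<and> bij_betw (app f) (ext a) (ext b)"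

definition countable :: "'a \<Rightarrow> bool" where
  "countable a \<longleftrightarrow> (\<exists>f. injection f a omega)"

text \<open>A real is an element of the Baire space.\<close>

definition reals :: 'a where
  "reals = funs omega omega"

definition equiv_rel :: "'a \<Rightarrow> 'a \<Rightarrow> bool" where
  "equiv_rel a r \<longleftrightarrow> ext r \<subseteq> ext (cprod a a) \<and>
    (\<forall>x\<in>ext a. opair x x \<in> ext r) \<and>
    (\<forall>x y. opair x y \<in> ext r \<longrightarrow> opair y x \<in> ext r) \<and>
    (\<forall>x y z. opair x y \<in> ext r \<and> opair y z \<in> ext r \<longrightarrow> opair x z \<in> ext r)"

definition eq_class :: "'a \<Rightarrow> 'a \<Rightarrow> 'a" where
  "eq_class r x = coll {y. opair x y \<in> ext r}"

definition quot :: "'a \<Rightarrow> 'a \<Rightarrow> 'a" where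
  "quot a r = coll (eq_class r ` ext a)"

text \<open>\<open>seq\<close> is a function with domain \<open>\<kappa>\<close> whose values are relations on \<open>reals\<close>.\<close>

definition disjoint_union_quot :: "'a \<Rightarrow> 'a \<Rightarrow> 'a" where
  "disjoint_union_quot \<kappa> seq =
    coll {opair \<alpha> c | \<alpha> c. \<alpha> \<in> ext \<kappa> \<and> c \<in> ext (quot reals (app seq \<alpha>))}"

section \<open>Relative constructibility\<close>

text \<open>
  \<open>def_closed Ps A F\<close>: the set \<open>F\<close> of pairs \<open>(n, R)\<close> with \<open>R \<subseteq> A\<^sup>n\<close> contains the relations given by
  the atomic formulas of the structure \<open>(A, \<in>, P \<inter> A)\<close>, with \<open>P\<close> ranging over \<open>Ps\<close>, and is closed
  under complement, intersection and projection along the last coordinate. The least such \<open>F\<close>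
  consists of the relations first-order definable without parameters over that structure. Since
  \<open>n\<close> and \<open>F\<close> range over the structure, this is definability by formulas in the sense of the
  structure.
\<close>

definition def_closed :: "'a list \<Rightarrow> 'a \<Rightarrow> 'a \<Rightarrow> bool" where
  "def_closed Ps A F \<longleftrightarrow>
    (\<forall>n\<in>ext omega. \<forall>i\<in>ext n. \<forall>j\<in>ext n.
      opair n (coll {s. func s n A \<and> app s i \<in>\<^sub>M app s j}) \<in> ext F \<and>
      opair n (coll {s. func s n A \<and> app s i = app s j}) \<in> ext F) \<and>
    (\<forall>P\<in>set Ps. \<forall>n\<in>ext omega. \<forall>i\<in>ext n.
      opair n (coll {s. func s n A \<and> app s i \<in>\<^sub>M P}) \<in> ext F) \<and>
    (\<forall>n R. n \<in> ext omega \<and> opair n R \<in> ext F \<longrightarrow>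
      opair n (coll (ext (funs n A) - ext R)) \<in> ext F) \<and>
    (\<forall>n R S. n \<in> ext omega \<and> opair n R \<in> ext F \<and> opair n S \<in> ext F \<longrightarrow>
      opair n (coll (ext R \<inter> ext S)) \<in> ext F) \<and>
    (\<forall>n R. n \<in> ext omega \<and> opair (succ n) R \<in> ext F \<longrightarrow>
      opair n (coll {s. func s n A \<and>
        (\<exists>a\<in>ext A. coll (insert (opair n a) (ext s)) \<in> ext R)}) \<in> ext F)"

definition definable_rel :: "'a list \<Rightarrow> 'a \<Rightarrow> 'a \<Rightarrow> 'a \<Rightarrow> bool" where
  "definable_rel Ps A n R \<longleftrightarrow> n \<in> ext omega \<and> (\<forall>F. def_closed Ps A F \<longrightarrow> opair n R \<in> ext F)"

text \<open>The subsets of \<open>A\<close> definable over \<open>(A, \<in>, P \<inter> A)\<close> from parameters \<open>s \<in> A\<^sup>n\<close>.\<close>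

definition Def :: "'a list \<Rightarrow> 'a \<Rightarrow> 'a" where
  "Def Ps A = coll {X. \<exists>n\<in>ext omega. \<exists>s R. func s n A \<and> definable_rel Ps A (succ n) R \<and>
    X = coll {a \<in> ext A. coll (insert (opair n a) (ext s)) \<in> ext R}}"

text \<open>\<open>f\<close> is the sequence of levels up to and including \<open>\<alpha>\<close>, starting from \<open>T\<close>.\<close>

definition L_levels :: "'a list \<Rightarrow> 'a \<Rightarrow> 'a \<Rightarrow> 'a \<Rightarrow> bool" where
  "L_levels Ps T \<alpha> f \<longleftrightarrow> ordinal \<alpha> \<and> (\<exists>b. func f (succ \<alpha>) b) \<and>
    app f empty = T \<and>
    (\<forall>\<beta>\<in>ext \<alpha>. app f (succ \<beta>) = Def Ps (app f \<beta>)) \<and>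
    (\<forall>\<beta>\<in>ext (succ \<alpha>). limit \<beta> \<longrightarrow> app f \<beta> = coll (\<Union>\<gamma>\<in>ext \<beta>. ext (app f \<gamma>)))"

definition L_class :: "'a list \<Rightarrow> 'a \<Rightarrow> 'a set" where
  "L_class Ps T = {y. \<exists>\<alpha> f. L_levels Ps T \<alpha> f \<and> y \<in> ext (app f \<alpha>)}"

text \<open>\<open>L[S,x]\<close>, where \<open>S\<close> and \<open>x\<close> are used as predicates, and \<open>L(X)\<close>.\<close>

definition L_bracket :: "'a \<Rightarrow> 'a \<Rightarrow> 'a set" where
  "L_bracket S x = L_class [S, x] empty"

definition L_paren :: "'a \<Rightarrow> 'a set" where
  "L_paren X = L_class [] (trcl (coll {X}))"

definition V_eq_L_Pow_reals :: bool where
  "V_eq_L_Pow_reals \<longleftrightarrow> L_paren (pow reals) = UNIV"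

section \<open>AD$^+$\<close>

definition DC_reals :: bool where
  "DC_reals \<longleftrightarrow> (\<forall>r. ext r \<subseteq> ext (cprod reals reals) \<and>
      (\<forall>x\<in>ext reals. \<exists>y\<in>ext reals. opair x y \<in> ext r) \<longrightarrow>
    (\<exists>f. func f omega reals \<and> (\<forall>n\<in>ext omega. opair (app f n) (app f (succ n)) \<in> ext r)))"

text \<open>
  \<open>\<phi>\<close> is an actual formula, as truth in the proper class \<open>L[S,x]\<close> is not definable uniformly in
  codes of formulas. The environment assigns \<open>S\<close> to variable 0 and \<open>x\<close> to variable 1.
\<close>

definition infinity_Borel_code :: "'a \<Rightarrow> fm \<Rightarrow> 'a \<Rightarrow> bool" where
  "infinity_Borel_code S \<phi> A \<longleftrightarrow> (\<forall>\<alpha>\<in>ext S. ordinal \<alpha>) \<and> fv \<phi> \<subseteq> {0, 1} \<and>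
    ext A = {x \<in> ext reals. sat (L_bracket S x) \<phi> ((\<lambda>_. S)(1 := x))}"

text \<open>The ordinal 0 is excluded: it is trivially not a surjective image of the reals.\<close>

definition Theta :: 'a where
  "Theta = (THE \<theta>. ordinal \<theta> \<and> \<theta> \<noteq> empty \<and> (\<nexists>f. surjection f reals \<theta>) \<and>
    (\<forall>\<alpha>\<in>ext \<theta>. \<alpha> \<noteq> empty \<longrightarrow> (\<exists>f. surjection f reals \<alpha>)))"

text \<open>The product topology on \<open>\<^sup>\<omega>\<lambda>\<close>, with \<open>\<lambda>\<close> discrete.\<close>

definition seq_open :: "'a \<Rightarrow> 'a \<Rightarrow> bool" where
  "seq_open l U \<longleftrightarrow> ext U \<subseteq> ext (funs omega l) \<and>
    (\<forall>f\<in>ext U. \<exists>n\<in>ext omega. \<forall>g\<in>ext (funs omega l). restr g n = restr f n \<longrightarrow> g \<in> ext U)"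

definition preimage :: "'a \<Rightarrow> 'a \<Rightarrow> 'a \<Rightarrow> 'a" where
  "preimage p a B = coll {x \<in> ext a. app p x \<in> ext B}"

definition continuous_to_reals :: "'a \<Rightarrow> 'a \<Rightarrow> bool" where
  "continuous_to_reals l p \<longleftrightarrow> func p (funs omega l) reals \<and>
    (\<forall>U. seq_open omega U \<longrightarrow> seq_open l (preimage p (funs omega l) U))"

text \<open>
  The game on \<open>l\<close> with payoff \<open>B\<close>: player I moves at even stages, player II at odd stages, and
  player I wins iff the resulting sequence is in \<open>B\<close>.
\<close>

definition fin_seqs :: "'a \<Rightarrow> 'a" where
  "fin_seqs l = coll {s. \<exists>n\<in>ext omega. func s n l}"

definition determined :: "'a \<Rightarrow> 'a \<Rightarrow> bool" where
  "determined l B \<longleftrightarrow>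
    (\<exists>\<sigma>. func \<sigma> (fin_seqs l) l \<and>
      (\<forall>f. func f omega l \<and> (\<forall>n. even_nat n \<longrightarrow> app f n = app \<sigma> (restr f n)) \<longrightarrow> f \<in> ext B)) \<or>
    (\<exists>\<tau>. func \<tau> (fin_seqs l) l \<and>
      (\<forall>f. func f omega l \<and> (\<forall>n. odd_nat n \<longrightarrow> app f n = app \<tau> (restr f n)) \<longrightarrow> f \<notin> ext B))"

text \<open>In the third clause \<open>l = 0\<close> is excluded, since no moves are possible in a game on 0.\<close>

definition AD_plus :: bool where
  "AD_plus \<longleftrightarrow> DC_reals \<and>
    (\<forall>A. ext A \<subseteq> ext reals \<longrightarrow> (\<exists>S \<phi>. infinity_Borel_code S \<phi> A)) \<and>
    (\<forall>l\<in>ext Theta. l \<noteq> empty \<longrightarrow>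
      (\<forall>A p. ext A \<subseteq> ext reals \<and> continuous_to_reals l p \<longrightarrow>
        determined l (preimage p (funs omega l) A)))"

end

end

theory Submission
  imports Defs
begin

text \<open>
  Let \<open>C\<close> be a class of some \<open>E\<^sub>\<alpha>\<close>. Forcing with finite sequences from the countable set \<open>C\<close>
  adds a real \<open>x\<close> whose columns enumerate \<open>C\<close>; for a set \<open>A\<close> of reals let \<open>F A\<close> be the set of
  conditions that force \<open>x \<in> A\<close>. The set \<open>Y\<close> of reals whose columns are pairwise
  \<open>E\<^sub>\<beta>\<close>-equivalent for some \<open>\<beta>\<close> has an \<open>\<infinity>\<close>-Borel code, and the evaluation of the code meets
  only a well-ordered set \<open>X\<close> of sets of reals, which does not depend on \<open>C\<close>. If some \<open>A\<close> in \<open>X\<close> is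
  such that \<open>F A\<close> is nonempty and decides column 0, then the least such \<open>A\<close> selects an element of
  \<open>C\<close>; if this happens for all \<open>C\<close>, then mapping \<open>(\<alpha>, C)\<close> to the selected element and \<open>\<alpha>\<close> is the
  required injection.

  Otherwise consider the sets \<open>F A\<close>, for \<open>A\<close> in \<open>X\<close>, as conditions themselves. There are only
  countably many of them, because under determinacy well-orderable sets of reals are countable. By
  induction along the code their generic reals lie in \<open>Y\<close>, and as well-ordered unions of meager
  sets are meager, one \<open>\<beta>\<close> works below some condition. Column 0 of the generic real avoids every
  countable set, in particular every \<open>E\<^sub>\<beta>\<close>-class, so the real that a bijection of
  \<open>\<real>/E\<^sub>\<beta>\<close> with \<open>\<real>\<close> assigns to it is not decided, and two conditions force different values
  of one of its digits. Exchanging the first \<open>k\<close> columns with the next \<open>k\<close> moves the second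
  condition away from the first. A generic real below both has \<open>E\<^sub>\<beta>\<close>-equivalent columns 0 and \<open>k\<close> to
  which different reals are assigned, a contradiction.
\<close>

section \<open>Definability with parameters\<close>

text \<open>The classes of all the relations come with no simultaneous enumeration, so whatever is
  done to a class \<open>C\<close> has to be canonical; therefore \<open>X\<close> is fixed before
  any class is considered. Forcing is read as category: \<open>p\<close> forces \<open>W\<close> if
  countably many dense sets suffice to bring every generic sequence below \<open>p\<close> into
  \<open>W\<close>. Over countable orders generic sequences exist outright, and Banach-Mazur games
  give every invariant set the property of Baire, which does the work of the forcing theorem. The
  sets \<open>F A\<close> are only that part of the Cohen algebra of \<open>C\<close> which
  \<open>X\<close> can see. A filter generic for this part is not given as the trace of one generic
  for the whole, so that its real lies in \<open>A\<close> iff the filter enters \<open>F A\<close>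
  is a statement to be proved, and it is obtained for the sets met along the code. The code is a
  formula evaluated in \<open>L[S,x]\<close> rather than a tree, so induction along it runs through
  names: functions on the reals that evaluate to elements of \<open>L[S,x]\<close>. As the model may
  be ill-founded when seen from outside, every separation, induction and recursion needs a proof
  that the property involved is definable in it.\<close>

primrec ren :: "(nat => nat) => fm => fm" where
  "ren r (Mem i j) = Mem (r i) (r j)"
| "ren r (Eq i j) = Eq (r i) (r j)"
| "ren r (Neg p) = Neg (ren r p)"
| "ren r (Conj p q) = Conj (ren r p) (ren r q)"
| "ren r (All i p) = All (r i) (ren r p)"

definition mix :: "(nat => 'b) => (nat => 'b) => nat => 'b" where
  "mix g e n = (if even n then e (n div 2) else g (n div 2))"

text \<open>Syntax-directed rules for definability with parameters. With \<open>intro dfi\<close>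
  they discharge the side condition that later uses of separation, replacement, induction and
  recursion carry.\<close>

named_theorems dfi

text \<open>Parameter slot \<open>k\<close>, which is variable \<open>2 * k + 1\<close>, moves to
  slot \<open>2 * k\<close> for \<open>c = 1\<close> and to slot \<open>2 * k + 1\<close> for
  \<open>c = 3\<close>. Thus the parameter sequences of two formulas can be interleaved into
  one.\<close>

lemma inj_odd: assumes "odd (c::nat)" shows "inj (%n::nat. if even n then n else 4 * (n div 2) + c)"
proof (rule injI)
  fix x y :: nat
  assume a: "(if even x then x else 4 * (x div 2) + c) = (if even y then y else 4 * (y div 2) + c)"
  have o: "odd (4 * k + c)" for k :: nat using assms by simp
  show "x = y"
  proof (cases "even x")
    case True
    then show ?thesis using a o[of "y div 2"] by (cases "even y") auto
  next
    case False
    then have "odd y" using a o[of "x div 2"] by (cases "even y") auto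
    then have "x div 2 = y div 2" using a False by simp
    then show ?thesis using False \<open>odd y\<close> by (metis odd_two_times_div_two_succ)
  qed
qed
text \<open>Prepares a quantifier: environment variable 0 becomes variable 1, the other environment
  variables move down by one place, and the parameters move up by one slot, which frees variable 1
  for binding.\<close>

lemma inj_rot: "inj (%n::nat. if n = 0 then 1 else if even n then n - 2 else n + 2)"
proof (rule injI)
  fix x y :: nat
  assume a: "(if x = 0 then 1 else if even x then x - 2 else x + 2) =
    (if y = 0 then 1 else if even y then y - 2 else y + 2)"
  have e: "even n ==> n \<noteq> 0 ==> n \<ge> 2 \<and> even (n - 2)" for n :: nat by (auto elim!: evenE)
  show "x = y"
  proof (cases "even x \<and> x \<noteq> 0"; cases "even y \<and> y \<noteq> 0")
    assume "even x \<and> x \<noteq> 0" "\<not> (even y \<and> y \<noteq> 0)"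
    then show ?thesis using a e[of x] by (cases "y = 0") (metis odd_one, metis even_add even_numeral)
  next
    assume "\<not> (even x \<and> x \<noteq> 0)" "even y \<and> y \<noteq> 0"
    then show ?thesis using a e[of y] by (cases "x = 0") (metis odd_one, metis even_add even_numeral)
  next
    assume "even x \<and> x \<noteq> 0" "even y \<and> y \<noteq> 0"
    then show ?thesis using a e[of x] e[of y] by simp
  next
    assume "\<not> (even x \<and> x \<noteq> 0)" "\<not> (even y \<and> y \<noteq> 0)"
    then show ?thesis using a by (auto split: if_splits)
  qed
qed

context set_structure
begin

text \<open>\<open>ren\<close> renames bound variables too. Injectivity of \<open>r\<close> excludes
  capture: in the quantifier case it makes the update of the environment commute with the
  renaming.\<close>

lemma sat_ren: "inj r ==> sat C (ren r p) e = sat C p (e \<circ> r)"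
proof (induction p arbitrary: e)
  case (All i p)
  have "(e(r i := x)) \<circ> r = (e \<circ> r)(i := x)" for x
    using All.prems by (auto simp: fun_eq_iff inj_eq)
  then show ?case using All by (simp del: fun_upd_apply o_apply add: comp_def[symmetric])
qed auto

text \<open>A predicate on environments is definable if it is given by a formula; the odd variables of
  the formula hold the parameters, the even ones the environment.\<close>

definition DF :: "((nat => 'a) => bool) => bool" where
  "DF P \<longleftrightarrow> (\<exists>p g. \<forall>e. P e = sat UNIV p (mix g e))"

definition DT :: "((nat => 'a) => 'a) => bool" where
  "DT t \<longleftrightarrow> DF (%e. e 0 = t (%n. e (Suc n)))"

lemma DF_neg[dfi]: assumes "DF P" shows "DF (%e. \<not> P e)"
proof -
  obtain p g where "\<forall>e. P e = sat UNIV p (mix g e)" using assms unfolding DF_def by blast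
  then have "\<forall>e. (\<not> P e) = sat UNIV (Neg p) (mix g e)" by simp
  then show ?thesis unfolding DF_def by blast
qed

lemma DF_conj[dfi]: assumes "DF P" "DF Q" shows "DF (%e. P e \<and> Q e)"
proof -
  obtain p g where p: "\<forall>e. P e = sat UNIV p (mix g e)" using assms(1) unfolding DF_def by blast
  obtain q h where q: "\<forall>e. Q e = sat UNIV q (mix h e)" using assms(2) unfolding DF_def by blast
  define r1 :: "nat => nat" where "r1 = (%n. if even n then n else 4 * (n div 2) + 1)"
  define r2 :: "nat => nat" where "r2 = (%n. if even n then n else 4 * (n div 2) + 3)"
  have i1: "inj r1" unfolding r1_def by (rule inj_odd) simp
  have i2: "inj r2" unfolding r2_def by (rule inj_odd) simp
  let ?k = "mix h g"
  have d1: "(4 * m + 1) div 2 = 2 * m" "(4 * m + 3) div 2 = 2 * m + 1" for m :: nat by auto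
  have a: "mix ?k e \<circ> r1 = mix g e" for e
    by (rule ext) (auto simp: mix_def r1_def d1 elim!: oddE)
  have b: "mix ?k e \<circ> r2 = mix h e" for e
    by (rule ext) (auto simp: mix_def r2_def d1 elim!: oddE)
  have "\<forall>e. (P e \<and> Q e) = sat UNIV (Conj (ren r1 p) (ren r2 q)) (mix ?k e)"
    using p q by (simp add: sat_ren i1 i2 a b)
  then show ?thesis unfolding DF_def by blast
qed

text \<open>Variables are counted from the innermost quantifier outward: under one more quantifier
  the new object is variable 0 and the old environment is shifted. In the formula the bound variable
  takes the odd place 1, freed by moving the parameters up.\<close>

lemma DF_all[dfi]: assumes "DF (%e. Q (%n. e (Suc n)) (e 0))" shows "DF (%e. \<forall>y. Q e y)"
proof -
  obtain p g where p: "\<And>e. Q (%n. e (Suc n)) (e 0) = sat UNIV p (mix g e)"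
    using assms unfolding DF_def by blast
  define r :: "nat => nat" where "r = (%n. if n = 0 then 1 else if even n then n - 2 else n + 2)"
  have ir: "inj r" unfolding r_def by (rule inj_rot)
  define g' where "g' = (%k. g (k - 1))"
  have a: "(mix g' e)(1 := y) \<circ> r = mix g (case_nat y e)" for e y
  proof (rule ext)
    fix n :: nat
    have "n = 0 \<or> (\<exists>k. n = 2 * k + 2) \<or> (\<exists>k. n = 2 * k + 1)"
      by (metis Suc_1 Suc_eq_plus1 add_2_eq_Suc' evenE mult_Suc_right mult_0_right not0_implies_Suc oddE add.commute)
    then consider "n = 0" | k where "n = 2 * k + 2" | k where "n = 2 * k + 1" by blast
    then show "((mix g' e)(1 := y) \<circ> r) n = mix g (case_nat y e) n"
      by cases (auto simp: mix_def r_def g'_def)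
  qed
  have "(\<forall>y. Q e y) = sat UNIV (All 1 (ren r p)) (mix g' e)" for e
  proof -
    have "Q e y = sat UNIV p (mix g (case_nat y e))" for y
      using p[of "case_nat y e"] by simp
    then show ?thesis by (simp only: sat.simps sat_ren[OF ir] a) simp
  qed
  then show ?thesis unfolding DF_def by blast
qed

lemma DF_cong: "DF P ==> (\<And>e. P e = Q e) ==> DF Q"
  by (simp add: DF_def)

lemma DF_disj[dfi]: "DF P ==> DF Q ==> DF (%e. P e \<or> Q e)"
  by (rule DF_cong[of "%e. \<not> (\<not> P e \<and> \<not> Q e)"], intro dfi) auto
lemma DF_imp[dfi]: "DF P ==> DF Q ==> DF (%e. P e --> Q e)"
  by (rule DF_cong[of "%e. \<not> (P e \<and> \<not> Q e)"], intro dfi) auto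
lemma DF_iff[dfi]: "DF P ==> DF Q ==> DF (%e. P e \<longleftrightarrow> Q e)"
  by (rule DF_cong[of "%e. (P e --> Q e) \<and> (Q e --> P e)"], intro dfi) auto
lemma DF_if[dfi]: "DF P ==> DF Q ==> DF R ==> DF (%e. if P e then Q e else R e)"
  by (rule DF_cong[of "%e. (P e --> Q e) \<and> (\<not> P e --> R e)"], intro dfi) auto
lemma DF_ex[dfi]: assumes "DF (%e. Q (%n. e (Suc n)) (e 0))" shows "DF (%e. \<exists>y. Q e y)"
  by (rule DF_cong[of "%e. \<not> (\<forall>y. \<not> Q e y)"], rule DF_neg, rule DF_all, rule DF_neg, rule assms) auto

lemma DF_ren: assumes "inj r" "DF P" shows "DF (%e. P (%n. e (r n)))"
proof -
  obtain p g where p: "\<And>e. P e = sat UNIV p (mix g e)" using assms unfolding DF_def by blast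
  define r' where "r' = (%n. if even n then 2 * r (n div 2) else n)"
  have i: "inj r'"
    using assms(1) unfolding inj_def r'_def
    by (smt (verit) dvd_triv_left even_two_times_div_two mult_cancel_left zero_neq_numeral)
  have "mix g e \<circ> r' = mix g (%n. e (r n))" for e by (rule ext) (simp add: mix_def r'_def)
  then have "\<forall>e. P (%n. e (r n)) = sat UNIV (ren r' p) (mix g e)" by (simp add: p sat_ren[OF i])
  then show ?thesis unfolding DF_def by blast
qed

lemma DF_var_eq: "DF (%e. e i = e j)"
proof -
  have "\<forall>e. (e i = e j) = sat UNIV (Eq (2*i) (2*j)) (mix g e)" for g by (simp add: mix_def)
  then show ?thesis unfolding DF_def by blast
qed
lemma DF_var_mem: "DF (%e. e i \<in> ext (e j))"
proof -
  have "\<forall>e. (e i \<in> ext (e j)) = sat UNIV (Mem (2*i) (2*j)) (mix g e)" for g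
    by (simp add: mix_def ext_def)
  then show ?thesis unfolding DF_def by blast
qed
lemma DT_var[dfi]: "DT (%e. e k)"
  unfolding DT_def by (rule DF_var_eq)
lemma DT_const[dfi]: "DT (%e. c)"
proof -
  have "\<forall>e. (e 0 = c) = sat UNIV (Eq 0 1) (mix (%_. c) e)" by (simp add: mix_def)
  then show ?thesis unfolding DT_def DF_def by blast
qed
lemma DF_true: "DF (%e. True)"
  by (rule DF_cong[OF DF_var_eq[of 0 0]]) simp
lemma DF_const[dfi]: "DF (%e. b)"
proof (cases b)
  case True then show ?thesis using DF_true by simp
next
  case False then show ?thesis using DF_neg[OF DF_true] by simp
qed

text \<open>Formulas have no function symbols, so a term is substituted by quantifying over its
  value.\<close>

lemma DF_sub0: assumes "DF (%e. Q (e 0) (%n. e (Suc n)))" "DT t" shows "DF (%e. Q (t e) e)"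
proof -
  have "DF (%e. e 0 = t (%n. e (Suc n)) \<and> Q (e 0) (%n. e (Suc n)))"
    using assms unfolding DT_def by (intro DF_conj)
  then have "DF (%e. \<exists>y. y = t e \<and> Q y e)" by (rule DF_ex)
  then show ?thesis by (rule DF_cong) simp
qed

lemma DT_shift: assumes "DT t" shows "DT (%e. t (%n. e (Suc n)))"
proof -
  have "inj (case_nat 0 (%n. Suc (Suc n)))" by (auto simp: inj_def split: nat.splits)
  from DF_ren[OF this assms[unfolded DT_def]] show ?thesis unfolding DT_def by simp
qed

lemma DF1: assumes "DF (%e. P (e 0))" "DT t" shows "DF (%e. P (t e))"
  using DF_sub0[where Q="%y e. P y"] assms by simp

lemma DF2: assumes "DF (%e. P (e 0) (e 1))" "DT t" "DT u" shows "DF (%e. P (t e) (u e))"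
proof -
  have "DF (%e. P (e 1) (e 0))"
    using DF_ren[OF _ assms(1), of "id(0:=1,1:=0)"] by (simp add: inj_def)
  then have "DF (%e. P (e 0) (u (%n. e (Suc n))))"
    using DF_sub0[where Q="%y e. P (e 0) y", OF _ DT_shift[OF assms(3)]] by simp
  then show ?thesis using DF_sub0[where Q="%y e. P y (u e)"] assms(2) by simp
qed

text \<open>Only variable 0 can be replaced by a term, so the last argument is substituted first;
  hence the preliminary permutation of the arguments into reverse order.\<close>

lemma DF3: assumes "DF (%e. P (e 0) (e 1) (e 2))" "DT t" "DT u" "DT v"
  shows "DF (%e. P (t e) (u e) (v e))"
proof -
  have "DF (%e. P (e (Suc 0)) (e 0) (e 2))"
    using DF_ren[OF _ assms(1), of "id(0:=1,1:=0)"] by (simp add: inj_def)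
  from DF_ren[OF _ this, of "id(0:=1,1:=2,2:=0)"]
  have "DF (%e. P (e 2) (e 1) (e 0))"  by (simp add: inj_def)
  then have "DF (%e. P (e 1) (e 0) (v (%n. e (Suc (Suc n)))))"
    using DF_sub0[where Q="%y e. P (e 1) (e 0) y", OF _ DT_shift[OF DT_shift[OF assms(4)]]]
    by (simp add: numeral_2_eq_2)
  then have "DF (%e. P (e 0) (u (%n. e (Suc n))) (v (%n. e (Suc n))))"
    using DF_sub0[where Q="%y e. P (e 0) y (v (%n. e (Suc n)))", OF _ DT_shift[OF assms(3)]] by simp
  then show ?thesis using DF_sub0[where Q="%y e. P y (u e) (v e)"] assms(2) by simp
qed

lemma DF4: assumes "DF (%e. P (e 0) (e 1) (e 2) (e 3))" "DT t" "DT u" "DT v" "DT w"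
  shows "DF (%e. P (t e) (u e) (v e) (w e))"
proof -
  have "DF (%e. P (e 3) (e 2) (e 1) (e 0))"
    using DF_ren[OF _ assms(1), of "id(0:=3,1:=2,2:=1,3:=0)"] by (simp add: inj_def)
  then have "DF (%e. P (e 2) (e 1) (e 0) (w (%n. e (Suc (Suc (Suc n))))))"
    using DF_sub0[where Q="%y e. P (e 2) (e 1) (e 0) y", OF _ DT_shift[OF DT_shift[OF DT_shift[OF assms(5)]]]]
    by (simp add: numeral_2_eq_2 numeral_3_eq_3)
  then have "DF (%e. P (e 1) (e 0) (v (%n. e (Suc (Suc n)))) (w (%n. e (Suc (Suc n)))))"
    using DF_sub0[where Q="%y e. P (e 1) (e 0) y (w (%n. e (Suc (Suc n))))", OF _ DT_shift[OF DT_shift[OF assms(4)]]]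
    by (simp add: numeral_2_eq_2)
  then have "DF (%e. P (e 0) (u (%n. e (Suc n))) (v (%n. e (Suc n))) (w (%n. e (Suc n))))"
    using DF_sub0[where Q="%y e. P (e 0) y (v (%n. e (Suc n))) (w (%n. e (Suc n)))", OF _ DT_shift[OF assms(3)]] by simp
  then show ?thesis using DF_sub0[where Q="%y e. P y (u e) (v e) (w e)"] assms(2) by simp
qed

lemma DT1: assumes "DT (%e. F (e 0))" "DT t" shows "DT (%e. F (t e))"
proof -
  have "DF (%e. e 0 = F (e 1))" using assms(1) by (simp add: DT_def)
  then show ?thesis unfolding DT_def by (rule DF2[OF _ DT_var DT_shift[OF assms(2)]])
qed
lemma DT2: assumes "DT (%e. F (e 0) (e 1))" "DT t" "DT u" shows "DT (%e. F (t e) (u e))"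
proof -
  have "DF (%e. e 0 = F (e 1) (e 2))" using assms(1) by (simp add: DT_def numeral_2_eq_2)
  then show ?thesis unfolding DT_def
    by (rule DF3[OF _ DT_var DT_shift[OF assms(2)] DT_shift[OF assms(3)]])
qed
lemma DT3: assumes "DT (%e. F (e 0) (e 1) (e 2))" "DT t" "DT u" "DT v"
  shows "DT (%e. F (t e) (u e) (v e))"
proof -
  have "DF (%e. e 0 = F (e 1) (e 2) (e 3))"
    using assms(1) by (simp add: DT_def numeral_2_eq_2 numeral_3_eq_3)
  then show ?thesis unfolding DT_def
    by (rule DF4[OF _ DT_var DT_shift[OF assms(2)] DT_shift[OF assms(3)] DT_shift[OF assms(4)]])
qed

lemma DF_eq[dfi]: "DT t ==> DT u ==> DF (%e. t e = u e)"
  by (rule DF2[where P="(=)"], rule DF_var_eq)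
lemma DF_mem[dfi]: "DT t ==> DT u ==> DF (%e. t e \<in> ext (u e))"
  by (rule DF2[where P="%a b. a \<in> ext b"], rule DF_var_mem)
lemma DF_ball[dfi]: assumes "DT t" "DF (%e. Q (%n. e (Suc n)) (e 0))"
  shows "DF (%e. \<forall>y\<in>ext (t e). Q e y)"
  unfolding Ball_def by (intro DF_all DF_imp DF_mem DT_shift[OF assms(1)] assms dfi)
lemma DF_bex[dfi]: assumes "DT t" "DF (%e. Q (%n. e (Suc n)) (e 0))"
  shows "DF (%e. \<exists>y\<in>ext (t e). Q e y)"
  unfolding Bex_def by (intro DF_ex DF_conj DF_mem DT_shift[OF assms(1)] assms dfi)
lemma DF_sub[dfi]: assumes "DT t" "DT u" shows "DF (%e. ext (t e) \<subseteq> ext (u e))"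
  unfolding subset_iff by (intro DF_all DF_imp DF_mem DT_shift[OF assms(1)] DT_shift[OF assms(2)] dfi)
lemma DF_subc[dfi]: assumes "DT t" "DF (%e. Q (%n. e (Suc n)) (e 0))"
  shows "DF (%e. ext (t e) \<subseteq> {y. Q e y})"
  unfolding subset_iff mem_Collect_eq by (intro DF_all DF_imp DF_mem DT_shift[OF assms(1)] assms dfi)
lemma DF_extc[dfi]: assumes "DT t" "DF (%e. Q (%n. e (Suc n)) (e 0))"
  shows "DF (%e. ext (t e) = {y. Q e y})"
  unfolding set_eq_iff mem_Collect_eq by (intro DF_all DF_iff DF_mem DT_shift[OF assms(1)] assms dfi)
lemma DF_ex1[dfi]: assumes "DF (%e. Q (%n. e (Suc n)) (e 0))"
  shows "DF (%e. \<exists>!y. Q e y)"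
proof -
  have "DF (%e. Q (%n. e (Suc (Suc n))) (e 0))"
    using DF_ren[OF _ assms, of "case_nat 0 (%n. Suc (Suc n))"] by (simp add: inj_def split: nat.splits)
  then show ?thesis unfolding Ex1_def by (intro DF_ex DF_conj DF_all DF_imp assms dfi)
qed
lemma DT_if[dfi]: assumes "DF P" "DT t" "DT u" shows "DT (%e. if P e then t e else u e)"
proof -
  have "DF (%e. P (%n. e (Suc n)))" by (rule DF_ren[OF _ assms(1)]) simp
  then have "DF (%e. if P (%n. e (Suc n)) then e 0 = t (%n. e (Suc n)) else e 0 = u (%n. e (Suc n)))"
    using assms(2,3) unfolding DT_def by (rule DF_if)
  then show ?thesis unfolding DT_def by (rule DF_cong) auto
qed
definition D1 :: "('a => bool) => bool" where "D1 P \<longleftrightarrow> DF (%e. P (e 0))"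
definition F1 :: "('a => 'a) => bool" where "F1 F \<longleftrightarrow> DT (%e. F (e 0))"
definition F2 :: "('a => 'a => 'a) => bool" where "F2 F \<longleftrightarrow> DT (%e. F (e 0) (e 1))"

lemma D1I[dfi]: "DF (%e. P (e 0)) ==> D1 P" by (simp add: D1_def)
lemma F1I[dfi]: "DT (%e. F (e 0)) ==> F1 F" by (simp add: F1_def)
lemma F2I[dfi]: "DT (%e. F (e 0) (e 1)) ==> F2 F" by (simp add: F2_def)
lemma D1D: "D1 P ==> DT t ==> DF (%e. P (t e))" unfolding D1_def by (rule DF1[where P=P])
lemma F1D: "F1 F ==> DT t ==> DT (%e. F (t e))" unfolding F1_def by (rule DT1[where F=F])
lemma F2D: "F2 F ==> DT t ==> DT u ==> DT (%e. F (t e) (u e))" unfolding F2_def by (rule DT2[where F=F])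

definition is_set :: "'a set => bool" where "is_set X \<longleftrightarrow> (\<exists>a. ext a = X)"

end

section \<open>Sets of a ZF model from definable collections\<close>

context zf_model
begin

lemma ext_inject: "ext a = ext b ==> a = b"
  using extensionality by (auto simp: ext_def set_eq_iff)

lemma ext_inject_iff[simp]: "ext a = ext b \<longleftrightarrow> a = b"
  using ext_inject by blast

lemma coll_ext[simp]: "coll (ext a) = a"
  unfolding coll_def by (rule the_equality) auto

lemma ext_coll: "is_set X ==> ext (coll X) = X"
  unfolding is_set_def by auto

lemma is_set_ext[simp]: "is_set (ext a)" by (auto simp: is_set_def)

text \<open>If \<open>X\<close> is not a set of the model, then \<open>coll X\<close> is the one
  default value \<open>THE a. False\<close>. Distinguishing the two cases makes the term definable
  without knowing that the collection is a set.\<close>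

lemma DT_coll[dfi]: assumes "DF (%e. Q (%n. e (Suc n)) (e 0))"
  shows "DT (%e. coll {y. Q e y})"
proof -
  have eq: "(y = coll X) = (ext y = X \<or> (\<not> (\<exists>z. ext z = X) \<and> y = (THE a. False)))" for y X
  proof (cases "\<exists>z. ext z = X")
    case True
    then obtain z where "X = ext z" by blast
    then show ?thesis by auto
  next
    case False
    then have "(%a. ext a = X) = (%a. False)" by auto
    then have "coll X = (THE a. False)" unfolding coll_def by simp
    then show ?thesis using False by auto
  qed
  have h2: "DF (%e. Q (%n. e (Suc (Suc n))) (e 0))"
    using DF_ren[OF _ assms, of "case_nat 0 (%n. Suc (Suc n))"] by (simp add: inj_def split: nat.splits)
  have h3: "DF (%e. Q (%n. e (Suc (Suc (Suc n)))) (e 0))"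
    using DF_ren[OF _ assms, of "case_nat 0 (%n. Suc (Suc (Suc n)))"] by (simp add: inj_def split: nat.splits)
  have 1: "DF (%e. ext (e 0) = {y. Q (%n. e (Suc n)) y})"
    by (rule DF_extc[where t="%e. e 0" and Q="%e y. Q (%n. e (Suc n)) y", OF DT_var h2])
  have "DF (%e. ext (e 0) = {y. Q (%n. e (Suc (Suc n))) y})"
    by (rule DF_extc[where t="%e. e 0" and Q="%e y. Q (%n. e (Suc (Suc n))) y", OF DT_var h3])
  then have "DF (%e. \<exists>z. ext z = {y. Q (%n. e (Suc n)) y})"
    by (rule DF_ex[where Q="%e z. ext z = {y. Q (%n. e (Suc n)) y}"])
  with 1 show ?thesis unfolding DT_def eq by (intro DF_disj DF_conj DF_neg DF_eq DT_var DT_const)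
qed

lemma is_set_sep: assumes "D1 P" shows "is_set {x \<in> ext a. P x}"
proof -
  obtain p g where p: "\<And>e. P (e 0) = sat UNIV p (mix g e)" using assms unfolding D1_def DF_def by blast
  obtain b where b: "\<forall>x. x \<in>\<^sub>M b \<longleftrightarrow> x \<in>\<^sub>M a \<and> sat UNIV p ((mix g (%_. a))(0 := x))"
    using separation by blast
  have "(mix g (%_. a))(0 := x) = mix g ((%_. a)(0 := x))" for x
    by (rule ext) (auto simp: mix_def)
  then have "ext b = {x \<in> ext a. P x}" using b p[of "(%_. a)(0 := x)" for x] by (auto simp: ext_def)
  then show ?thesis unfolding is_set_def by blast
qed

lemma is_set_subset: assumes "X \<subseteq> ext a" "D1 (%x. x \<in> X)" shows "is_set X"
proof -
  have "X = {x \<in> ext a. x \<in> X}" using assms(1) by auto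
  then show ?thesis using is_set_sep[OF assms(2), of a] by simp
qed

lemma is_set_image: assumes "F1 F" shows "is_set (F ` ext a)"
proof -
  have "DF (%e. e 0 = F (e 1))" using assms by (simp add: F1_def DT_def)
  then obtain p g where p: "\<And>e. (e 0 = F (e 1)) = sat UNIV p (mix g e)" unfolding DF_def by blast
  \<comment> \<open>Replacement wants the argument at variable 0 and the value at variable 1, while
    the graph formula has the value at 0 and the argument at 2. All other variables are moved out of
    the way by 5.\<close>
  define r where "r = (%n::nat. if n = 0 then 1 else if n = 2 then 0 else n + 5)"
  have i: "inj r" by (rule injI) (auto simp: r_def split: if_splits)
  define E where "E = (%n. mix g (%_. a) (n - 5))"
  have m: "E(0 := x, 1 := y) \<circ> r = mix g ((%_. a)(0 := y, 1 := x))" for x y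
    by (rule ext) (auto simp: E_def r_def mix_def elim!: evenE)
  have s: "sat UNIV (ren r p) (E(0 := x, 1 := y)) = (y = F x)" for x y
    unfolding sat_ren[OF i] m p[symmetric] by simp
  obtain b where "\<forall>y. y \<in>\<^sub>M b \<longleftrightarrow> (\<exists>x. x \<in>\<^sub>M a \<and> sat UNIV (ren r p) (E(0 := x, 1 := y)))"
    using replacement[of a "ren r p" E] s by auto
  then have "ext b = F ` ext a" unfolding s by (auto simp: ext_def)
  then show ?thesis unfolding is_set_def by blast
qed

lemma is_set_empty[simp]: "is_set {}"
proof -
  have "is_set {x \<in> ext undefined. False}" by (rule is_set_sep) (intro dfi)
  then show ?thesis by simp
qed
lemma is_set_pair[simp]: "is_set {a, b}"
  using pairing[of a b] unfolding is_set_def ext_def by auto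
lemma is_set_sing[simp]: "is_set {a}" using is_set_pair[of a a] by simp
lemma is_set_Union: "is_set {z. \<exists>y\<in>ext a. z \<in> ext y}"
  using union[of a] unfolding is_set_def ext_def by auto
lemma is_set_Pow: "is_set {x. ext x \<subseteq> ext a}"
proof -
  obtain p where "\<forall>x. x \<in>\<^sub>M p \<longleftrightarrow> (\<forall>y. y \<in>\<^sub>M x --> y \<in>\<^sub>M a)" using power_set by blast
  then have "ext p = {x. ext x \<subseteq> ext a}" by (auto simp: ext_def)
  then show ?thesis unfolding is_set_def by blast
qed

lemma is_set_Un: assumes "is_set X" "is_set Y" shows "is_set (X \<union> Y)"
proof -
  have "X \<union> Y = {z. \<exists>y\<in>ext (coll {coll X, coll Y}). z \<in> ext y}"
    using assms by (auto simp: ext_coll)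
  then show ?thesis using is_set_Union by metis
qed
lemma is_set_insert[simp]: "is_set X ==> is_set (insert a X)"
  using is_set_Un[of "{a}" X] by simp

lemma ext_empty[simp]: "ext empty = {}" unfolding empty_def by (simp add: ext_coll)
lemma empty_iff[simp]: "ext a = {} \<longleftrightarrow> a = empty" using ext_inject[of a empty] by auto
lemma ext_succ[simp]: "ext (succ a) = insert a (ext a)" unfolding succ_def by (simp add: ext_coll)
lemma ext_pow[simp]: "ext (pow a) = {x. ext x \<subseteq> ext a}" unfolding pow_def by (simp add: ext_coll is_set_Pow)

definition up :: "'a => 'a => 'a" where "up a b = coll {a, b}"
definition un :: "'a => 'a" where "un a = coll {z. \<exists>y\<in>ext a. z \<in> ext y}"
definition sep :: "'a => ('a => bool) => 'a" where "sep a P = coll {x. x \<in> ext a \<and> P x}"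
definition img :: "('a => 'a) => 'a => 'a" where "img F a = coll {y. \<exists>x\<in>ext a. y = F x}"
definition bun :: "'a => 'a => 'a" where "bun a b = coll {x. x \<in> ext a \<or> x \<in> ext b}"

lemma ext_up[simp]: "ext (up a b) = {a, b}" unfolding up_def by (simp add: ext_coll)
lemma ext_un[simp]: "ext (un a) = {z. \<exists>y\<in>ext a. z \<in> ext y}" unfolding un_def by (simp add: ext_coll is_set_Union)
lemma ext_bun[simp]: "ext (bun a b) = ext a \<union> ext b"
proof -
  have "{x. x \<in> ext a \<or> x \<in> ext b} = ext a \<union> ext b" by auto
  then show ?thesis unfolding bun_def by (simp add: ext_coll is_set_Un)
qed
lemma ext_sep: "D1 P ==> ext (sep a P) = {x \<in> ext a. P x}"
  unfolding sep_def by (simp add: ext_coll is_set_sep)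
lemma ext_img: assumes "F1 F" shows "ext (img F a) = F ` ext a"
proof -
  have "{y. \<exists>x\<in>ext a. y = F x} = F ` ext a" by auto
  then show ?thesis unfolding img_def by (simp add: ext_coll is_set_image[OF assms])
qed

lemma opair_up: "opair a b = up (up a a) (up a b)" by (simp add: opair_def up_def)
lemma up_eq: "up a b = up c d \<longleftrightarrow> {a, b} = {c, d}"
  by (metis ext_up ext_inject)
lemma opair_inj[simp]: "opair a b = opair c d \<longleftrightarrow> a = c \<and> b = d"
  unfolding opair_up up_eq by (auto simp: up_eq doubleton_eq_iff)

lemma DT_empty[dfi]: "DT (%e. empty)" by (rule DT_const)
lemma DT_up[dfi]: assumes "DT t" "DT u" shows "DT (%e. up (t e) (u e))"
proof -
  have "up a b = coll {y. y = a \<or> y = b}" for a b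
    unfolding up_def by (rule arg_cong[of _ _ coll]) auto
  then have "DT (%e. up (e 0) (e 1))" by (simp only:) (intro dfi)
  then show ?thesis by (rule DT2[where F=up]) fact+
qed
lemma DT_opair[dfi]: "DT t ==> DT u ==> DT (%e. opair (t e) (u e))"
  unfolding opair_up by (intro dfi)
lemma F1_un: "F1 un" by (intro F1I, unfold un_def, intro dfi)
lemmas [dfi] = F1D[OF F1_un]
lemma F2_bun: "F2 bun" by (intro F2I, unfold bun_def, intro dfi)
lemmas [dfi] = F2D[OF F2_bun]
lemma DT_succ[dfi]: assumes "DT t" shows "DT (%e. succ (t e))"
proof -
  have "succ a = bun a (up a a)" for a by (rule ext_inject) auto
  then show ?thesis by (simp only:) (intro dfi assms)
qed
lemma F1_pow: "F1 pow" by (intro F1I, unfold pow_def, intro dfi)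
lemmas [dfi] = F1D[OF F1_pow]
lemma DT_sep[dfi]: assumes "DT t" "DF (%e. Q (%n. e (Suc n)) (e 0))"
  shows "DT (%e. sep (t e) (Q e))"
  unfolding sep_def by (rule DT_coll) (intro dfi DT_shift[OF assms(1)] assms)
lemma DT_img[dfi]: assumes "DT t" "DT (%e. F (%n. e (Suc n)) (e 0))"
  shows "DT (%e. img (F e) (t e))"
proof -
  have "DT (%e. F (%n. e (Suc (Suc n))) (e 0))"
    using DF_ren[OF _ assms(2)[unfolded DT_def], of "case_nat 0 (case_nat 1 (%n. Suc (Suc (Suc n))))"]
    unfolding DT_def by (simp add: inj_def split: nat.splits)
  then show ?thesis unfolding img_def by (intro DT_coll DF_bex DF_eq DT_shift[OF assms(1)] assms dfi)
qed

lemma ext_cprod[simp]: "ext (cprod a b) = {opair x y | x y. x \<in> ext a \<and> y \<in> ext b}"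
proof -
  have "{opair x y | x y. x \<in> ext a \<and> y \<in> ext b} \<subseteq> ext (pow (pow (bun a b)))"
    by (auto simp: opair_up)
  then have "is_set {opair x y | x y. x \<in> ext a \<and> y \<in> ext b}"
    by (rule is_set_subset) (simp only: mem_Collect_eq, intro dfi)
  then show ?thesis unfolding cprod_def by (rule ext_coll)
qed
lemma opair_mem_cprod: "opair x y \<in> ext (cprod a b) \<longleftrightarrow> x \<in> ext a \<and> y \<in> ext b"
  by auto
lemma F2_cprod: "F2 cprod" by (intro F2I, unfold cprod_def, intro dfi)
lemmas [dfi] = F2D[OF F2_cprod]

section \<open>Functions\<close>

text \<open>Application as the union of all values, a definable term for every \<open>f\<close> and
  \<open>x\<close>. Where \<open>f\<close> is single-valued at \<open>x\<close> it agrees with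
  \<open>app\<close>, whose description has no controlled value elsewhere.\<close>

definition ap :: "'a => 'a => 'a" where
  "ap f x = coll {z. \<exists>y. opair x y \<in> ext f \<and> z \<in> ext y}"

lemma F2_ap: "F2 ap" by (intro F2I, unfold ap_def, intro dfi)
lemmas [dfi] = F2D[OF F2_ap]

lemma ap_eq: assumes "\<And>z. opair x z \<in> ext f \<longleftrightarrow> z = y" shows "ap f x = y"
proof -
  have "{z. \<exists>y. opair x y \<in> ext f \<and> z \<in> ext y} = ext y" using assms by auto
  then show ?thesis by (simp add: ap_def)
qed

lemma app_eq_ap: assumes "\<exists>!y. opair x y \<in> ext f" shows "app f x = ap f x"
proof -
  obtain y where y: "\<And>z. opair x z \<in> ext f \<longleftrightarrow> z = y" using assms by metis
  then have "app f x = y" unfolding app_def by auto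
  then show ?thesis using ap_eq[OF y] by simp
qed

lemma func_app: "func f a b ==> x \<in> ext a ==> app f x = ap f x"
  by (rule app_eq_ap) (auto simp: func_def)

lemma func_ap_mem: assumes "func f a b" "x \<in> ext a" shows "opair x (ap f x) \<in> ext f"
  using assms unfolding func_def by (metis ap_eq)

lemma func_opair_iff: assumes "func f a b" shows "opair x y \<in> ext f \<longleftrightarrow> x \<in> ext a \<and> y = ap f x"
proof -
  have "opair x y \<in> ext f ==> x \<in> ext a" using assms unfolding func_def by auto
  moreover have "x \<in> ext a ==> opair x y \<in> ext f ==> y = ap f x"
    using assms func_ap_mem[OF assms] unfolding func_def by metis
  ultimately show ?thesis using func_ap_mem[OF assms] by metis
qed

lemma func_ap_in: assumes "func f a b" "x \<in> ext a" shows "ap f x \<in> ext b"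
  using func_ap_mem[OF assms] assms(1) unfolding func_def by auto

lemma func_ext_eq: assumes "func f a b" shows "ext f = {opair x (ap f x) | x. x \<in> ext a}"
proof -
  have "p \<in> ext f ==> \<exists>x y. p = opair x y" for p using assms unfolding func_def by auto
  then show ?thesis using func_opair_iff[OF assms] by fastforce
qed

lemma func_eqI: assumes "func f a b" "func g a c" "\<And>x. x \<in> ext a ==> ap f x = ap g x" shows "f = g"
proof -
  have "{opair x (ap f x) | x. x \<in> ext a} = {opair x (ap g x) | x. x \<in> ext a}"
    using assms(3) by (auto intro: exI)
  then have "ext f = ext g" using func_ext_eq[OF assms(1)] func_ext_eq[OF assms(2)] by simp
  then show ?thesis by simp
qed

lemma DF_func[dfi]: assumes "DT t" "DT u" "DT v" shows "DF (%e. func (t e) (u e) (v e))"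
  by (rule DF3[where P=func, OF _ assms]) (unfold func_def, intro dfi)

lemma ext_funs[simp]: "ext (funs a b) = {f. func f a b}"
proof -
  have "{f. func f a b} \<subseteq> ext (pow (cprod a b))" unfolding func_def by auto
  then have "is_set {f. func f a b}" by (rule is_set_subset) (simp only: mem_Collect_eq, intro dfi)
  then show ?thesis unfolding funs_def by (rule ext_coll)
qed
lemma F2_funs: "F2 funs" by (intro F2I, unfold funs_def, intro dfi)
lemmas [dfi] = F2D[OF F2_funs]

definition lam :: "'a => ('a => 'a) => 'a" where
  "lam a F = img (%x. opair x (F x)) a"

lemma DT_lam[dfi]: assumes "DT t" "DT (%e. F (%n. e (Suc n)) (e 0))"
  shows "DT (%e. lam (t e) (F e))"
  unfolding lam_def by (intro DT_img DT_opair assms dfi)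

lemma ext_lam: assumes "F1 F" shows "ext (lam a F) = {opair x (F x) | x. x \<in> ext a}"
  unfolding lam_def by (subst ext_img) (intro dfi F1D[OF assms], auto)

lemma lam_func: assumes "F1 F" "\<And>x. x \<in> ext a ==> F x \<in> ext b" shows "func (lam a F) a b"
  using assms(2) unfolding func_def ext_lam[OF assms(1)] by auto

lemma lam_func_img: assumes "F1 F" shows "func (lam a F) a (img F a)"
  by (rule lam_func[OF assms]) (simp add: ext_img[OF assms])

lemma ap_lam: assumes "F1 F" "x \<in> ext a" shows "ap (lam a F) x = F x"
  by (rule ap_eq) (use assms(2) in \<open>auto simp: ext_lam[OF assms(1)]\<close>)

lemma func_change: assumes "func f a b" "\<And>x. x \<in> ext a ==> ap f x \<in> ext c" shows "func f a c"
  using assms(2) func_opair_iff[OF assms(1)] func_ext_eq[OF assms(1)] unfolding func_def by auto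

definition dom :: "'a => 'a" where "dom f = coll {x. \<exists>y. opair x y \<in> ext f}"
lemma F1_dom: "F1 dom" by (intro F1I, unfold dom_def, intro dfi)
lemmas [dfi] = F1D[OF F1_dom]
lemma func_dom: assumes "func f a b" shows "dom f = a"
proof -
  have "{x. \<exists>y. opair x y \<in> ext f} = ext a" using func_opair_iff[OF assms] by auto
  then show ?thesis by (simp add: dom_def)
qed

lemma ext_restr: "ext (restr f a) = {p \<in> ext f. \<exists>x\<in>ext a. \<exists>y. p = opair x y}"
  unfolding restr_def by (rule ext_coll, rule is_set_sep) (intro dfi)
lemma DT_restr[dfi]: assumes "DT t" "DT u" shows "DT (%e. restr (t e) (u e))"
  by (rule DT2[where F=restr, OF _ assms]) (unfold restr_def Collect_conj_eq[symmetric] mem_Collect_eq, intro dfi)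
lemma restr_func: assumes "func f a b" "ext c \<subseteq> ext a" shows "func (restr f c) c b"
  using assms unfolding func_def ext_restr by (auto simp: subset_iff)
lemma restr_ap: assumes "x \<in> ext c" shows "ap (restr f c) x = ap f x"
proof -
  have "{z. \<exists>y. opair x y \<in> ext (restr f c) \<and> z \<in> ext y} = {z. \<exists>y. opair x y \<in> ext f \<and> z \<in> ext y}"
    using assms unfolding ext_restr by auto
  then show ?thesis by (simp add: ap_def)
qed

end

context zf_model
begin

section \<open>Ordinals and recursion\<close>

text \<open>A description operator written as a union: with a unique witness it returns this
  witness, and it remains a definable term when there is none.\<close>

definition dsc :: "('a => bool) => 'a" where "dsc P = coll {m. \<exists>n. P n \<and> m \<in> ext n}"

lemma dsc_eq: assumes "P n" "\<And>k. P k ==> k = n" shows "dsc P = n"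
proof -
  have "{m. \<exists>n. P n \<and> m \<in> ext n} = ext n" using assms by blast
  then show ?thesis by (simp add: dsc_def)
qed
lemma DT_dsc[dfi]: assumes "DF (%e. Q (%n. e (Suc n)) (e 0))" shows "DT (%e. dsc (Q e))"
proof -
  have "DF (%e. Q (%n. e (Suc (Suc n))) (e 0))"
    using DF_ren[OF _ assms, of "case_nat 0 (%n. Suc (Suc n))"] by (simp add: inj_def split: nat.splits)
  then show ?thesis unfolding dsc_def by (intro DT_coll DF_ex DF_conj dfi)
qed

lemma found: assumes "ext a \<noteq> {}" shows "\<exists>x\<in>ext a. ext x \<inter> ext a = {}"
  using foundation[of a] assms by (auto simp: ext_def)

lemma mem_irrefl[simp]: "x \<notin> ext x"
  using found[of "up x x"] by auto
lemma mem_asym: "x \<in> ext y ==> y \<notin> ext x"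
  using found[of "up x y"] by auto
lemma DF_transitive[dfi]: assumes "DT t" shows "DF (%e. transitive (t e))"
  by (rule DF1[where P=transitive, OF _ assms]) (unfold transitive_def, intro dfi)
lemma DF_ordinal[dfi]: assumes "DT t" shows "DF (%e. ordinal (t e))"
  by (rule DF1[where P=ordinal, OF _ assms]) (unfold ordinal_def, intro dfi)
lemma DF_limit[dfi]: assumes "DT t" shows "DF (%e. limit (t e))"
  by (rule DF1[where P=limit, OF _ assms]) (unfold limit_def, intro dfi)

lemma ord_mem: "ordinal a ==> x \<in> ext a ==> ordinal x"
  unfolding ordinal_def transitive_def by blast
lemma ord_trans: "ordinal a ==> x \<in> ext a ==> y \<in> ext x ==> y \<in> ext a"
  unfolding ordinal_def transitive_def by blast
lemma ord_sub: "ordinal a ==> x \<in> ext a ==> ext x \<subseteq> ext a"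
  using ord_trans by blast

lemma ord_least: assumes "D1 P" "ordinal a" "P a"
  obtains b where "ordinal b" "P b" "\<And>c. c \<in> ext b ==> \<not> P c"
proof -
  have "\<exists>b. ordinal b \<and> P b \<and> (\<forall>c\<in>ext b. \<not> P c)"
  proof (cases "\<exists>c\<in>ext a. P c")
    case False then show ?thesis using assms by blast
  next
    case True
    let ?s = "sep a P"
    have s: "ext ?s = {x \<in> ext a. P x}" by (rule ext_sep) fact
    then have "ext ?s \<noteq> {}" using True by auto
    from found[OF this] obtain x where x: "x \<in> ext a" "P x" "ext x \<inter> ext ?s = {}" unfolding s by blast
    then have "\<forall>c\<in>ext x. \<not> P c" using s ord_trans[OF assms(2)] by auto
    then show ?thesis using x ord_mem[OF assms(2)] by blast
  qed
  then show ?thesis using that by blast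
qed

text \<open>The ordinals of the model may be ill-founded from outside, so induction is limited to
  definable \<open>P\<close>: foundation is applied to a separated set of counterexamples.\<close>

lemma ord_induct: assumes "ordinal a" "D1 P"
    "\<And>b. ordinal b ==> (\<And>c. c \<in> ext b ==> P c) ==> P b" shows "P a"
proof (rule ccontr)
  assume n: "\<not> P a"
  have "D1 (%x. \<not> P x)" by (intro dfi D1D[OF assms(2)])
  from ord_least[OF this assms(1) n] obtain b where "ordinal b" "\<not> P b" "\<And>c. c \<in> ext b ==> P c" by metis
  then show False using assms(3) by blast
qed

lemma ord_linear: assumes "ordinal a" "ordinal b" shows "a \<in> ext b \<or> a = b \<or> b \<in> ext a"
proof (rule ccontr)
  assume n: "\<not> ?thesis"
  let ?C = "%a b. a \<in> ext b \<or> a = b \<or> b \<in> ext a"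
  have d1: "D1 (%a. \<exists>b. ordinal b \<and> \<not> ?C a b)" by (intro dfi)
  obtain a' where a': "ordinal a'" "\<exists>b. ordinal b \<and> \<not> ?C a' b"
    "\<And>c. c \<in> ext a' ==> \<not> (\<exists>b. ordinal b \<and> \<not> ?C c b)"
    by (rule ord_least[OF d1 assms(1)]) (use n assms(2) in blast)+
  have d2: "D1 (%b. \<not> ?C a' b)" by (intro dfi)
  obtain b' where b': "ordinal b'" "\<not> ?C a' b'" "\<And>c. c \<in> ext b' ==> ?C a' c"
  proof -
    obtain b where "ordinal b" "\<not> ?C a' b" using a'(2) by blast
    from ord_least[OF d2 this] show ?thesis using that by metis
  qed
  have "ext a' = ext b'"
  proof
    show "ext a' \<subseteq> ext b'" using a'(3) b'(1,2) ord_trans[OF a'(1)] by blast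
    show "ext b' \<subseteq> ext a'" using b' ord_trans[OF b'(1)] by blast
  qed
  then show False using b'(2) by simp
qed

lemma ord_sub_iff: assumes "ordinal a" "ordinal b" shows "ext a \<subseteq> ext b \<longleftrightarrow> a \<in> ext b \<or> a = b"
  using ord_linear[OF assms] ord_sub[OF assms(2)] mem_irrefl by blast

lemma ord_empty[simp]: "ordinal empty" by (simp add: ordinal_def transitive_def)
lemma ord_succ[simp]: "ordinal a ==> ordinal (succ a)"
  by (auto simp: ordinal_def transitive_def)
lemma ord_un: assumes "\<And>x. x \<in> ext A ==> ordinal x" shows "ordinal (un A)"
proof -
  have "transitive (un A)" unfolding transitive_def ext_un using ord_trans[OF assms] by blast
  moreover have "transitive x" if "x \<in> ext (un A)" for x
    using that ord_mem[OF assms] unfolding ext_un ordinal_def by blast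
  ultimately show ?thesis unfolding ordinal_def by blast
qed
lemma ord_bound: assumes "\<And>x. x \<in> ext A ==> ordinal x"
  shows "ordinal (succ (un A)) \<and> (\<forall>x\<in>ext A. x \<in> ext (succ (un A)))"
proof -
  have o: "ordinal (un A)" by (rule ord_un) fact
  have "x \<in> ext (succ (un A))" if "x \<in> ext A" for x
  proof -
    have "ext x \<subseteq> ext (un A)" using that by auto
    then show ?thesis using ord_sub_iff[OF assms[OF that] o] by auto
  qed
  then show ?thesis using o by auto
qed
lemma succ_inj[simp]: "succ a = succ b \<longleftrightarrow> a = b"
proof
  assume "succ a = succ b"
  then have "insert a (ext a) = insert b (ext b)" by (metis ext_succ)
  then show "a = b" using mem_asym by (metis insertE insertI1)
qed simp
lemma succ_ne[simp]: "succ a \<noteq> empty" "empty \<noteq> succ a"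
  by (metis ext_succ ext_empty insert_not_empty)+
lemma un_succ: "transitive a ==> un (succ a) = a"
  by (rule ext_inject) (auto simp: transitive_def)

text \<open>Induction places every ordinal without a limit ordinal at or below it into the inductive
  set of the axiom of infinity; separation then applies.\<close>

lemma is_set_omega: "is_set {n. ordinal n \<and> (\<forall>m\<in>ext (succ n). \<not> limit m)}"
proof -
  obtain w where w: "\<exists>z. z \<in>\<^sub>M w \<and> (\<forall>x. \<not> x \<in>\<^sub>M z)"
    "\<And>x. x \<in>\<^sub>M w ==> \<exists>y. y \<in>\<^sub>M w \<and> (\<forall>z. z \<in>\<^sub>M y \<longleftrightarrow> z \<in>\<^sub>M x \<or> z = x)"
    using infinity by blast
  obtain z where z: "z \<in> ext w" "ext z = {}" using w(1) unfolding ext_def by blast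
  have "z = empty" using z by simp
  have sw: "succ x \<in> ext w" if x: "x \<in> ext w" for x
  proof -
    obtain y where y: "y \<in> ext w" "\<forall>z. z \<in>\<^sub>M y \<longleftrightarrow> z \<in>\<^sub>M x \<or> z = x"
      using w(2)[of x] x unfolding ext_def by blast
    have "ext y = ext (succ x)" unfolding ext_succ using y(2) unfolding ext_def by blast
    then have "y = succ x" by (rule ext_inject)
    then show ?thesis using y(1) by simp
  qed
  have "n \<in> ext w" if "ordinal n" "\<forall>m\<in>ext (succ n). \<not> limit m" for n
  proof -
    have "ordinal n ==> (\<forall>m\<in>ext (succ n). \<not> limit m) --> n \<in> ext w"
    proof (erule ord_induct[where P="%n. (\<forall>m\<in>ext (succ n). \<not> limit m) --> n \<in> ext w"])
      show "D1 (%n. (\<forall>m\<in>ext (succ n). \<not> limit m) --> n \<in> ext w)" by (intro dfi)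
      fix b assume b: "ordinal b" "\<And>c. c \<in> ext b ==> (\<forall>m\<in>ext (succ c). \<not> limit m) --> c \<in> ext w"
      show "(\<forall>m\<in>ext (succ b). \<not> limit m) --> b \<in> ext w"
      proof
        assume nl: "\<forall>m\<in>ext (succ b). \<not> limit m"
        then have "b = empty \<or> (\<exists>c. b = succ c)" using b(1) unfolding limit_def by auto
        then show "b \<in> ext w"
        proof
          assume "b = empty" then show ?thesis using z \<open>z = empty\<close> by simp
        next
          assume "\<exists>c. b = succ c" then obtain c where c: "b = succ c" by blast
          then have "c \<in> ext w" using b(2)[of c] nl by auto
          then show ?thesis using c sw by simp
        qed
      qed
    qed
    then show ?thesis using that by blast
  qed
  then have "{n. ordinal n \<and> (\<forall>m\<in>ext (succ n). \<not> limit m)} \<subseteq> ext w" by blast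
  then show ?thesis by (rule is_set_subset) (simp only: mem_Collect_eq, intro dfi)
qed
lemma ext_omega: "ext omega = {n. ordinal n \<and> (\<forall>m\<in>ext (succ n). \<not> limit m)}"
  unfolding omega_def by (rule ext_coll[OF is_set_omega])

lemma omega0[simp]: "empty \<in> ext omega"
  unfolding ext_omega by (auto simp: limit_def)
lemma omegaS[simp]: "n \<in> ext omega ==> succ n \<in> ext omega"
  unfolding ext_omega by (auto simp: limit_def)
lemma omega_ord: "n \<in> ext omega ==> ordinal n" unfolding ext_omega by simp
lemma omega_trans: "n \<in> ext omega ==> m \<in> ext n ==> m \<in> ext omega"
  unfolding ext_omega using ord_mem ord_trans by auto
lemma ord_omega[simp]: "ordinal omega"
  unfolding ordinal_def transitive_def using omega_trans omega_ord ord_trans by blast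
lemma omega_cases: assumes "n \<in> ext omega" obtains "n = empty" | m where "m \<in> ext omega" "n = succ m"
proof -
  have "n = empty \<or> (\<exists>c. n = succ c)" using assms unfolding ext_omega limit_def by auto
  then show ?thesis
  proof
    assume "\<exists>c. n = succ c"
    then obtain c where c: "n = succ c" by blast
    then have "c \<in> ext omega" using omega_trans[OF assms, of c] by simp
    then show ?thesis using that(2) c by blast
  qed (rule that(1))
qed
lemma omega_induct: assumes "n \<in> ext omega" "D1 P" "P empty"
  "\<And>n. n \<in> ext omega ==> P n ==> P (succ n)" shows "P n"
proof -
  have d: "D1 (%x. x \<in> ext omega --> P x)" by (intro dfi D1D[OF assms(2)])
  have "n \<in> ext omega --> P n"
  proof (rule ord_induct[OF omega_ord[OF assms(1)] d])
    fix b assume b: "ordinal b" "\<And>c. c \<in> ext b ==> c \<in> ext omega --> P c"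
    show "b \<in> ext omega --> P b"
    proof
      assume "b \<in> ext omega"
      then show "P b" by (cases rule: omega_cases) (use assms(3,4) b(2) in auto)
    qed
  qed
  then show ?thesis using assms(1) by blast
qed
lemma omega_least: assumes "D1 P" "n \<in> ext omega" "P n"
  obtains m where "m \<in> ext omega" "P m" "\<And>k. k \<in> ext m ==> \<not> P k"
proof -
  have d: "D1 (%x. x \<in> ext omega \<and> P x)" by (intro dfi D1D[OF assms(1)])
  have "n \<in> ext omega \<and> P n" using assms by blast
  from ord_least[OF d omega_ord[OF assms(2)] this] obtain b
    where "b \<in> ext omega \<and> P b" "\<And>c. c \<in> ext b ==> \<not> (c \<in> ext omega \<and> P c)" by metis
  then show ?thesis using that omega_trans by blast
qed

definition lst :: "('a => bool) => 'a" where
  "lst P = dsc (%n. n \<in> ext omega \<and> P n \<and> (\<forall>k\<in>ext n. \<not> P k))"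
lemma lst: assumes "D1 P" "n \<in> ext omega" "P n"
  shows "lst P \<in> ext omega" "P (lst P)" "\<And>k. k \<in> ext (lst P) ==> \<not> P k"
proof -
  obtain m where m: "m \<in> ext omega" "P m" "\<And>k. k \<in> ext m ==> \<not> P k"
    using omega_least[OF assms] by metis
  have e: "lst P = m" unfolding lst_def
  proof (rule dsc_eq)
    show "m \<in> ext omega \<and> P m \<and> (\<forall>k\<in>ext m. \<not> P k)" using m by blast
    fix k assume "k \<in> ext omega \<and> P k \<and> (\<forall>j\<in>ext k. \<not> P j)"
    then show "k = m" using m ord_linear[OF omega_ord[of k] omega_ord[of m]] by blast
  qed
  show "lst P \<in> ext omega" "P (lst P)" unfolding e using m by blast+
  show "\<And>k. k \<in> ext (lst P) ==> \<not> P k" unfolding e using m by blast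
qed
lemma DT_lst[dfi]: assumes "DF (%e. Q (%n. e (Suc n)) (e 0))" shows "DT (%e. lst (Q e))"
proof -
  have "DF (%e. Q (%n. e (Suc (Suc n))) (e 0))"
    using DF_ren[OF _ assms, of "case_nat 0 (%n. Suc (Suc n))"] by (simp add: inj_def split: nat.splits)
  then show ?thesis unfolding lst_def by (intro DT_dsc DF_ball DF_conj DF_neg assms dfi)
qed

lemma omega_le_cases: assumes "n \<in> ext omega" "m \<in> ext omega"
  shows "n \<in> ext m \<or> n = m \<or> m \<in> ext n"
  using ord_linear omega_ord assms by blast

text \<open>\<open>H\<close> is given the whole history \<open>restr f b\<close>, whose domain is
  the stage \<open>b\<close>, so \<open>H\<close> can recover the stage as
  \<open>dom\<close>.\<close>

definition isrec :: "('a => 'a) => 'a => 'a => bool" where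
  "isrec H f a \<longleftrightarrow> ordinal a \<and> (\<exists>c. func f a c) \<and> (\<forall>b\<in>ext a. ap f b = H (restr f b))"
definition trec :: "('a => 'a) => 'a => 'a" where
  "trec H a = H (dsc (%f. isrec H f a))"

text \<open>\<open>H\<close> may depend on the environment. The renaming \<open>r\<close> shifts
  this dependence when the operation is used under further quantifiers.\<close>

lemma DT_happ: assumes "DT (%e. H (%n. e (Suc n)) (e 0))" "inj r" "DT t"
  shows "DT (%e. H (%n. e (r n)) (t e))"
proof -
  let ?r = "case_nat 1 (case_nat 0 (%n. Suc (Suc (r n))))"
  have i: "inj ?r" by (rule injI) (auto split: nat.splits dest: injD[OF assms(2)])
  have "DF (%e. e 1 = H (%n. e (Suc (Suc (r n)))) (e 0))"
    using DF_ren[OF i assms(1)[unfolded DT_def]] by simp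
  then show ?thesis unfolding DT_def
    using DF_sub0[where Q="%y e. e 0 = H (%n. e (Suc (r n))) y", OF _ DT_shift[OF assms(3)]] by simp
qed

lemma DT_happ2: assumes "DT (%e. H (%n. e (Suc (Suc n))) (e 1) (e 0))" "inj r" "DT t" "DT u"
  shows "DT (%e. H (%n. e (r n)) (t e) (u e))"
proof -
  let ?H = "%e' y. H (%n. e' (Suc n)) (e' 0) y"
  have 1: "DT (%e. ?H (%n. e (Suc n)) (e 0))" using assms(1) by simp
  have 2: "inj (case_nat 0 (%n. Suc (r n)))" by (rule injI) (auto split: nat.splits dest: injD[OF assms(2)])
  have 3: "DT (%e. H (%n. e (Suc (r n))) (e 0) (u (%n. e (Suc n))))"
    using DT_happ[where H="?H", OF 1 2 DT_shift[OF assms(4)]] by simp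
  let ?G = "%e y. H (%n. e (r n)) y (u e)"
  have 4: "DT (%e. ?G (%n. e (Suc n)) (e 0))" using 3 by simp
  show ?thesis using DT_happ[where H="?G" and r=id, OF 4 inj_on_id assms(3)] by simp
qed

lemma DT_trec[dfi]: assumes H: "DT (%e. H (%n. e (Suc n)) (e 0))" and u: "DT u"
  shows "DT (%e. trec (H e) (u e))"
proof -
  have "DF (%e. isrec (H (%n. e (Suc (Suc n)))) (e 0) (e (Suc 0)))"
    unfolding isrec_def
    by (intro dfi DT_happ[OF H, where r="%n. Suc (Suc (Suc n))"]) (auto simp: inj_def)
  then have "DT (%e. trec (H (%n. e (Suc n))) (e 0))"
    unfolding trec_def by (intro DT_happ[OF H, where r=Suc] DT_dsc) auto
  from DT_happ[where H="%e. trec (H e)" and r=id, OF this _ u] show ?thesis by simp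
qed

lemma isrec_unique: assumes "isrec H f a" "isrec H g a'" "ext a \<subseteq> ext a'" "b \<in> ext a"
  shows "ap f b = ap g b"
proof -
  have d: "D1 (%x. x \<in> ext a --> ap f x = ap g x)" by (intro dfi)
  have oa: "ordinal a" using assms(1) isrec_def by blast
  have "b \<in> ext a --> ap f b = ap g b"
  proof (rule ord_induct[OF ord_mem[OF oa assms(4)] d])
    fix b assume b: "ordinal b" "\<And>c. c \<in> ext b ==> c \<in> ext a --> ap f c = ap g c"
    show "b \<in> ext a --> ap f b = ap g b"
    proof
      assume ba: "b \<in> ext a"
      then have s: "ext b \<subseteq> ext a" "ext b \<subseteq> ext a'" using ord_sub[OF oa] assms(3) by blast+
      obtain c1 c2 where f: "func f a c1" "func g a' c2" using assms(1,2) isrec_def by blast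
      have "restr f b = restr g b"
        by (rule func_eqI[OF restr_func[OF f(1) s(1)] restr_func[OF f(2) s(2)]])
          (use b(2) s in \<open>auto simp: restr_ap\<close>)
      then show "ap f b = ap g b" using assms(1,2,3) ba unfolding isrec_def by auto
    qed
  qed
  then show ?thesis using assms(4) by blast
qed

lemma isrec_eq: assumes "isrec H f a" "isrec H g a" shows "f = g"
proof -
  obtain c d where "func f a c" "func g a d" using assms unfolding isrec_def by blast
  then show ?thesis by (rule func_eqI) (rule isrec_unique[OF assms], auto)
qed

text \<open>Existence of the approximation is proved by naming it in advance: it is the graph of
  \<open>trec H\<close> below \<open>a\<close>. At smaller stages approximations are unique, so the
  description inside \<open>trec\<close> evaluates to the right one.\<close>

lemma isrec_lam: assumes H: "F1 H" and "ordinal a"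
  shows "isrec H (lam a (trec H)) a"
proof -
  have dt: "F1 (trec H)" by (intro dfi F1D[OF H])
  have dp: "D1 (%a. isrec H (lam a (trec H)) a)" unfolding isrec_def
    by (intro dfi F1D[OF H] F1D[OF dt])
  show ?thesis
  proof (rule ord_induct[OF assms(2) dp])
    fix a assume a: "ordinal a" "\<And>b. b \<in> ext a ==> isrec H (lam b (trec H)) b"
    have f: "func (lam a (trec H)) a (img (trec H) a)" by (rule lam_func_img[OF dt])
    have "ap (lam a (trec H)) b = H (restr (lam a (trec H)) b)" if b: "b \<in> ext a" for b
    proof -
      have s: "ext b \<subseteq> ext a" using ord_sub a b by blast
      have "isrec H k b ==> k = lam b (trec H)" for k
        using a(2)[OF b] isrec_eq by blast
      then have "dsc (%f. isrec H f b) = lam b (trec H)" using a(2)[OF b] by (intro dsc_eq)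
      then have "trec H b = H (lam b (trec H))" by (simp add: trec_def)
      moreover have "restr (lam a (trec H)) b = lam b (trec H)"
        by (rule func_eqI[OF restr_func[OF f s] lam_func_img[OF dt]])
          (use s in \<open>auto simp: restr_ap ap_lam[OF dt]\<close>)
      ultimately show ?thesis using b by (simp add: ap_lam[OF dt])
    qed
    then show "isrec H (lam a (trec H)) a" unfolding isrec_def using a(1) f by blast
  qed
qed

lemma trec_eq: assumes H: "F1 H" and "ordinal a"
  shows "trec H a = H (lam a (trec H))"
proof -
  have "isrec H k a ==> k = lam a (trec H)" for k
    using isrec_lam[OF assms] isrec_eq by blast
  then have "dsc (%f. isrec H f a) = lam a (trec H)" using isrec_lam[OF assms] by (intro dsc_eq)
  then show ?thesis by (simp add: trec_def)
qed

text \<open>At stage \<open>succ n\<close> the history has domain \<open>succ n\<close>, from which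
  \<open>un\<close> recovers \<open>n\<close>.\<close>

definition nrec :: "'a => ('a => 'a => 'a) => 'a => 'a" where
  "nrec a G n = trec (%f. if dom f = empty then a else G (un (dom f)) (ap f (un (dom f)))) n"

lemma DT_nrec[dfi]: assumes "DT a" "DT (%e. G (%n. e (Suc (Suc n))) (e 1) (e 0))" "DT u"
  shows "DT (%e. nrec (a e) (G e) (u e))"
  unfolding nrec_def
  by (intro DT_trec[where H="%e f. if dom f = empty then a e else G e (un (dom f)) (ap f (un (dom f)))"]
    DT_if DT_shift[OF assms(1)] DT_happ2[OF assms(2), where r=Suc] assms(3)) (intro dfi | simp)+

lemma nrec: assumes G: "F2 G"
  shows nrec_0: "nrec a G empty = a"
    and nrec_S: "n \<in> ext omega ==> nrec a G (succ n) = G n (nrec a G n)"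
proof -
  let ?H = "%f. if dom f = empty then a else G (un (dom f)) (ap f (un (dom f)))"
  have H: "F1 ?H" by (intro dfi F2D[OF G])
  have dt: "F1 (trec ?H)" by (intro dfi F2D[OF G])
  have dl: "dom (lam b (trec ?H)) = b" for b by (rule func_dom[OF lam_func_img[OF dt]])
  show "nrec a G empty = a" unfolding nrec_def by (subst trec_eq[OF H]) (auto simp: dl)
  assume n: "n \<in> ext omega"
  then have "un (succ n) = n" using omega_ord ordinal_def by (intro un_succ) blast
  then show "nrec a G (succ n) = G n (nrec a G n)" unfolding nrec_def
    using n omega_ord by (subst trec_eq[OF H]) (auto simp: dl ap_lam[OF dt])
qed

end

context zf_model
begin

section \<open>Natural numbers and countable sets\<close>

definition addn :: "'a => 'a => 'a" where "addn m n = nrec m (%_ x. succ x) n"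
lemma DT_addn[dfi]: assumes "DT t" "DT u" shows "DT (%e. addn (t e) (u e))"
  unfolding addn_def by (intro dfi assms)
lemma F2_succ: "F2 (%_ x. succ x)" by (intro dfi)
lemma addn_0[simp]: "addn m empty = m" unfolding addn_def by (rule nrec_0[OF F2_succ])
lemma addn_S[simp]: "n \<in> ext omega ==> addn m (succ n) = succ (addn m n)"
  unfolding addn_def by (rule nrec_S[OF F2_succ])
lemma addn_in[simp]: assumes "m \<in> ext omega" "n \<in> ext omega" shows "addn m n \<in> ext omega"
  by (rule omega_induct[OF assms(2), where P="%n. addn m n \<in> ext omega"]) (intro dfi, use assms in auto)
lemma addn_0l[simp]: assumes "n \<in> ext omega" shows "addn empty n = n"
  by (rule omega_induct[OF assms, where P="%n. addn empty n = n"]) (intro dfi, auto)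
lemma addn_Sl[simp]: assumes "n \<in> ext omega" shows "addn (succ m) n = succ (addn m n)"
  by (rule omega_induct[OF assms, where P="%n. addn (succ m) n = succ (addn m n)"]) (intro dfi, auto)
lemma addn_mono: assumes "j \<in> ext omega" "i \<in> ext j" shows "addn k i \<in> ext (addn k j)"
proof -
  have "\<forall>i\<in>ext j. addn k i \<in> ext (addn k j)"
    by (rule omega_induct[OF assms(1), where P="%j. \<forall>i\<in>ext j. addn k i \<in> ext (addn k j)"]) (intro dfi, auto)
  then show ?thesis using assms(2) by blast
qed
lemma addn_ge: assumes "i \<in> ext omega" shows "ext k \<subseteq> ext (addn k i)"
  by (rule omega_induct[OF assms, where P="%i. ext k \<subseteq> ext (addn k i)"]) (intro dfi, auto)
lemma addn_inj: assumes "i \<in> ext omega" "j \<in> ext omega" "addn k i = addn k j" shows "i = j"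
  using omega_le_cases[OF assms(1,2)] addn_mono[OF assms(2), of i k] addn_mono[OF assms(1), of j k] assms(3)
  by auto

definition pfst :: "'a => 'a" where "pfst p = dsc (%a. \<exists>b. p = opair a b)"
definition psnd :: "'a => 'a" where "psnd p = dsc (%b. \<exists>a. p = opair a b)"
lemma pfst[simp]: "pfst (opair a b) = a" unfolding pfst_def by (rule dsc_eq) auto
lemma psnd[simp]: "psnd (opair a b) = b" unfolding psnd_def by (rule dsc_eq) auto
lemma DT_pfst[dfi]: assumes "DT t" shows "DT (%e. pfst (t e))"
  by (rule DT1[where F=pfst, OF _ assms]) (unfold pfst_def, intro dfi)
lemma DT_psnd[dfi]: assumes "DT t" shows "DT (%e. psnd (t e))"
  by (rule DT1[where F=psnd, OF _ assms]) (unfold psnd_def, intro dfi)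

text \<open>Cantor's walk along the antidiagonals, with \<open>un\<close> as predecessor: the pair
  \<open>a, b + 1\<close> is followed by \<open>a + 1, b\<close>, and the pair \<open>a, 0\<close>
  by \<open>0, a + 1\<close>.\<close>

definition nextp :: "'a => 'a" where
  "nextp p = (if psnd p = empty then opair empty (succ (pfst p)) else opair (succ (pfst p)) (un (psnd p)))"
definition prs :: 'a where "prs = lam omega (nrec (opair empty empty) (%_ p. nextp p))"
lemma F1_nextp: "F1 nextp" by (intro F1I, unfold nextp_def, intro dfi)
lemmas [dfi] = F1D[OF F1_nextp]

lemma omega_un_succ: "n \<in> ext omega ==> un (succ n) = n"
  using omega_ord ordinal_def by (intro un_succ) blast

lemma prs: "func prs omega (cprod omega omega)" "ap prs ` ext omega = ext (cprod omega omega)"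
proof -
  let ?N = "nrec (opair empty empty) (%_ p. nextp p)"
  have G: "F2 (%_ p. nextp p)" by (intro dfi)
  have N: "F1 ?N" by (intro dfi)
  have N0: "?N empty = opair empty empty" by (rule nrec_0[OF G])
  have NS: "?N (succ n) = nextp (?N n)" if "n \<in> ext omega" for n by (rule nrec_S[OF G that])
  have in2: "?N n \<in> ext (cprod omega omega)" if "n \<in> ext omega" for n
  proof (rule omega_induct[OF that, where P="%n. ?N n \<in> ext (cprod omega omega)"])
    show "D1 (%n. ?N n \<in> ext (cprod omega omega))" by (intro dfi)
    show "?N empty \<in> ext (cprod omega omega)" unfolding N0 by simp
    fix n assume n: "n \<in> ext omega" "?N n \<in> ext (cprod omega omega)"
    then obtain a b where ab: "?N n = opair a b" "a \<in> ext omega" "b \<in> ext omega" by auto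
    from ab(3) show "?N (succ n) \<in> ext (cprod omega omega)" unfolding NS[OF n(1)] ab(1)
      by (cases rule: omega_cases) (use ab in \<open>auto simp: nextp_def omega_un_succ\<close>)
  qed
  show f: "func prs omega (cprod omega omega)" unfolding prs_def by (rule lam_func[OF N in2])
  let ?R = "%a b. \<exists>n\<in>ext omega. ?N n = opair a b"
  have s1: "?R (succ a) b" if h: "?R a (succ b)" "b \<in> ext omega" for a b
  proof -
    obtain n where "n \<in> ext omega" "?N n = opair a (succ b)" using h by blast
    then show ?thesis using NS[of n] h(2) by (intro bexI[of _ "succ n"]) (auto simp: nextp_def omega_un_succ)
  qed
  have s2: "?R empty (succ a)" if h: "?R a empty" for a
  proof -
    obtain n where "n \<in> ext omega" "?N n = opair a empty" using h by blast
    then show ?thesis using NS[of n] by (intro bexI[of _ "succ n"]) (auto simp: nextp_def)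
  qed
  \<comment> \<open>Following an antidiagonal from the pair \<open>a, k\<close> leads to
    \<open>a + k, 0\<close>. Together with \<open>s2\<close> this passes from \<open>m, 0\<close> to
    \<open>m + 1, 0\<close>.\<close>
  have B: "\<forall>a\<in>ext omega. ?R a k --> ?R (addn a k) empty" if "k \<in> ext omega" for k
  proof (rule omega_induct[OF that, where P="%k. \<forall>a\<in>ext omega. ?R a k --> ?R (addn a k) empty"])
    show "D1 (%k. \<forall>a\<in>ext omega. ?R a k --> ?R (addn a k) empty)" by (intro dfi)
    show "\<forall>a\<in>ext omega. ?R a empty --> ?R (addn a empty) empty" by simp
    fix k assume k: "k \<in> ext omega" and IH: "\<forall>a\<in>ext omega. ?R a k --> ?R (addn a k) empty"
    show "\<forall>a\<in>ext omega. ?R a (succ k) --> ?R (addn a (succ k)) empty"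
    proof (intro ballI impI)
      fix a assume a: "a \<in> ext omega" "?R a (succ k)"
      have "?R (addn (succ a) k) empty" using IH s1[OF a(2) k] omegaS[OF a(1)] by blast
      then show "?R (addn a (succ k)) empty" by (simp only: addn_Sl[OF k] addn_S[OF k])
    qed
  qed
  have A: "?R m empty" if "m \<in> ext omega" for m
  proof (rule omega_induct[OF that, where P="%m. ?R m empty"])
    show "D1 (%m. ?R m empty)" by (intro dfi)
    show "?R empty empty" using N0 by (intro bexI[of _ empty]) auto
    fix m assume "m \<in> ext omega" "?R m empty"
    then have "?R (addn empty (succ m)) empty" using s2[of m] B[of "succ m"] omega0 omegaS by blast
    then show "?R (succ m) empty" using \<open>m \<in> ext omega\<close> by (simp only: addn_0l[OF omegaS])
  qed
  have Z: "?R empty m" if "m \<in> ext omega" for m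
    using that
  proof (cases rule: omega_cases)
    case 1 show ?thesis unfolding 1 by (rule A[OF omega0])
  next
    case (2 k) show ?thesis unfolding 2(2) by (rule s2[OF A[OF 2(1)]])
  qed
  have C: "\<forall>n\<in>ext omega. ?R m n" if "m \<in> ext omega" for m
  proof (rule omega_induct[OF that, where P="%m. \<forall>n\<in>ext omega. ?R m n"])
    show "D1 (%m. \<forall>n\<in>ext omega. ?R m n)" by (intro dfi)
    show "\<forall>n\<in>ext omega. ?R empty n" using Z by blast
    show "\<And>m. m \<in> ext omega ==> \<forall>n\<in>ext omega. ?R m n ==> \<forall>n\<in>ext omega. ?R (succ m) n" using s1 omegaS by blast
  qed
  have e: "ap prs n = ?N n" if "n \<in> ext omega" for n unfolding prs_def by (rule ap_lam[OF N that])
  show "ap prs ` ext omega = ext (cprod omega omega)"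
  proof
    show "ap prs ` ext omega \<subseteq> ext (cprod omega omega)" using func_ap_in[OF f] by blast
    show "ext (cprod omega omega) \<subseteq> ap prs ` ext omega"
    proof
      fix p assume "p \<in> ext (cprod omega omega)"
      then obtain a b where "p = opair a b" "a \<in> ext omega" "b \<in> ext omega" by auto
      then obtain n where "n \<in> ext omega" "?N n = p" using C by blast
      then show "p \<in> ap prs ` ext omega" using e by force
    qed
  qed
qed

definition lf :: "'a => 'a" where "lf j = pfst (ap prs j)"
definition rt :: "'a => 'a" where "rt j = psnd (ap prs j)"
definition pr :: "'a => 'a => 'a" where "pr i m = lst (%j. ap prs j = opair i m)"
lemma DT_lf[dfi]: assumes "DT t" shows "DT (%e. lf (t e))" unfolding lf_def by (intro dfi assms)
lemma DT_rt[dfi]: assumes "DT t" shows "DT (%e. rt (t e))" unfolding rt_def by (intro dfi assms)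
lemma F2_pr: "F2 pr" by (intro F2I, unfold pr_def, intro dfi)
lemmas [dfi] = F2D[OF F2_pr]
lemma prs_lr: assumes "j \<in> ext omega" shows "ap prs j = opair (lf j) (rt j)" "lf j \<in> ext omega" "rt j \<in> ext omega"
  using func_ap_in[OF prs(1) assms] unfolding lf_def rt_def by auto
lemma pr: assumes "i \<in> ext omega" "m \<in> ext omega"
  shows "pr i m \<in> ext omega" "lf (pr i m) = i" "rt (pr i m) = m"
proof -
  have "opair i m \<in> ap prs ` ext omega" using assms prs(2) by simp
  then obtain j where j: "j \<in> ext omega" "ap prs j = opair i m" by auto
  have d: "D1 (%j. ap prs j = opair i m)" by (intro dfi)
  show "pr i m \<in> ext omega" "lf (pr i m) = i" "rt (pr i m) = m"
    using lst[OF d j] unfolding pr_def lf_def rt_def by auto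
qed

text \<open>Countable and nonempty, witnessed by an enumeration. An enumeration is what
  constructions of generic sequences consume, and it passes to images directly.\<close>

definition ctb :: "'a => bool" where
  "ctb X \<longleftrightarrow> (\<exists>e. func e omega X \<and> (\<forall>x\<in>ext X. \<exists>n\<in>ext omega. ap e n = x))"
lemma DF_ctb[dfi]: assumes "DT t" shows "DF (%e. ctb (t e))"
  by (rule DF1[where P=ctb, OF _ assms]) (unfold ctb_def, intro dfi)

lemma ctbI: assumes "F1 F" "\<And>n. n \<in> ext omega ==> F n \<in> ext X" "\<And>x. x \<in> ext X ==> \<exists>n\<in>ext omega. F n = x"
  shows "ctb X"
  unfolding ctb_def using lam_func[OF assms(1), of omega X] assms(2,3) ap_lam[OF assms(1)] by metis

lemma ctb_omega: "ctb omega" by (rule ctbI[where F="%x. x"]) (intro dfi, auto)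
lemma ctb_ne: "ctb X ==> \<exists>x. x \<in> ext X" unfolding ctb_def using func_ap_in omega0 by blast

lemma ctb_img: assumes "ctb X" "F1 F" shows "ctb (img F X)"
proof -
  obtain e where e: "func e omega X" "\<And>x. x \<in> ext X ==> \<exists>n\<in>ext omega. ap e n = x"
    using assms(1) ctb_def by metis
  show ?thesis
    by (rule ctbI[where F="%n. F (ap e n)"]) (intro dfi F1D[OF assms(2)], use e func_ap_in[OF e(1)] in \<open>auto simp: ext_img[OF assms(2)]\<close>)
qed

lemma ctb_surj: assumes "ctb X" "F1 F" "\<And>x. x \<in> ext X ==> F x \<in> ext Y" "\<And>y. y \<in> ext Y ==> \<exists>x\<in>ext X. F x = y"
  shows "ctb Y"
proof -
  have "ext (img F X) = ext Y" unfolding ext_img[OF assms(2)] using assms(3,4) by blast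
  then have "img F X = Y" by (rule ext_inject)
  then show ?thesis using ctb_img[OF assms(1,2)] by simp
qed

lemma ctb_prod: assumes "ctb X" "ctb Y" shows "ctb (cprod X Y)"
proof -
  obtain e where e: "func e omega X" "\<And>x. x \<in> ext X ==> \<exists>n\<in>ext omega. ap e n = x"
    using assms(1) ctb_def by metis
  obtain d where d: "func d omega Y" "\<And>x. x \<in> ext Y ==> \<exists>n\<in>ext omega. ap d n = x"
    using assms(2) ctb_def by metis
  show ?thesis
  proof (rule ctbI[where F="%j. opair (ap e (lf j)) (ap d (rt j))"])
    show "F1 (%j. opair (ap e (lf j)) (ap d (rt j)))" by (intro dfi)
    show "opair (ap e (lf n)) (ap d (rt n)) \<in> ext (cprod X Y)" if "n \<in> ext omega" for n
      using func_ap_in[OF e(1)] func_ap_in[OF d(1)] prs_lr[OF that] by simp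
    fix x assume "x \<in> ext (cprod X Y)"
    then obtain a b where x: "x = opair a b" "a \<in> ext X" "b \<in> ext Y" by auto
    obtain n m where "n \<in> ext omega" "ap e n = a" "m \<in> ext omega" "ap d m = b" using e(2) d(2) x by blast
    then show "\<exists>n\<in>ext omega. opair (ap e (lf n)) (ap d (rt n)) = x"
      using pr[of n m] x by (intro bexI[of _ "pr n m"]) auto
  qed
qed

lemma ctb_bun: assumes "ctb X" "ctb Y" shows "ctb (bun X Y)"
proof -
  obtain x0 y0 where x0: "x0 \<in> ext X" "y0 \<in> ext Y" using assms ctb_ne by blast
  show ?thesis
  proof (rule ctb_surj[OF ctb_prod[OF ctb_omega ctb_prod[OF assms]],
      where F="%p. if pfst p = empty then pfst (psnd p) else psnd (psnd p)"])
    show "F1 (%p. if pfst p = empty then pfst (psnd p) else psnd (psnd p))" by (intro dfi)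
    show "(if pfst p = empty then pfst (psnd p) else psnd (psnd p)) \<in> ext (bun X Y)"
      if "p \<in> ext (cprod omega (cprod X Y))" for p using that by auto
    fix z assume "z \<in> ext (bun X Y)"
    then consider "z \<in> ext X" | "z \<in> ext Y" by auto
    then show "\<exists>p\<in>ext (cprod omega (cprod X Y)). (if pfst p = empty then pfst (psnd p) else psnd (psnd p)) = z"
    proof cases
      case 1 then show ?thesis using x0 by (intro bexI[of _ "opair empty (opair z y0)"]) auto
    next
      case 2 then show ?thesis using x0 by (intro bexI[of _ "opair (succ empty) (opair x0 z)"]) auto
    qed
  qed
qed

lemma ctb_of_inj: assumes "F1 F" "ctb Y" "x0 \<in> ext X" "\<And>x. x \<in> ext X ==> F x \<in> ext Y"
    "\<And>x y. x \<in> ext X ==> y \<in> ext X ==> F x = F y ==> x = y" shows "ctb X"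
proof -
  let ?P = "%y x. x \<in> ext X \<and> F x = y"
  have u: "dsc (?P (F x)) = x" if "x \<in> ext X" for x
    by (rule dsc_eq) (use assms(5) that in blast)+
  show ?thesis
  proof (rule ctb_surj[OF assms(2), where F="%y. if (\<exists>x. ?P y x) then dsc (?P y) else x0"])
    show "F1 (%y. if (\<exists>x. ?P y x) then dsc (?P y) else x0)" by (intro dfi F1D[OF assms(1)])
    show "(if (\<exists>x. ?P y x) then dsc (?P y) else x0) \<in> ext X" for y using u assms(3) by auto
    show "\<exists>y\<in>ext Y. (if (\<exists>x. ?P y x) then dsc (?P y) else x0) = x" if "x \<in> ext X" for x
    proof (rule bexI[of _ "F x"])
      have "\<exists>x'. ?P (F x) x'" using that by blast
      then show "(if (\<exists>x'. ?P (F x) x') then dsc (?P (F x)) else x0) = x" using u[OF that] by presburger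
    qed (rule assms(4)[OF that])
  qed
qed

lemma ctb_of_countable: assumes "countable X" "x0 \<in> ext X" shows "ctb X"
proof -
  obtain f where f: "func f X omega" "inj_on (app f) (ext X)" using assms(1) unfolding countable_def injection_def by blast
  show ?thesis
  proof (rule ctb_of_inj[where F="ap f", OF _ ctb_omega assms(2)])
    show "F1 (ap f)" by (intro dfi)
    show "\<And>x. x \<in> ext X ==> ap f x \<in> ext omega" by (rule func_ap_in[OF f(1)])
    show "\<And>x y. x \<in> ext X ==> y \<in> ext X ==> ap f x = ap f y ==> x = y"
      using f(2) func_app[OF f(1)] unfolding inj_on_def by metis
  qed
qed

subsection \<open>Finite sequences\<close>

definition snoc :: "'a => 'a => 'a" where "snoc s a = bun s (up (opair (dom s) a) (opair (dom s) a))"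
lemma DT_snoc[dfi]: assumes "DT t" "DT u" shows "DT (%e. snoc (t e) (u e))"
  unfolding snoc_def by (intro dfi assms)

lemma ext_fin_seqs: "ext (fin_seqs l) = {s. \<exists>n\<in>ext omega. func s n l}"
proof -
  have "{s. \<exists>n\<in>ext omega. func s n l} \<subseteq> ext (pow (cprod omega l))"
  proof
    fix s assume "s \<in> {s. \<exists>n\<in>ext omega. func s n l}"
    then obtain n where n: "n \<in> ext omega" "func s n l" by blast
    have "ext s \<subseteq> ext (cprod n l)" using n(2) unfolding func_def by blast
    also have "\<dots> \<subseteq> ext (cprod omega l)" unfolding ext_cprod using omega_trans[OF n(1)] by blast
    finally show "s \<in> ext (pow (cprod omega l))" by simp
  qed
  then have "is_set {s. \<exists>n\<in>ext omega. func s n l}" by (rule is_set_subset) (simp only: mem_Collect_eq, intro dfi)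
  then show ?thesis unfolding fin_seqs_def by (rule ext_coll)
qed
lemma F1_fin_seqs: "F1 fin_seqs" by (intro F1I, unfold fin_seqs_def, intro dfi)
lemmas [dfi] = F1D[OF F1_fin_seqs]

lemma snoc: assumes "func s n l" "a \<in> ext l"
  shows snoc_func: "func (snoc s a) (succ n) l" and snoc_last: "ap (snoc s a) n = a"
    and snoc_ap: "i \<in> ext n ==> ap (snoc s a) i = ap s i" and snoc_restr: "restr (snoc s a) n = s"
    and snoc_sub: "ext s \<subseteq> ext (snoc s a)"
proof -
  have d: "dom s = n" by (rule func_dom[OF assms(1)])
  have m: "opair i y \<in> ext (snoc s a) \<longleftrightarrow> (i \<in> ext n \<and> y = ap s i) \<or> (i = n \<and> y = a)" for i y
    unfolding snoc_def d using func_opair_iff[OF assms(1)] by auto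
  have "ext (snoc s a) \<subseteq> ext (cprod (succ n) l)"
    unfolding snoc_def d using assms unfolding func_def by auto
  then show f: "func (snoc s a) (succ n) l" unfolding func_def m by auto
  show "ap (snoc s a) n = a" by (rule ap_eq) (auto simp: m)
  show i: "i \<in> ext n ==> ap (snoc s a) i = ap s i" for i by (rule ap_eq) (auto simp: m)
  have sub: "ext n \<subseteq> ext (succ n)" by auto
  show "restr (snoc s a) n = s" by (rule func_eqI[OF restr_func[OF f sub] assms(1)]) (simp add: restr_ap i)
  show "ext s \<subseteq> ext (snoc s a)" unfolding snoc_def by auto
qed

lemma snoc_decomp: assumes "func t (succ n) l" shows "func (restr t n) n l" "ap t n \<in> ext l" "t = snoc (restr t n) (ap t n)"
proof -
  show f: "func (restr t n) n l" by (rule restr_func[OF assms]) auto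
  show a: "ap t n \<in> ext l" by (rule func_ap_in[OF assms]) auto
  show "t = snoc (restr t n) (ap t n)"
    by (rule func_eqI[OF assms snoc_func[OF f a]]) (auto simp: snoc_last[OF f a] snoc_ap[OF f a] restr_ap)
qed

lemma func_empty[simp]: "func empty empty l" by (simp add: func_def)
lemma func_empty_eq: "func s empty l ==> s = empty" by (rule func_eqI[of _ empty]) auto

text \<open>One enumeration of \<open>X\<close> yields enumerations of the sequences of each length
  by recursion on the length; this uniformity takes the place of countable choice.\<close>

lemma ctb_fin_seqs: assumes "ctb X" shows "ctb (fin_seqs X)"
proof -
  obtain d where d: "func d omega X" "\<And>x. x \<in> ext X ==> \<exists>n\<in>ext omega. ap d n = x"
    using assms ctb_def by metis
  let ?G = "%n g. lam omega (%k. snoc (ap g (lf k)) (ap d (rt k)))"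
  let ?N = "nrec (lam omega (%_. empty)) ?G"
  have G: "F2 ?G" by (intro dfi)
  have c0: "F1 (%_. empty)" by (intro dfi)
  have c1: "F1 (%k. snoc (ap g (lf k)) (ap d (rt k)))" for g by (intro dfi)
  have N: "F1 ?N" by (intro dfi)
  have key: "(\<forall>k\<in>ext omega. func (ap (?N n) k) n X) \<and> (\<forall>s. func s n X --> (\<exists>k\<in>ext omega. ap (?N n) k = s))"
    if "n \<in> ext omega" for n
  proof (rule omega_induct[OF that, where P="%n. (\<forall>k\<in>ext omega. func (ap (?N n) k) n X) \<and>
      (\<forall>s. func s n X --> (\<exists>k\<in>ext omega. ap (?N n) k = s))"])
    show "D1 (%n. (\<forall>k\<in>ext omega. func (ap (?N n) k) n X) \<and>
      (\<forall>s. func s n X --> (\<exists>k\<in>ext omega. ap (?N n) k = s)))" by (intro dfi)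
    show "(\<forall>k\<in>ext omega. func (ap (?N empty) k) empty X) \<and>
      (\<forall>s. func s empty X --> (\<exists>k\<in>ext omega. ap (?N empty) k = s))"
    proof (intro conjI ballI allI impI)
      show "func (ap (?N empty) k) empty X" if "k \<in> ext omega" for k
        unfolding nrec_0[OF G] using that by (simp add: ap_lam[OF c0])
      show "\<exists>k\<in>ext omega. ap (?N empty) k = s" if "func s empty X" for s
        unfolding nrec_0[OF G] using func_empty_eq[OF that]
        by (intro bexI[of _ empty]) (simp_all add: ap_lam[OF c0])
    qed
    fix n assume n: "n \<in> ext omega" and IH: "(\<forall>k\<in>ext omega. func (ap (?N n) k) n X) \<and>
      (\<forall>s. func s n X --> (\<exists>k\<in>ext omega. ap (?N n) k = s))"
    have e: "ap (?N (succ n)) k = snoc (ap (?N n) (lf k)) (ap d (rt k))" if "k \<in> ext omega" for k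
      unfolding nrec_S[OF G n] by (rule ap_lam[OF c1 that])
    have 1: "func (ap (?N (succ n)) k) (succ n) X" if "k \<in> ext omega" for k
      unfolding e[OF that] using IH prs_lr[OF that] func_ap_in[OF d(1)] by (intro snoc_func) auto
    have 2: "\<exists>k\<in>ext omega. ap (?N (succ n)) k = s" if "func s (succ n) X" for s
    proof -
      note D = snoc_decomp[OF that]
      obtain i where i: "i \<in> ext omega" "ap (?N n) i = restr s n" using conjunct2[OF IH] D(1) by blast
      obtain j where j: "j \<in> ext omega" "ap d j = ap s n" using d(2)[OF D(2)] by blast
      have "ap (?N (succ n)) (pr i j) = s" using e[of "pr i j"] pr[OF i(1) j(1)] i(2) j(2) D(3) by simp
      then show ?thesis using pr(1)[OF i(1) j(1)] by blast
    qed
    show "(\<forall>k\<in>ext omega. func (ap (?N (succ n)) k) (succ n) X) \<and>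
      (\<forall>s. func s (succ n) X --> (\<exists>k\<in>ext omega. ap (?N (succ n)) k = s))" using 1 2 by blast
  qed
  show ?thesis
  proof (rule ctbI[where F="%j. ap (?N (lf j)) (rt j)"])
    show "F1 (%j. ap (?N (lf j)) (rt j))" by (intro dfi)
    show "ap (?N (lf n)) (rt n) \<in> ext (fin_seqs X)" if "n \<in> ext omega" for n
      using key[of "lf n"] prs_lr[OF that] by (auto simp: ext_fin_seqs)
    fix s assume "s \<in> ext (fin_seqs X)"
    then obtain n where n: "n \<in> ext omega" "func s n X" by (auto simp: ext_fin_seqs)
    then obtain k where k: "k \<in> ext omega" "ap (?N n) k = s" using key[OF n(1)] n(2) by blast
    show "\<exists>j\<in>ext omega. ap (?N (lf j)) (rt j) = s"
      by (rule bexI[of _ "pr n k"]) (simp_all add: pr[OF n(1) k(1)] k(2))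
  qed
qed

end

context zf_model
begin

section \<open>Well-orders\<close>

text \<open>Least elements of all nonempty subsets, applied to pairs and triples, give reflexivity,
  totality and transitivity. Since \<open>w\<close> is unrestricted outside \<open>X\<close>, the
  same \<open>w\<close> well-orders every subset of \<open>X\<close>.\<close>

definition WO :: "'a => 'a => bool" where
  "WO w X \<longleftrightarrow> (\<forall>Z. ext Z \<subseteq> ext X --> Z \<noteq> empty --> (\<exists>z\<in>ext Z. \<forall>y\<in>ext Z. opair z y \<in> ext w)) \<and>
    (\<forall>a\<in>ext X. \<forall>b\<in>ext X. opair a b \<in> ext w --> opair b a \<in> ext w --> a = b)"

lemma DF_WO[dfi]: assumes "DT t" "DT u" shows "DF (%e. WO (t e) (u e))"
  by (rule DF2[where P=WO, OF _ assms]) (unfold WO_def, intro dfi)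

definition lw :: "'a => 'a => 'a" where
  "lw w Z = dsc (%z. z \<in> ext Z \<and> (\<forall>y\<in>ext Z. opair z y \<in> ext w))"
lemma F2_lw: "F2 lw" by (intro F2I, unfold lw_def, intro dfi)
lemmas [dfi] = F2D[OF F2_lw]

lemma WO_antisym: "WO w X ==> a \<in> ext X ==> b \<in> ext X ==> opair a b \<in> ext w ==> opair b a \<in> ext w ==> a = b"
  unfolding WO_def by blast
lemma WO_least: assumes "WO w X" "ext Z \<subseteq> ext X" "x \<in> ext Z"
  obtains z where "z \<in> ext Z" "\<And>y. y \<in> ext Z ==> opair z y \<in> ext w"
proof -
  have "Z \<noteq> empty" using assms(3) by auto
  then show ?thesis using assms(1,2) that unfolding WO_def by blast
qed
lemma WO_refl: assumes "WO w X" "a \<in> ext X" shows "opair a a \<in> ext w"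
  by (rule WO_least[OF assms(1), of "up a a" a]) (use assms(2) in auto)
lemma WO_total: assumes "WO w X" "a \<in> ext X" "b \<in> ext X" shows "opair a b \<in> ext w \<or> opair b a \<in> ext w"
  by (rule WO_least[OF assms(1), of "up a b" a]) (use assms(2,3) in auto)

lemma lw: assumes "WO w X" "ext Z \<subseteq> ext X" "x \<in> ext Z"
  shows "lw w Z \<in> ext Z" "\<And>y. y \<in> ext Z ==> opair (lw w Z) y \<in> ext w"
proof -
  obtain z where z: "z \<in> ext Z" "\<And>y. y \<in> ext Z ==> opair z y \<in> ext w" using WO_least[OF assms] by blast
  have e: "lw w Z = z" unfolding lw_def
  proof (rule dsc_eq)
    show "z \<in> ext Z \<and> (\<forall>y\<in>ext Z. opair z y \<in> ext w)" using z by blast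
    fix k assume "k \<in> ext Z \<and> (\<forall>y\<in>ext Z. opair k y \<in> ext w)"
    then show "k = z" using z WO_antisym[OF assms(1), of k z] assms(2) by blast
  qed
  show "lw w Z \<in> ext Z" unfolding e by (rule z(1))
  show "\<And>y. y \<in> ext Z ==> opair (lw w Z) y \<in> ext w" unfolding e by (rule z(2))
qed

definition pull :: "('a => 'a) => 'a => 'a => 'a" where
  "pull m w Y = sep (cprod Y Y) (%p. opair (m (pfst p)) (m (psnd p)) \<in> ext w)"

lemma WO_pull: assumes "WO w X" "F1 m" "\<And>y. y \<in> ext Y ==> m y \<in> ext X"
    "\<And>y z. y \<in> ext Y ==> z \<in> ext Y ==> m y = m z ==> y = z"
  shows "WO (pull m w Y) Y"
proof -
  have "D1 (%p. opair (m (pfst p)) (m (psnd p)) \<in> ext w)" by (intro dfi F1D[OF assms(2)])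
  from ext_sep[OF this] have p: "opair a b \<in> ext (pull m w Y) \<longleftrightarrow> a \<in> ext Y \<and> b \<in> ext Y \<and> opair (m a) (m b) \<in> ext w" for a b
    unfolding pull_def by auto
  show ?thesis unfolding WO_def
  proof (intro conjI allI impI ballI)
    fix Z assume Z: "ext Z \<subseteq> ext Y" "Z \<noteq> empty"
    then obtain z0 where z0: "z0 \<in> ext Z" using empty_iff by blast
    have i: "ext (img m Z) = m ` ext Z" by (rule ext_img[OF assms(2)])
    have "ext (img m Z) \<subseteq> ext X" "m z0 \<in> ext (img m Z)" unfolding i using assms(3) Z(1) z0 by blast+
    from WO_least[OF assms(1) this] obtain v where v: "v \<in> m ` ext Z" "\<And>y. y \<in> m ` ext Z ==> opair v y \<in> ext w"
      unfolding i by blast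
    then obtain z where z: "z \<in> ext Z" "v = m z" by blast
    have "opair z y \<in> ext (pull m w Y)" if y: "y \<in> ext Z" for y
      unfolding p using v(2)[OF imageI[OF y]] z Z(1) y by auto
    then show "\<exists>z\<in>ext Z. \<forall>y\<in>ext Z. opair z y \<in> ext (pull m w Y)" using z(1) by blast
  next
    fix a b assume h: "a \<in> ext Y" "b \<in> ext Y" "opair a b \<in> ext (pull m w Y)" "opair b a \<in> ext (pull m w Y)"
    have "m a = m b" by (rule WO_antisym[OF assms(1) assms(3)[OF h(1)] assms(3)[OF h(2)]])
      (use h(3,4) in \<open>simp_all add: p\<close>)
    then show "a = b" using assms(4) h by blast
  qed
qed

definition wE :: "'a => 'a" where "wE a = sep (cprod a a) (%p. pfst p \<in> ext (psnd p) \<or> pfst p = psnd p)"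
lemma F1_wE: "F1 wE" by (intro F1I, unfold wE_def, intro dfi)
lemmas [dfi] = F1D[OF F1_wE]
lemma wE: "opair x y \<in> ext (wE a) \<longleftrightarrow> x \<in> ext a \<and> y \<in> ext a \<and> (x \<in> ext y \<or> x = y)"
proof -
  have "D1 (%p. pfst p \<in> ext (psnd p) \<or> pfst p = psnd p)" by (intro dfi)
  from ext_sep[OF this] show ?thesis unfolding wE_def by auto
qed
lemma WO_ordinal: assumes "ordinal a" shows "WO (wE a) a"
  unfolding WO_def
proof (intro conjI allI impI ballI)
  fix Z assume Z: "ext Z \<subseteq> ext a" "Z \<noteq> empty"
  then obtain z where z: "z \<in> ext Z" "ext z \<inter> ext Z = {}" using found[of Z] by auto
  have "opair z y \<in> ext (wE a)" if "y \<in> ext Z" for y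
    using ord_linear[OF ord_mem[OF assms] ord_mem[OF assms], of z y] that z Z(1) unfolding wE by blast
  then show "\<exists>z\<in>ext Z. \<forall>y\<in>ext Z. opair z y \<in> ext (wE a)" using z(1) by blast
next
  fix x y assume "x \<in> ext a" "y \<in> ext a" "opair x y \<in> ext (wE a)" "opair y x \<in> ext (wE a)"
  then show "x = y" unfolding wE using mem_asym by blast
qed

definition wprod :: "'a => 'a => 'a => 'a => 'a" where
  "wprod w X v Y = sep (cprod (cprod X Y) (cprod X Y)) (%p.
     (pfst (pfst p) \<noteq> pfst (psnd p) \<and> opair (pfst (pfst p)) (pfst (psnd p)) \<in> ext w) \<or>
     (pfst (pfst p) = pfst (psnd p) \<and> opair (psnd (pfst p)) (psnd (psnd p)) \<in> ext v))"
lemma DT_wprod[dfi]: assumes "DT t" "DT u" "DT v" "DT z" shows "DT (%e. wprod (t e) (u e) (v e) (z e))"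
proof -
  have 1: "DF (%e. e 4 = wprod (e 0) (e 1) (e 2) (e 3))" unfolding wprod_def by (intro dfi)
  have "DF (%e. e 0 = wprod (t (%n. e (Suc n))) (u (%n. e (Suc n))) (v (%n. e (Suc n))) (z (%n. e (Suc n))))"
    unfolding wprod_def by (intro dfi DT_shift[OF DT_shift[OF assms(1)]] DT_shift[OF DT_shift[OF assms(2)]]
      DT_shift[OF DT_shift[OF assms(3)]] DT_shift[OF DT_shift[OF assms(4)]]
      DT_shift[OF assms(1)] DT_shift[OF assms(2)] DT_shift[OF assms(3)] DT_shift[OF assms(4)])
  then show ?thesis unfolding DT_def .
qed
lemma wprod: "opair (opair a b) (opair c d) \<in> ext (wprod w X v Y) \<longleftrightarrow> a \<in> ext X \<and> c \<in> ext X \<and> b \<in> ext Y \<and> d \<in> ext Y \<and>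
   (a \<noteq> c \<and> opair a c \<in> ext w \<or> a = c \<and> opair b d \<in> ext v)"
proof -
  have "D1 (%p. (pfst (pfst p) \<noteq> pfst (psnd p) \<and> opair (pfst (pfst p)) (pfst (psnd p)) \<in> ext w) \<or>
     (pfst (pfst p) = pfst (psnd p) \<and> opair (psnd (pfst p)) (psnd (psnd p)) \<in> ext v))" by (intro dfi)
  from ext_sep[OF this] show ?thesis unfolding wprod_def by auto
qed
lemma WO_prod: assumes w: "WO w X" and v: "WO v Y" shows "WO (wprod w X v Y) (cprod X Y)"
  unfolding WO_def
proof (intro conjI allI impI ballI)
  fix Z assume Z: "ext Z \<subseteq> ext (cprod X Y)" "Z \<noteq> empty"
  then obtain z0 where z0: "z0 \<in> ext Z" using empty_iff by blast
  have f: "F1 pfst" by (intro dfi)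
  have i: "ext (img pfst Z) = pfst ` ext Z" by (rule ext_img[OF f])
  have "ext (img pfst Z) \<subseteq> ext X" "pfst z0 \<in> ext (img pfst Z)" unfolding i using Z(1) z0 by auto
  from WO_least[OF w this] obtain a where a: "a \<in> pfst ` ext Z" "\<And>y. y \<in> pfst ` ext Z ==> opair a y \<in> ext w"
    unfolding i by blast
  have d: "D1 (%b. opair a b \<in> ext Z)" by (intro dfi)
  have B: "ext (sep Y (%b. opair a b \<in> ext Z)) = {b \<in> ext Y. opair a b \<in> ext Z}" by (rule ext_sep[OF d])
  obtain b0 where b0: "opair a b0 \<in> ext Z" "b0 \<in> ext Y" "a \<in> ext X" using a(1) Z(1) by force
  obtain b where b: "b \<in> ext Y" "opair a b \<in> ext Z" "\<And>y. y \<in> ext Y ==> opair a y \<in> ext Z ==> opair b y \<in> ext v"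
    by (rule WO_least[OF v, of "sep Y (%b. opair a b \<in> ext Z)" b0]) (use b0 in \<open>auto simp: B\<close>)
  have "opair (opair a b) y \<in> ext (wprod w X v Y)" if hy: "y \<in> ext Z" for y
  proof -
    obtain c d where y: "y = opair c d" "c \<in> ext X" "d \<in> ext Y" using hy Z(1) by auto
    have "c = pfst y" using y(1) by simp
    then have "opair a c \<in> ext w" using a(2)[of c] hy by blast
    then show ?thesis unfolding y(1) wprod using b y hy b0 by blast
  qed
  then show "\<exists>z\<in>ext Z. \<forall>y\<in>ext Z. opair z y \<in> ext (wprod w X v Y)" using b(2) by blast
next
  fix p q assume h: "p \<in> ext (cprod X Y)" "q \<in> ext (cprod X Y)" "opair p q \<in> ext (wprod w X v Y)" "opair q p \<in> ext (wprod w X v Y)"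
  then obtain a b c d where e: "p = opair a b" "q = opair c d" by auto
  have "a = c" using h(3,4) WO_antisym[OF w] unfolding e wprod by blast
  then have "b = d" using h(3,4) WO_antisym[OF v] unfolding e wprod by blast
  then show "p = q" using \<open>a = c\<close> e by simp
qed

definition wbun :: "'a => 'a => 'a => 'a => 'a" where
  "wbun w X v Y = sep (cprod (bun X Y) (bun X Y)) (%p.
     if pfst p \<in> ext X then psnd p \<in> ext X --> opair (pfst p) (psnd p) \<in> ext w
     else psnd p \<notin> ext X \<and> opair (pfst p) (psnd p) \<in> ext v)"
lemma wbun: "opair x y \<in> ext (wbun w X v Y) \<longleftrightarrow> x \<in> ext (bun X Y) \<and> y \<in> ext (bun X Y) \<and>
   (if x \<in> ext X then y \<in> ext X --> opair x y \<in> ext w else y \<notin> ext X \<and> opair x y \<in> ext v)"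
proof -
  have "D1 (%p. if pfst p \<in> ext X then psnd p \<in> ext X --> opair (pfst p) (psnd p) \<in> ext w
     else psnd p \<notin> ext X \<and> opair (pfst p) (psnd p) \<in> ext v)" by (intro dfi)
  from ext_sep[OF this] show ?thesis unfolding wbun_def by auto
qed
lemma WO_bun: assumes w: "WO w X" and v: "WO v Y" shows "WO (wbun w X v Y) (bun X Y)"
  unfolding WO_def
proof (intro conjI allI impI ballI)
  fix Z assume Z: "ext Z \<subseteq> ext (bun X Y)" "Z \<noteq> empty"
  then obtain z0 where z0: "z0 \<in> ext Z" using empty_iff by blast
  show "\<exists>z\<in>ext Z. \<forall>y\<in>ext Z. opair z y \<in> ext (wbun w X v Y)"
  proof (cases "\<exists>x\<in>ext Z. x \<in> ext X")
    case True
    then obtain x0 where x0: "x0 \<in> ext Z" "x0 \<in> ext X" by blast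
    have d: "D1 (%b. b \<in> ext X)" by (intro dfi)
    have B: "ext (sep Z (%b. b \<in> ext X)) = {b \<in> ext Z. b \<in> ext X}" by (rule ext_sep[OF d])
    obtain z where z: "z \<in> ext Z" "z \<in> ext X" "\<And>y. y \<in> ext Z ==> y \<in> ext X ==> opair z y \<in> ext w"
      by (rule WO_least[OF w, of "sep Z (%b. b \<in> ext X)" x0]) (use x0 in \<open>auto simp: B\<close>)
    then show ?thesis using Z(1) unfolding wbun by (intro bexI[of _ z]) auto
  next
    case False
    then have "ext Z \<subseteq> ext Y" using Z(1) by auto
    from WO_least[OF v this z0] obtain z where z: "z \<in> ext Z" "\<And>y. y \<in> ext Z ==> opair z y \<in> ext v" by blast
    then show ?thesis using Z(1) False unfolding wbun by (intro bexI[of _ z]) auto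
  qed
next
  fix a b assume h: "a \<in> ext (bun X Y)" "b \<in> ext (bun X Y)" "opair a b \<in> ext (wbun w X v Y)" "opair b a \<in> ext (wbun w X v Y)"
  show "a = b"
  proof (cases "a \<in> ext X")
    case True
    then show ?thesis using h(3,4) WO_antisym[OF w] unfolding wbun by (auto split: if_splits)
  next
    case False
    then show ?thesis using h WO_antisym[OF v, of a b] unfolding wbun by (auto split: if_splits)
  qed
qed

subsection \<open>Closing off a well-ordered set under definable operations\<close>

definition ob :: "'a => 'a" where "ob X = succ (un (sep X ordinal))"
lemma F1_ob: "F1 ob" by (intro F1I, unfold ob_def, intro dfi)
lemmas [dfi] = F1D[OF F1_ob]
lemma ob: "ordinal (ob X)" "\<And>a. a \<in> ext X ==> ordinal a ==> a \<in> ext (ob X)"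
proof -
  have "D1 ordinal" by (intro dfi)
  from ext_sep[OF this] have e: "ext (sep X ordinal) = {x \<in> ext X. ordinal x}" .
  from ord_bound[of "sep X ordinal"] show "ordinal (ob X)" "\<And>a. a \<in> ext X ==> ordinal a ==> a \<in> ext (ob X)"
    unfolding ob_def e by auto
qed

text \<open>Executes an instruction, a tag with two arguments: tag 0 returns the first argument, tag
  1 forms the unordered pair, and any other tag applies \<open>E\<close> to the first
  argument.\<close>

definition hop :: "('a => 'a) => 'a => 'a" where
  "hop E t = (if pfst t = empty then pfst (psnd t) else if pfst t = succ empty then up (pfst (psnd t)) (psnd (psnd t))
     else E (pfst (psnd t)))"
definition ddm :: "'a => 'a" where
  "ddm X = cprod (succ (succ (succ empty))) (cprod (bun X (ob X)) (bun X (ob X)))"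
definition ddw :: "'a => 'a => 'a" where
  "ddw X w = wprod (wE (succ (succ (succ empty)))) (succ (succ (succ empty)))
     (wprod (wbun w X (wE (ob X)) (ob X)) (bun X (ob X)) (wbun w X (wE (ob X)) (ob X)) (bun X (ob X)))
     (cprod (bun X (ob X)) (bun X (ob X)))"
definition nX :: "('a => 'a) => 'a => 'a" where "nX E X = img (hop E) (ddm X)"
text \<open>Elements are ordered by the least instruction that produces them.\<close>

definition nW :: "('a => 'a) => 'a => 'a => 'a" where
  "nW E X w = pull (%y. lw (ddw X w) (sep (ddm X) (%t. hop E t = y))) (ddw X w) (nX E X)"

lemma WO_ddw: "WO w X ==> WO (ddw X w) (ddm X)"
  unfolding ddw_def ddm_def by (intro WO_prod WO_bun WO_ordinal ord_succ ord_empty ob)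

lemma F1_hop: assumes "F1 E" shows "F1 (hop E)" unfolding hop_def by (intro dfi F1D[OF assms])

lemma WO_nW: assumes E: "F1 E" and w: "WO w X" shows "WO (nW E X w) (nX E X)"
  unfolding nW_def
proof (rule WO_pull[OF WO_ddw[OF w]])
  let ?m = "%y. lw (ddw X w) (sep (ddm X) (%t. hop E t = y))"
  show "F1 ?m" by (intro dfi F1D[OF F1_hop[OF E]])
  have m: "?m y \<in> ext (ddm X)" "hop E (?m y) = y" if y: "y \<in> ext (nX E X)" for y
  proof -
    have d: "D1 (%t. hop E t = y)" by (intro dfi F1D[OF F1_hop[OF E]])
    have B: "ext (sep (ddm X) (%t. hop E t = y)) = {t \<in> ext (ddm X). hop E t = y}" by (rule ext_sep[OF d])
    obtain t where "t \<in> ext (ddm X)" "hop E t = y" using y unfolding nX_def ext_img[OF F1_hop[OF E]] by blast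
    then show "?m y \<in> ext (ddm X)" "hop E (?m y) = y"
      using lw(1)[OF WO_ddw[OF w], of "sep (ddm X) (%t. hop E t = y)" t] unfolding B by auto
  qed
  show "\<And>y. y \<in> ext (nX E X) ==> ?m y \<in> ext (ddm X)" by (rule m(1))
  show "\<And>y z. y \<in> ext (nX E X) ==> z \<in> ext (nX E X) ==> ?m y = ?m z ==> y = z" using m(2) by metis
qed

lemma nX: assumes E: "F1 E"
  shows "ext X \<subseteq> ext (nX E X)" "a \<in> ext X ==> b \<in> ext X ==> up a b \<in> ext (nX E X)"
    "a \<in> ext X ==> E a \<in> ext (nX E X)" "c \<in> ext X ==> ordinal c ==> ext c \<subseteq> ext (nX E X)"
proof -
  have i: "ext (nX E X) = hop E ` ext (ddm X)" unfolding nX_def by (rule ext_img[OF F1_hop[OF E]])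
  have h: "opair t (opair a b) \<in> ext (ddm X) \<longleftrightarrow> t \<in> ext (succ (succ (succ empty))) \<and> a \<in> ext (bun X (ob X)) \<and> b \<in> ext (bun X (ob X))" for t a b
    unfolding ddm_def by (simp only: opair_mem_cprod)
  have 0: "z \<in> ext (nX E X)" if "z \<in> ext (bun X (ob X))" for z
    unfolding i by (rule image_eqI[of _ _ "opair empty (opair z z)"]) (use that h in \<open>auto simp: hop_def\<close>)
  show "ext X \<subseteq> ext (nX E X)" using 0 by auto
  show "a \<in> ext X ==> b \<in> ext X ==> up a b \<in> ext (nX E X)" for a b
    unfolding i by (rule image_eqI[of _ _ "opair (succ empty) (opair a b)"]) (use h in \<open>auto simp: hop_def\<close>)
  show "a \<in> ext X ==> E a \<in> ext (nX E X)" for a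
    unfolding i by (rule image_eqI[of _ _ "opair (succ (succ empty)) (opair a a)"]) (use h in \<open>auto simp: hop_def\<close>)
  show "ext c \<subseteq> ext (nX E X)" if "c \<in> ext X" "ordinal c" for c
    using 0 ord_sub[OF ob(1) ob(2)[OF that]] by auto
qed

text \<open>One closing step is iterated \<omega> times with its well-order carried along, so that
  no orders have to be chosen. The union is ordered by the stage \<open>lv\<close> at which an
  element first appears and then by the order of that stage, because the order of a later stage need
  not extend the earlier ones. As \<open>X\<close> is closed under pairs, the single unary
  \<open>E\<close> can take several arguments.\<close>

lemma closure_exists: assumes E: "F1 E" and w0: "WO w0 X0"
  obtains X w where "WO w X" "ext X0 \<subseteq> ext X" "\<And>a b. a \<in> ext X ==> b \<in> ext X ==> up a b \<in> ext X"
    "\<And>a. a \<in> ext X ==> E a \<in> ext X" "\<And>c. c \<in> ext X ==> ordinal c ==> ext c \<subseteq> ext X"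
proof -
  let ?G = "%_ p. opair (nX E (pfst p)) (nW E (pfst p) (psnd p))"
  define R where "R = nrec (opair X0 w0) ?G"
  define XX where "XX = (%n. pfst (R n))"
  define WW where "WW = (%n. psnd (R n))"
  have G: "F2 ?G" unfolding nX_def nW_def pull_def ddm_def ddw_def wbun_def
    by (intro dfi F1D[OF F1_hop[OF E]])
  have RF: "F1 R" unfolding R_def nX_def nW_def pull_def ddm_def ddw_def wbun_def
    by (intro dfi F1D[OF F1_hop[OF E]])
  have XF: "DT t ==> DT (%e. XX (t e))" for t unfolding XX_def by (intro DT_pfst F1D[OF RF])
  have WF: "DT t ==> DT (%e. WW (t e))" for t unfolding WW_def by (intro DT_psnd F1D[OF RF])
  have X0: "XX empty = X0" and W0: "WW empty = w0" unfolding XX_def WW_def R_def by (simp_all add: nrec_0[OF G])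
  have XS: "XX (succ n) = nX E (XX n)" and WS: "WW (succ n) = nW E (XX n) (WW n)" if "n \<in> ext omega" for n
    using nrec_S[OF G that] unfolding XX_def WW_def R_def by simp_all
  have wo: "WO (WW n) (XX n)" if "n \<in> ext omega" for n
  proof (rule omega_induct[OF that, where P="%n. WO (WW n) (XX n)"])
    show "D1 (%n. WO (WW n) (XX n))" by (intro D1I DF_WO XF WF dfi)
    show "WO (WW empty) (XX empty)" unfolding X0 W0 by (rule w0)
    fix n assume n: "n \<in> ext omega" "WO (WW n) (XX n)"
    then show "WO (WW (succ n)) (XX (succ n))" unfolding XS[OF n(1)] WS[OF n(1)] by (intro WO_nW[OF E])
  qed
  have mono: "\<forall>n\<in>ext m. ext (XX n) \<subseteq> ext (XX m)" if "m \<in> ext omega" for m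
  proof (rule omega_induct[OF that, where P="%m. \<forall>n\<in>ext m. ext (XX n) \<subseteq> ext (XX m)"])
    show "D1 (%m. \<forall>n\<in>ext m. ext (XX n) \<subseteq> ext (XX m))" by (intro D1I DF_ball DF_sub XF dfi)
    fix m assume m: "m \<in> ext omega" "\<forall>n\<in>ext m. ext (XX n) \<subseteq> ext (XX m)"
    then show "\<forall>n\<in>ext (succ m). ext (XX n) \<subseteq> ext (XX (succ m))" unfolding XS[OF m(1)] using nX(1)[OF E, of "XX m"] by auto
  qed simp
  define Xo where "Xo = un (img XX omega)"
  have FX: "F1 XX" by (intro F1I XF dfi)
  have Xo: "z \<in> ext Xo \<longleftrightarrow> (\<exists>n\<in>ext omega. z \<in> ext (XX n))" for z
    unfolding Xo_def ext_un ext_img[OF FX] by auto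
  define lv where "lv = (%z. lst (%n. z \<in> ext (XX n)))"
  have lvF: "DT t ==> DT (%e. lv (t e))" for t
  proof -
    have "DT (%e. lv (e 0))" unfolding lv_def by (intro DT_lst DF_mem XF dfi)
    then show "DT t ==> DT (%e. lv (t e))" by (rule DT1[where F=lv])
  qed
  have lv: "lv z \<in> ext omega" "z \<in> ext (XX (lv z))" if z: "z \<in> ext Xo" for z
  proof -
    obtain n where n: "n \<in> ext omega" "z \<in> ext (XX n)" using z Xo by blast
    have d: "D1 (%n. z \<in> ext (XX n))" by (intro D1I DF_mem XF dfi)
    show "lv z \<in> ext omega" "z \<in> ext (XX (lv z))" unfolding lv_def by (rule lst[OF d n])+
  qed
  let ?P = "%x y. lv x \<in> ext (lv y) \<or> (lv x = lv y \<and> opair x y \<in> ext (WW (lv x)))"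
  define wo' where "wo' = sep (cprod Xo Xo) (%p. ?P (pfst p) (psnd p))"
  have dP: "D1 (%p. ?P (pfst p) (psnd p))" by (intro D1I DF_disj DF_conj DF_mem DF_eq lvF WF dfi)
  have wo': "opair x y \<in> ext wo' \<longleftrightarrow> x \<in> ext Xo \<and> y \<in> ext Xo \<and> ?P x y" for x y
    unfolding wo'_def ext_sep[OF dP] by auto
  have WOo: "WO wo' Xo" unfolding WO_def
  proof (intro conjI allI impI ballI)
    fix Z assume Z: "ext Z \<subseteq> ext Xo" "Z \<noteq> empty"
    then obtain z0 where z0: "z0 \<in> ext Z" using empty_iff by blast
    have d: "D1 (%n. \<exists>z\<in>ext Z. lv z = n)" by (intro D1I DF_bex DF_eq lvF dfi)
    have "lv z0 \<in> ext omega" "\<exists>z\<in>ext Z. lv z = lv z0" using lv Z z0 by blast+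
    from omega_least[OF d this] obtain n where n: "n \<in> ext omega" "\<exists>z\<in>ext Z. lv z = n"
      "\<And>k. k \<in> ext n ==> \<not> (\<exists>z\<in>ext Z. lv z = k)" by metis
    have d2: "D1 (%z. lv z = n)" by (intro D1I DF_eq lvF dfi)
    have B: "ext (sep Z (%z. lv z = n)) = {z \<in> ext Z. lv z = n}" by (rule ext_sep[OF d2])
    obtain z1 where z1: "z1 \<in> ext Z" "lv z1 = n" using n(2) by blast
    have s: "ext (sep Z (%z. lv z = n)) \<subseteq> ext (XX n)" unfolding B using lv(2) Z(1) by blast
    have zS: "z1 \<in> ext (sep Z (%z. lv z = n))" unfolding B using z1 by blast
    obtain z where zz: "z \<in> ext (sep Z (%z. lv z = n))"
      "\<And>y. y \<in> ext (sep Z (%z. lv z = n)) ==> opair z y \<in> ext (WW n)"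
      by (rule WO_least[OF wo[OF n(1)] s zS]) (rule that)
    have z: "z \<in> ext Z" "lv z = n" using zz(1) unfolding B by blast+
    have z3: "\<And>y. y \<in> ext Z ==> lv y = n ==> opair z y \<in> ext (WW n)" using zz(2) unfolding B by blast
    have "opair z y \<in> ext wo'" if y: "y \<in> ext Z" for y
    proof -
      have yo: "y \<in> ext Xo" "z \<in> ext Xo" using y z(1) Z(1) by blast+
      have "lv y \<notin> ext n" using n(3)[of "lv y"] y by blast
      then have "n \<in> ext (lv y) \<or> lv y = n" using omega_le_cases[OF n(1) lv(1)[OF yo(1)]] by blast
      then show ?thesis unfolding wo' using yo z z3[OF y] by auto
    qed
    then show "\<exists>z\<in>ext Z. \<forall>y\<in>ext Z. opair z y \<in> ext wo'" using z(1) by blast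
  next
    fix a b assume h: "a \<in> ext Xo" "b \<in> ext Xo" "opair a b \<in> ext wo'" "opair b a \<in> ext wo'"
    have P: "?P a b" "?P b a" using h(3,4) unfolding wo' by simp_all
    have e: "lv a = lv b" using P mem_asym[of "lv a" "lv b"] by auto
    have o: "opair a b \<in> ext (WW (lv a))" "opair b a \<in> ext (WW (lv a))" using P unfolding e by simp_all
    show "a = b" by (rule WO_antisym[OF wo[OF lv(1)[OF h(1)]] lv(2)[OF h(1)] _ o]) (use lv(2)[OF h(2)] e in simp)
  qed
  have both: "\<exists>n\<in>ext omega. a \<in> ext (XX n) \<and> b \<in> ext (XX n)" if ab: "a \<in> ext Xo" "b \<in> ext Xo" for a b
  proof -
    obtain n where "n \<in> ext omega" "a \<in> ext (XX n)" using ab(1) unfolding Xo by (rule bexE)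
    moreover obtain m where "m \<in> ext omega" "b \<in> ext (XX m)" using ab(2) unfolding Xo by (rule bexE)
    ultimately have "n \<in> ext omega" "m \<in> ext omega" "a \<in> ext (XX n)" "b \<in> ext (XX m)" by blast+
    then show ?thesis using omega_le_cases[of n m] bspec[OF mono[of n], of m] bspec[OF mono[of m], of n] by blast
  qed
  show thesis
  proof (rule that[OF WOo])
    show "ext X0 \<subseteq> ext Xo" using X0 Xo omega0 by blast
    show "up a b \<in> ext Xo" if h: "a \<in> ext Xo" "b \<in> ext Xo" for a b
    proof -
      obtain n where n: "n \<in> ext omega" "a \<in> ext (XX n)" "b \<in> ext (XX n)" using both[OF h] by blast
      then have "up a b \<in> ext (XX (succ n))" unfolding XS[OF n(1)] by (intro nX(2)[OF E])
      then show ?thesis using Xo omegaS[OF n(1)] by blast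
    qed
    show "E a \<in> ext Xo" if h: "a \<in> ext Xo" for a
    proof -
      obtain n where n: "n \<in> ext omega" "a \<in> ext (XX n)" using both[OF h h] by blast
      then have "E a \<in> ext (XX (succ n))" unfolding XS[OF n(1)] by (intro nX(3)[OF E])
      then show ?thesis using Xo omegaS[OF n(1)] by blast
    qed
    show "ext c \<subseteq> ext Xo" if h: "c \<in> ext Xo" "ordinal c" for c
    proof -
      obtain n where n: "n \<in> ext omega" "c \<in> ext (XX n)" using h Xo by blast
      then have "ext c \<subseteq> ext (XX (succ n))" unfolding XS[OF n(1)] using nX(4)[OF E n(2) h(2)] by blast
      then show ?thesis using Xo omegaS[OF n(1)] by blast
    qed
  qed
qed

end

context zf_model
begin

section \<open>Games\<close>

definition par :: "'a => 'a" where "par n = nrec empty (%_ x. if x = empty then succ empty else empty) n"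
lemma DT_par[dfi]: assumes "DT t" shows "DT (%e. par (t e))" unfolding par_def by (intro dfi assms)
lemma par_0[simp]: "par empty = empty"
  unfolding par_def by (rule nrec_0) (intro dfi)
lemma par_S: "n \<in> ext omega ==> par (succ n) = (if par n = empty then succ empty else empty)"
  unfolding par_def by (rule nrec_S) (intro dfi)
lemma par_Sz: "n \<in> ext omega ==> par (succ n) = empty \<longleftrightarrow> par n \<noteq> empty" by (simp add: par_S)

lemma even_nat_par: "even_nat n \<longleftrightarrow> n \<in> ext omega \<and> par n = empty"
proof
  assume e: "even_nat n"
  then have n: "n \<in> ext omega" unfolding even_nat_def by blast
  have "D1 (%n. par n = empty)" by (intro dfi)
  from ext_sep[OF this] have s: "ext (sep omega (%n. par n = empty)) = {n \<in> ext omega. par n = empty}" .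
  have "empty \<in> ext (sep omega (%n. par n = empty)) \<and>
    (\<forall>m\<in>ext (sep omega (%n. par n = empty)). succ (succ m) \<in> ext (sep omega (%n. par n = empty)))"
    unfolding s by (auto simp: par_S)
  then have "n \<in> ext (sep omega (%n. par n = empty))" using e unfolding even_nat_def by blast
  then show "n \<in> ext omega \<and> par n = empty" unfolding s by blast
next
  assume n: "n \<in> ext omega \<and> par n = empty"
  have "n \<in> ext z" if z: "empty \<in> ext z" "\<And>m. m \<in> ext z ==> succ (succ m) \<in> ext z" for z
  proof -
    have "(par n = empty --> n \<in> ext z) \<and> (par n \<noteq> empty --> succ n \<in> ext z)"
    proof (rule omega_induct[OF conjunct1[OF n], where P="%n. (par n = empty --> n \<in> ext z) \<and> (par n \<noteq> empty --> succ n \<in> ext z)"])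
      show "D1 (%n. (par n = empty --> n \<in> ext z) \<and> (par n \<noteq> empty --> succ n \<in> ext z))" by (intro dfi)
      show "\<And>n. n \<in> ext omega ==> (par n = empty --> n \<in> ext z) \<and> (par n \<noteq> empty --> succ n \<in> ext z) ==>
         (par (succ n) = empty --> succ n \<in> ext z) \<and> (par (succ n) \<noteq> empty --> succ (succ n) \<in> ext z)"
        using z(2) par_Sz by blast
    qed (use z(1) in simp)
    then show ?thesis using n by blast
  qed
  then show "even_nat n" unfolding even_nat_def using n by blast
qed

definition Det :: bool where "Det \<longleftrightarrow> (\<forall>A. ext A \<subseteq> ext reals --> determined omega A)"

lemma restr_fin: assumes "func f omega l" "n \<in> ext omega" shows "func (restr f n) n l" "restr f n \<in> ext (fin_seqs l)"
proof -
  show "func (restr f n) n l" by (rule restr_func[OF assms(1)]) (use omega_trans[OF assms(2)] in blast)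
  then show "restr f n \<in> ext (fin_seqs l)" unfolding ext_fin_seqs using assms(2) by blast
qed

lemma det_cases: assumes "Det" "ext A \<subseteq> ext reals"
  shows "(\<exists>\<sigma>. func \<sigma> (fin_seqs omega) omega \<and> (\<forall>f. func f omega omega \<and>
      (\<forall>n\<in>ext omega. par n = empty --> ap f n = ap \<sigma> (restr f n)) --> f \<in> ext A)) \<or>
    (\<exists>\<sigma>. func \<sigma> (fin_seqs omega) omega \<and> (\<forall>f. func f omega omega \<and>
      (\<forall>n\<in>ext omega. par n \<noteq> empty --> ap f n = ap \<sigma> (restr f n)) --> f \<notin> ext A))"
proof -
  have c: "app f n = app \<sigma> (restr f n) \<longleftrightarrow> ap f n = ap \<sigma> (restr f n)"
    if "func \<sigma> (fin_seqs omega) omega" "func f omega omega" "n \<in> ext omega" for \<sigma> f n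
    using func_app[OF that(2,3)] func_app[OF that(1) restr_fin(2)[OF that(2,3)]] by simp
  have e: "(\<forall>n. even_nat n --> app f n = app \<sigma> (restr f n)) \<longleftrightarrow> (\<forall>n\<in>ext omega. par n = empty --> ap f n = ap \<sigma> (restr f n))"
    if "func \<sigma> (fin_seqs omega) omega" "func f omega omega" for \<sigma> f
    using c[OF that] unfolding even_nat_par by blast
  have o: "(\<forall>n. odd_nat n --> app f n = app \<sigma> (restr f n)) \<longleftrightarrow> (\<forall>n\<in>ext omega. par n \<noteq> empty --> ap f n = ap \<sigma> (restr f n))"
    if "func \<sigma> (fin_seqs omega) omega" "func f omega omega" for \<sigma> f
    using c[OF that] unfolding odd_nat_def even_nat_par by blast
  have "determined omega A" using assms unfolding Det_def by blast
  then show ?thesis unfolding determined_def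
  proof (elim disjE exE conjE)
    fix \<sigma> assume h: "func \<sigma> (fin_seqs omega) omega"
      "\<forall>f. func f omega omega \<and> (\<forall>n. even_nat n --> app f n = app \<sigma> (restr f n)) --> f \<in> ext A"
    show ?thesis by (rule disjI1, rule exI[of _ \<sigma>]) (use h e[OF h(1)] in blast)
  next
    fix \<sigma> assume h: "func \<sigma> (fin_seqs omega) omega"
      "\<forall>f. func f omega omega \<and> (\<forall>n. odd_nat n --> app f n = app \<sigma> (restr f n)) --> f \<notin> ext A"
    show ?thesis by (rule disjI2, rule exI[of _ \<sigma>]) (use h o[OF h(1)] in blast)
  qed
qed

text \<open>Yields the play in which the rule \<open>h\<close> makes every move; with
  \<open>h\<close> consulting a strategy at some stages, it runs this strategy against computed
  answers.\<close>

lemma cov: assumes h: "F1 h" and hX: "\<And>s. s \<in> ext (fin_seqs X) ==> h s \<in> ext X"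
  obtains y where "func y omega X" "\<And>n. n \<in> ext omega ==> ap y n = h (restr y n)"
proof -
  define N where "N = nrec empty (%_ s. snoc s (h s))"
  have G: "F2 (%_ s. snoc s (h s))" by (intro dfi F1D[OF h])
  have N: "F1 N" unfolding N_def by (intro dfi F1D[OF h])
  have N0: "N empty = empty" unfolding N_def by (rule nrec_0[OF G])
  have NS: "N (succ n) = snoc (N n) (h (N n))" if "n \<in> ext omega" for n unfolding N_def by (rule nrec_S[OF G that])
  have Nf: "func (N n) n X" if "n \<in> ext omega" for n
  proof (rule omega_induct[OF that, where P="%n. func (N n) n X"])
    show "D1 (%n. func (N n) n X)" by (intro dfi F1D[OF N])
    show "func (N empty) empty X" unfolding N0 by simp
    fix n assume n: "n \<in> ext omega" "func (N n) n X"
    then have "N n \<in> ext (fin_seqs X)" unfolding ext_fin_seqs by blast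
    then show "func (N (succ n)) (succ n) X" unfolding NS[OF n(1)] by (intro snoc_func[OF n(2)] hX)
  qed
  have Nin: "N n \<in> ext (fin_seqs X)" if "n \<in> ext omega" for n using Nf[OF that] that unfolding ext_fin_seqs by blast
  have yF: "F1 (%n. h (N n))" by (intro dfi F1D[OF h] F1D[OF N])
  define y where "y = lam omega (%n. h (N n))"
  have y: "func y omega X" unfolding y_def by (rule lam_func[OF yF hX[OF Nin]])
  have yn: "ap y n = h (N n)" if "n \<in> ext omega" for n unfolding y_def by (rule ap_lam[OF yF that])
  have r: "restr y n = N n" if "n \<in> ext omega" for n
  proof (rule omega_induct[OF that, where P="%n. restr y n = N n"])
    show "D1 (%n. restr y n = N n)" by (intro dfi F1D[OF N])
    show "restr y empty = N empty" unfolding N0 using func_empty_eq[OF restr_fin(1)[OF y omega0]] .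
    fix n assume n: "n \<in> ext omega" "restr y n = N n"
    have i: "ap (N n) i = ap y i" if "i \<in> ext n" for i using n(2) restr_ap[OF that, of y] by simp
    note S = snoc_ap[OF Nf[OF n(1)] hX[OF Nin[OF n(1)]]] snoc_last[OF Nf[OF n(1)] hX[OF Nin[OF n(1)]]]
    show "restr y (succ n) = N (succ n)"
    proof (rule func_eqI[OF restr_fin(1)[OF y omegaS[OF n(1)]] Nf[OF omegaS[OF n(1)]]])
      fix x assume x: "x \<in> ext (succ n)"
      then have "x \<in> ext n \<or> x = n" by auto
      then show "ap (restr y (succ n)) x = ap (N (succ n)) x"
        unfolding restr_ap[OF x] NS[OF n(1)] using S i yn[OF n(1)] by auto
    qed
  qed
  show thesis by (rule that[OF y]) (simp add: yn r)
qed

section \<open>Category in countable partial orders\<close>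

definition pos :: "'a => 'a => bool" where
  "pos P r \<longleftrightarrow> (\<forall>p\<in>ext P. opair p p \<in> ext r) \<and>
    (\<forall>p\<in>ext P. \<forall>q\<in>ext P. \<forall>s\<in>ext P. opair p q \<in> ext r --> opair q s \<in> ext r --> opair p s \<in> ext r)"
definition dseq :: "'a => 'a => 'a => bool" where
  "dseq P r f \<longleftrightarrow> func f omega P \<and> (\<forall>n\<in>ext omega. opair (ap f (succ n)) (ap f n) \<in> ext r)"
definition dns :: "'a => 'a => 'a => bool" where
  "dns P r D \<longleftrightarrow> ext D \<subseteq> ext P \<and> (\<forall>p\<in>ext P. \<exists>d\<in>ext D. opair d p \<in> ext r)"
definition mts :: "'a => 'a => 'a => bool" where
  "mts r f D \<longleftrightarrow> (\<exists>n\<in>ext omega. \<exists>d\<in>ext D. opair (ap f n) d \<in> ext r)"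
definition blw :: "'a => 'a => 'a => bool" where
  "blw r f p \<longleftrightarrow> (\<exists>n\<in>ext omega. opair (ap f n) p \<in> ext r)"
definition cdf :: "'a => 'a => 'a => bool" where
  "cdf P r DD \<longleftrightarrow> ctb DD \<and> (\<forall>D\<in>ext DD. dns P r D)"
definition gnr :: "'a => 'a => 'a => 'a => bool" where
  "gnr P r DD f \<longleftrightarrow> dseq P r f \<and> (\<forall>D\<in>ext DD. mts r f D)"
text \<open>Comeagerness of \<open>W\<close> below \<open>p\<close>, with generic descending
  sequences as the points. No names are involved, and over a countable order each \<open>DD\<close>
  has generic sequences, so a forced statement can be tested on an actual object.\<close>

definition frc :: "'a => 'a => 'a => 'a => bool" where
  "frc P r p W \<longleftrightarrow> (\<exists>DD. cdf P r DD \<and> (\<forall>f. gnr P r DD f \<and> blw r f p --> f \<in> ext W))"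
text \<open>Mutual cofinality: both sequences generate the same filter. Hence \<open>inv\<close>
  below says that membership in \<open>W\<close> depends on the filter only.\<close>

definition eqv :: "'a => 'a => 'a => bool" where
  "eqv r f g \<longleftrightarrow> (\<forall>n\<in>ext omega. \<exists>m\<in>ext omega. opair (ap g m) (ap f n) \<in> ext r) \<and>
     (\<forall>n\<in>ext omega. \<exists>m\<in>ext omega. opair (ap f m) (ap g n) \<in> ext r)"
definition inv :: "'a => 'a => 'a => bool" where
  "inv P r W \<longleftrightarrow> (\<forall>f g. dseq P r f \<and> dseq P r g \<and> eqv r f g \<and> f \<in> ext W --> g \<in> ext W)"

lemma DF_dseq[dfi]: assumes "DT t" "DT u" "DT v" shows "DF (%e. dseq (t e) (u e) (v e))"
  by (rule DF3[where P=dseq, OF _ assms]) (unfold dseq_def, intro dfi)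
lemma DF_dns[dfi]: assumes "DT t" "DT u" "DT v" shows "DF (%e. dns (t e) (u e) (v e))"
  by (rule DF3[where P=dns, OF _ assms]) (unfold dns_def, intro dfi)
lemma DF_mts[dfi]: assumes "DT t" "DT u" "DT v" shows "DF (%e. mts (t e) (u e) (v e))"
  by (rule DF3[where P=mts, OF _ assms]) (unfold mts_def, intro dfi)
lemma DF_blw[dfi]: assumes "DT t" "DT u" "DT v" shows "DF (%e. blw (t e) (u e) (v e))"
  by (rule DF3[where P=blw, OF _ assms]) (unfold blw_def, intro dfi)
lemma DF_cdf[dfi]: assumes "DT t" "DT u" "DT v" shows "DF (%e. cdf (t e) (u e) (v e))"
  by (rule DF3[where P=cdf, OF _ assms]) (unfold cdf_def, intro dfi)
lemma DF_gnr[dfi]: assumes "DT t" "DT u" "DT v" "DT w" shows "DF (%e. gnr (t e) (u e) (v e) (w e))"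
  by (rule DF4[where P=gnr, OF _ assms]) (unfold gnr_def, intro dfi)
lemma DF_frc[dfi]: assumes "DT t" "DT u" "DT v" "DT w" shows "DF (%e. frc (t e) (u e) (v e) (w e))"
  by (rule DF4[where P=frc, OF _ assms]) (unfold frc_def, intro dfi)

lemma pos_refl: "pos P r ==> p \<in> ext P ==> opair p p \<in> ext r" unfolding pos_def by blast
lemma pos_trans: "pos P r ==> p \<in> ext P ==> q \<in> ext P ==> s \<in> ext P ==> opair p q \<in> ext r ==> opair q s \<in> ext r ==> opair p s \<in> ext r"
  unfolding pos_def by blast
lemma dseq_in: "dseq P r f ==> n \<in> ext omega ==> ap f n \<in> ext P" unfolding dseq_def using func_ap_in by blast
lemma dseq_func: "dseq P r f ==> func f omega P" unfolding dseq_def by blast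

lemma dseq_mono: assumes "pos P r" "dseq P r f" "n \<in> ext omega" "m \<in> ext (succ n)"
  shows "opair (ap f n) (ap f m) \<in> ext r"
proof -
  have "\<forall>m\<in>ext (succ n). opair (ap f n) (ap f m) \<in> ext r"
  proof (rule omega_induct[OF assms(3), where P="%n. \<forall>m\<in>ext (succ n). opair (ap f n) (ap f m) \<in> ext r"])
    show "D1 (%n. \<forall>m\<in>ext (succ n). opair (ap f n) (ap f m) \<in> ext r)" by (intro dfi)
    show "\<forall>m\<in>ext (succ empty). opair (ap f empty) (ap f m) \<in> ext r"
      using pos_refl[OF assms(1) dseq_in[OF assms(2) omega0]] by simp
    fix n assume n: "n \<in> ext omega" "\<forall>m\<in>ext (succ n). opair (ap f n) (ap f m) \<in> ext r"
    show "\<forall>m\<in>ext (succ (succ n)). opair (ap f (succ n)) (ap f m) \<in> ext r"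
    proof
      fix m assume m: "m \<in> ext (succ (succ n))"
      have s: "opair (ap f (succ n)) (ap f n) \<in> ext r" using assms(2) n(1) unfolding dseq_def by blast
      show "opair (ap f (succ n)) (ap f m) \<in> ext r"
      proof (cases "m = succ n")
        case True then show ?thesis using pos_refl[OF assms(1) dseq_in[OF assms(2) omegaS[OF n(1)]]] by simp
      next
        case False
        then have mn: "m \<in> ext (succ n)" using m by simp
        have mo: "m \<in> ext omega" by (rule omega_trans[OF omegaS[OF n(1)] mn])
        show ?thesis
          by (rule pos_trans[OF assms(1) dseq_in[OF assms(2) omegaS[OF n(1)]] dseq_in[OF assms(2) n(1)] dseq_in[OF assms(2) mo] s])
            (use n(2) mn in blast)
      qed
    qed
  qed
  then show ?thesis using assms(4) by blast
qed

lemma omega_max: assumes "n \<in> ext omega" "m \<in> ext omega"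
  obtains k where "k \<in> ext omega" "n \<in> ext (succ k)" "m \<in> ext (succ k)"
  using omega_le_cases[OF assms] that[OF assms(1)] that[OF assms(2)] by auto

lemma blw_common: assumes "pos P r" "dseq P r f" "p \<in> ext P" "q \<in> ext P" "blw r f p" "blw r f q"
  obtains k where "k \<in> ext omega" "opair (ap f k) p \<in> ext r" "opair (ap f k) q \<in> ext r"
proof -
  obtain n m where nm: "n \<in> ext omega" "m \<in> ext omega" "opair (ap f n) p \<in> ext r" "opair (ap f m) q \<in> ext r"
    using assms(5,6) unfolding blw_def by blast
  obtain k where k: "k \<in> ext omega" "n \<in> ext (succ k)" "m \<in> ext (succ k)" by (rule omega_max[OF nm(1,2)])
  show thesis
  proof (rule that[OF k(1)])
    show "opair (ap f k) p \<in> ext r"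
      by (rule pos_trans[OF assms(1) dseq_in[OF assms(2) k(1)] dseq_in[OF assms(2) nm(1)] assms(3) dseq_mono[OF assms(1,2) k(1,2)] nm(3)])
    show "opair (ap f k) q \<in> ext r"
      by (rule pos_trans[OF assms(1) dseq_in[OF assms(2) k(1)] dseq_in[OF assms(2) nm(2)] assms(4) dseq_mono[OF assms(1,2) k(1,3)] nm(4)])
  qed
qed

lemma gen_exists: assumes "pos P r" "ctb P" "cdf P r DD" "p \<in> ext P"
  obtains f where "gnr P r DD f" "ap f empty = p"
proof -
  obtain e where e: "func e omega P" "\<And>x. x \<in> ext P ==> \<exists>n\<in>ext omega. ap e n = x"
    using assms(2) unfolding ctb_def by blast
  obtain d where d: "func d omega DD" "\<And>x. x \<in> ext DD ==> \<exists>n\<in>ext omega. ap d n = x"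
    using assms(3) unfolding ctb_def cdf_def by blast
  \<comment> \<open>Countability of \<open>P\<close> replaces dependent choice: the next condition
    is the one of least index that lies below \<open>x\<close> and in the \<open>n\<close>-th dense
    set.\<close>
  let ?S = "%n x k. opair (ap e k) x \<in> ext r \<and> ap e k \<in> ext (ap d n)"
  let ?G = "%n x. ap e (lst (?S n x))"
  define N where "N = nrec p ?G"
  have G: "F2 ?G" by (intro dfi)
  have N: "F1 N" unfolding N_def by (intro dfi)
  have N0: "N empty = p" unfolding N_def by (rule nrec_0[OF G])
  have NS: "N (succ n) = ?G n (N n)" if "n \<in> ext omega" for n unfolding N_def by (rule nrec_S[OF G that])
  have st: "?G n x \<in> ext P \<and> opair (?G n x) x \<in> ext r \<and> ?G n x \<in> ext (ap d n)" if n: "n \<in> ext omega" and x: "x \<in> ext P" for n x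
  proof -
    have "dns P r (ap d n)" using assms(3) func_ap_in[OF d(1) n] unfolding cdf_def by blast
    then obtain y where y: "y \<in> ext (ap d n)" "opair y x \<in> ext r" "y \<in> ext P" using x unfolding dns_def by blast
    then obtain k where k: "k \<in> ext omega" "ap e k = y" using e(2) by blast
    have D: "D1 (?S n x)" by (intro dfi)
    have "?S n x k" using k y by simp
    from lst[OF D k(1) this] show ?thesis using func_ap_in[OF e(1)] by blast
  qed
  have NP: "N n \<in> ext P" if "n \<in> ext omega" for n
    by (rule omega_induct[OF that, where P="%n. N n \<in> ext P"]) (intro dfi F1D[OF N], use N0 assms(4) NS st in auto)
  define f where "f = lam omega N"
  have fn: "ap f n = N n" if "n \<in> ext omega" for n unfolding f_def by (rule ap_lam[OF N that])
  have ff: "func f omega P" unfolding f_def by (rule lam_func[OF N NP])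
  have "dseq P r f" unfolding dseq_def using ff st[OF _ NP] by (auto simp: fn NS)
  moreover have "mts r f D" if D: "D \<in> ext DD" for D
  proof -
    obtain n where n: "n \<in> ext omega" "ap d n = D" using d(2)[OF D] by blast
    have "ap f (succ n) \<in> ext D" using st[OF n(1) NP[OF n(1)]] n by (simp add: fn NS)
    moreover have "opair (ap f (succ n)) (ap f (succ n)) \<in> ext r"
      by (rule pos_refl[OF assms(1) func_ap_in[OF ff omegaS[OF n(1)]]])
    ultimately show ?thesis unfolding mts_def using omegaS[OF n(1)] by blast
  qed
  ultimately have "gnr P r DD f" unfolding gnr_def by blast
  then show thesis using that fn[OF omega0] N0 by simp
qed

lemma cdf_bun: "cdf P r D ==> cdf P r D' ==> cdf P r (bun D D')"
  unfolding cdf_def using ctb_bun by auto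
lemma gnr_bun: "gnr P r (bun D D') f \<longleftrightarrow> gnr P r D f \<and> gnr P r D' f"
  unfolding gnr_def by auto
lemma cdf_triv: assumes "pos P r" "p \<in> ext P" shows "cdf P r (up P P)"
proof -
  have "ctb (up P P)" by (rule ctbI[where F="%_. P"], intro dfi, simp, rule bexI[OF _ omega0], simp)
  moreover have "dns P r P" unfolding dns_def using pos_refl[OF assms(1)] by blast
  ultimately show ?thesis unfolding cdf_def by auto
qed
lemma frcI: assumes "pos P r" "p \<in> ext P" "\<And>f. dseq P r f ==> f \<in> ext W" shows "frc P r p W"
  unfolding frc_def using cdf_triv[OF assms(1,2)] assms(3) unfolding gnr_def by blast

lemma blw_mono: assumes "pos P r" "dseq P r f" "p \<in> ext P" "q \<in> ext P" "opair p q \<in> ext r" "blw r f p" shows "blw r f q"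
  using assms pos_trans[OF assms(1) dseq_in[OF assms(2)] assms(3,4) _ assms(5)] unfolding blw_def by blast

lemma frc_mono: assumes "pos P r" "p \<in> ext P" "q \<in> ext P" "opair p q \<in> ext r" "frc P r q W" shows "frc P r p W"
  using assms(5) blw_mono[OF assms(1) _ assms(2,3,4)] unfolding frc_def gnr_def by blast

lemma frc_imp2: assumes "frc P r p W" "frc P r p V" "\<And>f. dseq P r f ==> f \<in> ext W ==> f \<in> ext V ==> f \<in> ext U"
  shows "frc P r p U"
proof -
  obtain D where D: "cdf P r D" "\<And>f. gnr P r D f ==> blw r f p ==> f \<in> ext W" using assms(1) unfolding frc_def by blast
  obtain E where E: "cdf P r E" "\<And>f. gnr P r E f ==> blw r f p ==> f \<in> ext V" using assms(2) unfolding frc_def by blast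
  have "f \<in> ext U" if "gnr P r (bun D E) f" "blw r f p" for f
    using that D(2) E(2) assms(3) unfolding gnr_bun by (meson gnr_def)
  then show ?thesis unfolding frc_def using cdf_bun[OF D(1) E(1)] by blast
qed
lemma frc_imp: assumes "frc P r p W" "\<And>f. dseq P r f ==> f \<in> ext W ==> f \<in> ext U" shows "frc P r p U"
  using frc_imp2[OF assms(1) assms(1)] assms(2) by blast

lemma frc_gen: assumes "pos P r" "ctb P" "frc P r p W" "frc P r q V" "cdf P r DD" "s \<in> ext P" "p \<in> ext P" "q \<in> ext P"
    "opair s p \<in> ext r" "opair s q \<in> ext r"
  obtains f where "gnr P r DD f" "ap f empty = s" "f \<in> ext W" "f \<in> ext V"
proof -
  obtain D where D: "cdf P r D" "\<And>f. gnr P r D f ==> blw r f p ==> f \<in> ext W" using assms(3) unfolding frc_def by blast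
  obtain E where E: "cdf P r E" "\<And>f. gnr P r E f ==> blw r f q ==> f \<in> ext V" using assms(4) unfolding frc_def by blast
  obtain f where f: "gnr P r (bun DD (bun D E)) f" "ap f empty = s"
    by (rule gen_exists[OF assms(1,2) cdf_bun[OF assms(5) cdf_bun[OF D(1) E(1)]] assms(6)])
  have "blw r f p" "blw r f q" unfolding blw_def using f(2) assms(9,10) omega0 by metis+
  then show thesis using that[of f] f D(2) E(2) unfolding gnr_bun by blast
qed

definition cmp :: "'a => 'a => 'a" where "cmp P W = sep (funs omega P) (%f. f \<notin> ext W)"
lemma F2_cmp: "F2 cmp" by (intro F2I, unfold cmp_def, intro dfi)
lemmas [dfi] = F2D[OF F2_cmp]
lemma cmp: "f \<in> ext (cmp P W) \<longleftrightarrow> func f omega P \<and> f \<notin> ext W"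
proof -
  have "D1 (%f. f \<notin> ext W)" by (intro dfi)
  from ext_sep[OF this] show ?thesis unfolding cmp_def by auto
qed
lemma eqv_sym: "eqv r f g ==> eqv r g f" unfolding eqv_def by blast
lemma inv_cmp: "inv P r W ==> inv P r (cmp P W)"
  unfolding inv_def cmp using eqv_sym dseq_func by meson

lemma frc_contra: assumes "pos P r" "ctb P" "frc P r p W" "frc P r q (cmp P W)" "p \<in> ext P" "q \<in> ext P" "opair p q \<in> ext r"
  shows False
  by (rule frc_gen[OF assms(1-4) cdf_triv[OF assms(1,5)] assms(5,5,6) pos_refl[OF assms(1,5)] assms(7)]) (simp add: cmp)

end

context zf_model
begin

text \<open>The Banach--Mazur game below \<open>p\<close>: a move is the index of a condition, and a move that is not
  below the current condition counts as a pass, so that every sequence of moves is legal.\<close>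

definition cst :: "'a => 'a => 'a => 'a => 'a => 'a" where
  "cst e r p y n = nrec p (%n x. if opair (ap e (ap y n)) x \<in> ext r then ap e (ap y n) else x) n"

context
  fixes P r e p
  assumes pos: "pos P r" and ef: "func e omega P" and es: "\<forall>x\<in>ext P. \<exists>n\<in>ext omega. ap e n = x" and pP: "p \<in> ext P"
begin

abbreviation "cstp \<equiv> cst e r p"

lemma cstF[dfi]: assumes "DT t" "DT u" shows "DT (%e. cstp (t e) (u e))"
  by (rule DT2[where F=cstp, OF _ assms]) (unfold cst_def, intro dfi)

lemma cst0: "cstp y empty = p" unfolding cst_def by (rule nrec_0) (intro dfi)
lemma cstS: "n \<in> ext omega ==> cstp y (succ n) = (if opair (ap e (ap y n)) (cstp y n) \<in> ext r then ap e (ap y n) else cstp y n)"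
  unfolding cst_def by (rule nrec_S) (intro dfi)

lemma cst_in: assumes "n \<in> ext omega" "\<And>i. i \<in> ext n ==> ap y i \<in> ext omega" shows "cstp y n \<in> ext P"
proof -
  have "(\<forall>i\<in>ext n. ap y i \<in> ext omega) --> cstp y n \<in> ext P"
  proof (rule omega_induct[OF assms(1), where P="%n. (\<forall>i\<in>ext n. ap y i \<in> ext omega) --> cstp y n \<in> ext P"])
    show "D1 (%n. (\<forall>i\<in>ext n. ap y i \<in> ext omega) --> cstp y n \<in> ext P)" by (intro dfi)
  qed (use func_ap_in[OF ef] in \<open>auto simp: cst0 cstS pP\<close>)
  then show ?thesis using assms(2) by blast
qed

lemma cst_agree: assumes "n \<in> ext omega" "\<And>i. i \<in> ext n ==> ap y i = ap z i" shows "cstp y n = cstp z n"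
proof -
  have "(\<forall>i\<in>ext n. ap y i = ap z i) --> cstp y n = cstp z n"
  proof (rule omega_induct[OF assms(1), where P="%n. (\<forall>i\<in>ext n. ap y i = ap z i) --> cstp y n = cstp z n"])
    show "D1 (%n. (\<forall>i\<in>ext n. ap y i = ap z i) --> cstp y n = cstp z n)" by (intro dfi)
  qed (auto simp: cst0 cstS)
  then show ?thesis using assms(2) by blast
qed

lemma cst_dec: assumes "n \<in> ext omega" "\<And>i. i \<in> ext n ==> ap y i \<in> ext omega"
  shows "opair (cstp y (succ n)) (cstp y n) \<in> ext r"
  using pos_refl[OF pos cst_in[OF assms]] by (simp add: cstS[OF assms(1)])

lemma cst_dseq: assumes "func y omega omega" shows "dseq P r (lam omega (cstp y))"
proof -
  have F: "F1 (cstp y)" by (intro dfi)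
  have i: "\<And>n i. n \<in> ext omega ==> i \<in> ext n ==> ap y i \<in> ext omega"
    using func_ap_in[OF assms] omega_trans by blast
  have "func (lam omega (cstp y)) omega P" by (rule lam_func[OF F cst_in]) (use i in blast)+
  moreover have "opair (ap (lam omega (cstp y)) (succ n)) (ap (lam omega (cstp y)) n) \<in> ext r" if "n \<in> ext omega" for n
    using cst_dec[OF that, of y] i[OF that] by (simp add: ap_lam[OF F] that)
  ultimately show ?thesis unfolding dseq_def by blast
qed

definition lastc :: "'a => 'a" where "lastc s = cstp s (dom s)"
lemma lastcF[dfi]: "DT t ==> DT (%e. lastc (t e))" unfolding lastc_def by (intro dfi)

lemma lastc_snoc: assumes "func s n omega" "n \<in> ext omega" "j \<in> ext omega"
  shows "lastc (snoc s j) = (if opair (ap e j) (lastc s) \<in> ext r then ap e j else lastc s)"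
    "lastc s \<in> ext P" "opair (lastc (snoc s j)) (lastc s) \<in> ext r"
proof -
  have d: "dom s = n" "dom (snoc s j) = succ n" using func_dom[OF assms(1)] func_dom[OF snoc_func[OF assms(1,3)]] .
  have a: "cstp (snoc s j) n = cstp s n" by (rule cst_agree[OF assms(2)]) (rule snoc_ap[OF assms(1,3)])
  show 1: "lastc (snoc s j) = (if opair (ap e j) (lastc s) \<in> ext r then ap e j else lastc s)"
    unfolding lastc_def d cstS[OF assms(2)] a snoc_last[OF assms(1,3)] ..
  show 2: "lastc s \<in> ext P" unfolding lastc_def d by (rule cst_in[OF assms(2) func_ap_in[OF assms(1)]])
  show "opair (lastc (snoc s j)) (lastc s) \<in> ext r" unfolding 1 using pos_refl[OF pos 2] by simp
qed

text \<open>\<open>Opp n\<close> says that stage \<open>n\<close> belongs to the player without the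
  strategy. A sufficiently generic \<open>f\<close> below \<open>q\<close> is shadowed by a play
  that follows \<open>\<sigma>\<close>: the opponent pushes the play below \<open>f n\<close>, and
  genericity allows a push whose answer by \<open>\<sigma>\<close> stays in the filter of
  \<open>f\<close>. The play then generates the same filter as \<open>f\<close>, and invariance
  transfers membership in \<open>U\<close>.\<close>

lemma strategy_forces:
  assumes \<sigma>: "func \<sigma> (fin_seqs omega) omega"
    and dO: "D1 Opp" and alt: "\<And>n. n \<in> ext omega ==> Opp (succ n) \<longleftrightarrow> \<not> Opp n"
    and win: "\<And>y. func y omega omega ==> (\<And>n. n \<in> ext omega ==> \<not> Opp n ==> ap y n = ap \<sigma> (restr y n)) ==> lam omega (cstp y) \<in> ext U"
    and inv: "inv P r U" and cP: "ctb P"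
    and q: "q = (if Opp empty then p else lastc (snoc empty (ap \<sigma> empty)))"
  shows "q \<in> ext P" "opair q p \<in> ext r" "frc P r q U"
proof -
  have sin: "s \<in> ext (fin_seqs omega)" if "func s n omega" "n \<in> ext omega" for s n
    using that unfolding ext_fin_seqs by blast
  have s\<sigma>: "ap \<sigma> s \<in> ext omega" if "func s n omega" "n \<in> ext omega" for s n
    by (rule func_ap_in[OF \<sigma> sin[OF that]])
  have \<sigma>0: "ap \<sigma> empty \<in> ext omega" by (rule s\<sigma>[OF func_empty omega0])
  have d0: "dom empty = empty" by (rule func_dom[OF func_empty])
  have l0: "lastc empty = p" unfolding lastc_def d0 cst0 ..
  have lS: "lastc (snoc empty (ap \<sigma> empty)) \<in> ext P" by (rule lastc_snoc(2)[OF snoc_func[OF func_empty \<sigma>0] omegaS[OF omega0] omega0])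
  have lL: "opair (lastc (snoc empty (ap \<sigma> empty))) p \<in> ext r"
    using lastc_snoc(3)[OF func_empty omega0 \<sigma>0] unfolding l0 .
  show qP: "q \<in> ext P" and qp: "opair q p \<in> ext r" unfolding q using pP lS lL pos_refl[OF pos pP] by auto
  let ?n2 = "%s j. snoc (snoc s j) (ap \<sigma> (snoc s j))"
  \<comment> \<open>Either \<open>x\<close> is below the answer of \<open>\<sigma>\<close> to some
    move under both \<open>t\<close> and the current position, or nothing is below \<open>x\<close>,
    \<open>t\<close> and the position at once. The second alternative provides density; it fails in
    a filter that contains \<open>t\<close> and the position.\<close>
  let ?A = "%s t x. (\<exists>j\<in>ext omega. opair (ap e j) t \<in> ext r \<and> opair (ap e j) (lastc s) \<in> ext r \<and> opair x (lastc (?n2 s j)) \<in> ext r)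
     \<or> \<not> (\<exists>z\<in>ext P. opair z x \<in> ext r \<and> opair z t \<in> ext r \<and> opair z (lastc s) \<in> ext r)"
  define Ds where "Ds = (%s t. sep P (?A s t))"
  have dA: "D1 (?A s t)" for s t by (intro dfi)
  have Ds: "x \<in> ext (Ds s t) \<longleftrightarrow> x \<in> ext P \<and> ?A s t x" for s t x unfolding Ds_def ext_sep[OF dA] by blast
  have dD: "F1 (%z. Ds (pfst z) (psnd z))" unfolding Ds_def by (intro dfi)
  have n2: "opair (lastc (?n2 s j)) (ap e j) \<in> ext r" "lastc (?n2 s j) \<in> ext P"
    if s: "func s n omega" "n \<in> ext omega" and j: "j \<in> ext omega" "opair (ap e j) (lastc s) \<in> ext r" for s n j
  proof -
    note f1 = snoc_func[OF s(1) j(1)]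
    note k = s\<sigma>[OF f1 omegaS[OF s(2)]]
    have "lastc (snoc s j) = ap e j" unfolding lastc_snoc(1)[OF s j(1)] using j(2) by simp
    then show "opair (lastc (?n2 s j)) (ap e j) \<in> ext r" using lastc_snoc(3)[OF f1 omegaS[OF s(2)] k] by simp
    show "lastc (?n2 s j) \<in> ext P" by (rule lastc_snoc(2)[OF snoc_func[OF f1 k] omegaS[OF omegaS[OF s(2)]] omega0])
  qed
  have dense: "dns P r (Ds s t)" if s: "s \<in> ext (fin_seqs omega)" and t: "t \<in> ext P" for s t
    unfolding dns_def
  proof (intro conjI ballI)
    show "ext (Ds s t) \<subseteq> ext P"
    proof
      fix x assume "x \<in> ext (Ds s t)" then show "x \<in> ext P" unfolding Ds by (rule conjunct1)
    qed
    obtain n where n: "n \<in> ext omega" "func s n omega" using s unfolding ext_fin_seqs by blast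
    have lP: "lastc s \<in> ext P" by (rule lastc_snoc(2)[OF n(2,1) omega0])
    fix x assume x: "x \<in> ext P"
    show "\<exists>d\<in>ext (Ds s t). opair d x \<in> ext r"
    proof (cases "\<exists>z\<in>ext P. opair z x \<in> ext r \<and> opair z t \<in> ext r \<and> opair z (lastc s) \<in> ext r")
      case True
      then obtain z where z: "z \<in> ext P" "opair z x \<in> ext r" "opair z t \<in> ext r" "opair z (lastc s) \<in> ext r" by blast
      obtain j where j: "j \<in> ext omega" "ap e j = z" using bspec[OF es z(1)] by blast
      have j2: "opair (ap e j) (lastc s) \<in> ext r" using j z by simp
      note m = n2[OF n(2,1) j(1) j2]
      have "lastc (?n2 s j) \<in> ext (Ds s t)" unfolding Ds
        using m j z pos_refl[OF pos m(2)] by (intro conjI disjI1 bexI[of _ j]) auto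
      moreover have "opair (lastc (?n2 s j)) x \<in> ext r"
        by (rule pos_trans[OF pos m(2) z(1) x _ z(2)]) (use m(1) j(2) in simp)
      ultimately show ?thesis by blast
    next
      case False
      then have "x \<in> ext (Ds s t)" unfolding Ds using x by blast
      then show ?thesis using pos_refl[OF pos x] by blast
    qed
  qed
  define DD where "DD = img (%z. Ds (pfst z) (psnd z)) (cprod (fin_seqs omega) P)"
  have DDe: "ext DD = (%z. Ds (pfst z) (psnd z)) ` ext (cprod (fin_seqs omega) P)" unfolding DD_def by (rule ext_img[OF dD])
  have "ctb DD" unfolding DD_def by (rule ctb_img[OF ctb_prod[OF ctb_fin_seqs[OF ctb_omega] cP] dD])
  moreover have "\<forall>D\<in>ext DD. dns P r D" unfolding DDe using dense by auto
  ultimately have cdf: "cdf P r DD" unfolding cdf_def by blast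
  have "f \<in> ext U" if f: "gnr P r DD f" "blw r f q" for f
  proof -
    have fd: "dseq P r f" using f(1) unfolding gnr_def by blast
    have fP: "\<And>n. n \<in> ext omega ==> ap f n \<in> ext P" by (rule dseq_in[OF fd])
    define gg where "gg = (%s j. opair (ap e j) (ap f (dom s)) \<in> ext r \<and> opair (ap e j) (lastc s) \<in> ext r \<and>
      (\<exists>i\<in>ext omega. opair (ap f i) (lastc (?n2 s j)) \<in> ext r))"
    \<comment> \<open>The opponent plays the least suitable index, a definable choice; the default
      \<open>empty\<close> makes \<open>hh\<close> total.\<close>
    define hh where "hh = (%s. if Opp (dom s) then (if \<exists>j\<in>ext omega. gg s j then lst (gg s) else empty) else ap \<sigma> s)"
    have dg: "D1 (gg s)" for s unfolding gg_def by (intro dfi)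
    have g: "lst (gg s) \<in> ext omega \<and> gg s (lst (gg s))" if gs: "\<exists>j\<in>ext omega. gg s j" for s
    proof -
      obtain j where j: "j \<in> ext omega" "gg s j" using gs by (rule bexE)
      note L = lst(1,2)[OF dg, OF j]
      show ?thesis by (rule conjI[OF L])
    qed
    have hF: "F1 hh" unfolding hh_def gg_def by (intro dfi D1D[OF dO])
    have hin: "hh s \<in> ext omega" if "s \<in> ext (fin_seqs omega)" for s
    proof (cases "Opp (dom s)")
      case True
      show ?thesis
      proof (cases "\<exists>j\<in>ext omega. gg s j")
        case ex: True
        have "hh s = lst (gg s)" unfolding hh_def by (simp only: True ex if_True)
        then show ?thesis using conjunct1[OF g[OF ex]] by simp
      next
        case nex: False
        have "hh s = empty" unfolding hh_def by (simp only: True nex if_True if_False)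
        then show ?thesis using omega0 by simp
      qed
    next
      case False
      have "hh s = ap \<sigma> s" unfolding hh_def by (simp only: False if_False)
      then show ?thesis using func_ap_in[OF \<sigma> that] by simp
    qed
    obtain y where y: "func y omega omega" "\<And>n. n \<in> ext omega ==> ap y n = hh (restr y n)"
      by (rule cov[OF hF hin], assumption) (rule that)
    have rf: "func (restr y n) n omega" if "n \<in> ext omega" for n by (rule restr_fin(1)[OF y(1) that])
    have rd: "dom (restr y n) = n" if "n \<in> ext omega" for n by (rule func_dom[OF rf[OF that]])
    have yo: "\<And>n. n \<in> ext omega ==> ap y n \<in> ext omega" by (rule func_ap_in[OF y(1)])
    have Cr: "lastc (restr y n) = cstp y n" if "n \<in> ext omega" for n
      unfolding lastc_def rd[OF that] by (rule cst_agree[OF that]) (rule restr_ap)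
    have rS: "restr y (succ n) = snoc (restr y n) (ap y n)" if n: "n \<in> ext omega" for n
    proof (rule func_eqI[OF rf[OF omegaS[OF n]] snoc_func[OF rf[OF n] yo[OF n]]])
      fix x assume x: "x \<in> ext (succ n)"
      then have "x = n \<or> x \<in> ext n" by auto
      then show "ap (restr y (succ n)) x = ap (snoc (restr y n) (ap y n)) x"
        unfolding restr_ap[OF x] using snoc_last[OF rf[OF n] yo[OF n]] snoc_ap[OF rf[OF n] yo[OF n]] restr_ap by auto
    qed
    have yi: "\<And>n i. n \<in> ext omega ==> i \<in> ext n ==> ap y i \<in> ext omega" using yo omega_trans by blast
    have CP: "cstp y n \<in> ext P" if "n \<in> ext omega" for n by (rule cst_in[OF that yi[OF that]])
    have Cd: "opair (cstp y (succ n)) (cstp y n) \<in> ext r" if "n \<in> ext omega" for n by (rule cst_dec[OF that yi[OF that]])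
    have ys: "ap y n = ap \<sigma> (restr y n)" if "n \<in> ext omega" "\<not> Opp n" for n
      using y(2)[OF that(1)] that(2) rd[OF that(1)] unfolding hh_def by simp
    let ?I = "%n. blw r f (cstp y n)"
    have move: "?I (succ n) \<and> ?I (succ (succ n)) \<and> opair (cstp y (succ n)) (ap f n) \<in> ext r"
      if n: "n \<in> ext omega" and O: "Opp n" and I: "?I n" for n
    proof -
      let ?s = "restr y n"
      have "Ds ?s (ap f n) \<in> ext DD" unfolding DDe
        by (rule image_eqI[of _ _ "opair ?s (ap f n)"]) (use sin[OF rf[OF n] n] fP[OF n] in auto)
      then have "mts r f (Ds ?s (ap f n))" using f(1) unfolding gnr_def by blast
      then obtain m d where m: "m \<in> ext omega" "d \<in> ext (Ds ?s (ap f n))" "opair (ap f m) d \<in> ext r" unfolding mts_def by blast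
      have dP: "d \<in> ext P" using m(2) unfolding Ds by blast
      have bd: "blw r f d" unfolding blw_def using m by blast
      obtain k where k: "k \<in> ext omega" "opair (ap f k) d \<in> ext r" "opair (ap f k) (cstp y n) \<in> ext r"
        by (rule blw_common[OF pos fd dP CP[OF n] bd I])
      have bk: "blw r f (ap f k)" unfolding blw_def using k(1) pos_refl[OF pos fP[OF k(1)]] by blast
      have bn: "blw r f (ap f n)" unfolding blw_def using n pos_refl[OF pos fP[OF n]] by blast
      obtain l where l: "l \<in> ext omega" "opair (ap f l) (ap f k) \<in> ext r" "opair (ap f l) (ap f n) \<in> ext r"
        by (rule blw_common[OF pos fd fP[OF k(1)] fP[OF n] bk bn])
      have "opair (ap f l) d \<in> ext r" "opair (ap f l) (lastc ?s) \<in> ext r"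
        unfolding Cr[OF n] using pos_trans[OF pos fP[OF l(1)] fP[OF k(1)] _ l(2)] dP CP[OF n] k(2,3) by blast+
      then have "\<exists>z\<in>ext P. opair z d \<in> ext r \<and> opair z (ap f n) \<in> ext r \<and> opair z (lastc ?s) \<in> ext r"
        using fP[OF l(1)] l(3) by blast
      then have "\<exists>j\<in>ext omega. opair (ap e j) (ap f n) \<in> ext r \<and> opair (ap e j) (lastc ?s) \<in> ext r \<and> opair d (lastc (?n2 ?s j)) \<in> ext r"
        using m(2) unfolding Ds by blast
      then obtain j where j: "j \<in> ext omega" "opair (ap e j) (ap f n) \<in> ext r" "opair (ap e j) (lastc ?s) \<in> ext r" "opair d (lastc (?n2 ?s j)) \<in> ext r" by blast
      have "opair (ap f m) (lastc (?n2 ?s j)) \<in> ext r"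
        by (rule pos_trans[OF pos fP[OF m(1)] dP n2(2)[OF rf[OF n] n j(1,3)] m(3) j(4)])
      then have ex: "\<exists>j\<in>ext omega. gg ?s j" unfolding gg_def rd[OF n] using j m(1) by blast
      have yn: "ap y n = lst (gg ?s)" using y(2)[OF n] O ex unfolding hh_def rd[OF n] by simp
      have "gg ?s (ap y n)" unfolding yn using g[OF ex] by (rule conjunct2)
      note gy = this[unfolded gg_def rd[OF n]]
      have e1: "cstp y (succ n) = ap e (ap y n)" unfolding cstS[OF n] using gy unfolding Cr[OF n] by simp
      have "ap y (succ n) = ap \<sigma> (snoc ?s (ap y n))" using ys[OF omegaS[OF n]] alt[OF n] O rS[OF n] by simp
      then have e2: "cstp y (succ (succ n)) = lastc (?n2 ?s (ap y n))"
        using Cr[OF omegaS[OF omegaS[OF n]]] rS[OF omegaS[OF n]] rS[OF n] by simp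
      have I2: "?I (succ (succ n))" unfolding e2 blw_def using gy by blast
      have I1: "?I (succ n)" by (rule blw_mono[OF pos fd CP[OF omegaS[OF omegaS[OF n]]] CP[OF omegaS[OF n]] Cd[OF omegaS[OF n]] I2])
      show ?thesis using I1 I2 gy unfolding e1 by blast
    qed
    \<comment> \<open>The position stays in the filter of \<open>f\<close>. At a stage of
      \<open>\<sigma>\<close> the claim includes the position after its answer, since the preceding
      move of the opponent was chosen with this answer in view.\<close>
    have K: "?I n \<and> (\<not> Opp n --> ?I (succ n))" if "n \<in> ext omega" for n
    proof (rule omega_induct[OF that, where P="%n. ?I n \<and> (\<not> Opp n --> ?I (succ n))"])
      show "D1 (%n. ?I n \<and> (\<not> Opp n --> ?I (succ n)))" by (intro dfi D1D[OF dO])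
      have I0: "?I empty" unfolding cst0 by (rule blw_mono[OF pos fd qP pP qp f(2)])
      moreover have "?I (succ empty)" if "\<not> Opp empty"
      proof -
        have r0: "restr y empty = empty" by (rule func_empty_eq[OF rf[OF omega0]])
        have "cstp y (succ empty) = q"
          using Cr[OF omegaS[OF omega0]] rS[OF omega0] ys[OF omega0 that] that unfolding q r0 by simp
        then show ?thesis using f(2) by simp
      qed
      ultimately show "?I empty \<and> (\<not> Opp empty --> ?I (succ empty))" by blast
      fix n assume n: "n \<in> ext omega" "?I n \<and> (\<not> Opp n --> ?I (succ n))"
      show "?I (succ n) \<and> (\<not> Opp (succ n) --> ?I (succ (succ n)))"
        using move[OF n(1)] n(2) alt[OF n(1)] by (cases "Opp n") auto
    qed
    have F: "F1 (cstp y)" by (intro dfi)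
    have "eqv r (lam omega (cstp y)) f" unfolding eqv_def
    proof (intro conjI ballI)
      fix n assume n: "n \<in> ext omega"
      show "\<exists>m\<in>ext omega. opair (ap f m) (ap (lam omega (cstp y)) n) \<in> ext r"
        using K[OF n] unfolding blw_def ap_lam[OF F n] by blast
      show "\<exists>m\<in>ext omega. opair (ap (lam omega (cstp y)) m) (ap f n) \<in> ext r"
      proof (cases "Opp n")
        case True
        then show ?thesis using move[OF n True] K[OF n] omegaS[OF n] ap_lam[OF F omegaS[OF n]] by (intro bexI[of _ "succ n"]) auto
      next
        case False
        let ?m = "succ n"
        have m: "?m \<in> ext omega" "Opp ?m" using omegaS[OF n] alt[OF n] False by auto
        have "opair (cstp y (succ ?m)) (ap f ?m) \<in> ext r" using move[OF m] K[OF m(1)] by blast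
        moreover have "opair (ap f ?m) (ap f n) \<in> ext r" using fd n unfolding dseq_def by blast
        ultimately have "opair (cstp y (succ ?m)) (ap f n) \<in> ext r"
          by (rule pos_trans[OF pos CP[OF omegaS[OF m(1)]] fP[OF m(1)] fP[OF n]])
        then show ?thesis using omegaS[OF m(1)] ap_lam[OF F omegaS[OF m(1)]] by (intro bexI[of _ "succ ?m"]) auto
      qed
    qed
    moreover have "lam omega (cstp y) \<in> ext U" by (rule win[OF y(1) ys])
    ultimately show ?thesis using inv cst_dseq[OF y(1)] fd unfolding inv_def by blast
  qed
  then show "frc P r q U" unfolding frc_def using cdf by blast
qed

end

lemma ext_reals: "f \<in> ext reals \<longleftrightarrow> func f omega omega" unfolding reals_def by simp

text \<open>The property of Baire, from the Banach-Mazur game with payoff \<open>W\<close>. Player I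
  moves first, so his strategy yields a condition \<open>q\<close>, the position after his first
  move, while a strategy of player II works from \<open>p\<close> itself. This explains the
  asymmetry of the two alternatives.\<close>

lemma baire: assumes Det "pos P r" "ctb P" "p \<in> ext P" "inv P r W"
  shows "(\<exists>q\<in>ext P. opair q p \<in> ext r \<and> frc P r q W) \<or> frc P r p (cmp P W)"
proof -
  obtain e where e: "func e omega P" "\<forall>x\<in>ext P. \<exists>n\<in>ext omega. ap e n = x"
    using assms(3) unfolding ctb_def by blast
  note S = strategy_forces[OF assms(2) e assms(4)]
  let ?B = "sep reals (%y. lam omega (cst e r p y) \<in> ext W)"
  have dB: "D1 (%y. lam omega (cst e r p y) \<in> ext W)" unfolding cst_def by (intro dfi)
  have B: "ext ?B = {y \<in> ext reals. lam omega (cst e r p y) \<in> ext W}" by (rule ext_sep[OF dB])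
  have "ext ?B \<subseteq> ext reals" unfolding B by blast
  from det_cases[OF assms(1) this] show ?thesis
  proof (elim disjE exE conjE)
    fix \<sigma> assume \<sigma>: "func \<sigma> (fin_seqs omega) omega"
      "\<forall>f. func f omega omega \<and> (\<forall>n\<in>ext omega. par n = empty --> ap f n = ap \<sigma> (restr f n)) --> f \<in> ext ?B"
    have O: "D1 (%n. par n \<noteq> empty)" by (intro dfi)
    have alt: "n \<in> ext omega ==> (par (succ n) \<noteq> empty) \<longleftrightarrow> \<not> (par n \<noteq> empty)" for n using par_Sz by simp
    have win: "lam omega (cst e r p y) \<in> ext W" if "func y omega omega" "\<And>n. n \<in> ext omega ==> \<not> par n \<noteq> empty ==> ap y n = ap \<sigma> (restr y n)" for y
      using \<sigma>(2) that unfolding B by blast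
    from S[where Opp="%n. par n \<noteq> empty" and \<sigma>=\<sigma> and U=W, OF \<sigma>(1) O alt win assms(5,3) refl] show ?thesis by blast
  next
    fix \<sigma> assume \<sigma>: "func \<sigma> (fin_seqs omega) omega"
      "\<forall>f. func f omega omega \<and> (\<forall>n\<in>ext omega. par n \<noteq> empty --> ap f n = ap \<sigma> (restr f n)) --> f \<notin> ext ?B"
    have O: "D1 (%n. par n = empty)" by (intro dfi)
    have win: "lam omega (cst e r p y) \<in> ext (cmp P W)" if h: "func y omega omega" "\<And>n. n \<in> ext omega ==> par n \<noteq> empty ==> ap y n = ap \<sigma> (restr y n)" for y
    proof -
      have "y \<notin> ext ?B" using \<sigma>(2) h by blast
      then have "lam omega (cst e r p y) \<notin> ext W" using h(1) unfolding B ext_reals by blast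
      then show ?thesis unfolding cmp using dseq_func[OF cst_dseq[OF assms(2) e assms(4) h(1)]] by blast
    qed
    have "p = (if par empty = empty then p else lastc r e p (snoc empty (ap \<sigma> empty)))" by simp
    from S(3)[where Opp="%n. par n = empty" and \<sigma>=\<sigma> and U="cmp P W", OF \<sigma>(1) O par_Sz win inv_cmp[OF assms(5)] assms(3) this]
    show ?thesis by (rule disjI2)
  qed
qed

end

section \<open>Category in products and well-ordered unions\<close>

context zf_model
begin

definition dns2 :: "'a => 'a => 'a => bool" where
  "dns2 P r D \<longleftrightarrow> ext D \<subseteq> ext (cprod P P) \<and> (\<forall>a\<in>ext P. \<forall>b\<in>ext P. \<exists>c d. opair c d \<in> ext D \<and> opair c a \<in> ext r \<and> opair d b \<in> ext r)"
definition gnr2 :: "'a => 'a => 'a => 'a => 'a => bool" where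
  "gnr2 P r DD f h \<longleftrightarrow> dseq P r f \<and> dseq P r h \<and>
    (\<forall>D\<in>ext DD. \<exists>n\<in>ext omega. \<exists>c d. opair c d \<in> ext D \<and> opair (ap f n) c \<in> ext r \<and> opair (ap h n) d \<in> ext r)"
definition frc2 :: "'a => 'a => 'a => 'a => ('a => 'a => bool) => bool" where
  "frc2 P r a b V \<longleftrightarrow> (\<exists>DD. ctb DD \<and> (\<forall>D\<in>ext DD. dns2 P r D) \<and>
     (\<forall>f h. gnr2 P r DD f h \<and> blw r f a \<and> blw r h b --> V f h))"

lemma frc2_swap: assumes "frc2 P r a b V" shows "frc2 P r b a (%h f. V f h)"
proof -
  obtain DD where DD: "ctb DD" "\<forall>D\<in>ext DD. dns2 P r D" "\<And>f h. gnr2 P r DD f h ==> blw r f a ==> blw r h b ==> V f h"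
    using assms unfolding frc2_def by blast
  let ?s = "%z. opair (psnd z) (pfst z)"
  have s: "F1 ?s" by (intro dfi)
  have S: "F1 (img ?s)" by (intro dfi)
  have m: "opair c d \<in> ext (img ?s D) \<longleftrightarrow> opair d c \<in> ext D" if D: "dns2 P r D" for D c d
  proof
    assume "opair c d \<in> ext (img ?s D)"
    then obtain z where z: "z \<in> ext D" "opair c d = ?s z" unfolding ext_img[OF s] by blast
    obtain x y where "z = opair x y" using z(1) D unfolding dns2_def by auto
    then show "opair d c \<in> ext D" using z by simp
  next
    assume "opair d c \<in> ext D"
    then have "?s (opair d c) \<in> ext (img ?s D)" unfolding ext_img[OF s] by (rule imageI)
    then show "opair c d \<in> ext (img ?s D)" by simp
  qed
  have "ctb (img (img ?s) DD)" by (rule ctb_img[OF DD(1) S])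
  moreover have "dns2 P r D'" if D': "D' \<in> ext (img (img ?s) DD)" for D'
  proof -
    obtain D where D: "D \<in> ext DD" "D' = img ?s D" using D' unfolding ext_img[OF S] by blast
    have d: "dns2 P r D" using DD(2) D(1) by blast
    have "ext D' \<subseteq> ext (cprod P P)"
    proof
      fix z assume "z \<in> ext D'"
      then obtain y where y: "y \<in> ext D" "z = ?s y" unfolding D(2) ext_img[OF s] by blast
      then show "z \<in> ext (cprod P P)" using d unfolding dns2_def by auto
    qed
    moreover have "\<exists>c e. opair c e \<in> ext D' \<and> opair c x \<in> ext r \<and> opair e y \<in> ext r" if "x \<in> ext P" "y \<in> ext P" for x y
      using d that unfolding D(2) m[OF d] dns2_def by blast
    ultimately show ?thesis unfolding dns2_def by blast
  qed
  moreover have "V f h" if g: "gnr2 P r (img (img ?s) DD) h f" "blw r h b" "blw r f a" for f h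
  proof (rule DD(3)[OF _ g(3,2)])
    have "\<exists>n\<in>ext omega. \<exists>c d. opair c d \<in> ext D \<and> opair (ap f n) c \<in> ext r \<and> opair (ap h n) d \<in> ext r" if D: "D \<in> ext DD" for D
    proof -
      have d: "dns2 P r D" using DD(2) D by blast
      have "img ?s D \<in> ext (img (img ?s) DD)" unfolding ext_img[OF S] using D by (rule imageI)
      then obtain n c d where "n \<in> ext omega" "opair c d \<in> ext (img ?s D)" "opair (ap h n) c \<in> ext r" "opair (ap f n) d \<in> ext r"
        using g(1) unfolding gnr2_def by blast
      then show ?thesis unfolding m[OF d] by blast
    qed
    then show "gnr2 P r DD f h" using g(1) unfolding gnr2_def by blast
  qed
  ultimately show ?thesis unfolding frc2_def by blast
qed

text \<open>One point \<open>f\<close> with a comeager section suffices, provided it can be made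
  generic for a prescribed \<open>DE\<close>. If \<open>f\<close> meets the projections
  \<open>S\<close> of every dense \<open>D\<close> along every \<open>t\<close>, then the sections
  \<open>T D\<close> at \<open>f\<close> are dense, and they witness that the section of
  \<open>V\<close> is comeager.\<close>

lemma kuratowski_ulam: assumes "pos P r" "ctb P" "frc2 P r a b V" "a \<in> ext P" "cdf P r DE"
  obtains f EE where "gnr P r DE f" "ap f empty = a" "cdf P r EE" "\<And>h. gnr P r EE h ==> blw r h b ==> V f h"
proof -
  obtain DD where DD: "ctb DD" "\<And>D. D \<in> ext DD ==> dns2 P r D" "\<And>f h. gnr2 P r DD f h ==> blw r f a ==> blw r h b ==> V f h"
    using assms(3) unfolding frc2_def by blast
  define S where "S = (%z. sep P (%c. \<exists>d. opair c d \<in> ext (pfst z) \<and> opair d (psnd z) \<in> ext r))"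
  have SF: "F1 S" unfolding S_def by (intro dfi)
  have dS: "D1 (%c. \<exists>d. opair c d \<in> ext D \<and> opair d t \<in> ext r)" for D t by (intro dfi)
  have S: "c \<in> ext (S (opair D t)) \<longleftrightarrow> c \<in> ext P \<and> (\<exists>d. opair c d \<in> ext D \<and> opair d t \<in> ext r)" for c D t
    unfolding S_def pfst psnd ext_sep[OF dS] by blast
  define SS where "SS = img S (cprod DD P)"
  have "ctb SS" unfolding SS_def by (rule ctb_img[OF ctb_prod[OF DD(1) assms(2)] SF])
  moreover have "dns P r E" if E: "E \<in> ext SS" for E
  proof -
    obtain D t where D: "D \<in> ext DD" "t \<in> ext P" "E = S (opair D t)" using E unfolding SS_def ext_img[OF SF] by auto
    note d = DD(2)[OF D(1)]
    have "\<exists>c\<in>ext E. opair c x \<in> ext r" if x: "x \<in> ext P" for x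
    proof -
      obtain c e where ce: "opair c e \<in> ext D" "opair c x \<in> ext r" "opair e t \<in> ext r" using d x D(2) unfolding dns2_def by blast
      have "c \<in> ext P" using ce(1) d unfolding dns2_def by auto
      then have "c \<in> ext E" unfolding D(3) S using ce by blast
      then show ?thesis using ce(2) by blast
    qed
    moreover have "ext E \<subseteq> ext P" unfolding D(3) by (rule subsetI) (simp only: S)
    ultimately show ?thesis unfolding dns_def by blast
  qed
  ultimately have cS: "cdf P r SS" unfolding cdf_def by blast
  obtain f where f: "gnr P r (bun DE SS) f" "ap f empty = a" by (rule gen_exists[OF assms(1,2) cdf_bun[OF assms(5) cS] assms(4)])
  have fd: "dseq P r f" using f(1) unfolding gnr_def by blast
  have fP: "\<And>n. n \<in> ext omega ==> ap f n \<in> ext P" by (rule dseq_in[OF fd])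
  define T where "T = (%D. sep P (%d. \<exists>n\<in>ext omega. \<exists>c. opair c d \<in> ext D \<and> opair (ap f n) c \<in> ext r))"
  have TF: "F1 T" unfolding T_def by (intro dfi)
  have dT: "D1 (%d. \<exists>n\<in>ext omega. \<exists>c. opair c d \<in> ext D \<and> opair (ap f n) c \<in> ext r)" for D by (intro dfi)
  have T: "d \<in> ext (T D) \<longleftrightarrow> d \<in> ext P \<and> (\<exists>n\<in>ext omega. \<exists>c. opair c d \<in> ext D \<and> opair (ap f n) c \<in> ext r)" for d D
    unfolding T_def ext_sep[OF dT] by blast
  have Te: "ext (img T DD) = T ` ext DD" by (rule ext_img[OF TF])
  have "dns P r (T D)" if D: "D \<in> ext DD" for D
  proof -
    note d = DD(2)[OF D]
    have "\<exists>c\<in>ext (T D). opair c t \<in> ext r" if t: "t \<in> ext P" for t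
    proof -
      have "S (opair D t) \<in> ext SS" unfolding SS_def ext_img[OF SF] by (rule imageI) (use D t in simp)
      then have "mts r f (S (opair D t))" using f(1) unfolding gnr_def by auto
      then obtain n c where n: "n \<in> ext omega" "c \<in> ext (S (opair D t))" "opair (ap f n) c \<in> ext r" unfolding mts_def by blast
      then obtain e where e: "opair c e \<in> ext D" "opair e t \<in> ext r" unfolding S by blast
      have "e \<in> ext P" using e(1) d unfolding dns2_def by auto
      then have "e \<in> ext (T D)" unfolding T using n e by blast
      then show ?thesis using e(2) by blast
    qed
    moreover have "ext (T D) \<subseteq> ext P" by (rule subsetI) (simp only: T)
    ultimately show ?thesis unfolding dns_def by blast
  qed
  then have cT: "cdf P r (img T DD)" unfolding cdf_def Te using ctb_img[OF DD(1) TF] by blast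
  have V: "V f h" if h: "gnr P r (img T DD) h" "blw r h b" for h
  proof (rule DD(3)[OF _ _ h(2)])
    show "blw r f a" unfolding blw_def using f(2) pos_refl[OF assms(1,4)] omega0 by metis
    have hd: "dseq P r h" using h(1) unfolding gnr_def by blast
    have "\<exists>n\<in>ext omega. \<exists>c d. opair c d \<in> ext D \<and> opair (ap f n) c \<in> ext r \<and> opair (ap h n) d \<in> ext r" if D: "D \<in> ext DD" for D
    proof -
      note d = DD(2)[OF D]
      have "mts r h (T D)" using h(1) D unfolding gnr_def Te by blast
      then obtain m e where m: "m \<in> ext omega" "e \<in> ext (T D)" "opair (ap h m) e \<in> ext r" unfolding mts_def by blast
      then obtain n c where n: "n \<in> ext omega" "opair c e \<in> ext D" "opair (ap f n) c \<in> ext r" "e \<in> ext P" unfolding T by blast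
      have cP: "c \<in> ext P" using n(2) d unfolding dns2_def by auto
      obtain k where k: "k \<in> ext omega" "n \<in> ext (succ k)" "m \<in> ext (succ k)" by (rule omega_max[OF n(1) m(1)])
      have "opair (ap f k) c \<in> ext r"
        by (rule pos_trans[OF assms(1) fP[OF k(1)] fP[OF n(1)] cP dseq_mono[OF assms(1) fd k(1,2)] n(3)])
      moreover have "opair (ap h k) e \<in> ext r"
        by (rule pos_trans[OF assms(1) dseq_in[OF hd k(1)] dseq_in[OF hd m(1)] n(4) dseq_mono[OF assms(1) hd k(1,3)] m(3)])
      ultimately show ?thesis using k(1) n(2) by blast
    qed
    then show "gnr2 P r DD f h" unfolding gnr2_def using fd hd by blast
  qed
  show thesis using that[OF _ f(2) cT V] f(1) unfolding gnr_bun by blast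
qed

text \<open>Reduction to \<open>baire\<close> for the product order: a descending sequence of pairs
  is a pair of descending sequences, so \<open>V\<close> becomes an invariant set
  \<open>W\<close>.\<close>

lemma baire2: assumes Det "pos P r" "ctb P" "a \<in> ext P" "b \<in> ext P" and dV: "DF (%e. V (e 0) (e 1))"
    and iV: "\<And>f f' h h'. dseq P r f ==> dseq P r f' ==> dseq P r h ==> dseq P r h' ==> eqv r f f' ==> eqv r h h' ==> V f h ==> V f' h'"
  shows "(\<exists>c\<in>ext P. \<exists>d\<in>ext P. opair c a \<in> ext r \<and> opair d b \<in> ext r \<and> frc2 P r c d V) \<or> frc2 P r a b (%f h. \<not> V f h)"
proof -
  define PP where "PP = cprod P P"
  let ?R = "%z. opair (pfst (pfst z)) (pfst (psnd z)) \<in> ext r \<and> opair (psnd (pfst z)) (psnd (psnd z)) \<in> ext r"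
  define rr where "rr = sep (cprod PP PP) ?R"
  have dR: "D1 ?R" by (intro dfi)
  have PPm: "opair x y \<in> ext PP \<longleftrightarrow> x \<in> ext P \<and> y \<in> ext P" for x y unfolding PP_def by simp
  have PPe: "\<exists>x y. z = opair x y \<and> x \<in> ext P \<and> y \<in> ext P" if "z \<in> ext PP" for z using that unfolding PP_def by auto
  have rr: "opair (opair x y) (opair u v) \<in> ext rr \<longleftrightarrow> x \<in> ext P \<and> y \<in> ext P \<and> u \<in> ext P \<and> v \<in> ext P \<and> opair x u \<in> ext r \<and> opair y v \<in> ext r" for x y u v
    unfolding rr_def ext_sep[OF dR] using PPm by auto
  have posP: "pos PP rr" unfolding pos_def
  proof (intro conjI ballI impI)
    fix p assume "p \<in> ext PP" then show "opair p p \<in> ext rr" using PPe[of p] rr pos_refl[OF assms(2)] by auto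
  next
    fix p q s assume "p \<in> ext PP" "q \<in> ext PP" "s \<in> ext PP" and o: "opair p q \<in> ext rr" "opair q s \<in> ext rr"
    then obtain p1 p2 q1 q2 s1 s2 where "p = opair p1 p2" "q = opair q1 q2" "s = opair s1 s2" using PPe by metis
    then show "opair p s \<in> ext rr" using o rr pos_trans[OF assms(2), of p1 q1 s1] pos_trans[OF assms(2), of p2 q2 s2] by simp
  qed
  have cPP: "ctb PP" unfolding PP_def by (rule ctb_prod[OF assms(3,3)])
  define fs where "fs = (%g. lam omega (%n. pfst (ap g n)))"
  define ss where "ss = (%g. lam omega (%n. psnd (ap g n)))"
  have l1: "F1 (%n. pfst (ap g n))" and l2: "F1 (%n. psnd (ap g n))" for g by (intro dfi)+
  have fsF: "F1 fs" and ssF: "F1 ss" unfolding fs_def ss_def by (intro dfi)+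
  have fsn: "ap (fs g) n = pfst (ap g n)" and ssn: "ap (ss g) n = psnd (ap g n)" if "n \<in> ext omega" for g n
    unfolding fs_def ss_def using ap_lam[OF l1 that] ap_lam[OF l2 that] by auto
  define W where "W = sep (funs omega PP) (%g. V (fs g) (ss g))"
  have dW: "D1 (%g. V (fs g) (ss g))" by (intro D1I DF2[where P=V, OF dV] F1D[OF fsF] F1D[OF ssF] dfi)
  have W: "g \<in> ext W \<longleftrightarrow> func g omega PP \<and> V (fs g) (ss g)" for g unfolding W_def ext_sep[OF dW] by simp
  have gP: "ap g n = opair (ap (fs g) n) (ap (ss g) n)" "ap (fs g) n \<in> ext P" "ap (ss g) n \<in> ext P" if g: "func g omega PP" and n: "n \<in> ext omega" for g n
    using PPe[OF func_ap_in[OF g n]] unfolding fsn[OF n] ssn[OF n] by auto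
  have ds: "dseq P r (fs g) \<and> dseq P r (ss g)" if g: "dseq PP rr g" for g
  proof -
    note gf = dseq_func[OF g]
    have g0: "opair (ap g (succ n)) (ap g n) \<in> ext rr" if "n \<in> ext omega" for n using g that unfolding dseq_def by blast
    have s: "opair (ap (fs g) (succ n)) (ap (fs g) n) \<in> ext r \<and> opair (ap (ss g) (succ n)) (ap (ss g) n) \<in> ext r" if n: "n \<in> ext omega" for n
      using g0[OF n] unfolding gP(1)[OF gf n] gP(1)[OF gf omegaS[OF n]] rr by blast
    have "func (fs g) omega P" unfolding fs_def by (rule lam_func[OF l1]) (use gP(2)[OF gf] fsn in auto)
    moreover have "func (ss g) omega P" unfolding ss_def by (rule lam_func[OF l2]) (use gP(3)[OF gf] ssn in auto)
    ultimately show ?thesis unfolding dseq_def using s by blast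
  qed
  have "inv PP rr W" unfolding inv_def
  proof (intro allI impI, elim conjE)
    fix g g' assume h: "dseq PP rr g" "dseq PP rr g'" "eqv rr g g'" "g \<in> ext W"
    note gf = dseq_func[OF h(1)] and gf' = dseq_func[OF h(2)]
    have 1: "\<exists>m\<in>ext omega. opair (ap (fs g') m) (ap (fs g) n) \<in> ext r \<and> opair (ap (ss g') m) (ap (ss g) n) \<in> ext r" if n: "n \<in> ext omega" for n
    proof -
      obtain m where m: "m \<in> ext omega" "opair (ap g' m) (ap g n) \<in> ext rr" using h(3) n unfolding eqv_def by blast
      then show ?thesis using gP(1)[OF gf n] gP(1)[OF gf' m(1)] rr by auto
    qed
    have 2: "\<exists>m\<in>ext omega. opair (ap (fs g) m) (ap (fs g') n) \<in> ext r \<and> opair (ap (ss g) m) (ap (ss g') n) \<in> ext r" if n: "n \<in> ext omega" for n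
    proof -
      obtain m where m: "m \<in> ext omega" "opair (ap g m) (ap g' n) \<in> ext rr" using h(3) n unfolding eqv_def by blast
      then show ?thesis using gP(1)[OF gf' n] gP(1)[OF gf m(1)] rr by auto
    qed
    have "eqv r (fs g) (fs g')" "eqv r (ss g) (ss g')" unfolding eqv_def using 1 2 by blast+
    then have "V (fs g') (ss g')" using iV[of "fs g" "fs g'" "ss g" "ss g'"] ds[OF h(1)] ds[OF h(2)] h(4) unfolding W by blast
    then show "g' \<in> ext W" unfolding W using gf' by blast
  qed
  have ab: "opair a b \<in> ext PP" using assms(4,5) PPm by blast
  have tr: "frc2 P r c d U" if fr: "frc PP rr (opair c d) Z" and cd: "c \<in> ext P" "d \<in> ext P" and ZU: "\<And>g. g \<in> ext Z ==> U (fs g) (ss g)" for c d Z U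
  proof -
    obtain DD where DD: "cdf PP rr DD" "\<And>g. gnr PP rr DD g ==> blw rr g (opair c d) ==> g \<in> ext Z" using fr unfolding frc_def by blast
    have 1: "dns2 P r D" if D: "D \<in> ext DD" for D
    proof -
      have dn: "dns PP rr D" using DD(1) D unfolding cdf_def by blast
      have "\<exists>u v. opair u v \<in> ext D \<and> opair u x \<in> ext r \<and> opair v y \<in> ext r" if "x \<in> ext P" "y \<in> ext P" for x y
      proof -
        have "opair x y \<in> ext PP" using that PPm by blast
        then obtain z where z: "z \<in> ext D" "opair z (opair x y) \<in> ext rr" using dn unfolding dns_def by blast
        then obtain u v where "z = opair u v" using dn PPe unfolding dns_def by blast
        then show ?thesis using z rr by auto
      qed
      then show ?thesis using dn unfolding dns2_def dns_def PP_def by blast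
    qed
    have 2: "U f h" if g2: "gnr2 P r DD f h" "blw r f c" "blw r h d" for f h
    proof -
      have fd: "dseq P r f" and hd: "dseq P r h" using g2(1) unfolding gnr2_def by blast+
      define g where "g = lam omega (%n. opair (ap f n) (ap h n))"
      have gF: "F1 (%n. opair (ap f n) (ap h n))" by (intro dfi)
      have gn: "ap g n = opair (ap f n) (ap h n)" if "n \<in> ext omega" for n unfolding g_def by (rule ap_lam[OF gF that])
      have gf: "func g omega PP" unfolding g_def by (rule lam_func[OF gF]) (use PPm dseq_in[OF fd] dseq_in[OF hd] in blast)
      have gd: "dseq PP rr g" unfolding dseq_def
        using gf fd hd dseq_in[OF fd] dseq_in[OF hd] unfolding dseq_def by (auto simp: gn rr)
      have "mts rr g D" if D: "D \<in> ext DD" for D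
      proof -
        obtain n u v where n: "n \<in> ext omega" "opair u v \<in> ext D" "opair (ap f n) u \<in> ext r" "opair (ap h n) v \<in> ext r"
          using g2(1) D unfolding gnr2_def by blast
        have "u \<in> ext P \<and> v \<in> ext P" using 1[OF D] n(2) unfolding dns2_def by auto
        then have "opair (ap g n) (opair u v) \<in> ext rr" unfolding gn[OF n(1)] rr using n dseq_in[OF fd n(1)] dseq_in[OF hd n(1)] by blast
        then show ?thesis unfolding mts_def using n by blast
      qed
      then have gg: "gnr PP rr DD g" unfolding gnr_def using gd by blast
      obtain n m where nm: "n \<in> ext omega" "opair (ap f n) c \<in> ext r" "m \<in> ext omega" "opair (ap h m) d \<in> ext r" using g2(2,3) unfolding blw_def by blast
      obtain k where k: "k \<in> ext omega" "n \<in> ext (succ k)" "m \<in> ext (succ k)" by (rule omega_max[OF nm(1,3)])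
      have "opair (ap f k) c \<in> ext r"
        by (rule pos_trans[OF assms(2) dseq_in[OF fd k(1)] dseq_in[OF fd nm(1)] cd(1) dseq_mono[OF assms(2) fd k(1,2)] nm(2)])
      moreover have "opair (ap h k) d \<in> ext r"
        by (rule pos_trans[OF assms(2) dseq_in[OF hd k(1)] dseq_in[OF hd nm(3)] cd(2) dseq_mono[OF assms(2) hd k(1,3)] nm(4)])
      ultimately have "opair (ap g k) (opair c d) \<in> ext rr" unfolding gn[OF k(1)] rr using cd dseq_in[OF fd k(1)] dseq_in[OF hd k(1)] by blast
      then have "blw rr g (opair c d)" unfolding blw_def using k(1) by blast
      then have "U (fs g) (ss g)" using ZU DD(2)[OF gg] by blast
      moreover have "fs g = f" by (rule func_eqI[OF dseq_func[OF conjunct1[OF ds[OF gd]]] dseq_func[OF fd]]) (simp add: fsn gn)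
      moreover have "ss g = h" by (rule func_eqI[OF dseq_func[OF conjunct2[OF ds[OF gd]]] dseq_func[OF hd]]) (simp add: ssn gn)
      ultimately show ?thesis by simp
    qed
    show ?thesis unfolding frc2_def using DD(1) 1 2 unfolding cdf_def by blast
  qed
  from baire[OF assms(1) posP cPP ab \<open>inv PP rr W\<close>] show ?thesis
  proof
    assume "\<exists>q\<in>ext PP. opair q (opair a b) \<in> ext rr \<and> frc PP rr q W"
    then obtain c d where cd: "opair (opair c d) (opair a b) \<in> ext rr" "frc PP rr (opair c d) W" using PPe by blast
    have "frc2 P r c d V" by (rule tr[OF cd(2)]) (use cd(1) rr W in auto)
    then show ?thesis using cd(1) rr by blast
  next
    assume "frc PP rr (opair a b) (cmp PP W)"
    then have "frc2 P r a b (%f h. \<not> V f h)" by (rule tr) (use assms(4,5) W in \<open>auto simp: cmp\<close>)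
    then show ?thesis by blast
  qed
qed

lemma WO_trans: assumes "WO w X" "a \<in> ext X" "b \<in> ext X" "c \<in> ext X" "opair a b \<in> ext w" "opair b c \<in> ext w" shows "opair a c \<in> ext w"
proof -
  have s: "ext (bun (up a b) (up c c)) \<subseteq> ext X" "a \<in> ext (bun (up a b) (up c c))" using assms by auto
  obtain z where z: "z \<in> ext (bun (up a b) (up c c))" "\<And>y. y \<in> ext (bun (up a b) (up c c)) ==> opair z y \<in> ext w"
    by (rule WO_least[OF assms(1) s]) (rule that)
  have zz: "opair z a \<in> ext w" "opair z b \<in> ext w" "opair z c \<in> ext w" using z(2) by auto
  have "z = a \<or> z = b \<or> z = c" using z(1) by auto
  then show ?thesis
  proof (elim disjE)
    assume "z = a" then show ?thesis using zz by simp
  next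
    assume "z = b" then have "a = b" using zz(1) assms(5) WO_antisym[OF assms(1,2,3)] by simp
    then show ?thesis using assms(6) by simp
  next
    assume "z = c" then have "b = c" using zz(2) assms(6) WO_antisym[OF assms(1,3,4)] by simp
    then show ?thesis using assms(5) by simp
  qed
qed

text \<open>For a least counterexample, comparing the least indices \<open>i\<close> with \<open>f \<in> W i\<close> and
  \<open>j\<close> with \<open>h \<in> W j\<close> gives a subset of the product all of whose sections are meager in one
  direction and comeager in the other, against Kuratowski--Ulam.\<close>

lemma wo_additivity: assumes Det "pos P r" "ctb P" "p \<in> ext P" and wo: "WO w I" and dW: "F1 W" and iW: "\<And>i. i \<in> ext I ==> inv P r (W i)"
    and fr: "frc P r p U" and U: "\<And>f. dseq P r f ==> f \<in> ext U ==> \<exists>i\<in>ext I. f \<in> ext (W i)"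
  shows "\<exists>q\<in>ext P. \<exists>i\<in>ext I. opair q p \<in> ext r \<and> frc P r q (W i)"
proof (rule ccontr)
  assume no: "\<not> ?thesis"
  define Z where "Z = (%i. sep (funs omega P) (%f. \<exists>j\<in>ext I. opair j i \<in> ext w \<and> f \<in> ext (W j)))"
  have ZF: "F1 Z" unfolding Z_def by (intro dfi F1D[OF dW])
  have dZ: "D1 (%f. \<exists>j\<in>ext I. opair j i \<in> ext w \<and> f \<in> ext (W j))" for i by (intro dfi F1D[OF dW])
  have Z: "f \<in> ext (Z i) \<longleftrightarrow> func f omega P \<and> (\<exists>j\<in>ext I. opair j i \<in> ext w \<and> f \<in> ext (W j))" for f i
    unfolding Z_def ext_sep[OF dZ] by simp
  have iZ: "inv P r (Z i)" for i using iW dseq_func unfolding inv_def Z by blast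
  have Zm: "f \<in> ext (Z i)" if "f \<in> ext (Z j)" "opair j i \<in> ext w" "i \<in> ext I" "j \<in> ext I" for f i j
    using that WO_trans[OF wo] unfolding Z by blast
  \<comment> \<open>Passes to a condition \<open>q\<close> and an initial segment \<open>J\<close>
    such that the union over \<open>J\<close> is comeager below \<open>q\<close> but every
    \<open>Z i\<close> with \<open>i\<close> in \<open>J\<close> is meager there. If some
    \<open>Z i\<close> is comeager below a condition, the least such index \<open>i0\<close> is
    taken; \<open>W i0\<close> is meager by assumption, so the indices strictly below
    \<open>i0\<close> suffice.\<close>
  have "\<exists>q J. q \<in> ext P \<and> ext J \<subseteq> ext I \<and> (\<exists>V. frc P r q V \<and> (\<forall>f. dseq P r f \<and> f \<in> ext V --> (\<exists>i\<in>ext J. f \<in> ext (W i)))) \<and> (\<forall>i\<in>ext J. frc P r q (cmp P (Z i)))"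
  proof (cases "\<exists>i\<in>ext I. \<exists>q\<in>ext P. opair q p \<in> ext r \<and> frc P r q (Z i)")
    case False
    have "frc P r p (cmp P (Z i))" if "i \<in> ext I" for i
      using baire[OF assms(1-4) iZ[of i]] False that by blast
    then show ?thesis using assms(4) fr U by (intro exI[of _ p] exI[of _ I]) blast
  next
    case True
    let ?S = "sep I (%i. \<exists>q\<in>ext P. opair q p \<in> ext r \<and> frc P r q (Z i))"
    have dS: "D1 (%i. \<exists>q\<in>ext P. opair q p \<in> ext r \<and> frc P r q (Z i))" by (intro dfi F1D[OF ZF])
    have S: "ext ?S = {i \<in> ext I. \<exists>q\<in>ext P. opair q p \<in> ext r \<and> frc P r q (Z i)}" by (rule ext_sep[OF dS])
    obtain i1 where i1: "i1 \<in> ext ?S" unfolding S using True by blast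
    have SI: "ext ?S \<subseteq> ext I" unfolding S by blast
    obtain i0 where i0: "i0 \<in> ext ?S" "\<And>y. y \<in> ext ?S ==> opair i0 y \<in> ext w"
      by (rule WO_least[OF wo SI i1]) (rule that)
    have i0I: "i0 \<in> ext I" using i0(1) unfolding S by blast
    obtain q where q: "q \<in> ext P" "opair q p \<in> ext r" "frc P r q (Z i0)" using i0(1) unfolding S by blast
    let ?J = "sep I (%i. opair i i0 \<in> ext w \<and> i \<noteq> i0)"
    have dJ: "D1 (%i. opair i i0 \<in> ext w \<and> i \<noteq> i0)" by (intro dfi)
    have J: "ext ?J = {i \<in> ext I. opair i i0 \<in> ext w \<and> i \<noteq> i0}" by (rule ext_sep[OF dJ])
    have below: "opair x p \<in> ext r" if "x \<in> ext P" "opair x q \<in> ext r" for x by (rule pos_trans[OF assms(2) that(1) q(1) assms(4) that(2) q(2)])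
    have "frc P r q (cmp P (W i0))" using baire[OF assms(1-3) q(1) iW[OF i0I]] no i0I below by blast
    from q(3) this have 1: "frc P r q (sep (Z i0) (%f. f \<notin> ext (W i0)))"
    proof (rule frc_imp2)
      have d: "D1 (%f. f \<notin> ext (W i0))" by (intro dfi)
      show "\<And>f. f \<in> ext (Z i0) ==> f \<in> ext (cmp P (W i0)) ==> f \<in> ext (sep (Z i0) (%f. f \<notin> ext (W i0)))"
        unfolding ext_sep[OF d] cmp by blast
    qed
    have d: "D1 (%f. f \<notin> ext (W i0))" by (intro dfi)
    have 2: "\<exists>i\<in>ext ?J. f \<in> ext (W i)" if "f \<in> ext (sep (Z i0) (%f. f \<notin> ext (W i0)))" for f
      using that unfolding ext_sep[OF d] J Z by blast
    have 3: "frc P r q (cmp P (Z i))" if i: "i \<in> ext ?J" for i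
    proof -
      have iI: "i \<in> ext I" "opair i i0 \<in> ext w" "i \<noteq> i0" using i unfolding J by blast+
      have "i \<notin> ext ?S" using i0(2)[of i] WO_antisym[OF wo iI(1) i0I iI(2)] iI(3) by blast
      then have "\<not> (\<exists>x\<in>ext P. opair x p \<in> ext r \<and> frc P r x (Z i))" unfolding S using iI by blast
      then show ?thesis using baire[OF assms(1-3) q(1) iZ[of i]] below by blast
    qed
    have 4: "ext ?J \<subseteq> ext I" unfolding J by blast
    show ?thesis by (rule exI[of _ q], rule exI[of _ ?J]) (use q(1) 1 2 3 4 in blast)
  qed
  then obtain q J V where q: "q \<in> ext P" "ext J \<subseteq> ext I" "frc P r q V" "\<And>f. dseq P r f ==> f \<in> ext V ==> \<exists>i\<in>ext J. f \<in> ext (W i)"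
    "\<And>i. i \<in> ext J ==> frc P r q (cmp P (Z i))" by blast
  obtain DV where DV: "cdf P r DV" "\<And>f. gnr P r DV f ==> blw r f q ==> f \<in> ext V" using q(3) unfolding frc_def by blast
  have ZI: "f \<in> ext (Z i)" if "dseq P r f" "f \<in> ext (W i)" "i \<in> ext J" for f i
    using that dseq_func[OF that(1)] WO_refl[OF wo] q(2) unfolding Z by blast
  \<comment> \<open>For points of the union over \<open>J\<close> this says that the least index of
    \<open>f\<close> is at most that of \<open>h\<close>, expressed through the increasing sets
    \<open>Z i\<close>.\<close>
  define Vp where "Vp = (%f h. \<forall>i\<in>ext J. h \<in> ext (Z i) --> f \<in> ext (Z i))"
  have dV: "DF (%e. Vp (e 0) (e 1))" unfolding Vp_def by (intro dfi F1D[OF ZF])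
  have iV: "Vp f' h'" if h: "dseq P r f" "dseq P r f'" "dseq P r h" "dseq P r h'" "eqv r f f'" "eqv r h h'" "Vp f h" for f f' h h'
    unfolding Vp_def
  proof (intro ballI impI)
    fix i assume i: "i \<in> ext J" "h' \<in> ext (Z i)"
    have "h \<in> ext (Z i)" using iZ[of i] i(2) h(3,4) eqv_sym[OF h(6)] unfolding inv_def by blast
    then have "f \<in> ext (Z i)" using h(7) i(1) unfolding Vp_def by blast
    then show "f' \<in> ext (Z i)" using iZ[of i] h(1,2,5) unfolding inv_def by blast
  qed
  have contra: False if "x \<in> ext P" "opair x q \<in> ext r" "i \<in> ext J" "cdf P r EE" "\<And>f. gnr P r EE f ==> blw r f x ==> f \<in> ext (Z i)" for x i EE
  proof -
    have "frc P r x (Z i)" unfolding frc_def using that(4,5) by blast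
    then show False using frc_contra[OF assms(2,3) _ q(5)[OF that(3)] that(1) q(1) that(2)] by blast
  qed
  have "(\<exists>c\<in>ext P. \<exists>d\<in>ext P. opair c q \<in> ext r \<and> opair d q \<in> ext r \<and> frc2 P r c d Vp) \<or> frc2 P r q q (%f h. \<not> Vp f h)"
    by (rule baire2[where V=Vp, OF assms(1-3) q(1) q(1) dV]) (blast intro: iV)
  \<comment> \<open>Fixing \<open>h\<close> in the first case and \<open>f\<close> in the second
    traps comeagerly many values of the other coordinate in a single \<open>Z i\<close>, which is
    meager below \<open>q\<close>.\<close>
  then consider c d where "c \<in> ext P" "d \<in> ext P" "opair c q \<in> ext r" "opair d q \<in> ext r" "frc2 P r c d Vp"
    | "frc2 P r q q (%f h. \<not> Vp f h)" by blast
  then show False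
  proof cases
    case (1 c d)
    obtain h EE where h: "gnr P r DV h" "ap h empty = d" "cdf P r EE" "\<And>f. gnr P r EE f ==> blw r f c ==> Vp f h"
      by (rule kuratowski_ulam[OF assms(2,3) frc2_swap[OF 1(5)] 1(2) DV(1)]) (rule that)
    have hd: "dseq P r h" using h(1) unfolding gnr_def by blast
    have "blw r h q" unfolding blw_def using h(2) 1(4) omega0 by metis
    then obtain i where i: "i \<in> ext J" "h \<in> ext (W i)" using q(4)[OF hd DV(2)[OF h(1)]] by blast
    have hz: "h \<in> ext (Z i)" by (rule ZI[OF hd i(2,1)])
    show False by (rule contra[OF 1(1,3) i(1) h(3)]) (use h(4) hz i(1) in \<open>unfold Vp_def, blast\<close>)
  next
    case 2
    obtain f EE where f: "gnr P r DV f" "ap f empty = q" "cdf P r EE" "\<And>h. gnr P r EE h ==> blw r h q ==> \<not> Vp f h"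
      by (rule kuratowski_ulam[OF assms(2,3) 2 q(1) DV(1)]) (rule that)
    have fd: "dseq P r f" using f(1) unfolding gnr_def by blast
    have "blw r f q" unfolding blw_def using f(2) pos_refl[OF assms(2) q(1)] omega0 by metis
    then obtain i where i: "i \<in> ext J" "f \<in> ext (W i)" using q(4)[OF fd DV(2)[OF f(1)]] by blast
    have fz: "f \<in> ext (Z i)" by (rule ZI[OF fd i(2,1)])
    have "h \<in> ext (Z i)" if h: "gnr P r EE h" "blw r h q" for h
    proof -
      obtain j where j: "j \<in> ext J" "h \<in> ext (Z j)" "f \<notin> ext (Z j)" using f(4)[OF h] unfolding Vp_def by blast
      have ij: "i \<in> ext I" "j \<in> ext I" using i(1) j(1) q(2) by blast+
      have "opair i j \<notin> ext w" using Zm[OF fz _ ij(2,1)] j(3) by blast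
      then have "opair j i \<in> ext w" using WO_total[OF wo ij] by blast
      then show ?thesis using Zm[OF j(2) _ ij] by blast
    qed
    then show False by (intro contra[OF q(1) pos_refl[OF assms(2) q(1)] i(1) f(3)]) blast
  qed
qed

end

context zf_model
begin

section \<open>Cohen conditions\<close>

definition Qo :: "'a => 'a" where
  "Qo C = sep (cprod (fin_seqs C) (fin_seqs C)) (%z. ext (psnd z) \<subseteq> ext (pfst z))"
lemma F1_Qo: "F1 Qo" by (intro F1I, unfold Qo_def, intro dfi)
lemmas [dfi] = F1D[OF F1_Qo]
lemma Qo: "opair s t \<in> ext (Qo C) \<longleftrightarrow> s \<in> ext (fin_seqs C) \<and> t \<in> ext (fin_seqs C) \<and> ext t \<subseteq> ext s"
proof -
  have "D1 (%z. ext (psnd z) \<subseteq> ext (pfst z))" by (intro dfi)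
  from ext_sep[OF this] show ?thesis unfolding Qo_def by auto
qed
lemma pos_Q: "pos (fin_seqs C) (Qo C)" unfolding pos_def Qo by blast

definition gf :: "'a => 'a" where "gf f = un (img (ap f) omega)"
lemma F1_gf: "F1 gf" by (intro F1I, unfold gf_def, intro dfi)
lemmas [dfi] = F1D[OF F1_gf]
lemma gf: "z \<in> ext (gf f) \<longleftrightarrow> (\<exists>n\<in>ext omega. z \<in> ext (ap f n))"
proof -
  have "F1 (ap f)" by (intro dfi)
  then show ?thesis unfolding gf_def by (simp add: ext_img)
qed
text \<open>These dense sets make the union of a generic sequence a total function on
  \<omega>.\<close>

definition QD :: "'a => 'a" where
  "QD C = img (%n. sep (fin_seqs C) (%s. n \<in> ext (dom s))) omega"

lemma fin_extend: assumes "c \<in> ext C" "s \<in> ext (fin_seqs C)" "n \<in> ext omega"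
  shows "\<exists>t\<in>ext (fin_seqs C). ext s \<subseteq> ext t \<and> ext n \<subseteq> ext (dom t)"
proof (rule omega_induct[OF assms(3), where P="%n. \<exists>t\<in>ext (fin_seqs C). ext s \<subseteq> ext t \<and> ext n \<subseteq> ext (dom t)"])
  show "D1 (%n. \<exists>t\<in>ext (fin_seqs C). ext s \<subseteq> ext t \<and> ext n \<subseteq> ext (dom t))" by (intro dfi)
  show "\<exists>t\<in>ext (fin_seqs C). ext s \<subseteq> ext t \<and> ext empty \<subseteq> ext (dom t)" using assms(2) by auto
  fix n assume n: "n \<in> ext omega" "\<exists>t\<in>ext (fin_seqs C). ext s \<subseteq> ext t \<and> ext n \<subseteq> ext (dom t)"
  then obtain t where t: "t \<in> ext (fin_seqs C)" "ext s \<subseteq> ext t" "ext n \<subseteq> ext (dom t)" by blast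
  obtain m where m: "m \<in> ext omega" "func t m C" using t(1) unfolding ext_fin_seqs by blast
  have d: "dom t = m" by (rule func_dom[OF m(2)])
  have nm: "n \<in> ext m \<or> n = m" using ord_sub_iff[OF omega_ord[OF n(1)] omega_ord[OF m(1)]] t(3) d by simp
  show "\<exists>t\<in>ext (fin_seqs C). ext s \<subseteq> ext t \<and> ext (succ n) \<subseteq> ext (dom t)"
  proof (cases "n \<in> ext m")
    case True
    then have "ext (succ n) \<subseteq> ext (dom t)" using t(3) d by auto
    then show ?thesis using t by blast
  next
    case False
    then have "n = m" using nm by blast
    note f = snoc_func[OF m(2) assms(1)]
    have "snoc t c \<in> ext (fin_seqs C)" unfolding ext_fin_seqs using f omegaS[OF m(1)] by blast
    moreover have "ext (succ n) \<subseteq> ext (dom (snoc t c))" using func_dom[OF f] \<open>n = m\<close> by simp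
    moreover have "ext s \<subseteq> ext (snoc t c)" using t(2) snoc_sub[OF m(2) assms(1)] by (rule subset_trans)
    ultimately show ?thesis by (intro bexI conjI)
  qed
qed

lemma QD: assumes "c \<in> ext C" shows "cdf (fin_seqs C) (Qo C) (QD C)"
proof -
  have F: "F1 (%n. sep (fin_seqs C) (%s. n \<in> ext (dom s)))" by (intro dfi)
  have d: "D1 (%s. n \<in> ext (dom s))" for n by (intro dfi)
  have "dns (fin_seqs C) (Qo C) (sep (fin_seqs C) (%s. n \<in> ext (dom s)))" if n: "n \<in> ext omega" for n
    unfolding dns_def ext_sep[OF d]
  proof (intro conjI ballI)
    fix s assume s: "s \<in> ext (fin_seqs C)"
    obtain t where t: "t \<in> ext (fin_seqs C)" "ext s \<subseteq> ext t" "ext (succ n) \<subseteq> ext (dom t)"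
      using fin_extend[OF assms s omegaS[OF n]] by blast
    then show "\<exists>d\<in>{x \<in> ext (fin_seqs C). n \<in> ext (dom x)}. opair d s \<in> ext (Qo C)" unfolding Qo using s by auto
  qed blast
  then show ?thesis unfolding cdf_def QD_def ext_img[OF F] using ctb_img[OF ctb_omega F] by blast
qed

lemma gf_func: assumes "gnr (fin_seqs C) (Qo C) (QD C) f"
  shows "func (gf f) omega C"
proof -
  have fd: "dseq (fin_seqs C) (Qo C) f" using assms unfolding gnr_def by blast
  have fP: "\<And>n. n \<in> ext omega ==> ap f n \<in> ext (fin_seqs C)" by (rule dseq_in[OF fd])
  have fn: "\<exists>m\<in>ext omega. func (ap f n) m C" if "n \<in> ext omega" for n using fP[OF that] unfolding ext_fin_seqs by blast
  have sub: "ext (gf f) \<subseteq> ext (cprod omega C)"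
  proof
    fix z assume "z \<in> ext (gf f)"
    then obtain n where n: "n \<in> ext omega" "z \<in> ext (ap f n)" unfolding gf by blast
    obtain m where m: "m \<in> ext omega" "func (ap f n) m C" using fn[OF n(1)] by blast
    then have "z \<in> ext (cprod m C)" using n(2) unfolding func_def by blast
    then show "z \<in> ext (cprod omega C)" using omega_trans[OF m(1)] by auto
  qed
  have ex: "\<exists>y. opair i y \<in> ext (gf f)" if i: "i \<in> ext omega" for i
  proof -
    have F: "F1 (%n. sep (fin_seqs C) (%s. n \<in> ext (dom s)))" by (intro dfi)
    have d: "D1 (%s. i \<in> ext (dom s))" by (intro dfi)
    have "sep (fin_seqs C) (%s. i \<in> ext (dom s)) \<in> ext (QD C)" unfolding QD_def ext_img[OF F] using i by (rule imageI)
    then have "mts (Qo C) f (sep (fin_seqs C) (%s. i \<in> ext (dom s)))" using assms unfolding gnr_def by blast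
    then obtain n s where n: "n \<in> ext omega" "s \<in> ext (fin_seqs C)" "i \<in> ext (dom s)" "opair (ap f n) s \<in> ext (Qo C)" unfolding mts_def ext_sep[OF d] by blast
    obtain m where m: "m \<in> ext omega" "func s m C" using n(2) unfolding ext_fin_seqs by blast
    have "i \<in> ext m" using n(3) func_dom[OF m(2)] by simp
    then have "opair i (ap s i) \<in> ext s" by (rule func_ap_mem[OF m(2)])
    then have "opair i (ap s i) \<in> ext (ap f n)" using n(4) unfolding Qo by blast
    then show ?thesis unfolding gf using n(1) by blast
  qed
  have uq: "y = y'" if h: "opair i y \<in> ext (gf f)" "opair i y' \<in> ext (gf f)" for i y y'
  proof -
    obtain n where n: "n \<in> ext omega" "opair i y \<in> ext (ap f n)" using h(1) unfolding gf by blast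
    obtain m where m: "m \<in> ext omega" "opair i y' \<in> ext (ap f m)" using h(2) unfolding gf by blast
    obtain k where k: "k \<in> ext omega" "n \<in> ext (succ k)" "m \<in> ext (succ k)" by (rule omega_max[OF n(1) m(1)])
    have "opair i y \<in> ext (ap f k)" using dseq_mono[OF pos_Q fd k(1,2)] n(2) unfolding Qo by blast
    moreover have "opair i y' \<in> ext (ap f k)" using dseq_mono[OF pos_Q fd k(1,3)] m(2) unfolding Qo by blast
    moreover obtain j where j: "func (ap f k) j C" using fn[OF k(1)] by blast
    ultimately show ?thesis unfolding func_opair_iff[OF j] by simp
  qed
  show ?thesis unfolding func_def using sub ex uq by blast
qed

lemma gf_ap: assumes "func (gf f) omega C" "n \<in> ext omega" "func (ap f n) m C" "i \<in> ext m"
  shows "ap (gf f) i = ap (ap f n) i"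
proof -
  have "opair i (ap (ap f n) i) \<in> ext (gf f)" unfolding gf using func_ap_mem[OF assms(3,4)] assms(2) by blast
  then show ?thesis unfolding func_opair_iff[OF assms(1)] by simp
qed

text \<open>Makes conditions on the generic function invariant, as required for the property of
  Baire and for additivity.\<close>

lemma gf_eqv: assumes "eqv (Qo C) f g" shows "gf f = gf g"
proof (rule ext_inject, rule set_eqI)
  fix z
  show "z \<in> ext (gf f) \<longleftrightarrow> z \<in> ext (gf g)"
  proof
    assume "z \<in> ext (gf f)"
    then obtain n where n: "n \<in> ext omega" "z \<in> ext (ap f n)" unfolding gf by blast
    obtain m where "m \<in> ext omega" "opair (ap g m) (ap f n) \<in> ext (Qo C)" using assms n(1) unfolding eqv_def by blast
    then show "z \<in> ext (gf g)" unfolding gf Qo using n(2) by blast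
  next
    assume "z \<in> ext (gf g)"
    then obtain n where n: "n \<in> ext omega" "z \<in> ext (ap g n)" unfolding gf by blast
    obtain m where "m \<in> ext omega" "opair (ap f m) (ap g n) \<in> ext (Qo C)" using assms n(1) unfolding eqv_def by blast
    then show "z \<in> ext (gf f)" unfolding gf Qo using n(2) by blast
  qed
qed

section \<open>Well-orderable sets of reals are countable\<close>

definition dbl :: "'a => 'a" where "dbl k = addn k k"
lemma DT_dbl[dfi]: assumes "DT t" shows "DT (%e. dbl (t e))" unfolding dbl_def by (intro dfi assms)
lemma dbl_in[simp]: "k \<in> ext omega ==> dbl k \<in> ext omega" unfolding dbl_def by simp
lemma dbl_0[simp]: "dbl empty = empty" unfolding dbl_def by simp
lemma dbl_S: "k \<in> ext omega ==> dbl (succ k) = succ (succ (dbl k))" unfolding dbl_def by simp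
lemma par_dbl: assumes "k \<in> ext omega" shows "par (dbl k) = empty"
  by (rule omega_induct[OF assms, where P="%k. par (dbl k) = empty"]) (intro dfi, auto simp: dbl_S par_S)
lemma par_dblS: "k \<in> ext omega ==> par (succ (dbl k)) \<noteq> empty" by (simp add: par_S par_dbl)
lemma dbl_cases: assumes "n \<in> ext omega" shows "\<exists>k\<in>ext omega. n = dbl k \<or> n = succ (dbl k)"
proof (rule omega_induct[OF assms, where P="%n. \<exists>k\<in>ext omega. n = dbl k \<or> n = succ (dbl k)"])
  show "D1 (%n. \<exists>k\<in>ext omega. n = dbl k \<or> n = succ (dbl k))" by (intro dfi)
  show "\<exists>k\<in>ext omega. empty = dbl k \<or> empty = succ (dbl k)" by (rule bexI[OF _ omega0]) simp
  fix n assume "n \<in> ext omega" "\<exists>k\<in>ext omega. n = dbl k \<or> n = succ (dbl k)"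
  then obtain k where k: "k \<in> ext omega" "n = dbl k \<or> n = succ (dbl k)" by blast
  then show "\<exists>k\<in>ext omega. succ n = dbl k \<or> succ n = succ (dbl k)" using dbl_S[OF k(1)] omegaS[OF k(1)] by metis
qed
lemma dbl_mono: assumes "j \<in> ext omega" "k \<in> ext j" shows "dbl k \<in> ext (dbl j)"
proof -
  have "\<forall>k\<in>ext j. dbl k \<in> ext (dbl j)"
    by (rule omega_induct[OF assms(1), where P="%j. \<forall>k\<in>ext j. dbl k \<in> ext (dbl j)"]) (intro dfi, auto simp: dbl_S)
  then show ?thesis using assms(2) by blast
qed
lemma dbl_inj: assumes "k \<in> ext omega" "j \<in> ext omega" "dbl k = dbl j" shows "k = j"
  using omega_le_cases[OF assms(1,2)] dbl_mono[OF assms(2), of k] dbl_mono[OF assms(1), of j] assms(3) by auto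
lemma dbl_ne: "k \<in> ext omega ==> j \<in> ext omega ==> dbl k \<noteq> succ (dbl j)"
  using par_dbl[of k] par_dblS[of j] by auto

definition hf :: "'a => 'a" where "hf n = lst (%k. n = dbl k \<or> n = succ (dbl k))"
lemma F1_hf: "F1 hf" by (intro F1I, unfold hf_def, intro dfi)
lemmas [dfi] = F1D[OF F1_hf]
lemma hf: assumes "k \<in> ext omega" shows "hf (dbl k) = k" "hf (succ (dbl k)) = k"
proof -
  have d: "D1 (%k. n = dbl k \<or> n = succ (dbl k))" for n by (intro dfi)
  have *: "hf n \<in> ext omega \<and> (n = dbl (hf n) \<or> n = succ (dbl (hf n)))" if "n = dbl k \<or> n = succ (dbl k)" for n
    unfolding hf_def using lst(1,2)[OF d, OF assms that] by (rule conjI)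
  have "dbl k = dbl (hf (dbl k))" "hf (dbl k) \<in> ext omega" using *[of "dbl k"] dbl_ne[OF assms, of "hf (dbl k)"] by auto
  then show "hf (dbl k) = k" by (rule dbl_inj[OF assms, symmetric, rotated])
  have "dbl k = dbl (hf (succ (dbl k)))" "hf (succ (dbl k)) \<in> ext omega"
    using *[of "succ (dbl k)"] dbl_ne[OF _ assms, of "hf (succ (dbl k))"] by auto
  then show "hf (succ (dbl k)) = k" by (rule dbl_inj[OF assms, symmetric, rotated])
qed
lemma hf_in: assumes "n \<in> ext omega" shows "hf n \<in> ext omega"
  using dbl_cases[OF assms] hf by metis

definition dig :: "'a => 'a" where "dig y = lam omega (%k. ap y (dbl k))"
lemma F1_dig: "F1 dig" by (intro F1I, unfold dig_def, intro dfi)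
lemmas [dfi] = F1D[OF F1_dig]
lemma dig: "func y omega omega ==> func (dig y) omega omega" "k \<in> ext omega ==> ap (dig y) k = ap y (dbl k)"
proof -
  have F: "F1 (%k. ap y (dbl k))" by (intro dfi)
  show "func y omega omega ==> func (dig y) omega omega" unfolding dig_def by (rule lam_func[OF F]) (simp add: func_ap_in)
  show "k \<in> ext omega ==> ap (dig y) k = ap y (dbl k)" unfolding dig_def by (rule ap_lam[OF F])
qed

text \<open>Player I follows \<open>\<sigma>\<close>, player II plays the odd entries of
  \<open>z\<close>, and the even entries of \<open>z\<close> are ignored. Indexing \<open>z\<close>
  by stages makes the play below \<open>m\<close> depend on \<open>z\<close> below \<open>m\<close>
  only.\<close>

definition isR :: "'a => 'a => 'a => bool" where
  "isR \<sigma> z y \<longleftrightarrow> func y omega omega \<and> (\<forall>n\<in>ext omega. ap y n = (if par n = empty then ap \<sigma> (restr y n) else ap z n))"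
lemma DF_isR[dfi]: assumes "DT t" "DT u" "DT v" shows "DF (%e. isR (t e) (u e) (v e))"
  by (rule DF3[where P=isR, OF _ assms]) (unfold isR_def, intro dfi)

lemma isR_ex: assumes "func \<sigma> (fin_seqs omega) omega" "func z omega omega" shows "\<exists>y. isR \<sigma> z y"
proof -
  let ?h = "%s. if par (dom s) = empty then ap \<sigma> s else ap z (dom s)"
  have F: "F1 ?h" by (intro dfi)
  have i: "?h s \<in> ext omega" if "s \<in> ext (fin_seqs omega)" for s
  proof -
    obtain n where n: "n \<in> ext omega" "func s n omega" using \<open>s \<in> _\<close> unfolding ext_fin_seqs by blast
    then show ?thesis using func_ap_in[OF assms(1) that] func_ap_in[OF assms(2) n(1)] func_dom[OF n(2)] by simp
  qed
  obtain y where y: "func y omega omega" "\<And>n. n \<in> ext omega ==> ap y n = ?h (restr y n)"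
    by (rule cov[OF F i], assumption) (rule that)
  have "isR \<sigma> z y" unfolding isR_def using y func_dom[OF restr_fin(1)[OF y(1)]] by simp
  then show ?thesis by blast
qed

lemma isR_agree: assumes "isR \<sigma> z y" "isR \<sigma> z' y'" "m \<in> ext omega" "\<And>i. i \<in> ext m ==> ap z i = ap z' i" "i \<in> ext m"
  shows "ap y i = ap y' i"
proof -
  have d: "D1 (%i. i \<in> ext m --> ap y i = ap y' i)" by (intro dfi)
  have "i \<in> ext m --> ap y i = ap y' i"
  proof (rule ord_induct[OF ord_mem[OF omega_ord[OF assms(3)] assms(5)] d])
    fix b assume b: "\<And>c. c \<in> ext b ==> c \<in> ext m --> ap y c = ap y' c"
    show "b \<in> ext m --> ap y b = ap y' b"
    proof
      assume bm: "b \<in> ext m"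
      have bo: "b \<in> ext omega" by (rule omega_trans[OF assms(3) bm])
      have f: "func y omega omega" "func y' omega omega" using assms(1,2) unfolding isR_def by blast+
      have "restr y b = restr y' b"
        by (rule func_eqI[OF restr_fin(1)[OF f(1) bo] restr_fin(1)[OF f(2) bo]])
          (use b ord_trans[OF omega_ord[OF assms(3)] bm] in \<open>auto simp: restr_ap\<close>)
      then show "ap y b = ap y' b" using assms(1,2) bo assms(4)[OF bm] unfolding isR_def by simp
    qed
  qed
  then show ?thesis using assms(5) by blast
qed

definition isE :: "'a => 'a => 'a => bool" where
  "isE \<tau> x y \<longleftrightarrow> func y omega omega \<and> (\<forall>n\<in>ext omega. ap y n = (if par n = empty then ap x (hf n) else ap \<tau> (restr y n)))"
lemma DF_isE[dfi]: assumes "DT t" "DT u" "DT v" shows "DF (%e. isE (t e) (u e) (v e))"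
  by (rule DF3[where P=isE, OF _ assms]) (unfold isE_def, intro dfi)
lemma isE_ex: assumes "func \<sigma> (fin_seqs omega) omega" "func z omega omega" shows "\<exists>y. isE \<sigma> z y"
proof -
  let ?h = "%s. if par (dom s) = empty then ap z (hf (dom s)) else ap \<sigma> s"
  have F: "F1 ?h" by (intro dfi)
  have i: "?h s \<in> ext omega" if "s \<in> ext (fin_seqs omega)" for s
  proof -
    obtain n where n: "n \<in> ext omega" "func s n omega" using \<open>s \<in> _\<close> unfolding ext_fin_seqs by blast
    then show ?thesis using func_ap_in[OF assms(1) that] func_ap_in[OF assms(2) hf_in[OF n(1)]] func_dom[OF n(2)] by simp
  qed
  obtain y where y: "func y omega omega" "\<And>n. n \<in> ext omega ==> ap y n = ?h (restr y n)"
    by (rule cov[OF F i], assumption) (rule that)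
  have "isE \<sigma> z y" unfolding isE_def using y func_dom[OF restr_fin(1)[OF y(1)]] by simp
  then show ?thesis by blast
qed

text \<open>Player I produces a real digit by digit and player II tries to guess the next digit; player I
  wins if the real is in \<open>X\<close> and infinitely many guesses were wrong. Against a strategy of player
  II every real in \<open>X\<close> is determined by a finite initial segment. A strategy of player I is refuted
  by additivity: for some real \<open>x\<close> non-meager many guesses of player II would lead to \<open>x\<close>.\<close>

lemma wo_reals_ctb: assumes Det and wo: "WO w X" and XR: "ext X \<subseteq> ext reals" and x0: "x0 \<in> ext X"
  shows "ctb X"
proof -
  \<comment> \<open>Digits are played at even stages, and the move at stage \<open>2 * j + 1\<close>
    guesses digit \<open>j + 1\<close>, which comes next. The condition
    \<open>k \<in> ext (succ j)\<close> means that \<open>j\<close> is at least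
    \<open>k\<close>.\<close>
  let ?A = "%y. dig y \<in> ext X \<and> (\<forall>k\<in>ext omega. \<exists>j\<in>ext omega. k \<in> ext (succ j) \<and> ap (dig y) (succ j) \<noteq> ap y (succ (dbl j)))"
  have dA: "D1 ?A" by (intro dfi)
  have A: "ext (sep reals ?A) = {y \<in> ext reals. ?A y}" by (rule ext_sep[OF dA])
  have "ext (sep reals ?A) \<subseteq> ext reals" unfolding A by blast
  from det_cases[OF assms(1) this] show ?thesis
  proof (elim disjE exE conjE)
    fix \<sigma> assume \<sigma>: "func \<sigma> (fin_seqs omega) omega"
      "\<forall>f. func f omega omega \<and> (\<forall>n\<in>ext omega. par n = empty --> ap f n = ap \<sigma> (restr f n)) --> f \<in> ext (sep reals ?A)"
    have win: "?A y" if "isR \<sigma> z y" for y z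
    proof -
      have "func y omega omega" "\<forall>n\<in>ext omega. par n = empty --> ap y n = ap \<sigma> (restr y n)" using that unfolding isR_def by auto
      then have "y \<in> ext (sep reals ?A)" using \<sigma>(2) by blast
      then show ?thesis unfolding A by blast
    qed
    let ?Q = "fin_seqs omega" and ?r = "Qo omega"
    define W where "W = (%x. sep (funs omega ?Q) (%f. \<exists>y. isR \<sigma> (gf f) y \<and> dig y = x))"
    have WF: "F1 W" unfolding W_def by (intro dfi)
    have dW: "D1 (%f. \<exists>y. isR \<sigma> (gf f) y \<and> dig y = x)" for x by (intro dfi)
    have W: "f \<in> ext (W x) \<longleftrightarrow> func f omega ?Q \<and> (\<exists>y. isR \<sigma> (gf f) y \<and> dig y = x)" for f x unfolding W_def ext_sep[OF dW] by simp
    have iW: "inv ?Q ?r (W x)" for x unfolding inv_def W using gf_eqv dseq_func by metis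
    define U where "U = sep (funs omega ?Q) (%f. func (gf f) omega omega)"
    have dU: "D1 (%f. func (gf f) omega omega)" by (intro dfi)
    have U: "f \<in> ext U \<longleftrightarrow> func f omega ?Q \<and> func (gf f) omega omega" for f unfolding U_def ext_sep[OF dU] by simp
    have emp: "empty \<in> ext ?Q" unfolding ext_fin_seqs using func_empty omega0 by blast
    have "frc ?Q ?r empty U" unfolding frc_def using QD[OF omega0] gf_func U dseq_func unfolding gnr_def by blast
    moreover have "\<exists>x\<in>ext X. f \<in> ext (W x)" if "dseq ?Q ?r f" "f \<in> ext U" for f
    proof -
      obtain y where y: "isR \<sigma> (gf f) y" using isR_ex[OF \<sigma>(1)] \<open>f \<in> ext U\<close> unfolding U by blast
      have "dig y \<in> ext X" using win[OF y] by blast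
      moreover have "f \<in> ext (W (dig y))" unfolding W using y dseq_func[OF that(1)] by blast
      ultimately show ?thesis by blast
    qed
    ultimately obtain s x where s: "s \<in> ext ?Q" "x \<in> ext X" "frc ?Q ?r s (W x)"
      using wo_additivity[OF assms(1) pos_Q ctb_fin_seqs[OF ctb_omega] emp wo WF iW] by blast
    obtain n0 where n0: "n0 \<in> ext omega" "func s n0 omega" using s(1) unfolding ext_fin_seqs by blast
    have xf: "func x omega omega" using s(2) XR ext_reals by blast
    \<comment> \<open>From place \<open>n0\<close> on, every guess in \<open>z\<close> is the next
      digit of \<open>x\<close>. Once the outcome against \<open>z\<close> is shown to be
      \<open>x\<close>, only finitely many guesses are wrong, although \<open>\<sigma>\<close>
      wins.\<close>
    let ?z = "%i. if i \<in> ext n0 then ap s i else if par i = empty then empty else ap x (succ (hf i))"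
    have zF: "F1 ?z" by (intro dfi)
    define z where "z = lam omega ?z"
    have zi: "?z i \<in> ext omega" if "i \<in> ext omega" for i
      using func_ap_in[OF n0(2), of i] func_ap_in[OF xf omegaS[OF hf_in[OF that]]] by simp
    have zf: "func z omega omega" unfolding z_def by (rule lam_func[OF zF zi])
    have zn: "ap z i = ?z i" if "i \<in> ext omega" for i unfolding z_def by (rule ap_lam[OF zF that])
    obtain y where y: "isR \<sigma> z y" using isR_ex[OF \<sigma>(1) zf] by blast
    have yf: "func y omega omega" using y unfolding isR_def by blast
    \<comment> \<open>\<open>z\<close> itself need not be generic. Each digit depends on a finite
      part of \<open>z\<close>, which extends \<open>s\<close>, and a generic sequence through this
      part leads to \<open>x\<close>.\<close>
    have "dig y = x"
    proof (rule func_eqI[OF dig(1)[OF yf] xf])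
      fix k assume k: "k \<in> ext omega"
      obtain kk where kk: "kk \<in> ext omega" "n0 \<in> ext (succ kk)" "dbl k \<in> ext (succ kk)" by (rule omega_max[OF n0(1) dbl_in[OF k]])
      let ?m = "succ kk"
      have mo: "?m \<in> ext omega" by (rule omegaS[OF kk(1)])
      have n0m: "ext n0 \<subseteq> ext ?m" using ord_sub[OF omega_ord[OF mo] kk(2)] .
      let ?t = "restr z ?m"
      have tf: "func ?t ?m omega" and tQ: "?t \<in> ext ?Q" using restr_fin[OF zf mo] by blast+
      have "opair i (ap s i) \<in> ext ?t" if i: "i \<in> ext n0" for i
      proof -
        have im: "i \<in> ext ?m" using i n0m by blast
        have "ap ?t i = ap s i" unfolding restr_ap[OF im] zn[OF omega_trans[OF mo im]] using i by simp
        then show ?thesis using func_ap_mem[OF tf im] by simp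
      qed
      then have "ext s \<subseteq> ext ?t" unfolding func_ext_eq[OF n0(2)] by blast
      then have ts: "opair ?t s \<in> ext ?r" unfolding Qo using tQ s(1) by blast
      have f0: "frc ?Q ?r ?t (W x)" by (rule frc_mono[OF pos_Q tQ s(1) ts s(3)])
      obtain f where f: "gnr ?Q ?r (QD omega) f" "ap f empty = ?t" "f \<in> ext (W x)"
        by (rule frc_gen[OF pos_Q ctb_fin_seqs[OF ctb_omega] f0 f0 QD[OF omega0] tQ tQ tQ pos_refl[OF pos_Q tQ] pos_refl[OF pos_Q tQ]]) (rule that)
      obtain y' where y': "isR \<sigma> (gf f) y'" "dig y' = x" using f(3) unfolding W by blast
      have "ap (gf f) i = ap z i" if i: "i \<in> ext ?m" for i
        using gf_ap[OF gf_func[OF f(1)] omega0, of ?m i] f(2) tf i restr_ap[OF i] by simp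
      then have "ap y' (dbl k) = ap y (dbl k)" by (rule isR_agree[OF y'(1) y mo _ kk(3)])
      then show "ap (dig y) k = ap x k" using dig(2)[OF k, of y] dig(2)[OF k, of y'] y'(2) by simp
    qed
    moreover obtain j where j: "j \<in> ext omega" "n0 \<in> ext (succ j)" "ap (dig y) (succ j) \<noteq> ap y (succ (dbl j))"
      using win[OF y] n0(1) by blast
    have jd: "succ (dbl j) \<in> ext omega" "par (succ (dbl j)) \<noteq> empty" using par_dblS[OF j(1)] dbl_in[OF j(1)] by auto
    have jj: "ext j \<subseteq> ext (dbl j)" unfolding dbl_def by (rule addn_ge[OF j(1)])
    have "succ (dbl j) \<notin> ext n0"
    proof
      assume "succ (dbl j) \<in> ext n0"
      then have a: "dbl j \<in> ext n0" using ord_trans[OF omega_ord[OF n0(1)]] by auto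
      have "n0 = j \<or> n0 \<in> ext j" using j(2) by auto
      then show False
      proof
        assume "n0 = j" then show False using a jj mem_irrefl by blast
      next
        assume "n0 \<in> ext j" then show False using a jj mem_asym by blast
      qed
    qed
    then have "ap y (succ (dbl j)) = ap x (succ j)"
      using y jd zn[OF jd(1)] hf(2)[OF j(1)] unfolding isR_def by simp
    ultimately show ?thesis using j(3) by simp
  next
    fix \<tau> assume \<tau>: "func \<tau> (fin_seqs omega) omega"
      "\<forall>f. func f omega omega \<and> (\<forall>n\<in>ext omega. par n \<noteq> empty --> ap f n = ap \<tau> (restr f n)) --> f \<notin> ext (sep reals ?A)"
    let ?g = "%x k. \<exists>y. isE \<tau> x y \<and> (\<forall>j\<in>ext omega. k \<in> ext (succ j) --> ap x (succ j) = ap y (succ (dbl j)))"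
    have dg: "D1 (?g x)" for x by (intro dfi)
    have xf: "func x omega omega" if "x \<in> ext X" for x using that XR ext_reals by blast
    have yx: "ap y (dbl k) = ap x k" if "isE \<tau> x y" "k \<in> ext omega" for x y k
      using that hf(1)[OF that(2)] par_dbl[OF that(2)] dbl_in[OF that(2)] unfolding isE_def by simp
    have ex: "\<exists>k\<in>ext omega. ?g x k" if x: "x \<in> ext X" for x
    proof -
      obtain y where y: "isE \<tau> x y" using isE_ex[OF \<tau>(1) xf[OF x]] by blast
      have yf: "func y omega omega" using y unfolding isE_def by blast
      have "dig y = x" by (rule func_eqI[OF dig(1)[OF yf] xf[OF x]]) (simp add: dig(2) yx[OF y])
      moreover have "\<forall>n\<in>ext omega. par n \<noteq> empty --> ap y n = ap \<tau> (restr y n)" using y unfolding isE_def by simp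
      then have "y \<notin> ext (sep reals ?A)" using \<tau>(2) yf by blast
      ultimately have "\<exists>k\<in>ext omega. \<forall>j\<in>ext omega. k \<in> ext (succ j) --> ap x (succ j) = ap y (succ (dbl j))"
        unfolding A using yf ext_reals x by blast
      then show ?thesis using y by blast
    qed
    define kx where "kx = (%x. lst (?g x))"
    have kF: "F1 kx" unfolding kx_def by (intro dfi)
    have kx: "kx x \<in> ext omega" "?g x (kx x)" if x: "x \<in> ext X" for x
    proof -
      obtain k where k: "k \<in> ext omega" "?g x k" using ex[OF x] by (rule bexE)
      show "kx x \<in> ext omega" "?g x (kx x)" unfolding kx_def by (rule lst[OF dg, OF k])+
    qed
    \<comment> \<open>The length of the initial segment reveals \<open>kx x\<close>, and from there
      on the correct guesses of \<open>\<tau>\<close> continue the segment to the whole of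
      \<open>x\<close>.\<close>
    show ?thesis
    proof (rule ctb_of_inj[where F="%x. restr x (succ (kx x))", OF _ ctb_fin_seqs[OF ctb_omega] x0])
      show "F1 (%x. restr x (succ (kx x)))" by (intro dfi F1D[OF kF])
      show "\<And>x. x \<in> ext X ==> restr x (succ (kx x)) \<in> ext (fin_seqs omega)" using restr_fin(2)[OF xf] kx(1) omegaS by blast
      fix x x' assume x: "x \<in> ext X" and x': "x' \<in> ext X" and eq: "restr x (succ (kx x)) = restr x' (succ (kx x'))"
      have "succ (kx x) = succ (kx x')"
        using func_dom[OF restr_fin(1)[OF xf[OF x] omegaS[OF kx(1)[OF x]]]] func_dom[OF restr_fin(1)[OF xf[OF x'] omegaS[OF kx(1)[OF x']]]] eq by simp
      then have ke: "kx x' = kx x" by simp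
      have ini: "ap x i = ap x' i" if "i \<in> ext (succ (kx x))" for i
        using restr_ap[OF that, of x] restr_ap[OF that, of x'] eq ke by simp
      obtain y where y: "isE \<tau> x y" "\<And>j. j \<in> ext omega ==> kx x \<in> ext (succ j) ==> ap x (succ j) = ap y (succ (dbl j))" using kx(2)[OF x] by blast
      obtain y' where y': "isE \<tau> x' y'" "\<And>j. j \<in> ext omega ==> kx x \<in> ext (succ j) ==> ap x' (succ j) = ap y' (succ (dbl j))" using kx(2)[OF x'] unfolding ke by blast
      have f: "func y omega omega" "func y' omega omega" using y(1) y'(1) unfolding isE_def by blast+
      have d: "D1 (%n. n \<in> ext omega --> ap y n = ap y' n)" by (intro dfi)
      have yy: "n \<in> ext omega --> ap y n = ap y' n" if "ordinal n" for n
      proof (rule ord_induct[OF that d])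
        fix b assume b: "\<And>c. c \<in> ext b ==> c \<in> ext omega --> ap y c = ap y' c"
        show "b \<in> ext omega --> ap y b = ap y' b"
        proof
          assume bo: "b \<in> ext omega"
          show "ap y b = ap y' b"
          proof (cases "par b = empty")
            case False
            have "restr y b = restr y' b"
              by (rule func_eqI[OF restr_fin(1)[OF f(1) bo] restr_fin(1)[OF f(2) bo]])
                (use b omega_trans[OF bo] in \<open>auto simp: restr_ap\<close>)
            then show ?thesis using y(1) y'(1) bo False unfolding isE_def by simp
          next
            case True
            obtain i where i: "i \<in> ext omega" "b = dbl i" using dbl_cases[OF bo] par_dblS True by metis
            have "ap x i = ap x' i"
            proof (cases "i \<in> ext (succ (kx x))")
              case False
              then have ki: "kx x \<in> ext i" using omega_le_cases[OF i(1) kx(1)[OF x]] by auto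
              then have ne: "i \<noteq> empty" by auto
              have "\<exists>j\<in>ext omega. i = succ j" by (rule omega_cases[OF i(1)]) (use ne in blast)+
              then obtain j where j: "j \<in> ext omega" "i = succ j" by blast
              have "succ (dbl j) \<in> ext b" unfolding i(2) j(2) dbl_S[OF j(1)] by simp
              then have "ap y (succ (dbl j)) = ap y' (succ (dbl j))" using b omegaS[OF dbl_in[OF j(1)]] by blast
              then show ?thesis using y(2)[OF j(1)] y'(2)[OF j(1)] ki unfolding j(2) by simp
            qed (rule ini)
            then show ?thesis unfolding i(2) yx[OF y(1) i(1)] yx[OF y'(1) i(1)] .
          qed
        qed
      qed
      show "x = x'"
        by (rule func_eqI[OF xf[OF x] xf[OF x']]) (use yy omega_ord yx[OF y(1)] yx[OF y'(1)] dbl_in in metis)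
    qed
  qed
qed

end

context zf_model
begin

section \<open>Determinacy of games on the natural numbers\<close>

lemma surjection_ap: "surjection f a b \<longleftrightarrow> func f a b \<and> (\<forall>y\<in>ext b. \<exists>x\<in>ext a. ap f x = y)"
proof (cases "func f a b")
  case True
  have "app f ` ext a = ap f ` ext a" by (rule image_cong) (auto simp: func_app[OF True])
  moreover have "ap f ` ext a \<subseteq> ext b" using func_ap_in[OF True] by blast
  moreover have "ext b \<subseteq> ap f ` ext a \<longleftrightarrow> (\<forall>y\<in>ext b. \<exists>x\<in>ext a. ap f x = y)" by (auto simp: subset_iff image_iff eq_commute)
  ultimately have "app f ` ext a = ext b \<longleftrightarrow> (\<forall>y\<in>ext b. \<exists>x\<in>ext a. ap f x = y)" by auto
  then show ?thesis unfolding surjection_def using True by simp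
qed (simp add: surjection_def)
lemma DF_surjection[dfi]: assumes "DT t" "DT u" "DT v" shows "DF (%e. surjection (t e) (u e) (v e))"
  by (rule DF3[where P=surjection, OF _ assms]) (unfold surjection_ap, intro dfi)

text \<open>The relation that \<open>f\<close> induces on \<open>D\<close> determines the values of
  \<open>f\<close> by induction, and the ordinal is the set of these values.\<close>

lemma surjection_order_unique:
  assumes f: "surjection f D a" and g: "surjection g D b" and o: "ordinal a" "ordinal b"
    and r: "\<And>x y. x \<in> ext D ==> y \<in> ext D ==> ap f x \<in> ext (ap f y) \<longleftrightarrow> ap g x \<in> ext (ap g y)"
  shows "a = b"
proof -
  have ff: "func f D a" "\<And>y. y \<in> ext a ==> \<exists>x\<in>ext D. ap f x = y" using f unfolding surjection_ap by blast+
  have gf: "func g D b" "\<And>y. y \<in> ext b ==> \<exists>x\<in>ext D. ap g x = y" using g unfolding surjection_ap by blast+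
  have eq: "ap f x = ap g x" if x: "x \<in> ext D" for x
  proof -
    have d: "D1 (%c. \<forall>x\<in>ext D. ap f x = c --> ap g x = c)" by (intro dfi)
    have "\<forall>z\<in>ext D. ap f z = ap f x --> ap g z = ap f x"
    proof (rule ord_induct[OF ord_mem[OF o(1) func_ap_in[OF ff(1) x]] d], intro ballI impI)
      fix c z assume IH: "\<And>d. d \<in> ext c ==> \<forall>x\<in>ext D. ap f x = d --> ap g x = d" and z: "z \<in> ext D" "ap f z = c"
      show "ap g z = c"
      proof (rule ext_inject, rule set_eqI)
        fix d
        show "d \<in> ext (ap g z) \<longleftrightarrow> d \<in> ext c"
        proof
          assume h: "d \<in> ext (ap g z)"
          obtain y where y: "y \<in> ext D" "ap g y = d" using gf(2) ord_trans[OF o(2) func_ap_in[OF gf(1) z(1)] h] by blast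
          have "ap f y \<in> ext c" using r[OF y(1) z(1)] h y(2) z(2) by simp
          moreover from this have "ap g y = ap f y" using IH y(1) by blast
          ultimately show "d \<in> ext c" using y(2) by simp
        next
          assume h: "d \<in> ext c"
          have "d \<in> ext a" using ord_trans[OF o(1) func_ap_in[OF ff(1) z(1)]] h z(2) by simp
          then obtain y where y: "y \<in> ext D" "ap f y = d" using ff(2) by blast
          have "ap g y = d" using IH[OF h] y by blast
          then show "d \<in> ext (ap g z)" using r[OF y(1) z(1)] h y(2) z(2) by simp
        qed
      qed
    qed
    then show ?thesis using x by simp
  qed
  show ?thesis
  proof (rule ext_inject, rule set_eqI)
    fix d
    show "d \<in> ext a \<longleftrightarrow> d \<in> ext b"
    proof
      assume "d \<in> ext a"
      then obtain x where x: "x \<in> ext D" "ap f x = d" using ff(2) by blast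
      then show "d \<in> ext b" using func_ap_in[OF gf(1) x(1)] eq[OF x(1)] by simp
    next
      assume "d \<in> ext b"
      then obtain x where x: "x \<in> ext D" "ap g x = d" using gf(2) by blast
      then show "d \<in> ext a" using func_ap_in[OF ff(1) x(1)] eq[OF x(1)] by simp
    qed
  qed
qed

text \<open>Hartogs' argument for surjections: an ordinal onto which \<open>D\<close> maps is
  recovered from a binary relation on \<open>D\<close>, so replacement on the set of these relations
  would collect all nonzero ordinals.\<close>

lemma surjection_bound: "\<exists>a. ordinal a \<and> a \<noteq> empty \<and> \<not> (\<exists>f. surjection f D a)"
proof (rule ccontr)
  assume "\<not> ?thesis"
  then have n: "\<exists>f. surjection f D a" if "ordinal a" "a \<noteq> empty" for a using that by blast
  let ?R = "%f. sep (cprod D D) (%p. ap f (pfst p) \<in> ext (ap f (psnd p)))"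
  have dR: "D1 (%p. ap f (pfst p) \<in> ext (ap f (psnd p)))" for f by (intro dfi)
  let ?F = "%r. dsc (%a. ordinal a \<and> (\<exists>f. surjection f D a \<and> r = ?R f))"
  let ?A = "sep (img ?F (pow (cprod D D))) ordinal"
  have FF: "F1 ?F" by (intro dfi)
  have dO: "D1 ordinal" by (intro dfi)
  have m: "a \<in> ext ?A" if a: "ordinal a" "a \<noteq> empty" for a
  proof -
    obtain f where f: "surjection f D a" using n[OF a] by blast
    have "?F (?R f) = a"
    proof (rule dsc_eq)
      show "ordinal a \<and> (\<exists>g. surjection g D a \<and> ?R f = ?R g)" using f a by blast
      fix b assume "ordinal b \<and> (\<exists>g. surjection g D b \<and> ?R f = ?R g)"
      then obtain g where g: "ordinal b" "surjection g D b" "?R f = ?R g" by blast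
      have *: "ap h x \<in> ext (ap h y) \<longleftrightarrow> opair x y \<in> ext (?R h)" if "x \<in> ext D" "y \<in> ext D" for x y h
        unfolding ext_sep[OF dR] using that by (simp add: pfst psnd)
      show "b = a"
      proof (rule surjection_order_unique[OF g(2) f g(1) a(1)])
        fix x y assume h: "x \<in> ext D" "y \<in> ext D"
        show "ap g x \<in> ext (ap g y) \<longleftrightarrow> ap f x \<in> ext (ap f y)" unfolding *[OF h] g(3) ..
      qed
    qed
    moreover have "ext (?R f) \<subseteq> ext (cprod D D)" unfolding ext_sep[OF dR] by blast
    then have "?R f \<in> ext (pow (cprod D D))" unfolding ext_pow by (rule CollectI)
    ultimately have "a \<in> ext (img ?F (pow (cprod D D)))" unfolding ext_img[OF FF] by (rule image_eqI[OF sym])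
    then show ?thesis unfolding ext_sep[OF dO] using a by blast
  qed
  have b: "ordinal (succ (un ?A))" "\<And>x. x \<in> ext ?A ==> x \<in> ext (succ (un ?A))"
    using ord_bound[of ?A] unfolding ext_sep[OF dO] by blast+
  have "succ (un ?A) \<in> ext ?A" by (rule m[OF b(1)]) simp
  then show False using b(2) mem_irrefl by blast
qed

lemma Theta: "ordinal Theta" "Theta \<noteq> empty" "\<not> (\<exists>f. surjection f reals Theta)"
proof -
  let ?P = "%a. ordinal a \<and> a \<noteq> empty \<and> \<not> (\<exists>f. surjection f reals a)"
  have d: "D1 ?P" by (intro dfi)
  obtain a where a: "ordinal a" "?P a" using surjection_bound by blast
  obtain b where b: "ordinal b" "?P b" "\<And>c. c \<in> ext b ==> \<not> ?P c" using ord_least[OF d a] by blast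
  let ?Q = "%\<theta>. ordinal \<theta> \<and> \<theta> \<noteq> empty \<and> (\<nexists>f. surjection f reals \<theta>) \<and>
    (\<forall>\<alpha>\<in>ext \<theta>. \<alpha> \<noteq> empty --> (\<exists>f. surjection f reals \<alpha>))"
  have Q: "?Q b" using b ord_mem by blast
  have "?Q c ==> c = b" for c using Q ord_linear[of c b] by blast
  then have "Theta = b" unfolding Theta_def using Q by (intro the_equality) blast+
  then show "ordinal Theta" "Theta \<noteq> empty" "\<not> (\<exists>f. surjection f reals Theta)" using b(2) by blast+
qed

lemma omega_in_Theta: "omega \<in> ext Theta"
proof -
  have "\<exists>f. surjection f reals n" if n: "n \<in> ext (succ omega)" "n \<noteq> empty" for n
  proof -
    let ?F = "%x. if ap x empty \<in> ext n then ap x empty else empty"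
    have F: "F1 ?F" by (intro dfi)
    have on: "ordinal n" using n(1) ord_mem[OF ord_succ[OF ord_omega]] by blast
    have z: "empty \<in> ext n" using ord_linear[OF on ord_empty] n(2) by auto
    have sn: "ext n \<subseteq> ext omega" using n(1) ord_sub[OF ord_omega] by auto
    have f: "func (lam reals ?F) reals n" by (rule lam_func[OF F]) (use z in simp)
    have "\<exists>x\<in>ext reals. ap (lam reals ?F) x = m" if m: "m \<in> ext n" for m
    proof -
      have c: "F1 (%_. m)" by (intro dfi)
      have l: "lam omega (%_. m) \<in> ext reals" unfolding ext_reals by (rule lam_func[OF c]) (use m sn in blast)
      have "?F (lam omega (%_. m)) = m" using ap_lam[OF c omega0] m by simp
      with ap_lam[OF F l] have "ap (lam reals ?F) (lam omega (%_. m)) = m" by (rule trans)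
      then show ?thesis using l by (rule bexI)
    qed
    then show ?thesis unfolding surjection_ap using f by blast
  qed
  then have "Theta \<notin> ext (succ omega)" using Theta by blast
  then show ?thesis using ord_linear[OF Theta(1) ord_omega] by simp
qed

text \<open>The third clause of \<open>AD_plus\<close> for the ordinal \<omega> and the identity map
  on the reals; \<omega> lies below \<open>Theta\<close> because the reals map onto every nonzero
  ordinal up to \<omega>.\<close>

lemma Det_of_AD_plus: assumes AD_plus shows Det
  unfolding Det_def
proof (intro allI impI)
  fix A assume A: "ext A \<subseteq> ext reals"
  let ?p = "lam reals (%x. x)"
  have F: "F1 (%x. x)" by (intro dfi)
  have f: "func ?p reals reals" by (rule lam_func[OF F])
  have pre: "preimage ?p (funs omega omega) U = U" if U: "ext U \<subseteq> ext reals" for U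
  proof -
    have "{x \<in> ext reals. app ?p x \<in> ext U} = ext U" using func_app[OF f] ap_lam[OF F] U by auto
    then show ?thesis unfolding preimage_def reals_def[symmetric] by simp
  qed
  have "continuous_to_reals omega ?p"
    unfolding continuous_to_reals_def using f pre unfolding seq_open_def reals_def by auto
  moreover have "ext omega \<noteq> {}" using omega0 by blast
  then have "omega \<noteq> empty" by simp
  ultimately have "determined omega (preimage ?p (funs omega omega) A)"
    using assms A omega_in_Theta unfolding AD_plus_def by blast
  then show "determined omega A" unfolding pre[OF A] .
qed

section \<open>Closing under several operations\<close>

text \<open>Packs finitely many operations into one, since \<open>closure_exists\<close> handles a
  single \<open>E\<close>. An empty tag selects the head of the list, any other tag passes the
  argument on to the tail.\<close>

primrec join :: "('a => 'a) list => 'a => 'a" where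
  "join [] z = z"
| "join (F # Fs) z = (if pfst z = empty then F (psnd z) else join Fs (psnd z))"

lemma join_F1: "(\<And>F. F \<in> set Fs ==> F1 F) ==> F1 (join Fs)"
proof (induction Fs)
  case Nil
  have "join [] = (%z. z)" by (simp add: fun_eq_iff)
  moreover have "F1 (%z. z)" by (intro dfi)
  ultimately show ?case by simp
next
  case (Cons F Fs)
  then have h: "F1 F" "F1 (join Fs)" by auto
  have "join (F # Fs) = (%z. if pfst z = empty then F (psnd z) else join Fs (psnd z))" by (simp add: fun_eq_iff)
  moreover have "F1 (%z. if pfst z = empty then F (psnd z) else join Fs (psnd z))"
    by (intro dfi F1D[OF h(1)] F1D[OF h(2)])
  ultimately show ?case by simp
qed

lemma join_closed:
  assumes "\<And>a b. a \<in> ext X ==> b \<in> ext X ==> opair a b \<in> ext X" "empty \<in> ext X"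
    "\<And>a. a \<in> ext X ==> join Fs a \<in> ext X" "F \<in> set Fs" "a \<in> ext X"
  shows "F a \<in> ext X"
  using assms(3-5)
proof (induction Fs arbitrary: a)
  case (Cons G Fs)
  let ?o = "opair empty empty"
  have o: "?o \<in> ext X" using assms(1,2) by blast
  have "ext ?o \<noteq> {}" unfolding opair_up by simp
  then have ne: "?o \<noteq> empty" by simp
  have G: "G b \<in> ext X" "join Fs b \<in> ext X" if b: "b \<in> ext X" for b
  proof -
    have "join (G # Fs) (opair empty b) = G b" "join (G # Fs) (opair ?o b) = join Fs b" using ne by simp_all
    then show "G b \<in> ext X" "join Fs b \<in> ext X"
      using Cons.prems(1)[OF assms(1)[OF assms(2) b]] Cons.prems(1)[OF assms(1)[OF o b]] by simp_all
  qed
  show ?case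
  proof (cases "F = G")
    case True then show ?thesis using G(1)[OF Cons.prems(3)] by simp
  next
    case False
    then have "F \<in> set Fs" using Cons.prems(2) by simp
    then show ?thesis using Cons.IH[of a] G(2) Cons.prems(3) by blast
  qed
qed simp

lemma closure_exists_list: assumes Fs: "\<And>F. F \<in> set Fs ==> F1 F" and w0: "WO w0 X0" "empty \<in> ext X0"
  obtains X w where "WO w X" "ext X0 \<subseteq> ext X" "\<And>a b. a \<in> ext X ==> b \<in> ext X ==> up a b \<in> ext X"
    "\<And>a b. a \<in> ext X ==> b \<in> ext X ==> opair a b \<in> ext X"
    "\<And>F a. F \<in> set Fs ==> a \<in> ext X ==> F a \<in> ext X" "\<And>c. c \<in> ext X ==> ordinal c ==> ext c \<subseteq> ext X"
proof -
  have j: "F1 (join Fs)" by (rule join_F1) (rule Fs)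
  obtain X w where X: "WO w X" "ext X0 \<subseteq> ext X" "\<And>a b. a \<in> ext X ==> b \<in> ext X ==> up a b \<in> ext X"
    "\<And>a. a \<in> ext X ==> join Fs a \<in> ext X" "\<And>c. c \<in> ext X ==> ordinal c ==> ext c \<subseteq> ext X"
    by (rule closure_exists[OF j w0(1)]) (rule that)
  have o: "opair a b \<in> ext X" if "a \<in> ext X" "b \<in> ext X" for a b unfolding opair_up using X(3) that by blast
  have z: "empty \<in> ext X" using X(2) w0(2) by blast
  have c: "F a \<in> ext X" if "F \<in> set Fs" "a \<in> ext X" for F a
    by (rule join_closed[where X=X and Fs=Fs]) (use o z X(4) that in auto)
  show ?thesis
    by (rule that[of w X], rule X(1), rule X(2), erule (1) X(3), erule (1) o, erule (1) c, erule (1) X(5))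
qed

end

context zf_model
begin

section \<open>The levels of \<open>L[S,x]\<close>\<close>

definition ins :: "'a => 'a => 'a => 'a" where "ins n s a = bun s (up (opair n a) (opair n a))"
lemma DT_ins[dfi]: assumes "DT t" "DT u" "DT v" shows "DT (%e. ins (t e) (u e) (v e))"
  by (rule DT3[where F=ins, OF _ assms]) (unfold ins_def, intro dfi)
lemma coll_ins: "coll (insert (opair n a) (ext s)) = ins n s a"
proof -
  have "insert (opair n a) (ext s) = ext (ins n s a)" unfolding ins_def by auto
  then show ?thesis by simp
qed
lemma ins_snoc: "func s n A ==> ins n s a = snoc s a" unfolding ins_def snoc_def by (simp add: func_dom)

definition rM :: "'a => 'a => 'a => 'a => 'a" where "rM A n i j = sep (funs n A) (%s. ap s i \<in> ext (ap s j))"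
definition rE :: "'a => 'a => 'a => 'a => 'a" where "rE A n i j = sep (funs n A) (%s. ap s i = ap s j)"
definition rP :: "'a => 'a => 'a => 'a => 'a" where "rP P A n i = sep (funs n A) (%s. ap s i \<in> ext P)"
definition rC :: "'a => 'a => 'a => 'a" where "rC A n R = sep (funs n A) (%s. s \<notin> ext R)"
definition rI :: "'a => 'a => 'a" where "rI R R' = sep R (%s. s \<in> ext R')"
definition rJ :: "'a => 'a => 'a => 'a" where "rJ A n R = sep (funs n A) (%s. \<exists>a\<in>ext A. ins n s a \<in> ext R)"

lemma ext_rM: "ext (rM A n i j) = {s. func s n A \<and> ap s i \<in> ext (ap s j)}"
  unfolding rM_def by (subst ext_sep) (intro dfi, simp)
lemma ext_rE: "ext (rE A n i j) = {s. func s n A \<and> ap s i = ap s j}"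
  unfolding rE_def by (subst ext_sep) (intro dfi, simp)
lemma ext_rP: "ext (rP P A n i) = {s. func s n A \<and> ap s i \<in> ext P}"
  unfolding rP_def by (subst ext_sep) (intro dfi, simp)
lemma ext_rC: "ext (rC A n R) = {s. func s n A \<and> s \<notin> ext R}"
  unfolding rC_def by (subst ext_sep) (intro dfi, simp)
lemma ext_rI: "ext (rI R R') = ext R \<inter> ext R'"
  unfolding rI_def by (subst ext_sep) (intro dfi, auto)
lemma ext_rJ: "ext (rJ A n R) = {s. func s n A \<and> (\<exists>a\<in>ext A. ins n s a \<in> ext R)}"
  unfolding rJ_def by (subst ext_sep) (intro dfi, simp)

lemma DT_rC[dfi]: assumes "DT t" "DT u" "DT v" shows "DT (%e. rC (t e) (u e) (v e))"
  by (rule DT3[where F=rC, OF _ assms]) (unfold rC_def, intro dfi)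
lemma F2_rI: "F2 rI" by (intro F2I, unfold rI_def, intro dfi)
lemmas [dfi] = F2D[OF F2_rI]
lemma DT_rJ[dfi]: assumes "DT t" "DT u" "DT v" shows "DT (%e. rJ (t e) (u e) (v e))"
  by (rule DT3[where F=rJ, OF _ assms]) (unfold rJ_def, intro dfi)

text \<open>\<open>def_closed [S, x]\<close> with \<open>app\<close> replaced by \<open>ap\<close>
  and the collections by separated sets, which makes its definability evident.\<close>

definition dc :: "'a => 'a => 'a => 'a => bool" where
  "dc S x A F \<longleftrightarrow> (\<forall>n\<in>ext omega. \<forall>i\<in>ext n. \<forall>j\<in>ext n. opair n (rM A n i j) \<in> ext F \<and> opair n (rE A n i j) \<in> ext F) \<and>
    (\<forall>n\<in>ext omega. \<forall>i\<in>ext n. opair n (rP S A n i) \<in> ext F \<and> opair n (rP x A n i) \<in> ext F) \<and>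
    (\<forall>n R. n \<in> ext omega \<and> opair n R \<in> ext F --> opair n (rC A n R) \<in> ext F) \<and>
    (\<forall>n R R'. n \<in> ext omega \<and> opair n R \<in> ext F \<and> opair n R' \<in> ext F --> opair n (rI R R') \<in> ext F) \<and>
    (\<forall>n R. n \<in> ext omega \<and> opair (succ n) R \<in> ext F --> opair n (rJ A n R) \<in> ext F)"

lemma DF_dc[dfi]: assumes "DT t" "DT u" "DT v" shows "DF (%e. dc S (t e) (u e) (v e))"
  by (rule DF3[where P="dc S", OF _ assms]) (unfold dc_def rM_def rE_def rP_def, intro dfi)

lemma coll_eqI: "X = ext a ==> coll X = a" by simp

lemma def_closed_dc: "def_closed [S, x] A F \<longleftrightarrow> dc S x A F"
proof -
  have m: "a \<in>\<^sub>M b \<longleftrightarrow> a \<in> ext b" for a b by (simp add: ext_def)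
  have 1: "coll {s. func s n A \<and> app s i \<in>\<^sub>M app s j} = rM A n i j"
    "coll {s. func s n A \<and> app s i = app s j} = rE A n i j" if h: "i \<in> ext n" "j \<in> ext n" for n i j
  proof -
    have e: "app s i = ap s i" "app s j = ap s j" if "func s n A" for s using func_app[OF that] h by blast+
    show "coll {s. func s n A \<and> app s i \<in>\<^sub>M app s j} = rM A n i j"
      by (rule coll_eqI, unfold ext_rM, rule Collect_cong) (use e m in metis)
    show "coll {s. func s n A \<and> app s i = app s j} = rE A n i j"
      by (rule coll_eqI, unfold ext_rE, rule Collect_cong) (use e in metis)
  qed
  have 2: "coll {s. func s n A \<and> app s i \<in>\<^sub>M P} = rP P A n i" if h: "i \<in> ext n" for n i P
  proof -
    have e: "app s i = ap s i" if "func s n A" for s using func_app[OF that] h by blast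
    show ?thesis by (rule coll_eqI, unfold ext_rP, rule Collect_cong) (use e m in metis)
  qed
  have 3: "coll (ext (funs n A) - ext R) = rC A n R" for n R by (rule coll_eqI) (auto simp: ext_rC)
  have 4: "coll (ext R \<inter> ext R') = rI R R'" for R R' by (rule coll_eqI) (simp add: ext_rI)
  have 5: "coll {s. func s n A \<and> (\<exists>a\<in>ext A. coll (insert (opair n a) (ext s)) \<in> ext R)} = rJ A n R" for n R
    by (rule coll_eqI) (simp add: ext_rJ coll_ins)
  show ?thesis unfolding def_closed_def dc_def 3 4 5 by (simp add: 1 2 ball_conj_distrib cong: ball_cong)
qed

definition dr :: "'a => 'a => 'a => 'a => 'a => bool" where
  "dr S x A n R \<longleftrightarrow> n \<in> ext omega \<and> (\<forall>F. dc S x A F --> opair n R \<in> ext F)"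
lemma DF_dr[dfi]: assumes "DT t" "DT u" "DT v" "DT w" shows "DF (%e. dr S (t e) (u e) (v e) (w e))"
  by (rule DF4[where P="dr S", OF _ assms]) (unfold dr_def, intro dfi)
lemma definable_rel_dr: "definable_rel [S, x] A n R \<longleftrightarrow> dr S x A n R"
  unfolding definable_rel_def dr_def def_closed_dc ..

lemma dr_dc: assumes "n \<in> ext omega"
  shows "i \<in> ext n ==> j \<in> ext n ==> dr S x A n (rM A n i j)" "i \<in> ext n ==> j \<in> ext n ==> dr S x A n (rE A n i j)"
    "i \<in> ext n ==> dr S x A n (rP S A n i)" "i \<in> ext n ==> dr S x A n (rP x A n i)"
    "dr S x A n R ==> dr S x A n (rC A n R)" "dr S x A n R ==> dr S x A n R' ==> dr S x A n (rI R R')"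
    "dr S x A (succ n) R ==> dr S x A n (rJ A n R)"
proof -
  have i: "dr S x A m R ==> dc S x A F ==> opair m R \<in> ext F" for m R F unfolding dr_def by blast
  have dI: "(\<And>F. dc S x A F ==> opair n R \<in> ext F) ==> dr S x A n R" for R unfolding dr_def using assms by blast
  show "i \<in> ext n ==> j \<in> ext n ==> dr S x A n (rM A n i j)" "i \<in> ext n ==> j \<in> ext n ==> dr S x A n (rE A n i j)"
    "i \<in> ext n ==> dr S x A n (rP S A n i)" "i \<in> ext n ==> dr S x A n (rP x A n i)"
    by (rule dI, use assms in \<open>simp add: dc_def\<close>)+
  show "dr S x A n (rC A n R)" if "dr S x A n R"
  proof (rule dI)
    fix F assume F: "dc S x A F"
    show "opair n (rC A n R) \<in> ext F" using F i[OF that F] assms unfolding dc_def by blast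
  qed
  show "dr S x A n (rI R R')" if "dr S x A n R" "dr S x A n R'"
  proof (rule dI)
    fix F assume F: "dc S x A F"
    show "opair n (rI R R') \<in> ext F" using F i[OF that(1) F] i[OF that(2) F] assms unfolding dc_def by blast
  qed
  show "dr S x A n (rJ A n R)" if "dr S x A (succ n) R"
  proof (rule dI)
    fix F assume F: "dc S x A F"
    show "opair n (rJ A n R) \<in> ext F" using F i[OF that F] assms unfolding dc_def by blast
  qed
qed

definition Dset :: "'a => 'a => 'a => 'a => 'a" where "Dset A n s R = sep A (%a. ins n s a \<in> ext R)"
lemma ext_Dset: "ext (Dset A n s R) = {a \<in> ext A. ins n s a \<in> ext R}"
  unfolding Dset_def by (rule ext_sep) (intro dfi)

definition Df :: "'a => 'a => 'a => 'a" where
  "Df S x A = sep (pow A) (%X. \<exists>n\<in>ext omega. \<exists>s R. func s n A \<and> dr S x A (succ n) R \<and> X = Dset A n s R)"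
lemma DT_Df[dfi]: assumes "DT t" "DT u" shows "DT (%e. Df S (t e) (u e))"
  by (rule DT2[where F="Df S", OF _ assms]) (unfold Df_def Dset_def, intro dfi)
lemma ext_Df: "X \<in> ext (Df S x A) \<longleftrightarrow> (\<exists>n\<in>ext omega. \<exists>s R. func s n A \<and> dr S x A (succ n) R \<and> X = Dset A n s R)"
proof -
  have "D1 (%X. \<exists>n\<in>ext omega. \<exists>s R. func s n A \<and> dr S x A (succ n) R \<and> X = Dset A n s R)"
    unfolding Dset_def by (intro dfi)
  from ext_sep[OF this] show ?thesis unfolding Df_def using ext_Dset by auto
qed
lemma Def_Df: "Def [S, x] A = Df S x A"
proof -
  have "coll {a \<in> ext A. coll (insert (opair n a) (ext s)) \<in> ext R} = Dset A n s R" for n s R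
    by (rule coll_eqI) (simp add: ext_Dset coll_ins)
  note E = this
  show ?thesis unfolding Def_def definable_rel_dr E by (rule coll_eqI) (simp add: set_eq_iff ext_Df)
qed

text \<open>Away from limits the inner set contains just the predecessor of \<open>dom f\<close>, if
  there is one. So the union is \<open>Df\<close> of the previous level at a successor and empty at
  0.\<close>

definition LvH :: "'a => 'a => 'a => 'a" where
  "LvH S x f = (if limit (dom f) then un (img (ap f) (dom f))
    else un (img (%b. Df S x (ap f b)) (sep (dom f) (%b. dom f = succ b))))"
definition Lv :: "'a => 'a => 'a => 'a" where "Lv S x c = trec (LvH S x) c"

lemma DT_LvH[dfi]: assumes "DT t" "DT u" shows "DT (%e. LvH S (t e) (u e))"
  by (rule DT2[where F="LvH S", OF _ assms]) (unfold LvH_def, intro dfi)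
lemma DT_Lv[dfi]: assumes "DT t" "DT u" shows "DT (%e. Lv S (t e) (u e))"
  by (rule DT2[where F="Lv S", OF _ assms]) (unfold Lv_def, intro dfi)

lemma Lv_unfold: assumes "ordinal c"
  shows "a \<in> ext (Lv S x c) \<longleftrightarrow> (limit c \<and> (\<exists>b\<in>ext c. a \<in> ext (Lv S x b))) \<or> (\<exists>b. c = succ b \<and> a \<in> ext (Df S x (Lv S x b)))"
proof -
  have H: "F1 (LvH S x)" by (intro dfi)
  have F: "F1 (trec (LvH S x))" by (intro dfi)
  let ?f = "lam c (trec (LvH S x))"
  have d: "dom ?f = c" by (rule func_dom[OF lam_func_img[OF F]])
  have e: "ap ?f b = Lv S x b" if "b \<in> ext c" for b unfolding Lv_def by (rule ap_lam[OF F that])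
  have 1: "F1 (ap ?f)" "F1 (%b. Df S x (ap ?f b))" by (intro dfi)+
  have 2: "D1 (%b. c = succ b)" by (intro dfi)
  have ns: "limit c ==> c \<noteq> succ b" for b unfolding limit_def by blast
  have L: "Lv S x c = LvH S x ?f" unfolding Lv_def by (rule trec_eq[OF H assms])
  show ?thesis
  proof (cases "limit c")
    case True
    have "LvH S x ?f = un (img (ap ?f) c)" unfolding LvH_def[of S x ?f] d using True by simp
    then have "ext (Lv S x c) = {z. \<exists>b\<in>ext c. z \<in> ext (ap ?f b)}" unfolding L by (simp add: ext_img[OF 1(1)])
    then show ?thesis using True ns e by auto
  next
    case False
    have "LvH S x ?f = un (img (%b. Df S x (ap ?f b)) (sep c (%b. c = succ b)))" unfolding LvH_def[of S x ?f] d using False by simp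
    then have "ext (Lv S x c) = {z. \<exists>b\<in>ext c. c = succ b \<and> z \<in> ext (Df S x (ap ?f b))}"
      unfolding L by (auto simp: ext_img[OF 1(2)] ext_sep[OF 2])
    moreover have "c = succ b ==> b \<in> ext c \<and> ap ?f b = Lv S x b" for b using e[of b] by auto
    ultimately show ?thesis using False by auto
  qed
qed

lemma Lv_0: "Lv S x empty = empty"
  by (rule ext_inject, rule set_eqI, subst Lv_unfold) (simp_all add: limit_def)
lemma Lv_S: "ordinal b ==> Lv S x (succ b) = Df S x (Lv S x b)"
  by (rule ext_inject, rule set_eqI, subst Lv_unfold) (simp_all add: limit_def)
lemma Lv_L: "limit b ==> ext (Lv S x b) = (\<Union>c\<in>ext b. ext (Lv S x c))"
  using Lv_unfold[of b] unfolding limit_def by auto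

text \<open>The levels become values of one definable function of \<open>x\<close> and the ordinal.
  This allows truth in the proper class \<open>L[S,x]\<close> to be expressed inside the model, one
  formula at a time.\<close>

lemma L_bracket_Lv: "L_bracket S x = {y. \<exists>c. ordinal c \<and> y \<in> ext (Lv S x c)}"
proof (rule set_eqI)
  fix y
  show "y \<in> L_bracket S x \<longleftrightarrow> y \<in> {y. \<exists>c. ordinal c \<and> y \<in> ext (Lv S x c)}"
  proof
    assume "y \<in> L_bracket S x"
    then obtain c f where f: "L_levels [S, x] empty c f" "y \<in> ext (app f c)" unfolding L_bracket_def L_class_def by blast
    have oc: "ordinal c" using f(1) unfolding L_levels_def by blast
    obtain B where B: "func f (succ c) B" using f(1) unfolding L_levels_def by blast
    have d: "D1 (%b. b \<in> ext (succ c) --> ap f b = Lv S x b)" by (intro dfi)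
    have *: "b \<in> ext (succ c) --> ap f b = Lv S x b" if ob: "ordinal b" for b
    proof (rule ord_induct[OF ob d], rule impI)
      fix b assume b: "ordinal b" "\<And>d. d \<in> ext b ==> d \<in> ext (succ c) --> ap f d = Lv S x d" "b \<in> ext (succ c)"
      have bs: "d \<in> ext (succ c)" if "d \<in> ext b" for d using ord_trans[OF ord_succ[OF oc] b(3) that] .
      consider "b = empty" | d where "b = succ d" | "limit b" using b(1) unfolding limit_def by blast
      then have "app f b = Lv S x b"
      proof cases
        case 1 then show ?thesis using f(1) unfolding L_levels_def by (simp add: Lv_0)
      next
        case (2 d)
        have dc: "d \<in> ext c" using b(3) ord_trans[OF oc] unfolding 2 by auto
        have db: "d \<in> ext b" using 2 by simp
        have e: "app f d = Lv S x d" using func_app[OF B bs[OF db]] b(2)[OF db, THEN mp, OF bs[OF db]] by (rule trans)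
        have "\<forall>b\<in>ext c. app f (succ b) = Def [S, x] (app f b)" using f(1) unfolding L_levels_def by blast
        then have "app f b = Df S x (Lv S x d)" using dc unfolding Def_Df 2 e[symmetric] by (rule bspec)
        then show ?thesis unfolding 2 Lv_S[OF ord_mem[OF b(1) db]] .
      next
        case 3
        have "app f b = coll (\<Union>d\<in>ext b. ext (app f d))" using f(1) b(3) 3 unfolding L_levels_def by blast
        moreover have "app f d = Lv S x d" if db: "d \<in> ext b" for d
          using func_app[OF B bs[OF db]] b(2)[OF db, THEN mp, OF bs[OF db]] by (rule trans)
        ultimately show ?thesis using Lv_L[OF 3, of S x, symmetric] by simp
      qed
      then show "ap f b = Lv S x b" using func_app[OF B b(3)] by simp
    qed
    have "app f c = Lv S x c" using *[OF oc] func_app[OF B, of c] by simp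
    then show "y \<in> {y. \<exists>c. ordinal c \<and> y \<in> ext (Lv S x c)}" using oc f(2) by auto
  next
    assume "y \<in> {y. \<exists>c. ordinal c \<and> y \<in> ext (Lv S x c)}"
    then obtain c where c: "ordinal c" "y \<in> ext (Lv S x c)" by blast
    let ?f = "lam (succ c) (Lv S x)"
    have F: "F1 (Lv S x)" by (intro dfi)
    have B: "func ?f (succ c) (img (Lv S x) (succ c))" by (rule lam_func_img[OF F])
    have e: "app ?f b = Lv S x b" if "b \<in> ext (succ c)" for b using func_app[OF B that] ap_lam[OF F that] by simp
    have tr: "d \<in> ext (succ c)" if "b \<in> ext (succ c)" "d \<in> ext b" for b d by (rule ord_trans[OF ord_succ[OF c(1)] that])
    have z: "empty \<in> ext (succ c)" using ord_linear[OF c(1) ord_empty] by auto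
    have 1: "app ?f (succ b) = Def [S, x] (app ?f b)" if b: "b \<in> ext c" for b
    proof -
      have "succ b \<in> ext (succ c)" "b \<in> ext (succ c)"
        using ord_sub_iff[OF ord_succ[OF ord_mem[OF c(1) b]] c(1)] ord_sub[OF c(1) b] b by auto
      then show ?thesis using e Lv_S[OF ord_mem[OF c(1) b]] unfolding Def_Df by simp
    qed
    have 2: "app ?f b = coll (\<Union>d\<in>ext b. ext (app ?f d))" if b: "b \<in> ext (succ c)" "limit b" for b
    proof -
      have "(\<Union>d\<in>ext b. ext (app ?f d)) = ext (Lv S x b)" unfolding Lv_L[OF b(2)] using e tr[OF b(1)] by simp
      then show ?thesis using e[OF b(1)] by simp
    qed
    have "L_levels [S, x] empty c ?f" unfolding L_levels_def using c(1) B 1 2 e[OF z] Lv_0 by auto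
    moreover have "y \<in> ext (app ?f c)" using e[of c] c(2) by simp
    ultimately show "y \<in> L_bracket S x" unfolding L_bracket_def L_class_def by blast
  qed
qed

end

section \<open>Names for the elements of \<open>L[S,x]\<close>\<close>

primrec subs :: "fm => fm list" where
  "subs (Mem i j) = [Mem i j]"
| "subs (Eq i j) = [Eq i j]"
| "subs (Neg p) = Neg p # subs p"
| "subs (Conj p q) = Conj p q # subs p @ subs q"
| "subs (All i p) = All i p # subs p"

lemma subs_refl: "p \<in> set (subs p)" by (cases p) auto
lemma subs_trans: "q \<in> set (subs p) ==> set (subs q) \<subseteq> set (subs p)" by (induction p) auto
lemma finite_fv: "finite (fv p)" by (induction p) auto
lemma fv_bound: "\<exists>k. \<forall>q\<in>set (subs p). fv q \<subseteq> {..<k}"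
proof -
  have "finite (\<Union>q\<in>set (subs p). fv q)" using finite_fv by simp
  then obtain k where "\<forall>i\<in>(\<Union>q\<in>set (subs p). fv q). i < k" using finite_nat_set_iff_bounded by blast
  then show ?thesis by blast
qed

context zf_model
begin

lemma sat_cong: "(\<And>i. i \<in> fv p ==> e i = e' i) ==> sat C p e = sat C p e'"
proof (induction p arbitrary: e e')
  case (All i p)
  have "sat C p (e(i := x)) = sat C p (e'(i := x))" for x by (rule All.IH) (use All.prems in auto)
  then show ?case by simp
next
  case (Conj p q)
  have "sat C p e = sat C p e'" by (rule Conj.IH(1)) (use Conj.prems in auto)
  moreover have "sat C q e = sat C q e'" by (rule Conj.IH(2)) (use Conj.prems in auto)
  ultimately show ?case by simp
next
  case (Neg p)
  have "sat C p e = sat C p e'" by (rule Neg.IH) (use Neg.prems in auto)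
  then show ?case by simp
qed auto

text \<open>By induction on the formula, carried out outside the model. A quantifier over
  \<open>L[S,x]\<close> turns into quantifiers over an ordinal \<open>c\<close> and an element of
  \<open>Lv S x c\<close>.\<close>

lemma DF_satL: assumes "\<And>i. DT (t i)" "DT u" shows "DF (%e. sat (L_bracket S (u e)) p (%i. t i e))"
  using assms
proof (induction p arbitrary: t u)
  case (Mem i j)
  have "DF (%e. t i e \<in> ext (t j e))" by (rule DF_mem[OF Mem(1) Mem(1)])
  then show ?case by (simp add: ext_def)
next
  case (Eq i j)
  have "DF (%e. t i e = t j e)" by (rule DF_eq[OF Eq(1) Eq(1)])
  then show ?case by simp
next
  case (Neg p)
  from DF_neg[OF Neg.IH[OF Neg.prems]] show ?case by simp
next
  case (Conj p q)
  from DF_conj[OF Conj.IH(1)[OF Conj.prems] Conj.IH(2)[OF Conj.prems]] show ?case by simp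
next
  case (All i p)
  let ?t = "%j. if j = i then (%e. e 0) else (%e. t j (%n. e (Suc n)))"
  have t: "DT (?t j)" for j using DT_shift[OF All.prems(1)] DT_var by simp
  have u: "DT (%e. u (%n. e (Suc n)))" by (rule DT_shift[OF All.prems(2)])
  have s: "DF (%e. sat (L_bracket S (u (%n. e (Suc n)))) p (%j. ?t j e))" by (rule All.IH[OF t u])
  have l: "DF (%e. \<exists>c. ordinal c \<and> e 0 \<in> ext (Lv S (u (%n. e (Suc n))) c))"
    by (intro DF_ex DF_conj DF_ordinal DF_mem DT_Lv DT_var DT_shift[OF u])
  have "DF (%e. (\<exists>c. ordinal c \<and> e 0 \<in> ext (Lv S (u (%n. e (Suc n))) c)) -->
    sat (L_bracket S (u (%n. e (Suc n)))) p (%j. if j = i then e 0 else t j (%n. e (Suc n))))"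
    by (rule DF_imp[OF l DF_cong[OF s]]) (rule arg_cong[where f="sat _ p"], auto)
  from DF_all[where Q="%e y. (\<exists>c. ordinal c \<and> y \<in> ext (Lv S (u e) c)) -->
    sat (L_bracket S (u e)) p (%j. if j = i then y else t j e)", OF this]
  show ?case
  proof (rule DF_cong)
    fix e
    have "(%j. t j e)(i := y) = (%j. if j = i then y else t j e)" for y by auto
    then show "(\<forall>y. (\<exists>c. ordinal c \<and> y \<in> ext (Lv S (u e) c)) --> sat (L_bracket S (u e)) p (%j. if j = i then y else t j e))
      = sat (L_bracket S (u e)) (All i p) (%i. t i e)"
      by (simp add: L_bracket_Lv[of S "u e"] Ball_def)
  qed
qed

text \<open>Names are functions on the reals, evaluated at \<open>x\<close> by application:
  \<open>Kc a\<close> always names \<open>a\<close>, and \<open>idR\<close> names \<open>x\<close>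
  itself. \<open>MemS\<close>, \<open>EqS\<close> and \<open>TS\<close> are the truth values of
  statements about names, taken in the algebra of sets of reals, and \<open>Ev\<close> turns a
  finite sequence of names into a name of the sequence of values.\<close>

definition Kc :: "'a => 'a" where "Kc a = lam reals (%_. a)"
definition idR :: 'a where "idR = lam reals (%x. x)"
definition MemS :: "'a => 'a => 'a" where "MemS f g = sep reals (%x. ap f x \<in> ext (ap g x))"
definition EqS :: "'a => 'a => 'a" where "EqS f g = sep reals (%x. ap f x = ap g x)"
definition rc :: "'a => 'a" where "rc A = sep reals (%x. x \<notin> ext A)"
definition ri :: "'a => 'a => 'a" where "ri A B = sep reals (%x. x \<in> ext A \<and> x \<in> ext B)"
definition bs :: "'a => 'a" where "bs p = sep reals (%x. p \<in> ext x)"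
definition Ev :: "'a => 'a" where "Ev s = lam reals (%x. lam (dom s) (%i. ap (ap s i) x))"
definition TS :: "'a => fm => (nat => 'a) => 'a" where
  "TS S p e = sep reals (%x. sat (L_bracket S x) p (%i. ap (e i) x))"

lemma F2_MemS: "F2 MemS" by (intro F2I, unfold MemS_def, intro dfi)
lemmas [dfi] = F2D[OF F2_MemS]
lemma F2_EqS: "F2 EqS" by (intro F2I, unfold EqS_def, intro dfi)
lemmas [dfi] = F2D[OF F2_EqS]
lemma F2_ri: "F2 ri" by (intro F2I, unfold ri_def, intro dfi)
lemmas [dfi] = F2D[OF F2_ri]
lemma F1_rc: "F1 rc" by (intro F1I, unfold rc_def, intro dfi)
lemmas [dfi] = F1D[OF F1_rc]
lemma F1_bs: "F1 bs" by (intro F1I, unfold bs_def, intro dfi)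
lemmas [dfi] = F1D[OF F1_bs]
lemma F1_Kc: "F1 Kc" by (intro F1I, unfold Kc_def, intro dfi)
lemmas [dfi] = F1D[OF F1_Kc]
lemma F1_Ev: "F1 Ev" by (intro F1I, unfold Ev_def, intro dfi)
lemmas [dfi] = F1D[OF F1_Ev]

lemma MemS: "x \<in> ext (MemS f g) \<longleftrightarrow> x \<in> ext reals \<and> ap f x \<in> ext (ap g x)"
  unfolding MemS_def by (subst ext_sep) (intro dfi, simp)
lemma EqS: "x \<in> ext (EqS f g) \<longleftrightarrow> x \<in> ext reals \<and> ap f x = ap g x"
  unfolding EqS_def by (subst ext_sep) (intro dfi, simp)
lemma rc: "x \<in> ext (rc A) \<longleftrightarrow> x \<in> ext reals \<and> x \<notin> ext A"
  unfolding rc_def by (subst ext_sep) (intro dfi, simp)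
lemma ri: "x \<in> ext (ri A B) \<longleftrightarrow> x \<in> ext reals \<and> x \<in> ext A \<and> x \<in> ext B"
  unfolding ri_def by (subst ext_sep) (intro dfi, simp)
lemma bs: "x \<in> ext (bs p) \<longleftrightarrow> x \<in> ext reals \<and> p \<in> ext x"
  unfolding bs_def by (subst ext_sep) (intro dfi, simp)
lemma TS: "x \<in> ext (TS S p e) \<longleftrightarrow> x \<in> ext reals \<and> sat (L_bracket S x) p (%i. ap (e i) x)"
proof -
  have "D1 (%x. sat (L_bracket S x) p (%i. ap (e i) x))" by (rule D1I, rule DF_satL) (intro dfi)+
  from ext_sep[OF this] show ?thesis unfolding TS_def by simp
qed
lemma ap_Kc: "x \<in> ext reals ==> ap (Kc a) x = a"
  unfolding Kc_def by (rule ap_lam) (intro dfi)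
lemma ap_idR: "x \<in> ext reals ==> ap idR x = x"
  unfolding idR_def by (rule ap_lam) (intro dfi)
lemma ap_Ev: "x \<in> ext reals ==> ap (Ev s) x = lam (dom s) (%i. ap (ap s i) x)"
  unfolding Ev_def by (rule ap_lam) (intro dfi)
lemma ap_Ev_ap: assumes "x \<in> ext reals" "func s n Z" "i \<in> ext n" shows "ap (ap (Ev s) x) i = ap (ap s i) x"
  unfolding ap_Ev[OF assms(1)] func_dom[OF assms(2)] by (rule ap_lam[OF _ assms(3)]) (intro dfi)
lemma Ev_func: assumes "x \<in> ext reals" "func s n Z" "\<And>t. t \<in> ext Z ==> ap t x \<in> ext B" shows "func (ap (Ev s) x) n B"
  unfolding ap_Ev[OF assms(1)] func_dom[OF assms(2)]
  by (rule lam_func) (intro dfi, use assms(3) func_ap_in[OF assms(2)] in blast)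
lemma Ev_snoc: assumes x: "x \<in> ext reals" and s: "func s n Z" and t: "t \<in> ext Z"
    and Z: "\<And>t. t \<in> ext Z ==> ap t x \<in> ext B"
  shows "ap (Ev (snoc s t)) x = ins n (ap (Ev s) x) (ap t x)"
proof -
  have f: "func (ap (Ev s) x) n B" by (rule Ev_func[OF x s Z])
  have 1: "func (snoc (ap (Ev s) x) (ap t x)) (succ n) B" by (rule snoc_func[OF f Z[OF t]])
  have 2: "func (ap (Ev (snoc s t)) x) (succ n) B" by (rule Ev_func[OF x snoc_func[OF s t] Z])
  have "ap (Ev (snoc s t)) x = snoc (ap (Ev s) x) (ap t x)"
  proof (rule func_eqI[OF 2 1])
    fix i assume i: "i \<in> ext (succ n)"
    have e: "ap (ap (Ev (snoc s t)) x) i = ap (ap (snoc s t) i) x" by (rule ap_Ev_ap[OF x snoc_func[OF s t] i])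
    show "ap (ap (Ev (snoc s t)) x) i = ap (snoc (ap (Ev s) x) (ap t x)) i"
    proof (cases "i = n")
      case True then show ?thesis unfolding e using snoc_last[OF s t] snoc_last[OF f Z[OF t]] by simp
    next
      case False
      then have i: "i \<in> ext n" using i by simp
      show ?thesis unfolding e snoc_ap[OF s t i] snoc_ap[OF f Z[OF t] i] ap_Ev_ap[OF x s i] ..
    qed
  qed
  then show ?thesis using ins_snoc[OF f] by simp
qed

end

text \<open>\<open>L\<close> is an arbitrary family of sets of reals that contains the basic sets
  and is closed under complements, binary intersections, and every intersection that happens to be
  an element of \<open>X\<close>. The aim is to place the truth values of the formulas in
  \<open>\<Phi>\<close> at suitable names into \<open>L\<close>. The closure conditions on
  \<open>X\<close> ensure that the intersections met on the way are elements of
  \<open>X\<close>.\<close>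

locale name_space = zf_model +
  fixes S X w :: 'a and \<Phi> :: "fm set" and L :: 'a
  assumes wo: "WO w X" and S_ord: "\<And>a. a \<in> ext S ==> ordinal a \<and> a \<in> ext X" and S_X: "S \<in> ext X"
    and om_X: "omega \<in> ext X" and emp_X: "empty \<in> ext X"
    and ord_X: "\<And>c. c \<in> ext X ==> ordinal c ==> ext c \<subseteq> ext X"
    and up_X: "\<And>a b. a \<in> ext X ==> b \<in> ext X ==> up a b \<in> ext X"
    and Kc_X: "\<And>a. a \<in> ext X ==> Kc a \<in> ext X" and idR_X: "idR \<in> ext X"
    and MemS_X: "\<And>a b. a \<in> ext X ==> b \<in> ext X ==> MemS a b \<in> ext X"
    and EqS_X: "\<And>a b. a \<in> ext X ==> b \<in> ext X ==> EqS a b \<in> ext X"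
    and rc_X: "\<And>a. a \<in> ext X ==> rc a \<in> ext X"
    and ins_X: "\<And>n s a. n \<in> ext X ==> s \<in> ext X ==> a \<in> ext X ==> ins n s a \<in> ext X"
    and Ev_X: "\<And>s. s \<in> ext X ==> Ev s \<in> ext X"
    and rM_X: "\<And>c n i j. c \<in> ext X ==> n \<in> ext X ==> i \<in> ext X ==> j \<in> ext X ==> lam reals (%x. rM (Lv S x c) n i j) \<in> ext X"
    and rE_X: "\<And>c n i j. c \<in> ext X ==> n \<in> ext X ==> i \<in> ext X ==> j \<in> ext X ==> lam reals (%x. rE (Lv S x c) n i j) \<in> ext X"
    and rPS_X: "\<And>c n i. c \<in> ext X ==> n \<in> ext X ==> i \<in> ext X ==> lam reals (%x. rP S (Lv S x c) n i) \<in> ext X"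
    and rPx_X: "\<And>c n i. c \<in> ext X ==> n \<in> ext X ==> i \<in> ext X ==> lam reals (%x. rP x (Lv S x c) n i) \<in> ext X"
    and rC_X: "\<And>c n r. c \<in> ext X ==> n \<in> ext X ==> r \<in> ext X ==> lam reals (%x. rC (Lv S x c) n (ap r x)) \<in> ext X"
    and rI_X: "\<And>r r'. r \<in> ext X ==> r' \<in> ext X ==> lam reals (%x. rI (ap r x) (ap r' x)) \<in> ext X"
    and rJ_X: "\<And>c n r. c \<in> ext X ==> n \<in> ext X ==> r \<in> ext X ==> lam reals (%x. rJ (Lv S x c) n (ap r x)) \<in> ext X"
    and Nm_X: "\<And>c n r s. c \<in> ext X ==> n \<in> ext X ==> r \<in> ext X ==> s \<in> ext X ==>
      lam reals (%x. Dset (Lv S x c) n (ap (Ev s) x) (ap r x)) \<in> ext X"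
    and TS_X: "\<And>p e. p \<in> \<Phi> ==> (\<And>i. e i \<in> ext X) ==> TS S p e \<in> ext X"
    and wit_X: "\<And>i p e. All i p \<in> \<Phi> ==> (\<And>i. e i \<in> ext X) ==> \<exists>c\<in>ext X. ordinal c \<and>
      (\<forall>x\<in>ext reals. (\<exists>a\<in>L_bracket S x. \<not> sat (L_bracket S x) p ((%j. ap (e j) x)(i := a))) -->
        (\<exists>b\<in>ext c. \<exists>a\<in>ext (Lv S x b). \<not> sat (L_bracket S x) p ((%j. ap (e j) x)(i := a))))"
    and \<Phi>_sub: "\<And>p. Neg p \<in> \<Phi> ==> p \<in> \<Phi>" "\<And>p q. Conj p q \<in> \<Phi> ==> p \<in> \<Phi>" "\<And>p q. Conj p q \<in> \<Phi> ==> q \<in> \<Phi>"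
      "\<And>i p. All i p \<in> \<Phi> ==> p \<in> \<Phi>"
    and L_bs: "\<And>j m. j \<in> ext omega ==> m \<in> ext omega ==> bs (opair j m) \<in> ext L"
    and L_rc: "\<And>A. A \<in> ext L ==> rc A \<in> ext L"
    and L_ri: "\<And>A B. A \<in> ext L ==> B \<in> ext L ==> ri A B \<in> ext L"
    and L_int: "\<And>A Z. ext Z \<subseteq> ext L ==> A \<in> ext X ==> ext A = {x \<in> ext reals. \<forall>B\<in>ext Z. x \<in> ext B} ==> A \<in> ext L"
begin

lemma L_INT: assumes "F1 F" "\<And>i. i \<in> ext I ==> F i \<in> ext L" "A \<in> ext X" "ext A \<subseteq> ext reals"
    "\<And>x. x \<in> ext reals ==> x \<in> ext A \<longleftrightarrow> (\<forall>i\<in>ext I. x \<in> ext (F i))"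
  shows "A \<in> ext L"
proof (rule L_int[of "img F I"])
  show "ext (img F I) \<subseteq> ext L" unfolding ext_img[OF assms(1)] using assms(2) by blast
  show "ext A = {x \<in> ext reals. \<forall>B\<in>ext (img F I). x \<in> ext B}" unfolding ext_img[OF assms(1)] using assms(4,5) by auto
qed fact

lemma L_UN: assumes "F1 F" "\<And>i. i \<in> ext I ==> F i \<in> ext L" "A \<in> ext X" "ext A \<subseteq> ext reals"
    "\<And>x. x \<in> ext reals ==> x \<in> ext A \<longleftrightarrow> (\<exists>i\<in>ext I. x \<in> ext (F i))"
  shows "A \<in> ext L"
proof -
  have "rc A \<in> ext L"
  proof (rule L_INT[where F="%i. rc (F i)" and I=I])
    show "F1 (%i. rc (F i))" by (intro dfi F1D[OF assms(1)])
    show "\<And>i. i \<in> ext I ==> rc (F i) \<in> ext L" using L_rc assms(2) by blast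
    show "rc A \<in> ext X" by (rule rc_X[OF assms(3)])
    show "ext (rc A) \<subseteq> ext reals" using rc by blast
    show "\<And>x. x \<in> ext reals ==> x \<in> ext (rc A) \<longleftrightarrow> (\<forall>i\<in>ext I. x \<in> ext (rc (F i)))" unfolding rc using assms(5) by blast
  qed
  from L_rc[OF this] have "rc (rc A) \<in> ext L" .
  moreover have "rc (rc A) = A" by (rule ext_inject, rule set_eqI, unfold rc) (use assms(4) in blast)
  ultimately show ?thesis by simp
qed

text \<open>A name is a function on the reals, and \<open>good D\<close> says that \<open>D\<close> is a transitive family of names
  between which membership and equality have truth values in \<open>L\<close>. By extensionality it suffices to
  know this for membership of names already present, which is how \<open>pl\<close> adds new ones.\<close>

definition good :: "'a => bool" where
  "good D \<longleftrightarrow> ext D \<subseteq> ext X \<and> (\<forall>t\<in>ext D. \<forall>x\<in>ext reals. \<forall>y\<in>ext (ap t x). \<exists>s\<in>ext D. ap s x = y) \<and>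
    (\<forall>s\<in>ext D. \<forall>t\<in>ext D. EqS s t \<in> ext L \<and> MemS s t \<in> ext L)"
definition pl :: "'a => 'a" where
  "pl D = sep X (%t. (\<forall>x\<in>ext reals. \<forall>y\<in>ext (ap t x). \<exists>s\<in>ext D. ap s x = y) \<and> (\<forall>s\<in>ext D. MemS s t \<in> ext L))"

lemma DF_good[dfi]: assumes "DT t" shows "DF (%e. good (t e))"
  by (rule DF1[where P=good, OF _ assms]) (unfold good_def, intro dfi)
lemma F1_pl: "F1 pl" by (intro F1I, unfold pl_def, intro dfi)
lemmas [dfi] = F1D[OF F1_pl]
lemma pl: "t \<in> ext (pl D) \<longleftrightarrow> t \<in> ext X \<and> (\<forall>x\<in>ext reals. \<forall>y\<in>ext (ap t x). \<exists>s\<in>ext D. ap s x = y) \<and> (\<forall>s\<in>ext D. MemS s t \<in> ext L)"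
  unfolding pl_def by (subst ext_sep) (intro dfi, simp)
lemma good_sub_pl: "good D ==> ext D \<subseteq> ext (pl D)" unfolding good_def pl subset_iff by blast

lemma good_pl: assumes g: "good D" shows "good (pl D)"
proof -
  have gX: "ext D \<subseteq> ext X" and gL: "\<And>s t. s \<in> ext D ==> t \<in> ext D ==> MemS s t \<in> ext L" using g unfolding good_def by blast+
  have E: "EqS t t' \<in> ext L" if t: "t \<in> ext (pl D)" and t': "t' \<in> ext (pl D)" for t t'
  proof (rule L_INT[where I=D and F="%s. ri (rc (ri (MemS s t) (rc (MemS s t')))) (rc (ri (MemS s t') (rc (MemS s t))))"])
    show "F1 (%s. ri (rc (ri (MemS s t) (rc (MemS s t')))) (rc (ri (MemS s t') (rc (MemS s t)))))" by (intro dfi)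
    show "\<And>s. s \<in> ext D ==> ri (rc (ri (MemS s t) (rc (MemS s t')))) (rc (ri (MemS s t') (rc (MemS s t)))) \<in> ext L"
      using t t' unfolding pl by (intro L_ri L_rc) blast+
    show "EqS t t' \<in> ext X" using t t' unfolding pl by (intro EqS_X) blast+
    show "ext (EqS t t') \<subseteq> ext reals" using EqS by blast
    fix x assume x: "x \<in> ext reals"
    have "x \<in> ext (EqS t t') \<longleftrightarrow> (\<forall>s\<in>ext D. ap s x \<in> ext (ap t x) \<longleftrightarrow> ap s x \<in> ext (ap t' x))"
    proof
      assume h: "\<forall>s\<in>ext D. ap s x \<in> ext (ap t x) \<longleftrightarrow> ap s x \<in> ext (ap t' x)"
      have "y \<in> ext (ap t x) \<longleftrightarrow> y \<in> ext (ap t' x)" for y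
      proof
        assume y: "y \<in> ext (ap t x)"
        then obtain s where s: "s \<in> ext D" "ap s x = y" using t x unfolding pl by blast
        then show "y \<in> ext (ap t' x)" using h y by blast
      next
        assume y: "y \<in> ext (ap t' x)"
        then obtain s where s: "s \<in> ext D" "ap s x = y" using t' x unfolding pl by blast
        then show "y \<in> ext (ap t x)" using h y by blast
      qed
      then have "ap t x = ap t' x" by (intro ext_inject set_eqI)
      then show "x \<in> ext (EqS t t')" unfolding EqS using x by blast
    qed (simp add: EqS)
    then show "x \<in> ext (EqS t t') \<longleftrightarrow> (\<forall>s\<in>ext D. x \<in> ext (ri (rc (ri (MemS s t) (rc (MemS s t')))) (rc (ri (MemS s t') (rc (MemS s t))))))"
      unfolding ri rc MemS using x by blast
  qed
  \<comment> \<open>Membership between new names is a union over the old ones: some \<open>s\<close>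
    in \<open>D\<close> equals \<open>t\<close> and belongs to \<open>t'\<close>. Equality has just
    been settled by \<open>E\<close>.\<close>
  have M: "MemS t t' \<in> ext L" if t: "t \<in> ext (pl D)" and t': "t' \<in> ext (pl D)" for t t'
  proof (rule L_UN[where I=D and F="%s. ri (EqS s t) (MemS s t')"])
    show "F1 (%s. ri (EqS s t) (MemS s t'))" by (intro dfi)
    show "ri (EqS s t) (MemS s t') \<in> ext L" if s: "s \<in> ext D" for s
    proof (rule L_ri)
      show "EqS s t \<in> ext L" by (rule E[OF _ t]) (use s good_sub_pl[OF g] in blast)
      show "MemS s t' \<in> ext L" using s t' unfolding pl by blast
    qed
    show "MemS t t' \<in> ext X" using t t' unfolding pl by (intro MemS_X) blast+
    show "ext (MemS t t') \<subseteq> ext reals" using MemS by blast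
    fix x assume x: "x \<in> ext reals"
    show "x \<in> ext (MemS t t') \<longleftrightarrow> (\<exists>s\<in>ext D. x \<in> ext (ri (EqS s t) (MemS s t')))"
    proof
      assume h: "x \<in> ext (MemS t t')"
      then obtain s where s: "s \<in> ext D" "ap s x = ap t x" using t' x unfolding pl MemS by blast
      then show "\<exists>s\<in>ext D. x \<in> ext (ri (EqS s t) (MemS s t'))" using h x unfolding ri EqS MemS by (intro bexI[of _ s]) simp_all
    next
      assume "\<exists>s\<in>ext D. x \<in> ext (ri (EqS s t) (MemS s t'))"
      then show "x \<in> ext (MemS t t')" unfolding ri EqS MemS by force
    qed
  qed
  have "ext (pl D) \<subseteq> ext X" unfolding pl subset_iff by blast
  moreover have "\<forall>t\<in>ext (pl D). \<forall>x\<in>ext reals. \<forall>y\<in>ext (ap t x). \<exists>s\<in>ext (pl D). ap s x = y"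
  proof (intro ballI)
    fix t x y assume h: "t \<in> ext (pl D)" "x \<in> ext reals" "y \<in> ext (ap t x)"
    then obtain s where "s \<in> ext D" "ap s x = y" unfolding pl by blast
    then show "\<exists>s\<in>ext (pl D). ap s x = y" using good_sub_pl[OF g] by blast
  qed
  ultimately show ?thesis unfolding good_def using E M by simp
qed

definition tow :: "'a => 'a" where "tow c = trec (%f. un (img (%b. pl (ap f b)) (dom f))) c"
lemma F1_tow: "F1 tow" by (intro F1I, unfold tow_def, intro dfi)
lemmas [dfi] = F1D[OF F1_tow]

lemma tow: assumes "ordinal c" shows "t \<in> ext (tow c) \<longleftrightarrow> (\<exists>b\<in>ext c. t \<in> ext (pl (tow b)))"
proof -
  let ?H = "%f. un (img (%b. pl (ap f b)) (dom f))"
  have H: "F1 ?H" by (intro dfi)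
  have F: "F1 (trec ?H)" by (intro dfi)
  let ?f = "lam c (trec ?H)"
  have d: "dom ?f = c" by (rule func_dom[OF lam_func_img[OF F]])
  have 1: "F1 (%b. pl (ap ?f b))" by (intro dfi)
  have e: "ap ?f b = tow b" if "b \<in> ext c" for b unfolding tow_def by (rule ap_lam[OF F that])
  have "tow c = ?H ?f" unfolding tow_def by (rule trec_eq[OF H assms])
  then have "ext (tow c) = {t. \<exists>b\<in>ext c. t \<in> ext (pl (ap ?f b))}" unfolding d by (simp add: ext_img[OF 1])
  then show ?thesis using e by auto
qed

lemma tow_mono: assumes "ordinal c" "b \<in> ext c" shows "ext (tow b) \<subseteq> ext (tow c)"
  unfolding subset_iff tow[OF assms(1)] tow[OF ord_mem[OF assms]] using ord_trans[OF assms] by blast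

lemma good_tow: assumes "ordinal c" shows "good (tow c)"
proof (rule ord_induct[OF assms])
  show "D1 (%c. good (tow c))" by (intro dfi)
  fix c assume c: "ordinal c" and IH: "\<And>b. b \<in> ext c ==> good (tow b)"
  have two: "\<exists>b\<in>ext c. s \<in> ext (pl (tow b)) \<and> t \<in> ext (pl (tow b))" if st: "s \<in> ext (tow c)" "t \<in> ext (tow c)" for s t
  proof -
    have inc: "ext (pl (tow a)) \<subseteq> ext (pl (tow b))" if ab: "a \<in> ext b" "b \<in> ext c" for a b
      using tow[OF ord_mem[OF c ab(2)]] ab(1) good_sub_pl[OF IH[OF ab(2)]] by blast
    obtain a b where ab: "a \<in> ext c" "b \<in> ext c" "s \<in> ext (pl (tow a))" "t \<in> ext (pl (tow b))" using st unfolding tow[OF c] by blast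
    consider "a \<in> ext b" | "a = b" | "b \<in> ext a" using ord_linear[OF ord_mem[OF c ab(1)] ord_mem[OF c ab(2)]] by blast
    then show ?thesis
    proof cases
      case 1 then show ?thesis using inc[OF 1 ab(2)] ab by blast
    next
      case 2 then show ?thesis using ab by blast
    next
      case 3 then show ?thesis using inc[OF 3 ab(1)] ab by blast
    qed
  qed
  have "ext (tow c) \<subseteq> ext X" unfolding subset_iff tow[OF c] pl by blast
  moreover have "\<exists>s\<in>ext (tow c). ap s x = y" if t: "t \<in> ext (tow c)" and x: "x \<in> ext reals" and y: "y \<in> ext (ap t x)" for t x y
  proof -
    obtain b where b: "b \<in> ext c" "t \<in> ext (pl (tow b))" using t unfolding tow[OF c] by blast
    then obtain s where "s \<in> ext (tow b)" "ap s x = y" using x y unfolding pl by blast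
    then show ?thesis using tow_mono[OF c b(1)] by blast
  qed
  moreover have "EqS s t \<in> ext L \<and> MemS s t \<in> ext L" if st: "s \<in> ext (tow c)" "t \<in> ext (tow c)" for s t
  proof -
    obtain b where b: "b \<in> ext c" "s \<in> ext (pl (tow b))" "t \<in> ext (pl (tow b))" using two[OF st] by blast
    then show ?thesis using good_pl[OF IH[OF b(1)]] unfolding good_def by blast
  qed
  ultimately show "good (tow c)" unfolding good_def by simp
qed

text \<open>All stages of the tower are subsets of \<open>X\<close>. By replacement some ordinal
  lies beyond the first appearance of every name that ever occurs, and the stage there is closed
  under \<open>pl\<close>.\<close>

lemma good_closed: "\<exists>N. good N \<and> ext (pl N) \<subseteq> ext N"
proof -
  let ?P = "%t c. ordinal c \<and> t \<in> ext (tow c)"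
  define NN where "NN = sep X (%t. \<exists>c. ?P t c)"
  have NN: "t \<in> ext NN \<longleftrightarrow> t \<in> ext X \<and> (\<exists>c. ?P t c)" for t unfolding NN_def by (subst ext_sep) (intro dfi, simp)
  let ?F = "%t. dsc (%c. ?P t c \<and> (\<forall>b\<in>ext c. \<not> ?P t b))"
  have F: "F1 ?F" by (intro dfi)
  have Fp: "?P t (?F t)" if "t \<in> ext NN" for t
  proof -
    obtain c where c: "?P t c" using \<open>t \<in> ext NN\<close> unfolding NN by blast
    have d: "D1 (?P t)" by (intro dfi)
    obtain b where b: "ordinal b" "?P t b" "\<And>d. d \<in> ext b ==> \<not> ?P t d" using ord_least[OF d, of c] c by blast
    have "?F t = b"
    proof (rule dsc_eq)
      show "?P t b \<and> (\<forall>d\<in>ext b. \<not> ?P t d)" using b by blast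
      fix k assume k: "?P t k \<and> (\<forall>d\<in>ext k. \<not> ?P t d)"
      then show "k = b" using ord_linear[of k b] b by blast
    qed
    then show ?thesis using b(2) by simp
  qed
  let ?A = "img ?F NN"
  have A: "ordinal a" if "a \<in> ext ?A" for a using Fp \<open>a \<in> ext ?A\<close> unfolding ext_img[OF F] by blast
  let ?c = "succ (un ?A)"
  have c: "ordinal ?c" "\<And>a. a \<in> ext ?A ==> a \<in> ext ?c" using ord_bound[of ?A] A by blast+
  have sub: "ext NN \<subseteq> ext (tow ?c)"
  proof
    fix t assume t: "t \<in> ext NN"
    have "?F t \<in> ext ?A" unfolding ext_img[OF F] using t by (rule imageI)
    from tow_mono[OF c(1) c(2)[OF this]] Fp[OF t] show "t \<in> ext (tow ?c)" by blast
  qed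
  have tX: "ext (pl N) \<subseteq> ext X" for N unfolding pl subset_iff by blast
  have "ext (pl (tow ?c)) \<subseteq> ext (tow (succ ?c))" using tow[OF ord_succ[OF c(1)]] by auto
  then have "ext (pl (tow ?c)) \<subseteq> ext NN" using tX[of "tow ?c"] ord_succ[OF c(1)] unfolding subset_iff NN by blast
  then show ?thesis using good_tow[OF c(1)] sub by blast
qed

end

locale names = name_space +
  fixes N :: 'a
  assumes gN: "good N" and plN: "ext (pl N) \<subseteq> ext N"
begin

lemma nX: "t \<in> ext N ==> t \<in> ext X" and nEq: "s \<in> ext N ==> t \<in> ext N ==> EqS s t \<in> ext L"
  and nMem: "s \<in> ext N ==> t \<in> ext N ==> MemS s t \<in> ext L"
  using gN unfolding good_def by blast+
text \<open>As \<open>N\<close> is a fixed point of \<open>pl\<close>, names for ever higher levels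
  pass this test and enter \<open>N\<close> without further stages.\<close>

lemma nI: assumes "t \<in> ext X" "\<And>x y. x \<in> ext reals ==> y \<in> ext (ap t x) ==> \<exists>s\<in>ext N. ap s x = y"
    "\<And>s. s \<in> ext N ==> MemS s t \<in> ext L" shows "t \<in> ext N"
proof -
  have "t \<in> ext (pl N)" unfolding pl using assms by blast
  then show ?thesis using plN by blast
qed

lemma Kc_N: assumes a: "a \<in> ext X" and b: "\<And>b. b \<in> ext a ==> Kc b \<in> ext N" shows "Kc a \<in> ext N"
proof (rule nI[OF Kc_X[OF a]])
  fix x y assume x: "x \<in> ext reals" and y: "y \<in> ext (ap (Kc a) x)"
  have "Kc y \<in> ext N" using b y unfolding ap_Kc[OF x] .
  then show "\<exists>s\<in>ext N. ap s x = y" using ap_Kc[OF x] by blast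
next
  fix s assume s: "s \<in> ext N"
  show "MemS s (Kc a) \<in> ext L"
  proof (rule L_UN[where I=a and F="%b. EqS s (Kc b)"])
    show "F1 (%b. EqS s (Kc b))" by (intro dfi)
    show "\<And>b'. b' \<in> ext a ==> EqS s (Kc b') \<in> ext L" using nEq[OF s] b by blast
    show "MemS s (Kc a) \<in> ext X" by (rule MemS_X[OF nX[OF s] Kc_X[OF a]])
    show "ext (MemS s (Kc a)) \<subseteq> ext reals" using MemS by blast
    show "\<And>x. x \<in> ext reals ==> x \<in> ext (MemS s (Kc a)) \<longleftrightarrow> (\<exists>i\<in>ext a. x \<in> ext (EqS s (Kc i)))"
      unfolding MemS EqS by (auto simp: ap_Kc)
  qed
qed

lemma Kc_ord: assumes "ordinal a" "a \<in> ext X" shows "Kc a \<in> ext N"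
proof -
  have "a \<in> ext X --> Kc a \<in> ext N"
  proof (rule ord_induct[OF assms(1)])
    show "D1 (%a. a \<in> ext X --> Kc a \<in> ext N)" by (intro dfi)
    fix b assume b: "ordinal b" "\<And>c. c \<in> ext b ==> c \<in> ext X --> Kc c \<in> ext N"
    show "b \<in> ext X --> Kc b \<in> ext N"
    proof
      assume bX: "b \<in> ext X"
      show "Kc b \<in> ext N" by (rule Kc_N[OF bX]) (use b(2) ord_X[OF bX b(1)] in blast)
    qed
  qed
  then show ?thesis using assms(2) by blast
qed
lemma Kc_S: "Kc S \<in> ext N" by (rule Kc_N[OF S_X]) (use S_ord Kc_ord in blast)
lemma omX: "n \<in> ext omega ==> n \<in> ext X" using ord_X[OF om_X ord_omega] by blast
lemma Kc_up: "a \<in> ext X ==> b \<in> ext X ==> Kc a \<in> ext N ==> Kc b \<in> ext N ==> Kc (up a b) \<in> ext N"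
  by (rule Kc_N[OF up_X]) auto
lemma Kc_op: assumes "i \<in> ext omega" "j \<in> ext omega" shows "Kc (opair i j) \<in> ext N"
proof -
  have 1: "Kc i \<in> ext N" "Kc j \<in> ext N" using Kc_ord omega_ord omX assms by blast+
  show ?thesis unfolding opair_up by (intro Kc_up up_X 1 omX assms)
qed

text \<open>A real is a set of pairs of natural numbers, so membership in \<open>x\<close> is a
  union, over these pairs, of an equality with a constant name intersected with a basic set. This is
  where the basic sets in \<open>L\<close> enter.\<close>

lemma idR_N: "idR \<in> ext N"
proof (rule nI[OF idR_X])
  fix x y assume x: "x \<in> ext reals" and y: "y \<in> ext (ap idR x)"
  have f: "func x omega omega" using x ext_reals by blast
  have "y \<in> ext x" using y unfolding ap_idR[OF x] .
  then obtain i j where "y = opair i j" "i \<in> ext omega" "j \<in> ext omega" using f unfolding func_def by auto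
  then show "\<exists>s\<in>ext N. ap s x = y" using ap_Kc[OF x] Kc_op by blast
next
  fix s assume s: "s \<in> ext N"
  show "MemS s idR \<in> ext L"
  proof (rule L_UN[where I="cprod omega omega" and F="%p. ri (EqS s (Kc p)) (bs p)"])
    show "F1 (%p. ri (EqS s (Kc p)) (bs p))" by (intro dfi)
    show "ri (EqS s (Kc p)) (bs p) \<in> ext L" if p: "p \<in> ext (cprod omega omega)" for p
    proof -
      obtain i j where "p = opair i j" "i \<in> ext omega" "j \<in> ext omega" using p by auto
      then show ?thesis using L_ri[OF nEq[OF s Kc_op] L_bs] by blast
    qed
    show "MemS s idR \<in> ext X" by (rule MemS_X[OF nX[OF s] idR_X])
    show "ext (MemS s idR) \<subseteq> ext reals" using MemS by blast
    fix x assume x: "x \<in> ext reals"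
    have sub: "ext x \<subseteq> ext (cprod omega omega)" using x unfolding ext_reals func_def by blast
    show "x \<in> ext (MemS s idR) \<longleftrightarrow> (\<exists>p\<in>ext (cprod omega omega). x \<in> ext (ri (EqS s (Kc p)) (bs p)))"
      unfolding ri bs EqS MemS ap_idR[OF x] ap_Kc[OF x] using x sub by blast
  qed
qed

lemma fin_X: assumes n: "n \<in> ext omega" and Z: "ext Z \<subseteq> ext X" and s: "func s n Z" shows "s \<in> ext X"
proof -
  have "\<forall>s. func s n Z --> s \<in> ext X"
  proof (rule omega_induct[OF n])
    show "D1 (%n. \<forall>s. func s n Z --> s \<in> ext X)" by (intro dfi)
    show "\<forall>s. func s empty Z --> s \<in> ext X"
    proof (intro allI impI)
      fix s assume "func s empty Z"
      then have "ext s \<subseteq> {}" unfolding func_def by auto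
      then have "s = empty" by simp
      then show "s \<in> ext X" using emp_X by simp
    qed
    fix n assume n: "n \<in> ext omega" "\<forall>s. func s n Z --> s \<in> ext X"
    show "\<forall>s. func s (succ n) Z --> s \<in> ext X"
    proof (intro allI impI)
      fix s assume s: "func s (succ n) Z"
      note d = snoc_decomp[OF s]
      have "ins n (restr s n) (ap s n) \<in> ext X" using n d(1,2) Z omX by (intro ins_X) blast+
      then show "s \<in> ext X" using d(3) unfolding ins_snoc[OF d(1)] by simp
    qed
  qed
  then show ?thesis using s by blast
qed

definition NL :: "'a => 'a" where "NL c = sep N (%t. \<forall>x\<in>ext reals. ap t x \<in> ext (Lv S x c))"
lemma F1_NL: "F1 NL" by (intro F1I, unfold NL_def, intro dfi)
lemmas [dfi] = F1D[OF F1_NL]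
lemma NL: "t \<in> ext (NL c) \<longleftrightarrow> t \<in> ext N \<and> (\<forall>x\<in>ext reals. ap t x \<in> ext (Lv S x c))"
  unfolding NL_def by (subst ext_sep) (intro dfi, simp)
definition Cv :: "'a => bool" where "Cv c \<longleftrightarrow> (\<forall>x\<in>ext reals. \<forall>a\<in>ext (Lv S x c). \<exists>t\<in>ext (NL c). ap t x = a)"
lemma DF_Cv[dfi]: assumes "DT t" shows "DF (%e. Cv (t e))"
  by (rule DF1[where P=Cv, OF _ assms]) (unfold Cv_def, intro dfi)

text \<open>\<open>r\<close> names a definable relation for all \<open>x\<close> at once, so that
  membership of a named tuple in it has a truth value as a set of reals.\<close>

definition gr :: "'a => 'a => 'a => bool" where
  "gr c n r \<longleftrightarrow> n \<in> ext omega \<and> r \<in> ext X \<and> (\<forall>x\<in>ext reals. dr S x (Lv S x c) n (ap r x)) \<and>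
    (\<forall>s. func s n (NL c) --> MemS (Ev s) r \<in> ext L)"
lemma DF_gr[dfi]: assumes "DT t" "DT u" "DT v" shows "DF (%e. gr (t e) (u e) (v e))"
  by (rule DF3[where P=gr, OF _ assms]) (unfold gr_def, intro dfi)

context
  fixes c assumes c: "c \<in> ext X" "ordinal c" and Cv: "Cv c"
begin

lemma NLx: "t \<in> ext (NL c) ==> x \<in> ext reals ==> ap t x \<in> ext (Lv S x c)" unfolding NL by blast
lemma NLN: "t \<in> ext (NL c) ==> t \<in> ext N" unfolding NL by blast
lemma NLX: "ext (NL c) \<subseteq> ext X" using NLN nX by blast
lemma Evf: "func s n (NL c) ==> x \<in> ext reals ==> func (ap (Ev s) x) n (Lv S x c)"
  by (rule Ev_func) (auto intro: NLx)

lemma grI: assumes "n \<in> ext omega" "r = lam reals F" "F1 F" "r \<in> ext X"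
    "\<And>x. x \<in> ext reals ==> dr S x (Lv S x c) n (F x)"
    "\<And>s. func s n (NL c) ==> \<exists>A\<in>ext L. \<forall>x\<in>ext reals. x \<in> ext A \<longleftrightarrow> ap (Ev s) x \<in> ext (F x)"
    "ext L \<subseteq> {A. ext A \<subseteq> ext reals}"
  shows "gr c n r"
proof -
  have e: "ap r x = F x" if "x \<in> ext reals" for x unfolding assms(2) by (rule ap_lam[OF assms(3) that])
  have "MemS (Ev s) r \<in> ext L" if s: "func s n (NL c)" for s
  proof -
    obtain A where A: "A \<in> ext L" "\<forall>x\<in>ext reals. x \<in> ext A \<longleftrightarrow> ap (Ev s) x \<in> ext (F x)" using assms(6)[OF s] by blast
    have AR: "ext A \<subseteq> ext reals" using A(1) assms(7) by blast
    have "A = MemS (Ev s) r"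
    proof (rule ext_inject, rule set_eqI)
      fix x show "x \<in> ext A \<longleftrightarrow> x \<in> ext (MemS (Ev s) r)"
      proof (cases "x \<in> ext reals")
        case True then show ?thesis unfolding MemS e[OF True] using A(2) by blast
      next
        case False then show ?thesis unfolding MemS using AR by blast
      qed
    qed
    then show ?thesis using A(1) by simp
  qed
  then show ?thesis unfolding gr_def using assms(1,4,5) e by simp
qed

context
  assumes LR: "ext L \<subseteq> {A. ext A \<subseteq> ext reals}"
begin

lemma gr_rM: assumes n: "n \<in> ext omega" "i \<in> ext n" "j \<in> ext n" shows "gr c n (lam reals (%x. rM (Lv S x c) n i j))"
proof (rule grI[OF n(1) refl _ _ _ _ LR])
  show "F1 (%x. rM (Lv S x c) n i j)" unfolding rM_def by (intro dfi)
  show "lam reals (%x. rM (Lv S x c) n i j) \<in> ext X" by (intro rM_X c omX n(1) omega_trans[OF n(1) n(2)] omega_trans[OF n(1) n(3)])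
  show "\<And>x. x \<in> ext reals ==> dr S x (Lv S x c) n (rM (Lv S x c) n i j)" by (rule dr_dc(1)[OF n])
  fix s assume s: "func s n (NL c)"
  have "MemS (ap s i) (ap s j) \<in> ext L" by (rule nMem) (use func_ap_in[OF s] n NLN in blast)+
  moreover have "x \<in> ext (MemS (ap s i) (ap s j)) \<longleftrightarrow> ap (Ev s) x \<in> ext (rM (Lv S x c) n i j)" if x: "x \<in> ext reals" for x
    unfolding MemS ext_rM mem_Collect_eq ap_Ev_ap[OF x s n(2)] ap_Ev_ap[OF x s n(3)] using Evf[OF s x] x by blast
  ultimately show "\<exists>A\<in>ext L. \<forall>x\<in>ext reals. x \<in> ext A \<longleftrightarrow> ap (Ev s) x \<in> ext (rM (Lv S x c) n i j)" by blast
qed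

lemma gr_rE: assumes n: "n \<in> ext omega" "i \<in> ext n" "j \<in> ext n" shows "gr c n (lam reals (%x. rE (Lv S x c) n i j))"
proof (rule grI[OF n(1) refl _ _ _ _ LR])
  show "F1 (%x. rE (Lv S x c) n i j)" unfolding rE_def by (intro dfi)
  show "lam reals (%x. rE (Lv S x c) n i j) \<in> ext X" by (intro rE_X c omX n(1) omega_trans[OF n(1) n(2)] omega_trans[OF n(1) n(3)])
  show "\<And>x. x \<in> ext reals ==> dr S x (Lv S x c) n (rE (Lv S x c) n i j)" by (rule dr_dc(2)[OF n])
  fix s assume s: "func s n (NL c)"
  have "EqS (ap s i) (ap s j) \<in> ext L" by (rule nEq) (use func_ap_in[OF s] n NLN in blast)+
  moreover have "x \<in> ext (EqS (ap s i) (ap s j)) \<longleftrightarrow> ap (Ev s) x \<in> ext (rE (Lv S x c) n i j)" if x: "x \<in> ext reals" for x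
    unfolding EqS ext_rE mem_Collect_eq ap_Ev_ap[OF x s n(2)] ap_Ev_ap[OF x s n(3)] using Evf[OF s x] x by blast
  ultimately show "\<exists>A\<in>ext L. \<forall>x\<in>ext reals. x \<in> ext A \<longleftrightarrow> ap (Ev s) x \<in> ext (rE (Lv S x c) n i j)" by blast
qed

lemma gr_rPS: assumes n: "n \<in> ext omega" "i \<in> ext n" shows "gr c n (lam reals (%x. rP S (Lv S x c) n i))"
proof (rule grI[OF n(1) refl _ _ _ _ LR])
  show "F1 (%x. rP S (Lv S x c) n i)" unfolding rP_def by (intro dfi)
  show "lam reals (%x. rP S (Lv S x c) n i) \<in> ext X" by (intro rPS_X c omX n(1) omega_trans[OF n])
  show "\<And>x. x \<in> ext reals ==> dr S x (Lv S x c) n (rP S (Lv S x c) n i)" by (rule dr_dc(3)[OF n])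
  fix s assume s: "func s n (NL c)"
  have "MemS (ap s i) (Kc S) \<in> ext L" by (rule nMem[OF _ Kc_S]) (use func_ap_in[OF s] n NLN in blast)
  moreover have "x \<in> ext (MemS (ap s i) (Kc S)) \<longleftrightarrow> ap (Ev s) x \<in> ext (rP S (Lv S x c) n i)" if x: "x \<in> ext reals" for x
    unfolding MemS ext_rP mem_Collect_eq ap_Ev_ap[OF x s n(2)] ap_Kc[OF x] using Evf[OF s x] x by blast
  ultimately show "\<exists>A\<in>ext L. \<forall>x\<in>ext reals. x \<in> ext A \<longleftrightarrow> ap (Ev s) x \<in> ext (rP S (Lv S x c) n i)" by blast
qed

lemma gr_rPx: assumes n: "n \<in> ext omega" "i \<in> ext n" shows "gr c n (lam reals (%x. rP x (Lv S x c) n i))"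
proof (rule grI[OF n(1) refl _ _ _ _ LR])
  show "F1 (%x. rP x (Lv S x c) n i)" unfolding rP_def by (intro dfi)
  show "lam reals (%x. rP x (Lv S x c) n i) \<in> ext X" by (intro rPx_X c omX n(1) omega_trans[OF n])
  show "\<And>x. x \<in> ext reals ==> dr S x (Lv S x c) n (rP x (Lv S x c) n i)" by (rule dr_dc(4)[OF n])
  fix s assume s: "func s n (NL c)"
  have "MemS (ap s i) idR \<in> ext L" by (rule nMem[OF _ idR_N]) (use func_ap_in[OF s] n NLN in blast)
  moreover have "x \<in> ext (MemS (ap s i) idR) \<longleftrightarrow> ap (Ev s) x \<in> ext (rP x (Lv S x c) n i)" if x: "x \<in> ext reals" for x
    unfolding MemS ext_rP mem_Collect_eq ap_Ev_ap[OF x s n(2)] ap_idR[OF x] using Evf[OF s x] x by blast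
  ultimately show "\<exists>A\<in>ext L. \<forall>x\<in>ext reals. x \<in> ext A \<longleftrightarrow> ap (Ev s) x \<in> ext (rP x (Lv S x c) n i)" by blast
qed

lemma grD: assumes "gr c n r"
  shows "n \<in> ext omega" "r \<in> ext X" "\<And>x. x \<in> ext reals ==> dr S x (Lv S x c) n (ap r x)" "\<And>s. func s n (NL c) ==> MemS (Ev s) r \<in> ext L"
  using assms unfolding gr_def by blast+

lemma gr_rC: assumes r: "gr c n r" shows "gr c n (lam reals (%x. rC (Lv S x c) n (ap r x)))"
proof (rule grI[OF grD(1)[OF r] refl _ _ _ _ LR])
  show "F1 (%x. rC (Lv S x c) n (ap r x))" by (intro dfi)
  show "lam reals (%x. rC (Lv S x c) n (ap r x)) \<in> ext X" by (intro rC_X c omX grD[OF r])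
  show "\<And>x. x \<in> ext reals ==> dr S x (Lv S x c) n (rC (Lv S x c) n (ap r x))" by (intro dr_dc(5) grD[OF r])
  fix s assume s: "func s n (NL c)"
  have "rc (MemS (Ev s) r) \<in> ext L" by (rule L_rc[OF grD(4)[OF r s]])
  moreover have "x \<in> ext (rc (MemS (Ev s) r)) \<longleftrightarrow> ap (Ev s) x \<in> ext (rC (Lv S x c) n (ap r x))" if x: "x \<in> ext reals" for x
    unfolding rc MemS ext_rC mem_Collect_eq using Evf[OF s x] x by blast
  ultimately show "\<exists>A\<in>ext L. \<forall>x\<in>ext reals. x \<in> ext A \<longleftrightarrow> ap (Ev s) x \<in> ext (rC (Lv S x c) n (ap r x))" by blast
qed

lemma gr_rI: assumes r: "gr c n r" and r': "gr c n r'" shows "gr c n (lam reals (%x. rI (ap r x) (ap r' x)))"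
proof (rule grI[OF grD(1)[OF r] refl _ _ _ _ LR])
  show "F1 (%x. rI (ap r x) (ap r' x))" by (intro dfi)
  show "lam reals (%x. rI (ap r x) (ap r' x)) \<in> ext X" by (intro rI_X grD[OF r] grD[OF r'])
  show "\<And>x. x \<in> ext reals ==> dr S x (Lv S x c) n (rI (ap r x) (ap r' x))" by (intro dr_dc(6) grD[OF r] grD[OF r'])
  fix s assume s: "func s n (NL c)"
  have "ri (MemS (Ev s) r) (MemS (Ev s) r') \<in> ext L" by (rule L_ri[OF grD(4)[OF r s] grD(4)[OF r' s]])
  moreover have "x \<in> ext (ri (MemS (Ev s) r) (MemS (Ev s) r')) \<longleftrightarrow> ap (Ev s) x \<in> ext (rI (ap r x) (ap r' x))" if x: "x \<in> ext reals" for x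
    unfolding ri MemS ext_rI using x by blast
  ultimately show "\<exists>A\<in>ext L. \<forall>x\<in>ext reals. x \<in> ext A \<longleftrightarrow> ap (Ev s) x \<in> ext (rI (ap r x) (ap r' x))" by blast
qed

lemma Cvx: "x \<in> ext reals ==> a \<in> ext (Lv S x c) ==> \<exists>t\<in>ext (NL c). ap t x = a" using Cv unfolding Cv_def by blast
lemma Evs: "x \<in> ext reals ==> func s n (NL c) ==> t \<in> ext (NL c) ==> ap (Ev (snoc s t)) x = ins n (ap (Ev s) x) (ap t x)"
  by (rule Ev_snoc) (auto intro: NLx)

text \<open>By \<open>Cv\<close> every element of the level has a name in \<open>NL c\<close>, so
  projection becomes a union over names. Its truth value is an element of \<open>X\<close> because
  \<open>Ev s\<close> and the name of the projection are.\<close>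

lemma gr_rJ: assumes r: "gr c (succ n) r" and n: "n \<in> ext omega" shows "gr c n (lam reals (%x. rJ (Lv S x c) n (ap r x)))"
proof (rule grI[OF n refl _ _ _ _ LR])
  show F: "F1 (%x. rJ (Lv S x c) n (ap r x))" by (intro dfi)
  show X: "lam reals (%x. rJ (Lv S x c) n (ap r x)) \<in> ext X" by (intro rJ_X c omX n grD[OF r])
  show "\<And>x. x \<in> ext reals ==> dr S x (Lv S x c) n (rJ (Lv S x c) n (ap r x))" by (intro dr_dc(7)[OF n] grD[OF r])
  fix s assume s: "func s n (NL c)"
  let ?r = "lam reals (%x. rJ (Lv S x c) n (ap r x))"
  have sX: "s \<in> ext X" by (rule fin_X[OF n NLX s])
  have "MemS (Ev s) ?r \<in> ext L"
  proof (rule L_UN[where I="NL c" and F="%t. MemS (Ev (snoc s t)) r"])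
    show "F1 (%t. MemS (Ev (snoc s t)) r)" by (intro dfi)
    show "\<And>t. t \<in> ext (NL c) ==> MemS (Ev (snoc s t)) r \<in> ext L" by (rule grD(4)[OF r snoc_func[OF s]])
    show "MemS (Ev s) ?r \<in> ext X" by (intro MemS_X Ev_X sX X)
    show "ext (MemS (Ev s) ?r) \<subseteq> ext reals" using MemS by blast
    fix x assume x: "x \<in> ext reals"
    have "(\<exists>a\<in>ext (Lv S x c). ins n (ap (Ev s) x) a \<in> ext (ap r x)) \<longleftrightarrow> (\<exists>t\<in>ext (NL c). ap (Ev (snoc s t)) x \<in> ext (ap r x))"
    proof
      assume "\<exists>a\<in>ext (Lv S x c). ins n (ap (Ev s) x) a \<in> ext (ap r x)"
      then obtain a where a: "a \<in> ext (Lv S x c)" "ins n (ap (Ev s) x) a \<in> ext (ap r x)" by blast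
      obtain t where t: "t \<in> ext (NL c)" "ap t x = a" using Cvx[OF x a(1)] by blast
      have "ap (Ev (snoc s t)) x \<in> ext (ap r x)" using a(2) unfolding Evs[OF x s t(1)] t(2) .
      then show "\<exists>t\<in>ext (NL c). ap (Ev (snoc s t)) x \<in> ext (ap r x)" using t(1) by blast
    next
      assume "\<exists>t\<in>ext (NL c). ap (Ev (snoc s t)) x \<in> ext (ap r x)"
      then obtain t where t: "t \<in> ext (NL c)" "ap (Ev (snoc s t)) x \<in> ext (ap r x)" by blast
      then show "\<exists>a\<in>ext (Lv S x c). ins n (ap (Ev s) x) a \<in> ext (ap r x)" using NLx[OF t(1) x] unfolding Evs[OF x s t(1)] by blast
    qed
    then show "x \<in> ext (MemS (Ev s) ?r) \<longleftrightarrow> (\<exists>i\<in>ext (NL c). x \<in> ext (MemS (Ev (snoc s i)) r))"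
      unfolding MemS ap_lam[OF F x] ext_rJ mem_Collect_eq using x Evf[OF s x] by blast
  qed
  moreover have "x \<in> ext (MemS (Ev s) ?r) \<longleftrightarrow> ap (Ev s) x \<in> ext (rJ (Lv S x c) n (ap r x))" if x: "x \<in> ext reals" for x
    unfolding MemS ap_lam[OF F x] using x by blast
  ultimately show "\<exists>A\<in>ext L. \<forall>x\<in>ext reals. x \<in> ext A \<longleftrightarrow> ap (Ev s) x \<in> ext (rJ (Lv S x c) n (ap r x))" by blast
qed

text \<open>The internal formulas may be nonstandard, so the minimality in the definition of
  \<open>dr\<close> takes the place of an induction along them: the values at \<open>x0\<close> of
  all relation names form a \<open>dc\<close>-closed family.\<close>

lemma dr_gr: assumes x0: "x0 \<in> ext reals" and d: "dr S x0 (Lv S x0 c) n R" shows "\<exists>r. gr c n r \<and> ap r x0 = R"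
proof -
  let ?A = "Lv S x0 c"
  define Z where "Z = sep (cprod omega X) (%p. gr c (pfst p) (psnd p))"
  have Z: "opair n r \<in> ext Z \<longleftrightarrow> gr c n r" for n r
  proof -
    have "D1 (%p. gr c (pfst p) (psnd p))" by (intro dfi)
    from ext_sep[OF this] show ?thesis unfolding Z_def opair_mem_cprod[symmetric] using grD(1,2)[of n r] by (auto simp: opair_mem_cprod)
  qed
  have Zp: "\<exists>n r. p = opair n r" if "p \<in> ext Z" for p
  proof -
    have "D1 (%p. gr c (pfst p) (psnd p))" by (intro dfi)
    from ext_sep[OF this] show ?thesis using \<open>p \<in> ext Z\<close> unfolding Z_def by auto
  qed
  let ?F = "%p. opair (pfst p) (ap (psnd p) x0)"
  have F: "F1 ?F" by (intro dfi)
  define Fx where "Fx = img ?F Z"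
  have Fx: "opair n R \<in> ext Fx \<longleftrightarrow> (\<exists>r. gr c n r \<and> ap r x0 = R)" for n R
  proof
    assume "opair n R \<in> ext Fx"
    then obtain p where p: "p \<in> ext Z" "opair n R = ?F p" unfolding Fx_def ext_img[OF F] by blast
    obtain m r where mr: "p = opair m r" using Zp[OF p(1)] by blast
    then show "\<exists>r. gr c n r \<and> ap r x0 = R" using p Z[of m r] by auto
  next
    assume "\<exists>r. gr c n r \<and> ap r x0 = R"
    then obtain r where r: "gr c n r" "ap r x0 = R" by blast
    have "?F (opair n r) \<in> ext Fx" unfolding Fx_def ext_img[OF F] using r(1) unfolding Z[symmetric] by (rule imageI)
    then show "opair n R \<in> ext Fx" using r(2) by simp
  qed
  have l: "ap (lam reals H) x0 = H x0" if "F1 H" for H by (rule ap_lam[OF that x0])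
  have "dc S x0 ?A Fx" unfolding dc_def Fx
  proof (intro conjI ballI allI impI)
    fix n i j assume h: "n \<in> ext omega" "i \<in> ext n" "j \<in> ext n"
    show "\<exists>r. gr c n r \<and> ap r x0 = rM ?A n i j" by (rule exI, rule conjI[OF gr_rM[OF h]], rule l) (unfold rM_def, intro dfi)
    show "\<exists>r. gr c n r \<and> ap r x0 = rE ?A n i j" by (rule exI, rule conjI[OF gr_rE[OF h]], rule l) (unfold rE_def, intro dfi)
  next
    fix n i assume h: "n \<in> ext omega" "i \<in> ext n"
    show "\<exists>r. gr c n r \<and> ap r x0 = rP S ?A n i" by (rule exI, rule conjI[OF gr_rPS[OF h]], rule l) (unfold rP_def, intro dfi)
    show "\<exists>r. gr c n r \<and> ap r x0 = rP x0 ?A n i" by (rule exI, rule conjI[OF gr_rPx[OF h]], rule l) (unfold rP_def, intro dfi)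
  next
    fix n R assume "n \<in> ext omega \<and> (\<exists>r. gr c n r \<and> ap r x0 = R)"
    then obtain r where r: "gr c n r" "ap r x0 = R" by blast
    show "\<exists>r. gr c n r \<and> ap r x0 = rC ?A n R" unfolding r(2)[symmetric]
      by (rule exI, rule conjI[OF gr_rC[OF r(1)]], rule l) (intro dfi)
  next
    fix n R R' assume "n \<in> ext omega \<and> (\<exists>r. gr c n r \<and> ap r x0 = R) \<and> (\<exists>r. gr c n r \<and> ap r x0 = R')"
    then obtain r r' where r: "gr c n r" "ap r x0 = R" "gr c n r'" "ap r' x0 = R'" by blast
    show "\<exists>r. gr c n r \<and> ap r x0 = rI R R'" unfolding r(2)[symmetric] r(4)[symmetric]
      by (rule exI, rule conjI[OF gr_rI[OF r(1,3)]], rule l) (intro dfi)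
  next
    fix n R assume "n \<in> ext omega \<and> (\<exists>r. gr c (succ n) r \<and> ap r x0 = R)"
    then obtain r where r: "n \<in> ext omega" "gr c (succ n) r" "ap r x0 = R" by blast
    show "\<exists>r. gr c n r \<and> ap r x0 = rJ ?A n R" unfolding r(3)[symmetric]
      by (rule exI, rule conjI[OF gr_rJ[OF r(2,1)]], rule l) (intro dfi)
  qed
  then have "opair n R \<in> ext Fx" using d unfolding dr_def by blast
  then show ?thesis unfolding Fx .
qed

text \<open>An element of the next level is given by a definable relation and finitely many
  parameters. Both have names, and these are combined into a name of the set that they
  define.\<close>

lemma Cv_succ: "Cv (succ c)"
  unfolding Cv_def
proof (intro ballI)
  fix x0 a assume x0: "x0 \<in> ext reals" and a: "a \<in> ext (Lv S x0 (succ c))"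
  obtain n s0 R where n: "n \<in> ext omega" and s0: "func s0 n (Lv S x0 c)" and R: "dr S x0 (Lv S x0 c) (succ n) R"
    and aD: "a = Dset (Lv S x0 c) n s0 R" using a unfolding Lv_S[OF c(2)] ext_Df by blast
  obtain r where r: "gr c (succ n) r" "ap r x0 = R" using dr_gr[OF x0 R] by blast
  \<comment> \<open>Each parameter is replaced by its least name in the well-order of
    \<open>X\<close>, which avoids choice; being finite, the sequence of these names is itself an
    element of \<open>X\<close>.\<close>
  let ?G = "%i. lw w (sep (NL c) (%t. ap t x0 = ap s0 i))"
  have G: "F1 ?G" by (intro dfi)
  define s where "s = lam n ?G"
  have Gi: "?G i \<in> ext (NL c)" "ap (?G i) x0 = ap s0 i" if i: "i \<in> ext n" for i
  proof -
    have d: "D1 (%t. ap t x0 = ap s0 i)" by (intro dfi)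
    obtain t where t: "t \<in> ext (NL c)" "ap t x0 = ap s0 i" using Cvx[OF x0 func_ap_in[OF s0 i]] by blast
    have "?G i \<in> ext (sep (NL c) (%t. ap t x0 = ap s0 i))"
      by (rule lw(1)[OF wo, where x=t]) (use NLX t in \<open>auto simp: ext_sep[OF d]\<close>)
    then show "?G i \<in> ext (NL c)" "ap (?G i) x0 = ap s0 i" unfolding ext_sep[OF d] by blast+
  qed
  have s: "func s n (NL c)" unfolding s_def by (rule lam_func[OF G Gi(1)])
  have sX: "s \<in> ext X" by (rule fin_X[OF n NLX s])
  have Es: "ap (Ev s) x0 = s0"
  proof (rule func_eqI[OF Evf[OF s x0] s0])
    fix i assume i: "i \<in> ext n"
    show "ap (ap (Ev s) x0) i = ap s0 i" unfolding ap_Ev_ap[OF x0 s i] unfolding s_def ap_lam[OF G i] by (rule Gi(2)[OF i])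
  qed
  let ?T = "%x. Dset (Lv S x c) n (ap (Ev s) x) (ap r x)"
  have T: "F1 ?T" unfolding Dset_def by (intro dfi)
  define t where "t = lam reals ?T"
  have tx: "ap t x = ?T x" if "x \<in> ext reals" for x unfolding t_def by (rule ap_lam[OF T that])
  have tX: "t \<in> ext X" unfolding t_def by (intro Nm_X c omX n grD[OF r(1)] sX)
  have tN: "t \<in> ext N"
  proof (rule nI[OF tX])
    fix x y assume x: "x \<in> ext reals" and y: "y \<in> ext (ap t x)"
    have "y \<in> ext (Lv S x c)" using y unfolding tx[OF x] ext_Dset by blast
    then show "\<exists>s\<in>ext N. ap s x = y" using Cvx[OF x] NLN by blast
  next
    fix u assume u: "u \<in> ext N"
    \<comment> \<open>\<open>u\<close> belongs to the new set iff it equals some name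
      \<open>v\<close> from the level such that \<open>s\<close> followed by \<open>v\<close>
      satisfies the relation.\<close>
    show "MemS u t \<in> ext L"
    proof (rule L_UN[where I="NL c" and F="%v. ri (EqS u v) (MemS (Ev (snoc s v)) r)"])
      show "F1 (%v. ri (EqS u v) (MemS (Ev (snoc s v)) r))" by (intro dfi)
      show "\<And>v. v \<in> ext (NL c) ==> ri (EqS u v) (MemS (Ev (snoc s v)) r) \<in> ext L"
        using L_ri[OF nEq[OF u NLN] grD(4)[OF r(1) snoc_func[OF s]]] .
      show "MemS u t \<in> ext X" by (rule MemS_X[OF nX[OF u] tX])
      show "ext (MemS u t) \<subseteq> ext reals" using MemS by blast
      fix x assume x: "x \<in> ext reals"
      show "x \<in> ext (MemS u t) \<longleftrightarrow> (\<exists>v\<in>ext (NL c). x \<in> ext (ri (EqS u v) (MemS (Ev (snoc s v)) r)))"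
      proof
        assume "x \<in> ext (MemS u t)"
        then have h: "ap u x \<in> ext (Lv S x c)" "ins n (ap (Ev s) x) (ap u x) \<in> ext (ap r x)" unfolding MemS tx[OF x] ext_Dset by blast+
        obtain v where v: "v \<in> ext (NL c)" "ap v x = ap u x" using Cvx[OF x h(1)] by blast
        have "ap (Ev (snoc s v)) x \<in> ext (ap r x)" using h(2) unfolding Evs[OF x s v(1)] v(2) .
        then show "\<exists>v\<in>ext (NL c). x \<in> ext (ri (EqS u v) (MemS (Ev (snoc s v)) r))"
          unfolding ri EqS MemS using v x by (intro bexI[of _ v]) simp_all
      next
        assume "\<exists>v\<in>ext (NL c). x \<in> ext (ri (EqS u v) (MemS (Ev (snoc s v)) r))"
        then obtain v where v: "v \<in> ext (NL c)" "ap u x = ap v x" "ap (Ev (snoc s v)) x \<in> ext (ap r x)" unfolding ri EqS MemS by blast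
        have "ins n (ap (Ev s) x) (ap u x) \<in> ext (ap r x)" using v(3) unfolding Evs[OF x s v(1)] v(2) .
        moreover have "ap u x \<in> ext (Lv S x c)" using NLx[OF v(1) x] v(2) by simp
        ultimately show "x \<in> ext (MemS u t)" unfolding MemS tx[OF x] ext_Dset using x by blast
      qed
    qed
  qed
  have "ap t x \<in> ext (Lv S x (succ c))" if x: "x \<in> ext reals" for x
    unfolding Lv_S[OF c(2)] ext_Df tx[OF x] using n Evf[OF s x] grD(3)[OF r(1) x] by blast
  then have "t \<in> ext (NL (succ c))" unfolding NL using tN by blast
  moreover have "ap t x0 = a" unfolding tx[OF x0] Es r(2) aD ..
  ultimately show "\<exists>t\<in>ext (NL (succ c)). ap t x0 = a" by blast
qed

end
end

lemma Cv_all: assumes LR: "ext L \<subseteq> {A. ext A \<subseteq> ext reals}" and c: "ordinal c" "c \<in> ext X" shows "Cv c"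
proof -
  have "c \<in> ext X --> Cv c"
  proof (rule ord_induct[OF c(1)])
    show "D1 (%c. c \<in> ext X --> Cv c)" by (intro dfi)
    fix b assume b: "ordinal b" "\<And>d. d \<in> ext b ==> d \<in> ext X --> Cv d"
    show "b \<in> ext X --> Cv b"
    proof
      assume bX: "b \<in> ext X"
      have IH: "d \<in> ext X \<and> ordinal d \<and> Cv d" if "d \<in> ext b" for d using b(2)[OF that] ord_X[OF bX b(1)] that ord_mem[OF b(1) that] by blast
      consider "b = empty" | d where "b = succ d" | "limit b" using b(1) unfolding limit_def by blast
      then show "Cv b"
      proof cases
        case 1 then show ?thesis unfolding Cv_def by (simp add: Lv_0)
      next
        case (2 d) then show ?thesis using Cv_succ[of d] IH[of d] LR by simp
      next
        case 3
        show ?thesis unfolding Cv_def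
        proof (intro ballI)
          fix x a assume x: "x \<in> ext reals" and a: "a \<in> ext (Lv S x b)"
          obtain d where d: "d \<in> ext b" "a \<in> ext (Lv S x d)" using a unfolding Lv_L[OF 3] by blast
          obtain t where t: "t \<in> ext (NL d)" "ap t x = a" using IH[OF d(1)] d(2) x unfolding Cv_def by blast
          have "t \<in> ext (NL b)" using t(1) d(1) unfolding NL Lv_L[OF 3] by blast
          then show "\<exists>t\<in>ext (NL b). ap t x = a" using t(2) by blast
        qed
      qed
    qed
  qed
  then show ?thesis using c(2) by blast
qed

text \<open>Induction on the formula. A quantifier over \<open>L[S,x]\<close> becomes an
  intersection over the names in \<open>M\<close>. For the direction from names to all elements,
  \<open>wit_X\<close> provides an ordinal in \<open>X\<close> below which a counterexample occurs
  if there is one at all, and elements of these levels have names.\<close>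

lemma TS_L: assumes LR: "ext L \<subseteq> {A. ext A \<subseteq> ext reals}" shows "p \<in> \<Phi> ==> (\<And>i. e i \<in> ext N) ==> TS S p e \<in> ext L"
proof (induction p arbitrary: e)
  case (Mem i j)
  have "TS S (Mem i j) e = MemS (e i) (e j)" by (rule ext_inject, rule set_eqI, unfold TS MemS) (simp add: ext_def)
  then show ?case using nMem[OF Mem(2) Mem(2)] by simp
next
  case (Eq i j)
  have "TS S (Eq i j) e = EqS (e i) (e j)" by (rule ext_inject, rule set_eqI, unfold TS EqS) simp
  then show ?case using nEq[OF Eq(2) Eq(2)] by simp
next
  case (Neg p)
  have "TS S (Neg p) e = rc (TS S p e)" by (rule ext_inject, rule set_eqI, unfold TS rc) auto
  then show ?case using L_rc[OF Neg.IH[OF \<Phi>_sub(1)[OF Neg.prems(1)] Neg.prems(2)]] by simp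
next
  case (Conj p q)
  have "TS S (Conj p q) e = ri (TS S p e) (TS S q e)" by (rule ext_inject, rule set_eqI, unfold TS ri) auto
  then show ?case
    using L_ri[OF Conj.IH(1)[OF \<Phi>_sub(2)[OF Conj.prems(1)] Conj.prems(2)] Conj.IH(2)[OF \<Phi>_sub(3)[OF Conj.prems(1)] Conj.prems(2)]] by simp
next
  case (All i p)
  define M where "M = sep N (%t. \<forall>x\<in>ext reals. \<exists>c. ordinal c \<and> ap t x \<in> ext (Lv S x c))"
  have M: "t \<in> ext M \<longleftrightarrow> t \<in> ext N \<and> (\<forall>x\<in>ext reals. ap t x \<in> L_bracket S x)" for t
    unfolding M_def L_bracket_Lv by (subst ext_sep) (intro dfi, simp)
  have eX: "e j \<in> ext X" for j using All.prems(2) nX by blast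
  obtain c where c: "c \<in> ext X" "ordinal c" and
    w: "\<And>x. x \<in> ext reals ==> \<exists>a\<in>L_bracket S x. \<not> sat (L_bracket S x) p ((%j. ap (e j) x)(i := a)) ==>
        (\<exists>b\<in>ext c. \<exists>a\<in>ext (Lv S x b). \<not> sat (L_bracket S x) p ((%j. ap (e j) x)(i := a)))"
    using wit_X[where e=e, OF All.prems(1) eX] by blast
  have upd: "(%j. ap ((e(i := t)) j) x) = (%j. ap (e j) x)(i := ap t x)" for t x by auto
  show ?case
  proof (rule L_INT[where I=M and F="%t. TS S p (e(i := t))"])
    have "DT (%f. TS S p (%j. if j = i then f 0 else e j))" unfolding TS_def
    proof (rule DT_sep[where Q="%f x. sat (L_bracket S x) p (%j. ap (if j = i then f 0 else e j) x)"])
      show "DT (%f. reals)" by (rule DT_const)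
      show "DF (%f. sat (L_bracket S (f 0)) p (%j. ap (if j = i then f (Suc 0) else e j) (f 0)))"
        by (rule DF_satL) (auto intro!: dfi)
    qed
    moreover have "e(i := t) = (%j. if j = i then t else e j)" for t by auto
    ultimately show "F1 (%t. TS S p (e(i := t)))" unfolding F1_def by simp
    show "TS S p (e(i := t)) \<in> ext L" if t: "t \<in> ext M" for t
      by (rule All.IH[OF \<Phi>_sub(4)[OF All.prems(1)]]) (use t All.prems(2) in \<open>simp add: M\<close>)
    show "TS S (All i p) e \<in> ext X" by (rule TS_X[where e=e, OF All.prems(1) eX])
    show "ext (TS S (All i p) e) \<subseteq> ext reals" using TS by blast
    fix x assume x: "x \<in> ext reals"
    show "x \<in> ext (TS S (All i p) e) \<longleftrightarrow> (\<forall>t\<in>ext M. x \<in> ext (TS S p (e(i := t))))"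
    proof
      assume h: "x \<in> ext (TS S (All i p) e)"
      show "\<forall>t\<in>ext M. x \<in> ext (TS S p (e(i := t)))"
      proof
        fix t assume "t \<in> ext M"
        then have "ap t x \<in> L_bracket S x" using x unfolding M by blast
        then show "x \<in> ext (TS S p (e(i := t)))" using h unfolding TS upd by simp
      qed
    next
      assume h: "\<forall>t\<in>ext M. x \<in> ext (TS S p (e(i := t)))"
      show "x \<in> ext (TS S (All i p) e)"
      proof (rule ccontr)
        assume "x \<notin> ext (TS S (All i p) e)"
        then have "\<exists>a\<in>L_bracket S x. \<not> sat (L_bracket S x) p ((%j. ap (e j) x)(i := a))" using x unfolding TS by simp
        then obtain b a where b: "b \<in> ext c" "a \<in> ext (Lv S x b)" "\<not> sat (L_bracket S x) p ((%j. ap (e j) x)(i := a))"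
          using w[OF x] by blast
        have ob: "ordinal b" "b \<in> ext X" using ord_mem[OF c(2) b(1)] ord_X[OF c] b(1) by blast+
        obtain t where t: "t \<in> ext (NL b)" "ap t x = a" using Cv_all[OF LR ob] x b(2) unfolding Cv_def by blast
        have "t \<in> ext M" unfolding M L_bracket_Lv using t(1) ob(1) unfolding NL by blast
        then have "sat (L_bracket S x) p ((%j. ap (e j) x)(i := ap t x))" using h unfolding TS upd by blast
        then show False using b(3) t(2) by simp
      qed
    qed
  qed
qed

end

section \<open>A well-ordered set that is rich enough to evaluate the code\<close>

context zf_model
begin

text \<open>Assignments are packed into single elements because the closure of \<open>X\<close>
  works with unary operations. Only the variables below \<open>k\<close> are kept, which covers the
  free variables of all subformulas of the code.\<close>

primrec enc :: "nat => (nat => 'a) => 'a" where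
  "enc 0 e = empty"
| "enc (Suc k) e = opair (e k) (enc k e)"
primrec dec :: "nat => nat => 'a => 'a" where
  "dec 0 i d = empty"
| "dec (Suc k) i d = (if i = k then pfst d else dec k i (psnd d))"
lemma dec_enc: "i < k ==> dec k i (enc k e) = e i" by (induction k) auto
lemma DT_dec[dfi]: "DT t ==> DT (%e. dec k i (t e))"
proof (induction k arbitrary: t)
  case (Suc k)
  have "DT (%e. dec k i (psnd (t e)))" by (rule Suc.IH[OF DT_psnd[OF Suc.prems]])
  then show ?case using DT_pfst[OF Suc.prems] by (cases "i = k") auto
qed (simp add: DT_const)

definition nsat :: "'a => nat => nat => fm => 'a => 'a => 'a => bool" where
  "nsat S k i p d x a \<longleftrightarrow> \<not> sat (L_bracket S x) p (%j. if j = i then a else ap (dec k j d) x)"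
lemma DF_nsat[dfi]: assumes "DT t" "DT u" "DT v" shows "DF (%e. nsat S k i p (t e) (u e) (v e))"
  unfolding nsat_def by (rule DF_neg, rule DF_satL) (intro dfi assms)+
definition Tp :: "'a => nat => fm => 'a => 'a" where "Tp S k p d = TS S p (%j. dec k j d)"
lemma Tp_F1: "F1 (Tp S k p)"
proof -
  have "DT (%f. sep reals (%x. sat (L_bracket S x) p (%j. ap (dec k j (f 0)) x)))"
  proof (rule DT_sep[where Q="%f x. sat (L_bracket S x) p (%j. ap (dec k j (f 0)) x)"])
    show "DT (%f. reals)" by (rule DT_const)
    show "DF (%f. sat (L_bracket S (f 0)) p (%j. ap (dec k j (f (Suc 0))) (f 0)))" by (rule DF_satL) (intro dfi)+
  qed
  then show ?thesis unfolding F1_def Tp_def TS_def .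
qed
definition Wt :: "'a => nat => nat => fm => 'a => 'a => 'a => bool" where
  "Wt S k i p d x c \<longleftrightarrow> ordinal c \<and> (\<exists>a\<in>ext (Lv S x c). nsat S k i p d x a)"
lemma DF_Wt[dfi]: assumes "DT t" "DT u" "DT v" shows "DF (%e. Wt S k i p (t e) (u e) (v e))"
  by (rule DF3[where P="Wt S k i p", OF _ assms]) (unfold Wt_def, intro dfi)
text \<open>A reflection bound: an ordinal above the least levels at which counterexamples to
  \<open>All i p\<close> appear. It is taken over all reals together and hence does not depend on
  \<open>x\<close>.\<close>

definition Gp :: "'a => nat => nat => fm => 'a => 'a" where
  "Gp S k i p d = ob (img (%x. dsc (%c. Wt S k i p d x c \<and> (\<forall>b\<in>ext c. \<not> Wt S k i p d x b))) reals)"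
lemma Gp_F1: "F1 (Gp S k i p)" unfolding Gp_def by (intro dfi)

lemma Gp: assumes x: "x \<in> ext reals" and a: "a \<in> L_bracket S x" "nsat S k i p d x a"
  shows "\<exists>b\<in>ext (Gp S k i p d). \<exists>a\<in>ext (Lv S x b). nsat S k i p d x a"
proof -
  let ?P = "Wt S k i p d x"
  obtain c where c: "ordinal c" "?P c" using a unfolding L_bracket_Lv Wt_def by blast
  have d: "D1 ?P" by (intro dfi)
  obtain b where b: "ordinal b" "?P b" "\<And>c. c \<in> ext b ==> \<not> ?P c" using ord_least[OF d c] by blast
  let ?F = "%x. dsc (%c. Wt S k i p d x c \<and> (\<forall>b\<in>ext c. \<not> Wt S k i p d x b))"
  have F: "F1 ?F" by (intro dfi)
  have "?F x = b"
  proof (rule dsc_eq)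
    show "?P b \<and> (\<forall>c\<in>ext b. \<not> ?P c)" using b by blast
    fix k assume k: "?P k \<and> (\<forall>c\<in>ext k. \<not> ?P c)"
    then have "ordinal k" unfolding Wt_def by blast
    then show "k = b" using ord_linear[of k b] b k by blast
  qed
  then have "b \<in> ext (img ?F reals)" unfolding ext_img[OF F] using x by (intro image_eqI) simp_all
  then have "b \<in> ext (Gp S k i p d)" unfolding Gp_def using b(1) by (intro ob(2))
  then show ?thesis using b(2) unfolding Wt_def by blast
qed

text \<open>The conditions that \<open>name_space\<close> puts on \<open>L\<close>. In the last one
  \<open>Z\<close> is any subset of \<open>L\<close>; it is the resulting intersection that has to
  belong to \<open>X\<close>.\<close>

definition bclosed :: "'a => 'a => bool" where
  "bclosed X L \<longleftrightarrow> ext L \<subseteq> {A. ext A \<subseteq> ext reals} \<and> (\<forall>i\<in>ext omega. \<forall>j\<in>ext omega. bs (opair i j) \<in> ext L) \<and>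
    (\<forall>A\<in>ext L. rc A \<in> ext L) \<and> (\<forall>A\<in>ext L. \<forall>B\<in>ext L. ri A B \<in> ext L) \<and>
    (\<forall>A\<in>ext X. \<forall>Z. ext Z \<subseteq> ext L --> ext A = {x \<in> ext reals. \<forall>B\<in>ext Z. x \<in> ext B} --> A \<in> ext L)"

text \<open>The set \<open>X\<close> is closed under everything that is needed to evaluate the code, so each set of
  reals met during the evaluation, and in particular each infinitary intersection, belongs to \<open>X\<close>.\<close>

lemma borel_closure:
  assumes Y: "infinity_Borel_code S \<phi> Y" and Gs: "\<And>G. G \<in> set Gs ==> F1 G"
  obtains X w where "WO w X" "omega \<in> ext X" "\<And>c. c \<in> ext X ==> ordinal c ==> ext c \<subseteq> ext X"
    "\<And>a b. a \<in> ext X ==> b \<in> ext X ==> opair a b \<in> ext X"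
    "\<And>G a. G \<in> set Gs ==> a \<in> ext X ==> G a \<in> ext X"
    "\<And>a. a \<in> ext X ==> rc a \<in> ext X" "\<And>a b. a \<in> ext X ==> b \<in> ext X ==> ri a b \<in> ext X"
    "\<And>i j. i \<in> ext omega ==> j \<in> ext omega ==> bs (opair i j) \<in> ext X" "Y \<in> ext X"
    "\<And>L. bclosed X L ==> Y \<in> ext L"
proof -
  obtain k where k: "\<And>q. q \<in> set (subs \<phi>) ==> fv q \<subseteq> {..<k}" using fv_bound by blast
  have So: "\<And>a. a \<in> ext S ==> ordinal a" and Ye: "ext Y = {x \<in> ext reals. sat (L_bracket S x) \<phi> ((%_. S)(1 := x))}"
    using Y unfolding infinity_Borel_code_def by blast+
  \<comment> \<open>Starting from an ordinal above \<omega> and above the elements of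
    \<open>S\<close> places all of these into \<open>X\<close>. The set \<open>S\<close> itself is
    added by a constant operation in the list \<open>F1s\<close>.\<close>
  let ?B = "bun S (up omega omega)"
  have "ordinal a" if "a \<in> ext ?B" for a using that So by auto
  from ord_bound[of ?B, OF this] obtain \<gamma> where c: "ordinal \<gamma>" "\<And>a. a \<in> ext ?B ==> a \<in> ext \<gamma>" by blast
  have wc: "omega \<in> ext \<gamma>" by (rule c(2)) simp
  have Sc: "ext S \<subseteq> ext \<gamma>" using c(2) by auto
  have ec: "empty \<in> ext \<gamma>" by (rule ord_trans[OF c(1) wc omega0])
  define F1s where "F1s = [%d. Kc d, %d. idR, %d. S, %d. MemS (pfst d) (psnd d), %d. EqS (pfst d) (psnd d), %d. rc d,
    %d. ri (pfst d) (psnd d), %d. ins (pfst d) (pfst (psnd d)) (psnd (psnd d)), %d. Ev d]"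
  define F2s where "F2s = [%d. lam reals (%x. rM (Lv S x (pfst d)) (pfst (psnd d)) (pfst (psnd (psnd d))) (psnd (psnd (psnd d)))),
    %d. lam reals (%x. rE (Lv S x (pfst d)) (pfst (psnd d)) (pfst (psnd (psnd d))) (psnd (psnd (psnd d)))),
    %d. lam reals (%x. rP S (Lv S x (pfst d)) (pfst (psnd d)) (psnd (psnd d))),
    %d. lam reals (%x. rP x (Lv S x (pfst d)) (pfst (psnd d)) (psnd (psnd d))),
    %d. lam reals (%x. rC (Lv S x (pfst d)) (pfst (psnd d)) (ap (psnd (psnd d)) x)),
    %d. lam reals (%x. rI (ap (pfst d) x) (ap (psnd d) x)),
    %d. lam reals (%x. rJ (Lv S x (pfst d)) (pfst (psnd d)) (ap (psnd (psnd d)) x)),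
    %d. lam reals (%x. Dset (Lv S x (pfst d)) (pfst (psnd d)) (ap (Ev (psnd (psnd (psnd d)))) x) (ap (pfst (psnd (psnd d))) x))]"
  define F3s where "F3s = map (Tp S k) (subs \<phi>)"
  define F4s where "F4s = map (%p. case p of All i q => Gp S k i q | _ => (%d. d)) (subs \<phi>)"
  have 1: "list_all F1 F1s" unfolding F1s_def list.pred_inject by (intro conjI list.pred_inject(1); intro dfi)
  have 2: "list_all F1 F2s" unfolding F2s_def list.pred_inject rM_def rE_def rP_def Dset_def by (intro conjI list.pred_inject(1); intro dfi)
  have 3: "F1 F" if "F \<in> set F3s" for F using that Tp_F1 unfolding F3s_def by auto
  have i: "F1 (%d. d)" by (intro dfi)
  have 4: "F1 F" if "F \<in> set F4s" for F using that Gp_F1 i unfolding F4s_def by (auto split: fm.splits)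
  have all: "F1 F" if "F \<in> set (F1s @ F2s @ F3s @ F4s @ Gs)" for F
    using that 1 2 3 4 Gs unfolding list_all_iff by auto
  obtain X w where X: "WO w X" "ext \<gamma> \<subseteq> ext X" "\<And>a b. a \<in> ext X ==> b \<in> ext X ==> up a b \<in> ext X"
    "\<And>a b. a \<in> ext X ==> b \<in> ext X ==> opair a b \<in> ext X"
    "\<And>F a. F \<in> set (F1s @ F2s @ F3s @ F4s @ Gs) ==> a \<in> ext X ==> F a \<in> ext X" "\<And>c. c \<in> ext X ==> ordinal c ==> ext c \<subseteq> ext X"
    by (rule closure_exists_list[where Fs="F1s @ F2s @ F3s @ F4s @ Gs", OF all WO_ordinal[OF c(1)] ec]) (assumption, rule that)
  note op = X(4)
  have wX: "omega \<in> ext X" and eX: "empty \<in> ext X" using X(2) wc ec by blast+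
  have cl: "list_all (%F. \<forall>a\<in>ext X. F a \<in> ext X) F1s" "list_all (%F. \<forall>a\<in>ext X. F a \<in> ext X) F2s"
    using X(5) unfolding list_all_iff by auto
  have c1: "\<forall>a\<in>ext X. Kc a \<in> ext X" "\<forall>a\<in>ext X. idR \<in> ext X" "\<forall>a\<in>ext X. S \<in> ext X"
    "\<forall>a\<in>ext X. MemS (pfst a) (psnd a) \<in> ext X" "\<forall>a\<in>ext X. EqS (pfst a) (psnd a) \<in> ext X" "\<forall>a\<in>ext X. rc a \<in> ext X"
    "\<forall>a\<in>ext X. ri (pfst a) (psnd a) \<in> ext X" "\<forall>d\<in>ext X. ins (pfst d) (pfst (psnd d)) (psnd (psnd d)) \<in> ext X"
    "\<forall>a\<in>ext X. Ev a \<in> ext X" using cl(1) unfolding F1s_def list.pred_inject by blast+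
  have "\<forall>d\<in>ext X. lam reals (%x. rM (Lv S x (pfst d)) (pfst (psnd d)) (pfst (psnd (psnd d))) (psnd (psnd (psnd d)))) \<in> ext X"
    using cl(2) unfolding F2s_def list.pred_inject by (elim conjE)
  note rM = bspec[OF this op[OF _ op[OF _ op]], unfolded pfst psnd]
  have "\<forall>d\<in>ext X. lam reals (%x. rE (Lv S x (pfst d)) (pfst (psnd d)) (pfst (psnd (psnd d))) (psnd (psnd (psnd d)))) \<in> ext X"
    using cl(2) unfolding F2s_def list.pred_inject by (elim conjE)
  note rE = bspec[OF this op[OF _ op[OF _ op]], unfolded pfst psnd]
  have "\<forall>d\<in>ext X. lam reals (%x. rP S (Lv S x (pfst d)) (pfst (psnd d)) (psnd (psnd d))) \<in> ext X"
    using cl(2) unfolding F2s_def list.pred_inject by (elim conjE)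
  note rPS = bspec[OF this op[OF _ op], unfolded pfst psnd]
  have "\<forall>d\<in>ext X. lam reals (%x. rP x (Lv S x (pfst d)) (pfst (psnd d)) (psnd (psnd d))) \<in> ext X"
    using cl(2) unfolding F2s_def list.pred_inject by (elim conjE)
  note rPx = bspec[OF this op[OF _ op], unfolded pfst psnd]
  have "\<forall>d\<in>ext X. lam reals (%x. rC (Lv S x (pfst d)) (pfst (psnd d)) (ap (psnd (psnd d)) x)) \<in> ext X"
    using cl(2) unfolding F2s_def list.pred_inject by (elim conjE)
  note rC = bspec[OF this op[OF _ op], unfolded pfst psnd]
  have "\<forall>d\<in>ext X. lam reals (%x. rI (ap (pfst d) x) (ap (psnd d) x)) \<in> ext X"
    using cl(2) unfolding F2s_def list.pred_inject by (elim conjE)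
  note rI = bspec[OF this op, unfolded pfst psnd]
  have "\<forall>d\<in>ext X. lam reals (%x. rJ (Lv S x (pfst d)) (pfst (psnd d)) (ap (psnd (psnd d)) x)) \<in> ext X"
    using cl(2) unfolding F2s_def list.pred_inject by (elim conjE)
  note rJ = bspec[OF this op[OF _ op], unfolded pfst psnd]
  have "\<forall>d\<in>ext X. lam reals (%x. Dset (Lv S x (pfst d)) (pfst (psnd d)) (ap (Ev (psnd (psnd (psnd d)))) x) (ap (pfst (psnd (psnd d))) x)) \<in> ext X"
    using cl(2) unfolding F2s_def list.pred_inject by (elim conjE)
  note Nm = bspec[OF this op[OF _ op[OF _ op]], unfolded pfst psnd]
  have Kc': "Kc a \<in> ext X" if "a \<in> ext X" for a using c1(1) that by blast
  have idR': "idR \<in> ext X" using c1(2) eX by blast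
  have S': "S \<in> ext X" using c1(3) eX by blast
  note MemS' = bspec[OF c1(4) op, unfolded pfst psnd]
  note EqS' = bspec[OF c1(5) op, unfolded pfst psnd]
  note ri' = bspec[OF c1(7) op, unfolded pfst psnd]
  note ins' = bspec[OF c1(8) op[OF _ op], unfolded pfst psnd]
  have encX: "enc m e \<in> ext X" if "\<And>i. e i \<in> ext X" for m and e :: "nat => 'a" using that eX op by (induction m) auto
  have TSX: "TS S p e \<in> ext X" if p: "p \<in> set (subs \<phi>)" and e: "\<And>i. e i \<in> ext X" for p e
  proof -
    have "Tp S k p (enc k e) \<in> ext X" by (rule X(5)[OF _ encX[OF e]]) (use p in \<open>simp add: F3s_def\<close>)
    moreover have "Tp S k p (enc k e) = TS S p e"
    proof (rule ext_inject, rule set_eqI, unfold Tp_def TS)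
      fix x
      have "sat (L_bracket S x) p (%i. ap (dec k i (enc k e)) x) = sat (L_bracket S x) p (%i. ap (e i) x)"
      proof (rule sat_cong)
        fix i assume "i \<in> fv p"
        then have "i < k" using k[OF p] by auto
        then show "ap (dec k i (enc k e)) x = ap (e i) x" by (simp add: dec_enc)
      qed
      then show "(x \<in> ext reals \<and> sat (L_bracket S x) p (%i. ap (dec k i (enc k e)) x)) = (x \<in> ext reals \<and> sat (L_bracket S x) p (%i. ap (e i) x))" by simp
    qed
    ultimately show ?thesis by simp
  qed
  have wit: "\<exists>c\<in>ext X. ordinal c \<and> (\<forall>x\<in>ext reals. (\<exists>a\<in>L_bracket S x. \<not> sat (L_bracket S x) p ((%j. ap (e j) x)(i := a))) -->
        (\<exists>b\<in>ext c. \<exists>a\<in>ext (Lv S x b). \<not> sat (L_bracket S x) p ((%j. ap (e j) x)(i := a))))"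
    if p: "All i p \<in> set (subs \<phi>)" and e: "\<And>i. e i \<in> ext X" for i p e
  proof -
    have "(case All i p of All i q => Gp S k i q | _ => (%d. d)) \<in> set F4s" unfolding F4s_def set_map using p by (rule imageI)
    then have "Gp S k i p (enc k e) \<in> ext X" by (intro X(5)[OF _ encX[OF e]]) simp
    moreover have "nsat S k i p (enc k e) x a \<longleftrightarrow> \<not> sat (L_bracket S x) p ((%j. ap (e j) x)(i := a))" for x a
    proof -
      have "sat (L_bracket S x) p (%j. if j = i then a else ap (dec k j (enc k e)) x) = sat (L_bracket S x) p ((%j. ap (e j) x)(i := a))"
      proof (rule sat_cong)
        fix j assume "j \<in> fv p"
        then have "j = i \<or> j < k" using k[OF p] by auto
        then show "(if j = i then a else ap (dec k j (enc k e)) x) = ((%j. ap (e j) x)(i := a)) j" by (auto simp: dec_enc)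
      qed
      then show ?thesis unfolding nsat_def by simp
    qed
    moreover have "ordinal (Gp S k i p (enc k e))" unfolding Gp_def by (rule ob(1))
    ultimately show ?thesis using Gp[of _ _ S k i p "enc k e"] by (intro bexI[of _ "Gp S k i p (enc k e)"]) auto
  qed
  \<comment> \<open>In the assignment of the code variable 1 is the real and all other variables are
    \<open>S\<close>; correspondingly \<open>idR\<close> stands at 1 and the constant name of
    \<open>S\<close> elsewhere.\<close>
  let ?e = "(%_. Kc S)(1 := idR) :: nat => 'a"
  have YT: "Y = TS S \<phi> ?e"
  proof (rule ext_inject, rule set_eqI)
    fix x
    have "(%i. ap (?e i) x) = (%_. S)(1 := x)" if "x \<in> ext reals" using ap_Kc[OF that] ap_idR[OF that] by auto
    then show "x \<in> ext Y \<longleftrightarrow> x \<in> ext (TS S \<phi> ?e)" unfolding Ye TS by auto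
  qed
  have eX': "?e i \<in> ext X" for i using Kc'[OF S'] idR' by simp
  have YX: "Y \<in> ext X" unfolding YT by (rule TSX[OF subs_refl eX'])
  have bsX: "bs (opair i j) \<in> ext X" if ij: "i \<in> ext omega" "j \<in> ext omega" for i j
  proof -
    have "MemS (Kc (opair i j)) idR \<in> ext X" using X(6)[OF wX ord_omega] ij by (intro MemS' Kc' op idR') blast+
    moreover have "MemS (Kc (opair i j)) idR = bs (opair i j)"
      by (rule ext_inject, rule set_eqI, unfold MemS bs) (auto simp: ap_Kc ap_idR)
    ultimately show ?thesis by simp
  qed
  have main: "Y \<in> ext L" if bc: "bclosed X L" for L
  proof -
    have LR: "ext L \<subseteq> {A. ext A \<subseteq> ext reals}"
      and Lb: "\<And>i j. i \<in> ext omega ==> j \<in> ext omega ==> bs (opair i j) \<in> ext L"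
      and Lc: "\<And>A. A \<in> ext L ==> rc A \<in> ext L" and Li: "\<And>A B. A \<in> ext L ==> B \<in> ext L ==> ri A B \<in> ext L"
      and Ln: "\<And>A Z. ext Z \<subseteq> ext L ==> A \<in> ext X ==> ext A = {x \<in> ext reals. \<forall>B\<in>ext Z. x \<in> ext B} ==> A \<in> ext L"
      using bc unfolding bclosed_def by blast+
    interpret name_space mem S X w "set (subs \<phi>)" L
    proof (unfold_locales, goal_cases)
      case 1 show ?case by (rule X(1))
    next
      case (2 a) then show ?case using So Sc X(2) by blast
    next
      case 3 show ?case by (rule S')
    next
      case 4 show ?case by (rule wX)
    next
      case 5 show ?case by (rule eX)
    next
      case (6 c) then show ?case by (rule X(6))
    next
      case (7 a b) then show ?case by (rule X(3))
    next
      case (8 a) then show ?case by (rule Kc')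
    next
      case 9 show ?case by (rule idR')
    next
      case (10 a b) then show ?case by (rule MemS')
    next
      case (11 a b) then show ?case by (rule EqS')
    next
      case (12 a) then show ?case using c1(6) by blast
    next
      case (13 n s a) then show ?case by (rule ins')
    next
      case (14 s) then show ?case using c1(9) by blast
    next
      case (15 c n i j) then show ?case by (rule rM)
    next
      case (16 c n i j) then show ?case by (rule rE)
    next
      case (17 c n i) then show ?case by (rule rPS)
    next
      case (18 c n i) then show ?case by (rule rPx)
    next
      case (19 c n r) then show ?case by (rule rC)
    next
      case (20 r r') then show ?case by (rule rI)
    next
      case (21 c n r) then show ?case by (rule rJ)
    next
      case (22 c n r s) then show ?case by (rule Nm)
    next
      case (23 p e) then show ?case by (intro TSX)
    next
      case (24 i p e) then show ?case by (intro wit)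
    next
      case (25 p) then show ?case using subs_trans[OF 25] subs_refl by auto
    next
      case (26 p q) then show ?case using subs_trans[OF 26] subs_refl by auto
    next
      case (27 p q) then show ?case using subs_trans[OF 27] subs_refl by auto
    next
      case (28 i p) then show ?case using subs_trans[OF 28] subs_refl by auto
    next
      case (29 j m) then show ?case by (rule Lb)
    next
      case (30 A) then show ?case by (rule Lc)
    next
      case (31 A B) then show ?case by (rule Li)
    next
      case (32 A Z) then show ?case by (rule Ln)
    qed
    obtain N where N: "good N" "ext (pl N) \<subseteq> ext N" using good_closed by blast
    interpret names mem S X w "set (subs \<phi>)" L N by unfold_locales (rule N)+
    show ?thesis unfolding YT by (rule TS_L[OF LR subs_refl]) (use Kc_S idR_N in simp)
  qed
  have GsX: "G a \<in> ext X" if "G \<in> set Gs" "a \<in> ext X" for G a by (rule X(5)) (use that in simp_all)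
  have rcX: "rc a \<in> ext X" if "a \<in> ext X" for a using c1(6) that by blast
  show ?thesis
    by (rule that[of w X], rule X(1), rule wX, erule (1) X(6), erule (1) op, erule (1) GsX, erule rcX, erule (1) ri',
      erule (1) bsX, rule YX, erule main)
qed

end

context zf_model
begin

section \<open>Exchanging columns\<close>

text \<open>The involution that exchanges \<open>i\<close> with \<open>k + i\<close> for all
  \<open>i\<close> below \<open>k\<close> and fixes every other index.\<close>

definition tsw :: "'a => 'a => 'a" where
  "tsw k i = (if i \<in> ext k then addn k i else if \<exists>j\<in>ext k. i = addn k j then lst (%j. j \<in> ext k \<and> i = addn k j) else i)"
lemma F2_tsw: "F2 tsw" by (intro F2I, unfold tsw_def, intro dfi)
lemmas [dfi] = F2D[OF F2_tsw]

lemma tsw_lo: "i \<in> ext k ==> tsw k i = addn k i" unfolding tsw_def by simp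
lemma tsw_hi: assumes k: "k \<in> ext omega" and j: "j \<in> ext k" shows "tsw k (addn k j) = j"
proof -
  have jo: "j \<in> ext omega" by (rule omega_trans[OF k j])
  have "addn k j \<notin> ext k" using addn_ge[OF jo, of k] mem_irrefl[of "addn k j"] by blast
  then have e: "tsw k (addn k j) = lst (%i. i \<in> ext k \<and> addn k j = addn k i)" unfolding tsw_def using j by auto
  have d: "D1 (%i. i \<in> ext k \<and> addn k j = addn k i)" by (intro dfi)
  have "j \<in> ext k \<and> addn k j = addn k j" using j by blast
  note l = lst(1,2)[OF d, OF jo this]
  show ?thesis unfolding e by (rule addn_inj[OF l(1) jo, where k=k]) (use l(2) in simp)
qed
lemma tsw_fix: "i \<notin> ext k ==> \<not> (\<exists>j\<in>ext k. i = addn k j) ==> tsw k i = i" unfolding tsw_def by simp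
lemma tsw_cases: assumes "k \<in> ext omega"
  obtains "i \<in> ext k" "tsw k i = addn k i" | j where "j \<in> ext k" "i = addn k j" "tsw k i = j" | "tsw k i = i"
proof -
  consider "i \<in> ext k" | j where "j \<in> ext k" "i = addn k j" | "i \<notin> ext k" "\<not> (\<exists>j\<in>ext k. i = addn k j)" by blast
  then show thesis
  proof cases
    case 1 then show thesis using that(1) tsw_lo by blast
  next
    case 2 then show thesis using that(2)[OF 2] tsw_hi[OF assms 2(1)] by simp
  next
    case 3 then show thesis using that(3) tsw_fix by blast
  qed
qed
lemma tsw_tsw: assumes k: "k \<in> ext omega" shows "tsw k (tsw k i) = i"
  by (rule tsw_cases[OF k, of i]) (simp_all add: tsw_hi[OF k] tsw_lo)
lemma tsw_in: assumes k: "k \<in> ext omega" and N: "ordinal N" "ext (addn k k) \<subseteq> ext N" and i: "i \<in> ext N" shows "tsw k i \<in> ext N"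
proof (rule tsw_cases[OF k, of i])
  assume h: "i \<in> ext k" "tsw k i = addn k i"
  then show ?thesis using addn_mono[OF k h(1), of k] N(2) by auto
next
  fix j assume h: "j \<in> ext k" "i = addn k j" "tsw k i = j"
  then show ?thesis using addn_ge[OF k, of k] N(2) by auto
next
  assume "tsw k i = i" then show ?thesis using i by simp
qed
lemma tsw_om: assumes k: "k \<in> ext omega" and i: "i \<in> ext omega" shows "tsw k i \<in> ext omega"
  by (rule tsw_in[OF k ord_omega _ i]) (use omega_trans[OF addn_in[OF k k]] in blast)

definition xT :: "'a => 'a => 'a" where "xT k x = lam omega (%j. ap x (pr (tsw k (lf j)) (rt j)))"
lemma F2_xT: "F2 xT" by (intro F2I, unfold xT_def, intro dfi)
lemmas [dfi] = F2D[OF F2_xT]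
lemma ap_xT: "j \<in> ext omega ==> ap (xT k x) j = ap x (pr (tsw k (lf j)) (rt j))"
  unfolding xT_def by (rule ap_lam) (intro dfi)
lemma pr_tsw: "k \<in> ext omega ==> j \<in> ext omega ==> pr (tsw k (lf j)) (rt j) \<in> ext omega"
  by (intro pr tsw_om prs_lr)
lemma xT_real: assumes k: "k \<in> ext omega" and x: "x \<in> ext reals" shows "xT k x \<in> ext reals"
  unfolding ext_reals xT_def by (rule lam_func) (intro dfi, use x func_ap_in pr_tsw[OF k] in \<open>unfold ext_reals, blast\<close>)
definition Ta :: "'a => 'a => 'a" where "Ta k A = sep reals (%x. xT k x \<in> ext A)"
lemma F2_Ta: "F2 Ta" by (intro F2I, unfold Ta_def, intro dfi)
lemmas [dfi] = F2D[OF F2_Ta]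
lemma Ta: "x \<in> ext (Ta k A) \<longleftrightarrow> x \<in> ext reals \<and> xT k x \<in> ext A"
  unfolding Ta_def by (subst ext_sep) (intro dfi, simp)
lemma Ta_bs: assumes k: "k \<in> ext omega" and j: "j \<in> ext omega" shows "Ta k (bs (opair j m)) = bs (opair (pr (tsw k (lf j)) (rt j)) m)"
proof (rule ext_inject, rule set_eqI, unfold Ta bs)
  fix x
  have "opair j m \<in> ext (xT k x) \<longleftrightarrow> opair (pr (tsw k (lf j)) (rt j)) m \<in> ext x" if x: "x \<in> ext reals"
  proof -
    have f: "func x omega omega" "func (xT k x) omega omega" using x xT_real[OF k x] unfolding ext_reals by blast+
    show ?thesis unfolding func_opair_iff[OF f(1)] func_opair_iff[OF f(2)] ap_xT[OF j] using j pr_tsw[OF k j] by blast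
  qed
  then show "(x \<in> ext reals \<and> xT k x \<in> ext reals \<and> opair j m \<in> ext (xT k x)) = (x \<in> ext reals \<and> opair (pr (tsw k (lf j)) (rt j)) m \<in> ext x)"
    using xT_real[OF k] by blast
qed

definition col :: "'a => 'a => 'a" where "col x i = lam omega (%m. ap x (pr i m))"
lemma F2_col: "F2 col" by (intro F2I, unfold col_def, intro dfi)
lemmas [dfi] = F2D[OF F2_col]
lemma ap_col: "m \<in> ext omega ==> ap (col x i) m = ap x (pr i m)" unfolding col_def by (rule ap_lam) (intro dfi)
lemma col_real: assumes "x \<in> ext reals" "i \<in> ext omega" shows "col x i \<in> ext reals"
  unfolding ext_reals col_def by (rule lam_func) (intro dfi, use assms func_ap_in pr(1) in \<open>unfold ext_reals, blast\<close>)
text \<open>As \<open>k\<close> is positive, column 0 is among the exchanged ones, and its partner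
  is column \<open>k\<close>.\<close>

lemma col_xT: assumes k: "k \<in> ext omega" "empty \<in> ext k" and x: "x \<in> ext reals" shows "col (xT k x) empty = col x k"
proof (rule func_eqI)
  show "func (col (xT k x) empty) omega omega" "func (col x k) omega omega"
    using col_real[OF xT_real[OF k(1) x] omega0] col_real[OF x k(1)] unfolding ext_reals by blast+
  fix m assume m: "m \<in> ext omega"
  show "ap (col (xT k x) empty) m = ap (col x k) m"
    unfolding ap_col[OF m] ap_xT[OF pr(1)[OF omega0 m]] pr(2,3)[OF omega0 m] tsw_lo[OF k(2)] by simp
qed

text \<open>The real whose column \<open>i\<close> is the real \<open>g i\<close>.\<close>

definition xg :: "'a => 'a" where "xg g = lam omega (%j. ap (ap g (lf j)) (rt j))"
lemma F1_xg: "F1 xg" by (intro F1I, unfold xg_def, intro dfi)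
lemmas [dfi] = F1D[OF F1_xg]
lemma ap_xg: "j \<in> ext omega ==> ap (xg g) j = ap (ap g (lf j)) (rt j)" unfolding xg_def by (rule ap_lam) (intro dfi)

lemma le_addn: assumes "m \<in> ext omega" "n \<in> ext omega" shows "n \<in> ext (succ (addn m n))"
proof -
  have s: "k \<in> ext (succ (addn m k))" if "k \<in> ext omega" "ext k \<subseteq> ext (addn m k)" for k
    using ord_sub_iff[OF omega_ord[OF that(1)] omega_ord[OF addn_in[OF assms(1) that(1)]]] that(2) by auto
  have "ext n \<subseteq> ext (addn m n)"
  proof (rule omega_induct[OF assms(2)])
    show "D1 (%n. ext n \<subseteq> ext (addn m n))" by (intro dfi)
    show "ext empty \<subseteq> ext (addn m empty)" by simp
    fix k assume k: "k \<in> ext omega" "ext k \<subseteq> ext (addn m k)"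
    have "ext (succ k) \<subseteq> ext (succ (addn m k))" using s[OF k] k(2) by auto
    then show "ext (succ k) \<subseteq> ext (addn m (succ k))" using k(1) by simp
  qed
  then show ?thesis by (rule s[OF assms(2)])
qed

section \<open>Forcing with finite sequences from a countable set of reals\<close>

definition Wd :: "'a => 'a => 'a" where "Wd C A = sep (funs omega (fin_seqs C)) (%f. xg (gf f) \<in> ext A)"
lemma F2_Wd: "F2 Wd" by (intro F2I, unfold Wd_def, intro dfi)
lemmas [dfi] = F2D[OF F2_Wd]
lemma Wd: "f \<in> ext (Wd C A) \<longleftrightarrow> func f omega (fin_seqs C) \<and> xg (gf f) \<in> ext A"
  unfolding Wd_def by (subst ext_sep) (intro dfi, simp)
definition FF :: "'a => 'a => 'a" where "FF C A = sep (fin_seqs C) (%s. frc (fin_seqs C) (Qo C) s (Wd C A))"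
lemma F2_FF: "F2 FF" by (intro F2I, unfold FF_def, intro dfi)
lemmas [dfi] = F2D[OF F2_FF]
lemma FF: "s \<in> ext (FF C A) \<longleftrightarrow> s \<in> ext (fin_seqs C) \<and> frc (fin_seqs C) (Qo C) s (Wd C A)"
  unfolding FF_def by (subst ext_sep) (intro dfi, simp)

definition tw :: "'a => 'a => 'a" where "tw k t = lam (dom t) (%i. ap t (tsw k i))"
lemma F2_tw: "F2 tw" by (intro F2I, unfold tw_def, intro dfi)
lemmas [dfi] = F2D[OF F2_tw]

end

locale col_forcing = zf_model +
  fixes C :: 'a
  assumes det: Det and cC: "ctb C" and CR: "ext C \<subseteq> ext reals"
begin

abbreviation Q where "Q \<equiv> fin_seqs C"
abbreviation qr where "qr \<equiv> Qo C"
abbreviation F where "F \<equiv> FF C"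

lemma cQ: "ctb Q" by (rule ctb_fin_seqs[OF cC])
lemma C_ne: "\<exists>c. c \<in> ext C" by (rule ctb_ne[OF cC])
lemma xg_real: assumes "func g omega C" shows "xg g \<in> ext reals"
  unfolding ext_reals xg_def
proof (rule lam_func)
  show "F1 (%j. ap (ap g (lf j)) (rt j))" by (intro dfi)
  fix j assume j: "j \<in> ext omega"
  have "ap g (lf j) \<in> ext reals" using func_ap_in[OF assms prs_lr(2)[OF j]] CR by blast
  then show "ap (ap g (lf j)) (rt j) \<in> ext omega" unfolding ext_reals by (rule func_ap_in[OF _ prs_lr(3)[OF j]])
qed
lemma col_xg: assumes "func g omega C" "i \<in> ext omega" shows "col (xg g) i = ap g i"
proof (rule func_eqI)
  show "func (col (xg g) i) omega omega" using col_real[OF xg_real[OF assms(1)] assms(2)] unfolding ext_reals .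
  show "func (ap g i) omega omega" using func_ap_in[OF assms] CR unfolding ext_reals[symmetric] by blast
  fix m assume m: "m \<in> ext omega"
  show "ap (col (xg g) i) m = ap (ap g i) m" unfolding ap_col[OF m] ap_xg[OF pr(1)[OF assms(2) m]] pr(2,3)[OF assms(2) m] ..
qed
lemma inv_Wd: "inv Q qr (Wd C A)" unfolding inv_def Wd using gf_eqv dseq_func by metis

lemma frcQ: assumes "s \<in> ext Q" "\<And>f. gnr Q qr (QD C) f ==> blw qr f s ==> xg (gf f) \<in> ext A" shows "s \<in> ext (F A)"
proof -
  obtain c where c: "c \<in> ext C" using C_ne by blast
  have "f \<in> ext (Wd C A)" if "gnr Q qr (QD C) f" "blw qr f s" for f
    unfolding Wd using assms(2)[OF that] that(1) dseq_func unfolding gnr_def by blast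
  then show ?thesis unfolding FF frc_def using QD[OF c] assms(1) by blast
qed
lemma frcQ_imp: assumes "s \<in> ext (F A)" "\<And>g. func g omega C ==> xg g \<in> ext A ==> xg g \<in> ext B" shows "s \<in> ext (F B)"
proof -
  obtain c where c: "c \<in> ext C" using C_ne by blast
  obtain D where D: "cdf Q qr D" "\<And>f. gnr Q qr D f ==> blw qr f s ==> f \<in> ext (Wd C A)" using assms(1) unfolding FF frc_def by blast
  have "f \<in> ext (Wd C B)" if h: "gnr Q qr (bun D (QD C)) f" "blw qr f s" for f
  proof -
    have g: "gnr Q qr D f" "gnr Q qr (QD C) f" using h(1) unfolding gnr_bun by blast+
    show ?thesis using D(2)[OF g(1) h(2)] assms(2)[OF gf_func[OF g(2)]] unfolding Wd by blast
  qed
  then show ?thesis using assms(1) unfolding FF frc_def using cdf_bun[OF D(1) QD[OF c]] by blast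
qed

lemma F_sub: "ext (F A) \<subseteq> ext Q" using FF by blast
lemma F_up: assumes "s \<in> ext (F A)" "t \<in> ext Q" "ext s \<subseteq> ext t" shows "t \<in> ext (F A)"
proof -
  have s: "s \<in> ext Q" using assms(1) F_sub by blast
  have "opair t s \<in> ext qr" unfolding Qo using assms(2,3) s by blast
  from frc_mono[OF pos_Q assms(2) s this] show ?thesis using assms(1,2) unfolding FF by blast
qed
lemma F_mono: "s \<in> ext (F A) ==> ext A \<subseteq> ext B ==> s \<in> ext (F B)" by (rule frcQ_imp) blast+
lemma F_ri: "s \<in> ext (F (ri A B)) \<longleftrightarrow> s \<in> ext (F A) \<and> s \<in> ext (F B)"
proof
  assume "s \<in> ext (F (ri A B))"
  then show "s \<in> ext (F A) \<and> s \<in> ext (F B)" using F_mono ri by (metis subsetI)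
next
  assume h: "s \<in> ext (F A) \<and> s \<in> ext (F B)"
  obtain D where D: "cdf Q qr D" "\<And>f. gnr Q qr D f ==> blw qr f s ==> f \<in> ext (Wd C A)" using h unfolding FF frc_def by blast
  obtain D' where D': "cdf Q qr D'" "\<And>f. gnr Q qr D' f ==> blw qr f s ==> f \<in> ext (Wd C B)" using h unfolding FF frc_def by blast
  obtain c where c: "c \<in> ext C" using C_ne by blast
  have "f \<in> ext (Wd C (ri A B))" if f: "gnr Q qr (bun (bun D D') (QD C)) f" "blw qr f s" for f
  proof -
    have g: "gnr Q qr D f" "gnr Q qr D' f" "gnr Q qr (QD C) f" using f(1) unfolding gnr_bun by blast+
    show ?thesis using D(2)[OF g(1) f(2)] D'(2)[OF g(2) f(2)] xg_real[OF gf_func[OF g(3)]] unfolding Wd ri by blast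
  qed
  then show "s \<in> ext (F (ri A B))" using h unfolding FF frc_def using cdf_bun[OF cdf_bun[OF D(1) D'(1)] QD[OF c]] by blast
qed
lemma F_rc_disj: assumes "s \<in> ext (F A)" "s \<in> ext (F (rc A))" shows False
proof -
  have s: "s \<in> ext Q" "opair s s \<in> ext qr" using assms(1) F_sub pos_refl[OF pos_Q] by blast+
  have "frc Q qr s (Wd C A)" "frc Q qr s (Wd C (rc A))" using assms unfolding FF by blast+
  then obtain f where "f \<in> ext (Wd C A)" "f \<in> ext (Wd C (rc A))"
    by (rule frc_gen[OF pos_Q cQ _ _ cdf_triv[OF pos_Q s(1)] s(1) s(1) s(1) s(2) s(2)])
  then show False unfolding Wd rc by blast
qed
text \<open>From the property of Baire for the complement. It makes \<open>F A\<close> a regular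
  open set of conditions.\<close>

lemma F_dense: assumes s: "s \<in> ext Q" "s \<notin> ext (F A)" shows "\<exists>t\<in>ext (F (rc A)). ext s \<subseteq> ext t"
proof -
  obtain c where c: "c \<in> ext C" using C_ne by blast
  have "(\<exists>q\<in>ext Q. opair q s \<in> ext qr \<and> frc Q qr q (Wd C (rc A))) \<or> frc Q qr s (cmp Q (Wd C (rc A)))"
    by (rule baire[OF det pos_Q cQ s(1) inv_Wd])
  moreover have False if h: "frc Q qr s (cmp Q (Wd C (rc A)))"
  proof -
    obtain D where D: "cdf Q qr D" "\<And>f. gnr Q qr D f ==> blw qr f s ==> f \<in> ext (cmp Q (Wd C (rc A)))" using h unfolding frc_def by blast
    have "f \<in> ext (Wd C A)" if f: "gnr Q qr (bun D (QD C)) f" "blw qr f s" for f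
    proof -
      have g: "gnr Q qr D f" "gnr Q qr (QD C) f" using f(1) unfolding gnr_bun by blast+
      show ?thesis using D(2)[OF g(1) f(2)] xg_real[OF gf_func[OF g(2)]] unfolding cmp Wd rc by blast
    qed
    then have "s \<in> ext (F A)" unfolding FF frc_def using s(1) cdf_bun[OF D(1) QD[OF c]] by blast
    then show False using s(2) by blast
  qed
  ultimately obtain q where q: "q \<in> ext Q" "opair q s \<in> ext qr" "frc Q qr q (Wd C (rc A))" by blast
  then show ?thesis unfolding Qo by (intro bexI[of _ q]) (use FF in blast)+
qed
lemma F_all: assumes "\<And>g. func g omega C ==> xg g \<in> ext A" shows "ext (F A) = ext Q"
proof
  show "ext Q \<subseteq> ext (F A)" by (rule subsetI, erule frcQ) (rule assms[OF gf_func])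
qed (rule F_sub)

text \<open>Otherwise an extension of \<open>s\<close> forces the generic real outside
  \<open>A\<close>. Additivity along the well-order of \<open>X\<close> then fixes one
  \<open>B\<close> in \<open>Z\<close> that the real avoids below some condition, although
  \<open>s\<close> forces \<open>B\<close>.\<close>

lemma F_int: assumes wo: "WO w X" and Z: "ext Z \<subseteq> ext X" and A: "ext A = {x \<in> ext reals. \<forall>B\<in>ext Z. x \<in> ext B}"
    and s: "s \<in> ext Q" "\<And>B. B \<in> ext Z ==> s \<in> ext (F B)"
  shows "s \<in> ext (F A)"
proof (rule ccontr)
  assume "s \<notin> ext (F A)"
  then obtain t where t: "t \<in> ext (F (rc A))" "ext s \<subseteq> ext t" using F_dense[OF s(1)] by blast
  have tQ: "t \<in> ext Q" using t(1) F_sub by blast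
  have woZ: "WO w Z" using wo Z unfolding WO_def by blast
  have W: "F1 (%B. Wd C (rc B))" by (intro dfi)
  have fr: "frc Q qr t (Wd C (rc A))" using t(1) unfolding FF by blast
  have "\<exists>B\<in>ext Z. f \<in> ext (Wd C (rc B))" if "f \<in> ext (Wd C (rc A))" for f using that unfolding Wd rc A by blast
  then obtain q B where q: "q \<in> ext Q" "B \<in> ext Z" "opair q t \<in> ext qr" "frc Q qr q (Wd C (rc B))"
    using wo_additivity[OF det pos_Q cQ tQ woZ W inv_Wd fr] by blast
  have "q \<in> ext (F B)" by (rule F_up[OF s(2)[OF q(2)] q(1)]) (use q(3) t(2) in \<open>unfold Qo, blast\<close>)
  moreover have "q \<in> ext (F (rc B))" unfolding FF using q by blast
  ultimately show False by (rule F_rc_disj)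
qed

lemma F_bsI: assumes t: "t \<in> ext Q" "lf j \<in> ext (dom t)" and j: "j \<in> ext omega"
  shows "t \<in> ext (F (bs (opair j (ap (ap t (lf j)) (rt j)))))"
proof (rule frcQ[OF t(1)])
  fix f assume f: "gnr Q qr (QD C) f" "blw qr f t"
  have g: "func (gf f) omega C" by (rule gf_func[OF f(1)])
  obtain n where n: "n \<in> ext omega" "opair (ap f n) t \<in> ext qr" using f(2) unfolding blw_def by blast
  obtain m where m: "func t m C" using t(1) unfolding ext_fin_seqs by blast
  have "opair (lf j) (ap t (lf j)) \<in> ext t" by (rule func_ap_mem[OF m]) (use t(2) func_dom[OF m] in simp)
  then have "opair (lf j) (ap t (lf j)) \<in> ext (gf f)" unfolding gf using n unfolding Qo by blast
  then have e: "ap t (lf j) = ap (gf f) (lf j)" unfolding func_opair_iff[OF g] by blast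
  have r: "xg (gf f) \<in> ext reals" by (rule xg_real[OF g])
  have fx: "func (xg (gf f)) omega omega" using r unfolding ext_reals .
  show "xg (gf f) \<in> ext (bs (opair j (ap (ap t (lf j)) (rt j))))"
    unfolding bs func_opair_iff[OF fx] ap_xg[OF j] e using r j by blast
qed
lemma F_bs: assumes s: "s \<in> ext Q" and j: "j \<in> ext omega"
  shows "\<exists>t\<in>ext Q. \<exists>m\<in>ext omega. ext s \<subseteq> ext t \<and> t \<in> ext (F (bs (opair j m)))"
proof -
  obtain c where c: "c \<in> ext C" using C_ne by blast
  note l = prs_lr(2,3)[OF j]
  obtain t where t: "t \<in> ext Q" "ext s \<subseteq> ext t" "ext (succ (lf j)) \<subseteq> ext (dom t)" using fin_extend[OF c s omegaS[OF l(1)]] by blast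
  have lt: "lf j \<in> ext (dom t)" using t(3) by auto
  obtain m where m: "func t m C" using t(1) unfolding ext_fin_seqs by blast
  have "ap t (lf j) \<in> ext C" by (rule func_ap_in[OF m]) (use lt func_dom[OF m] in simp)
  then have "func (ap t (lf j)) omega omega" using CR unfolding ext_reals[symmetric] by blast
  then have "ap (ap t (lf j)) (rt j) \<in> ext omega" by (rule func_ap_in[OF _ l(2)])
  then show ?thesis using F_bsI[OF t(1) lt j] t(1,2) by blast
qed
lemma F_bs_disj: assumes "m \<noteq> m'" "s \<in> ext (F (bs (opair j m)))" "s \<in> ext (F (bs (opair j m')))" shows False
proof -
  have "xg g \<in> ext (rc (bs (opair j m')))" if g: "func g omega C" "xg g \<in> ext (bs (opair j m))" for g
  proof -
    have r: "xg g \<in> ext reals" by (rule xg_real[OF g(1)])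
    have fx: "func (xg g) omega omega" using r unfolding ext_reals .
    show ?thesis using g(2) assms(1) unfolding rc bs func_opair_iff[OF fx] using r by auto
  qed
  from F_rc_disj[OF assms(3) frcQ_imp[OF assms(2) this]] show False .
qed

lemma tw: assumes k: "k \<in> ext omega" and t: "t \<in> ext Q" "ext (addn k k) \<subseteq> ext (dom t)"
  shows "tw k t \<in> ext Q" "dom (tw k t) = dom t" "i \<in> ext (dom t) ==> ap (tw k t) i = ap t (tsw k i)" "tw k (tw k t) = t"
proof -
  obtain n where n: "n \<in> ext omega" "func t n C" using t(1) unfolding ext_fin_seqs by blast
  have d: "dom t = n" by (rule func_dom[OF n(2)])
  have ti: "tsw k i \<in> ext n" if "i \<in> ext n" for i by (rule tsw_in[OF k omega_ord[OF n(1)] _ that]) (use t(2) d in simp)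
  have L: "F1 (%i. ap t (tsw k i))" by (intro dfi)
  have f: "func (tw k t) n C" unfolding tw_def d by (rule lam_func[OF L]) (use func_ap_in[OF n(2)] ti in blast)
  show 1: "tw k t \<in> ext Q" unfolding ext_fin_seqs using f n(1) by blast
  show 2: "dom (tw k t) = dom t" unfolding d by (rule func_dom[OF f])
  show 3: "ap (tw k t) i = ap t (tsw k i)" if "i \<in> ext (dom t)" for i unfolding tw_def by (rule ap_lam[OF L that])
  have L2: "F1 (%i. ap (tw k t) (tsw k i))" by (intro dfi)
  have f2: "func (tw k (tw k t)) n C" unfolding tw_def[of k "tw k t"] 2 d by (rule lam_func[OF L2]) (use func_ap_in[OF f] ti in blast)
  show "tw k (tw k t) = t"
  proof (rule func_eqI[OF f2 n(2)])
    fix i assume i: "i \<in> ext n"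
    have "ap (tw k (tw k t)) i = ap (tw k t) (tsw k i)" unfolding tw_def[of k "tw k t"] 2 d by (rule ap_lam[OF L2 i])
    also have "\<dots> = ap t i" unfolding 3[unfolded d, OF ti[OF i]] tsw_tsw[OF k] ..
    finally show "ap (tw k (tw k t)) i = ap t i" .
  qed
qed
lemma tw_sub: assumes k: "k \<in> ext omega" and t: "t \<in> ext Q" "ext (addn k k) \<subseteq> ext (dom t)" and u: "u \<in> ext Q" "ext t \<subseteq> ext u"
  shows "ext (addn k k) \<subseteq> ext (dom u)" "ext (tw k t) \<subseteq> ext (tw k u)"
proof -
  obtain n where n: "n \<in> ext omega" "func t n C" using t(1) unfolding ext_fin_seqs by blast
  obtain m where m: "m \<in> ext omega" "func u m C" using u(1) unfolding ext_fin_seqs by blast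
  have d: "dom t = n" "dom u = m" using func_dom n(2) m(2) by blast+
  have mem: "i \<in> ext m \<and> ap t i = ap u i" if i: "i \<in> ext n" for i
  proof -
    have "opair i (ap t i) \<in> ext u" using func_ap_mem[OF n(2) i] u(2) by blast
    then show ?thesis unfolding func_opair_iff[OF m(2)] .
  qed
  show du: "ext (addn k k) \<subseteq> ext (dom u)" using t(2) mem unfolding d by blast
  obtain n' where n': "func (tw k t) n' C" using tw(1)[OF k t] unfolding ext_fin_seqs by blast
  have "n' = n" using func_dom[OF n'] tw(2)[OF k t] d by simp
  obtain m' where m': "func (tw k u) m' C" using tw(1)[OF k u(1) du] unfolding ext_fin_seqs by blast
  have "m' = m" using func_dom[OF m'] tw(2)[OF k u(1) du] d by simp
  show "ext (tw k t) \<subseteq> ext (tw k u)"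
  proof
    fix z assume "z \<in> ext (tw k t)"
    then obtain i where i: "i \<in> ext n" "z = opair i (ap (tw k t) i)" unfolding func_ext_eq[OF n'] \<open>n' = n\<close> by blast
    have ti: "tsw k i \<in> ext n" by (rule tsw_in[OF k omega_ord[OF n(1)] _ i(1)]) (use t(2) d in simp)
    have im: "i \<in> ext m" using mem[OF i(1)] by blast
    have "ap (tw k t) i = ap (tw k u) i"
      unfolding tw(3)[OF k t, unfolded d, OF i(1)] tw(3)[OF k u(1) du, unfolded d, OF im] using mem[OF ti] by blast
    then show "z \<in> ext (tw k u)" unfolding i(2) func_ext_eq[OF m'] \<open>m' = m\<close> using im by auto
  qed
qed

text \<open>Exchanging columns is an automorphism of the conditions of length at least
  \<open>2 * k\<close>. It turns a sequence that is generic below \<open>t\<close> into one generic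
  below \<open>tw k t\<close>, and the real of the second is the exchanged real of the first. The
  sets \<open>tD E\<close> are the preimages of the dense sets.\<close>

lemma F_transfer: assumes k: "k \<in> ext omega" and t: "t \<in> ext Q" "ext (addn k k) \<subseteq> ext (dom t)" and h: "tw k t \<in> ext (F A)"
  shows "t \<in> ext (F (Ta k A))"
proof -
  obtain c where c: "c \<in> ext C" using C_ne by blast
  obtain D where D: "cdf Q qr D" "\<And>f. gnr Q qr D f ==> blw qr f (tw k t) ==> f \<in> ext (Wd C A)" using h unfolding FF frc_def by blast
  define tD where "tD = (%E. sep Q (%u. ext (addn k k) \<subseteq> ext (dom u) \<and> (\<exists>d\<in>ext E. ext d \<subseteq> ext (tw k u))))"
  have FD: "F1 tD" unfolding tD_def by (intro dfi)
  have tD: "u \<in> ext (tD E) \<longleftrightarrow> u \<in> ext Q \<and> ext (addn k k) \<subseteq> ext (dom u) \<and> (\<exists>d\<in>ext E. ext d \<subseteq> ext (tw k u))" for u E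
    unfolding tD_def by (subst ext_sep) (intro dfi, simp)
  have "dns Q qr (tD E)" if E: "dns Q qr E" for E
    unfolding dns_def
  proof (intro conjI ballI)
    show "ext (tD E) \<subseteq> ext Q" using tD by blast
    fix s assume s: "s \<in> ext Q"
    obtain u where u: "u \<in> ext Q" "ext s \<subseteq> ext u" "ext (addn k k) \<subseteq> ext (dom u)" using fin_extend[OF c s addn_in[OF k k]] by blast
    obtain d where d: "d \<in> ext E" "opair d (tw k u) \<in> ext qr" using E tw(1)[OF k u(1,3)] unfolding dns_def by blast
    have dq: "d \<in> ext Q" "ext (tw k u) \<subseteq> ext d" using d(2) unfolding Qo by blast+
    have "ext (addn k k) \<subseteq> ext (dom (tw k u))" using tw(2)[OF k u(1,3)] u(3) by simp
    note v = tw_sub[OF k tw(1)[OF k u(1,3)] this dq]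
    have "ext s \<subseteq> ext (tw k d)" using v(2) u(2) unfolding tw(4)[OF k u(1,3)] by blast
    moreover have "tw k d \<in> ext (tD E)" unfolding tD tw(2)[OF k dq(1) v(1)] tw(4)[OF k dq(1) v(1)] using tw(1)[OF k dq(1) v(1)] v(1) d(1) by blast
    ultimately show "\<exists>d\<in>ext (tD E). opair d s \<in> ext qr" unfolding Qo using s tw(1)[OF k dq(1) v(1)] by blast
  qed
  then have cd: "cdf Q qr (img tD D)" using D(1) ctb_img[OF _ FD] unfolding cdf_def ext_img[OF FD] by blast
  have "f \<in> ext (Wd C (Ta k A))" if f: "gnr Q qr (bun (img tD D) (QD C)) f" "blw qr f t" for f
  proof -
    have g1: "gnr Q qr (img tD D) f" "gnr Q qr (QD C) f" using f(1) unfolding gnr_bun by blast+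
    have fd: "dseq Q qr f" using g1(1) unfolding gnr_def by blast
    obtain n0 where n0: "n0 \<in> ext omega" "opair (ap f n0) t \<in> ext qr" using f(2) unfolding blw_def by blast
    \<comment> \<open>The first \<open>n0\<close> terms are dropped: from there on the conditions
      extend \<open>t\<close> and so are long enough to be exchanged.\<close>
    let ?h = "%n. tw k (ap f (addn n0 n))"
    have Fh: "F1 ?h" by (intro dfi)
    define h where "h = lam omega ?h"
    have hn: "ap h n = ?h n" if "n \<in> ext omega" for n unfolding h_def by (rule ap_lam[OF Fh that])
    have le: "n0 \<in> ext (succ (addn n0 n))" if n: "n \<in> ext omega" for n
      using addn_ge[OF n, of n0] ord_sub_iff[OF omega_ord[OF n0(1)] omega_ord[OF addn_in[OF n0(1) n]]] by auto
    have fn: "ap f (addn n0 n) \<in> ext Q" "ext t \<subseteq> ext (ap f (addn n0 n))" if n: "n \<in> ext omega" for n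
    proof -
      show "ap f (addn n0 n) \<in> ext Q" by (rule dseq_in[OF fd addn_in[OF n0(1) n]])
      show "ext t \<subseteq> ext (ap f (addn n0 n))" using dseq_mono[OF pos_Q fd addn_in[OF n0(1) n] le[OF n]] n0(2) unfolding Qo by blast
    qed
    note big = tw_sub(1)[OF k t fn]
    have hf: "func h omega Q" unfolding h_def by (rule lam_func[OF Fh]) (use tw(1)[OF k fn(1) big] in blast)
    have mono: "ext (?h n) \<subseteq> ext (?h m)" if n: "n \<in> ext omega" and m: "m \<in> ext omega" and s: "ext (ap f (addn n0 n)) \<subseteq> ext (ap f (addn n0 m))" for n m
      by (rule tw_sub(2)[OF k fn(1)[OF n] big[OF n n] fn(1)[OF m] s])
    have hd: "dseq Q qr h" unfolding dseq_def
    proof (intro conjI hf ballI)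
      fix n assume n: "n \<in> ext omega"
      have "opair (ap f (succ (addn n0 n))) (ap f (addn n0 n)) \<in> ext qr" using fd addn_in[OF n0(1) n] unfolding dseq_def by blast
      then have "ext (?h n) \<subseteq> ext (?h (succ n))" using n by (intro mono[OF n omegaS[OF n]]) (simp add: Qo)
      then show "opair (ap h (succ n)) (ap h n) \<in> ext qr" unfolding Qo hn[OF n] hn[OF omegaS[OF n]]
        using tw(1)[OF k fn(1) big] n omegaS[OF n] by blast
    qed
    have fh: "ext (tw k (ap f n)) \<subseteq> ext (?h n)" "ext (ap f n) \<subseteq> ext (ap f (addn n0 n))" if n: "n \<in> ext omega" and b: "ext (addn k k) \<subseteq> ext (dom (ap f n))" for n
    proof -
      have "n \<in> ext (succ (addn n0 n))"
        by (rule le_addn[OF n0(1) n])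
      from dseq_mono[OF pos_Q fd addn_in[OF n0(1) n] this] show s: "ext (ap f n) \<subseteq> ext (ap f (addn n0 n))" unfolding Qo by blast
      show "ext (tw k (ap f n)) \<subseteq> ext (?h n)" by (rule tw_sub(2)[OF k dseq_in[OF fd n] b fn(1)[OF n] s])
    qed
    have "mts qr h E" if E: "E \<in> ext D" for E
    proof -
      have "tD E \<in> ext (img tD D)" unfolding ext_img[OF FD] using E by blast
      then obtain n u where n: "n \<in> ext omega" "u \<in> ext (tD E)" "opair (ap f n) u \<in> ext qr" using g1(1) unfolding gnr_def mts_def by blast
      obtain d where d: "d \<in> ext E" "ext d \<subseteq> ext (tw k u)" using n(2) unfolding tD by blast
      have u: "u \<in> ext Q" "ext (addn k k) \<subseteq> ext (dom u)" "ext u \<subseteq> ext (ap f n)" using n(2,3) unfolding tD Qo by blast+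
      note v = tw_sub[OF k u(1,2) dseq_in[OF fd n(1)] u(3)]
      have "ext d \<subseteq> ext (ap h n)" unfolding hn[OF n(1)] using d(2) v(2) fh(1)[OF n(1) v(1)] by blast
      moreover have "d \<in> ext Q" using d(1) E D(1) unfolding cdf_def dns_def by blast
      ultimately have "opair (ap h n) d \<in> ext qr" unfolding Qo using dseq_in[OF hd n(1)] by blast
      then show ?thesis unfolding mts_def using n(1) d(1) by blast
    qed
    then have hg: "gnr Q qr D h" unfolding gnr_def using hd by blast
    have hb: "blw qr h (tw k t)"
    proof -
      have "ext (tw k t) \<subseteq> ext (ap h empty)" unfolding hn[OF omega0] by (rule tw_sub(2)[OF k t fn[OF omega0]])
      then have "opair (ap h empty) (tw k t) \<in> ext qr" unfolding Qo using dseq_in[OF hd omega0] tw(1)[OF k t] by blast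
      then show ?thesis unfolding blw_def using omega0 by blast
    qed
    have hA: "xg (gf h) \<in> ext A" using D(2)[OF hg hb] unfolding Wd by blast
    have g: "func (gf f) omega C" by (rule gf_func[OF g1(2)])
    have gh: "ap (gf h) i = ap (gf f) (tsw k i)" if i: "i \<in> ext omega" for i
    proof -
      obtain m where m: "m \<in> ext omega" "i \<in> ext m" "ext (addn k k) \<subseteq> ext m"
      proof -
        obtain m where m: "m \<in> ext omega" "i \<in> ext (succ m)" "addn k k \<in> ext (succ m)" by (rule omega_max[OF i addn_in[OF k k]])
        show thesis by (rule that[OF omegaS[OF m(1)] m(2)]) (use ord_sub[OF omega_ord[OF omegaS[OF m(1)]] m(3)] in simp)
      qed
      obtain n u where n: "n \<in> ext omega" "u \<in> ext (sep Q (%s. m \<in> ext (dom s)))" "opair (ap f n) u \<in> ext qr"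
      proof -
        have Fq: "F1 (%n. sep Q (%s. n \<in> ext (dom s)))" by (intro dfi)
        have "sep Q (%s. m \<in> ext (dom s)) \<in> ext (QD C)" unfolding QD_def ext_img[OF Fq] using m(1) by blast
        then show thesis using that g1(2) unfolding gnr_def mts_def by blast
      qed
      have u: "u \<in> ext Q" "m \<in> ext (dom u)" "ext u \<subseteq> ext (ap f n)"
        using n(2,3) unfolding Qo by (subst (asm) ext_sep; (intro dfi | blast))+
      obtain M where M: "M \<in> ext omega" "func (ap f n) M C" using dseq_in[OF fd n(1)] unfolding ext_fin_seqs by blast
      obtain U where U: "func u U C" using u(1) unfolding ext_fin_seqs by blast
      have mM: "m \<in> ext M"
      proof -
        have "opair m (ap u m) \<in> ext (ap f n)" using func_ap_mem[OF U, of m] u(2,3) func_dom[OF U] by auto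
        then show ?thesis unfolding func_opair_iff[OF M(2)] by blast
      qed
      have sM: "ext m \<subseteq> ext M" by (rule ord_sub[OF omega_ord[OF M(1)] mM])
      have b: "ext (addn k k) \<subseteq> ext (dom (ap f n))" using m(3) sM func_dom[OF M(2)] by simp
      have iM: "i \<in> ext (dom (ap f n))" using m(2) sM func_dom[OF M(2)] by auto
      have tM: "tsw k i \<in> ext M" by (rule tsw_in[OF k omega_ord[OF M(1)]]) (use b iM func_dom[OF M(2)] in simp_all)
      obtain M' where M': "func (tw k (ap f n)) M' C" using tw(1)[OF k dseq_in[OF fd n(1)] b] unfolding ext_fin_seqs by blast
      have "i \<in> ext M'" using func_dom[OF M'] tw(2)[OF k dseq_in[OF fd n(1)] b] iM by simp
      then have "opair i (ap (tw k (ap f n)) i) \<in> ext (ap h n)" unfolding hn[OF n(1)] using func_ap_mem[OF M'] fh(1)[OF n(1) b] by blast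
      then have m1: "opair i (ap (ap f n) (tsw k i)) \<in> ext (gf h)" unfolding gf tw(3)[OF k dseq_in[OF fd n(1)] b iM] using n(1) by blast
      have m2: "ap (gf f) (tsw k i) = ap (ap f n) (tsw k i)" by (rule gf_ap[OF g n(1) M(2) tM])
      have uq: "y = ap (ap f n) (tsw k i)" if y: "opair i y \<in> ext (gf h)" for y
      proof -
        obtain a where a: "a \<in> ext omega" "opair i y \<in> ext (ap h a)" using y unfolding gf by blast
        obtain b' where b': "b' \<in> ext omega" "opair i (ap (ap f n) (tsw k i)) \<in> ext (ap h b')" using m1 unfolding gf by blast
        obtain q where q: "q \<in> ext omega" "a \<in> ext (succ q)" "b' \<in> ext (succ q)" by (rule omega_max[OF a(1) b'(1)])
        have s: "ext (ap h a) \<subseteq> ext (ap h q)" "ext (ap h b') \<subseteq> ext (ap h q)"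
          using dseq_mono[OF pos_Q hd q(1,2)] dseq_mono[OF pos_Q hd q(1,3)] unfolding Qo by blast+
        obtain J where J: "func (ap h q) J C" using dseq_in[OF hd q(1)] unfolding ext_fin_seqs by blast
        have "opair i y \<in> ext (ap h q)" "opair i (ap (ap f n) (tsw k i)) \<in> ext (ap h q)" using a(2) b'(2) s by blast+
        then show ?thesis unfolding func_opair_iff[OF J] by simp
      qed
      have "ap (gf h) i = ap (ap f n) (tsw k i)" by (rule ap_eq) (use m1 uq in blast)
      then show ?thesis using m2 by simp
    qed
    have r: "xg (gf f) \<in> ext reals" by (rule xg_real[OF g])
    have "xT k (xg (gf f)) = xg (gf h)"
    proof (rule func_eqI)
      show "func (xT k (xg (gf f))) omega omega" using xT_real[OF k r] unfolding ext_reals .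
      have xgF: "F1 (%j. ap (ap (gf h) (lf j)) (rt j))" by (intro dfi)
      show "func (xg (gf h)) omega (img (%j. ap (ap (gf h) (lf j)) (rt j)) omega)" unfolding xg_def by (rule lam_func_img[OF xgF])
      fix j assume j: "j \<in> ext omega"
      show "ap (xT k (xg (gf f))) j = ap (xg (gf h)) j"
        unfolding ap_xT[OF j] ap_xg[OF j] ap_xg[OF pr_tsw[OF k j]] gh[OF prs_lr(2)[OF j]]
          pr(2,3)[OF tsw_om[OF k prs_lr(2)[OF j]] prs_lr(3)[OF j]] ..
    qed
    then show ?thesis unfolding Wd Ta using hA r dseq_func[OF fd] by simp
  qed
  then show ?thesis unfolding FF frc_def using t(1) cdf_bun[OF cd QD[OF c]] by blast
qed

text \<open>The double exchange reads entry \<open>pr (lf j) (rt j)\<close> in place of entry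
  \<open>j\<close>. In a real of the form \<open>xg g\<close> the two agree because
  \<open>xg\<close> looks at \<open>lf\<close> and \<open>rt\<close> only, and only such reals
  matter for \<open>F\<close>.\<close>

lemma F_Ta_Ta: assumes k: "k \<in> ext omega" shows "F (Ta k (Ta k A)) = F A"
proof -
  have e: "xT k (xT k (xg g)) = xg g" if g: "func g omega C" for g
  proof (rule func_eqI)
    note r = xg_real[OF g]
    show "func (xT k (xT k (xg g))) omega omega" "func (xg g) omega omega" using xT_real[OF k xT_real[OF k r]] r unfolding ext_reals by blast+
    fix j assume j: "j \<in> ext omega"
    note l = prs_lr(2,3)[OF j]
    have p: "tsw k (lf j) \<in> ext omega" using tsw_om[OF k l(1)] .
    show "ap (xT k (xT k (xg g))) j = ap (xg g) j"
      unfolding ap_xT[OF j] ap_xT[OF pr_tsw[OF k j]] pr(2,3)[OF p l(2)] tsw_tsw[OF k] ap_xg[OF pr(1)[OF l]] ap_xg[OF j] pr(2,3)[OF l] ..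
  qed
  have "xg g \<in> ext (Ta k (Ta k A)) \<longleftrightarrow> xg g \<in> ext A" if g: "func g omega C" for g
    unfolding Ta e[OF g] using xg_real[OF g] xT_real[OF k] by blast
  then show ?thesis by (intro ext_inject set_eqI) (use frcQ_imp in blast)
qed

text \<open>The action of the exchange on regular open sets of conditions. Short conditions cannot
  be exchanged, so membership is tested on their long extensions. The operation of the same name on
  families of names is unrelated.\<close>

definition pl :: "'a => 'a => 'a" where
  "pl k B = sep Q (%s. \<forall>t\<in>ext Q. ext s \<subseteq> ext t --> ext (addn k k) \<subseteq> ext (dom t) --> tw k t \<in> ext B)"
lemma F2_pl: "F2 pl" by (intro F2I, unfold pl_def, intro dfi)
lemmas [dfi] = F2D[OF F2_pl]
lemma pl: "s \<in> ext (pl k B) \<longleftrightarrow> s \<in> ext Q \<and> (\<forall>t\<in>ext Q. ext s \<subseteq> ext t --> ext (addn k k) \<subseteq> ext (dom t) --> tw k t \<in> ext B)"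
  unfolding pl_def by (subst ext_sep) (intro dfi, simp)
lemma pl_mono: "ext B \<subseteq> ext B' ==> ext (pl k B) \<subseteq> ext (pl k B')" unfolding subset_iff pl by blast

lemma F_Ta: assumes k: "k \<in> ext omega" shows "F (Ta k A) = pl k (F A)"
proof (rule ext_inject, rule set_eqI, rule iffI)
  fix s assume s: "s \<in> ext (F (Ta k A))"
  have "tw k t \<in> ext (F A)" if t: "t \<in> ext Q" "ext s \<subseteq> ext t" "ext (addn k k) \<subseteq> ext (dom t)" for t
  proof -
    have "t \<in> ext (F (Ta k A))" by (rule F_up[OF s t(1,2)])
    then have "tw k (tw k t) \<in> ext (F (Ta k A))" unfolding tw(4)[OF k t(1,3)] .
    from F_transfer[OF k tw(1)[OF k t(1,3)] _ this] show ?thesis unfolding tw(2)[OF k t(1,3)] F_Ta_Ta[OF k] using t(3) by blast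
  qed
  then show "s \<in> ext (pl k (F A))" unfolding pl using s F_sub by blast
next
  fix s assume s: "s \<in> ext (pl k (F A))"
  obtain c where c: "c \<in> ext C" using C_ne by blast
  show "s \<in> ext (F (Ta k A))"
  proof (rule ccontr)
    assume n: "s \<notin> ext (F (Ta k A))"
    have sQ: "s \<in> ext Q" using s unfolding pl by blast
    obtain u where u: "u \<in> ext (F (rc (Ta k A)))" "ext s \<subseteq> ext u" using F_dense[OF sQ n] by blast
    have uQ: "u \<in> ext Q" using u(1) F_sub by blast
    obtain t where t: "t \<in> ext Q" "ext u \<subseteq> ext t" "ext (addn k k) \<subseteq> ext (dom t)" using fin_extend[OF c uQ addn_in[OF k k]] by blast
    have "tw k t \<in> ext (F A)" using s t u(2) unfolding pl by blast
    then have "t \<in> ext (F (Ta k A))" by (rule F_transfer[OF k t(1,3)])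
    moreover have "t \<in> ext (F (rc (Ta k A)))" by (rule F_up[OF u(1) t(1,2)])
    ultimately show False by (rule F_rc_disj)
  qed
qed

end

section \<open>Forcing with the sets \<open>F A\<close>\<close>

text \<open>\<open>undecided\<close> states that no \<open>A\<close> in \<open>X\<close> selects an
  element of this one \<open>C\<close>; the assumptions are to be refuted. Closure of
  \<open>X\<close> under \<open>Ta\<close> lets the exchange of columns act on the new
  conditions.\<close>

locale poset_forcing = col_forcing +
  fixes X w Y :: 'a
  assumes wo: "WO w X" and X_rc: "\<And>A. A \<in> ext X ==> rc A \<in> ext X"
    and X_ri: "\<And>A B. A \<in> ext X ==> B \<in> ext X ==> ri A B \<in> ext X"
    and X_bs: "\<And>i j. i \<in> ext omega ==> j \<in> ext omega ==> bs (opair i j) \<in> ext X"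
    and X_Ta: "\<And>k A. k \<in> ext omega ==> A \<in> ext X ==> Ta k A \<in> ext X"
    and Y_X: "Y \<in> ext X" and Y_R: "ext Y \<subseteq> ext reals" and Y_F: "ext (F Y) = ext Q"
    and Y_L: "\<And>L. bclosed X L ==> Y \<in> ext L"
    and undecided: "\<And>A a. A \<in> ext X ==> ext A \<subseteq> ext reals ==> F A \<noteq> empty ==> a \<in> ext C ==>
      \<exists>s\<in>ext (F A). dom s \<noteq> empty \<and> ap s empty \<noteq> a"
begin

definition P :: 'a where "P = sep (img F (sep X (%A. ext A \<subseteq> ext reals))) (%B. B \<noteq> empty)"
definition le :: 'a where "le = sep (cprod P P) (%p. ext (pfst p) \<subseteq> ext (psnd p))"

lemma P: "B \<in> ext P \<longleftrightarrow> (\<exists>A\<in>ext X. ext A \<subseteq> ext reals \<and> B = F A) \<and> B \<noteq> empty"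
proof -
  have 1: "D1 (%A. ext A \<subseteq> ext reals)" "D1 (%B. B \<noteq> empty)" "F1 F" by (intro dfi)+
  show ?thesis unfolding P_def ext_sep[OF 1(2)] ext_img[OF 1(3)] ext_sep[OF 1(1)] by blast
qed
lemma le: "opair B B' \<in> ext le \<longleftrightarrow> B \<in> ext P \<and> B' \<in> ext P \<and> ext B \<subseteq> ext B'"
proof -
  have 1: "D1 (%p. ext (pfst p) \<subseteq> ext (psnd p))" by (intro dfi)
  show ?thesis unfolding le_def ext_sep[OF 1] mem_Collect_eq opair_mem_cprod by auto
qed
lemma pos_P: "pos P le" unfolding pos_def le by blast
lemma P_Q: "B \<in> ext P ==> ext B \<subseteq> ext Q" unfolding P using F_sub by blast
lemma P_ne: "B \<in> ext P ==> \<exists>s. s \<in> ext B" unfolding P using empty_iff by blast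
lemma P_up: "B \<in> ext P ==> s \<in> ext B ==> t \<in> ext Q ==> ext s \<subseteq> ext t ==> t \<in> ext B" unfolding P using F_up by blast
lemma PI: "A \<in> ext X ==> ext A \<subseteq> ext reals ==> s \<in> ext (F A) ==> F A \<in> ext P" unfolding P by (metis empty_iff emptyE)
lemma rc_R: "ext (rc A) \<subseteq> ext reals" and ri_R: "ext (ri A B) \<subseteq> ext reals" and bs_R: "ext (bs p) \<subseteq> ext reals"
  and Ta_R: "ext (Ta k A) \<subseteq> ext reals" using rc ri bs Ta by blast+
text \<open>\<open>F\<close> turns \<open>ri\<close> into intersection, so a single common member
  \<open>s\<close> is enough for a common lower bound in \<open>P\<close>.\<close>

lemma meet: assumes "B \<in> ext P" "A \<in> ext X" "s \<in> ext B" "s \<in> ext (F A)"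
  obtains B' where "B' \<in> ext P" "ext B' \<subseteq> ext B" "ext B' \<subseteq> ext (F A)"
proof -
  obtain A' where A': "A' \<in> ext X" "B = F A'" using assms(1) unfolding P by blast
  have "s \<in> ext (F (ri A' A))" using assms(3,4) A'(2) F_ri by blast
  then have "F (ri A' A) \<in> ext P" by (rule PI[OF X_ri[OF A'(1) assms(2)] ri_R])
  then show thesis using that[of "F (ri A' A)"] A'(2) F_ri by blast
qed

text \<open>Along an enumeration of \<open>Q\<close> the conditions become characteristic functions,
  which are reals. They are well-ordered by the least \<open>A\<close> in \<open>X\<close> that
  produces them, so \<open>wo_reals_ctb\<close> applies.\<close>

lemma ctb_P: "ctb P"
proof -
  obtain e where e: "func e omega Q" "\<And>q. q \<in> ext Q ==> \<exists>n\<in>ext omega. ap e n = q" using cQ unfolding ctb_def by blast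
  define ch where "ch = (%B. lam omega (%n. if ap e n \<in> ext B then succ empty else empty))"
  have chF: "F1 ch" unfolding ch_def by (intro dfi)
  have ap_ch: "ap (ch B) n = (if ap e n \<in> ext B then succ empty else empty)" if "n \<in> ext omega" for B n
    unfolding ch_def by (rule ap_lam[OF _ that]) (intro dfi)
  have chR: "ch B \<in> ext reals" for B unfolding ch_def ext_reals by (rule lam_func) (intro dfi, simp)
  have ch_inj: "B = B'" if B: "ext B \<subseteq> ext Q" "ext B' \<subseteq> ext Q" "ch B = ch B'" for B B'
  proof (rule ext_inject, rule set_eqI)
    fix q
    have "q \<in> ext B \<longleftrightarrow> q \<in> ext B'" if q: "q \<in> ext Q"
    proof -
      obtain n where n: "n \<in> ext omega" "ap e n = q" using e(2)[OF q] by blast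
      show ?thesis using ap_ch[OF n(1), of B] ap_ch[OF n(1), of B'] B(3) n(2) by (auto split: if_splits)
    qed
    then show "q \<in> ext B \<longleftrightarrow> q \<in> ext B'" using B(1,2) by blast
  qed
  define M where "M = img ch P"
  have M: "y \<in> ext M \<longleftrightarrow> (\<exists>B\<in>ext P. y = ch B)" for y unfolding M_def ext_img[OF chF] by blast
  let ?Z = "%y. sep X (%A. ch (F A) = y)"
  define mm where "mm = (%y. lw w (?Z y))"
  have mF: "F1 mm" unfolding mm_def by (intro dfi F1D[OF chF])
  have Z: "A \<in> ext (?Z y) \<longleftrightarrow> A \<in> ext X \<and> ch (F A) = y" for A y by (subst ext_sep) (intro dfi F1D[OF chF], simp)
  have mm: "mm y \<in> ext X \<and> ch (F (mm y)) = y" if y: "y \<in> ext M" for y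
  proof -
    obtain B where B: "B \<in> ext P" "y = ch B" using y unfolding M by blast
    obtain A where "A \<in> ext X" "B = F A" using B(1) unfolding P by blast
    then have A: "A \<in> ext X" "ch (F A) = y" using B(2) by simp_all
    have "mm y \<in> ext (?Z y)" unfolding mm_def by (rule lw(1)[OF wo, where x=A]) (use A Z in blast)+
    then show ?thesis unfolding Z .
  qed
  have "WO (pull mm w M) M" by (rule WO_pull[OF wo mF]) (use mm in metis)+
  moreover have "ext M \<subseteq> ext reals" using M chR by auto
  moreover obtain p0 where p0: "p0 \<in> ext P"
  proof -
    obtain q where "q \<in> ext Q" using ctb_ne[OF cQ] by blast
    then show thesis using PI[OF Y_X Y_R] Y_F that by blast
  qed
  moreover have "ch p0 \<in> ext M" using M p0 by blast
  ultimately have "ctb M" using wo_reals_ctb[OF det] by blast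
  then show ?thesis by (rule ctb_of_inj[OF chF _ p0]) (use M ch_inj P_Q in blast)+
qed

text \<open>\<open>B\<close> itself need not be a condition; it may even be empty, in which case the
  statement fails for every \<open>f\<close> in \<open>dseq P le\<close>.\<close>

definition cn :: "'a => 'a => bool" where "cn f B \<longleftrightarrow> (\<exists>k\<in>ext omega. ext (ap f k) \<subseteq> ext B)"
lemma DF_cn[dfi]: assumes "DT t" "DT u" shows "DF (%e. cn (t e) (u e))"
  by (rule DF2[where P=cn, OF _ assms]) (unfold cn_def, intro dfi)
text \<open>The real is read off the new conditions: entry \<open>j\<close> is \<open>m\<close> if
  the filter enters \<open>F (bs (opair j m))\<close>. Its columns are not assumed to be elements of
  \<open>C\<close>.\<close>

definition xf :: "'a => 'a" where "xf f = lam omega (%j. lst (%m. cn f (F (bs (opair j m)))))"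
lemma F1_xf: "F1 xf" by (intro F1I, unfold xf_def, intro dfi)
lemmas [dfi] = F1D[OF F1_xf]

lemma cn_two: assumes f: "dseq P le f" and c: "cn f B" "cn f B'"
  obtains k where "k \<in> ext omega" "ext (ap f k) \<subseteq> ext B" "ext (ap f k) \<subseteq> ext B'"
proof -
  obtain n m where n: "n \<in> ext omega" "ext (ap f n) \<subseteq> ext B" "m \<in> ext omega" "ext (ap f m) \<subseteq> ext B'" using c unfolding cn_def by blast
  obtain k where k: "k \<in> ext omega" "n \<in> ext (succ k)" "m \<in> ext (succ k)" by (rule omega_max[OF n(1,3)])
  have "ext (ap f k) \<subseteq> ext (ap f n)" "ext (ap f k) \<subseteq> ext (ap f m)" using dseq_mono[OF pos_P f k(1,2)] dseq_mono[OF pos_P f k(1,3)] unfolding le by blast+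
  then show thesis using that[OF k(1)] n(2,4) by blast
qed
lemma cn_meet: assumes "dseq P le f" "cn f B" "cn f B'" shows "\<exists>s. s \<in> ext B \<and> s \<in> ext B'"
proof -
  obtain k where k: "k \<in> ext omega" "ext (ap f k) \<subseteq> ext B" "ext (ap f k) \<subseteq> ext B'" by (rule cn_two[OF assms])
  then show ?thesis using P_ne[OF dseq_in[OF assms(1) k(1)]] by blast
qed
lemma cn_rc: "dseq P le f ==> cn f (F A) ==> cn f (F (rc A)) ==> False" using cn_meet F_rc_disj by blast
lemma blw_cn: "blw le f B ==> ext B \<subseteq> ext B' ==> cn f B'" unfolding blw_def cn_def le by blast
lemma eqv_cn: "eqv le f g ==> cn f B \<longleftrightarrow> cn g B"
proof
  assume e: "eqv le f g"
  { assume "cn f B"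
    then obtain n where n: "n \<in> ext omega" "ext (ap f n) \<subseteq> ext B" unfolding cn_def by blast
    obtain m where "m \<in> ext omega" "opair (ap g m) (ap f n) \<in> ext le" using e n(1) unfolding eqv_def by blast
    then show "cn g B" using n(2) unfolding cn_def le by blast }
  { assume "cn g B"
    then obtain n where n: "n \<in> ext omega" "ext (ap g n) \<subseteq> ext B" unfolding cn_def by blast
    obtain m where "m \<in> ext omega" "opair (ap f m) (ap g n) \<in> ext le" using e n(1) unfolding eqv_def by blast
    then show "cn f B" using n(2) unfolding cn_def le by blast }
qed
lemma eqv_xf: "eqv le f g ==> xf f = xf g" unfolding xf_def by (simp add: eqv_cn)

definition DJ :: 'a where "DJ = img (%j. sep P (%B. \<exists>m\<in>ext omega. ext B \<subseteq> ext (F (bs (opair j m))))) omega"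
lemma cdf_DJ: "cdf P le DJ"
proof -
  let ?D = "%j. sep P (%B. \<exists>m\<in>ext omega. ext B \<subseteq> ext (F (bs (opair j m))))"
  have FD: "F1 ?D" by (intro dfi)
  have D: "B \<in> ext (?D j) \<longleftrightarrow> B \<in> ext P \<and> (\<exists>m\<in>ext omega. ext B \<subseteq> ext (F (bs (opair j m))))" for B j by (subst ext_sep) (intro dfi, simp)
  have "dns P le (?D j)" if j: "j \<in> ext omega" for j
    unfolding dns_def
  proof (intro conjI ballI)
    show "ext (?D j) \<subseteq> ext P" using D by blast
    fix B assume B: "B \<in> ext P"
    obtain s where s: "s \<in> ext B" using P_ne[OF B] by blast
    obtain t m where t: "t \<in> ext Q" "m \<in> ext omega" "ext s \<subseteq> ext t" "t \<in> ext (F (bs (opair j m)))" using F_bs[OF _ j] P_Q[OF B] s by blast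
    obtain B' where B': "B' \<in> ext P" "ext B' \<subseteq> ext B" "ext B' \<subseteq> ext (F (bs (opair j m)))"
      by (rule meet[OF B X_bs[OF j t(2)] P_up[OF B s t(1,3)] t(4)])
    then have "B' \<in> ext (?D j)" unfolding D using t(2) by blast
    then show "\<exists>d\<in>ext (?D j). opair d B \<in> ext le" unfolding le using B B' by blast
  qed
  then show ?thesis unfolding cdf_def DJ_def ext_img[OF FD] using ctb_img[OF ctb_omega FD] by blast
qed
lemma xf_iff: assumes f: "gnr P le DJ f" and j: "j \<in> ext omega"
  shows "ap (xf f) j \<in> ext omega" "cn f (F (bs (opair j m))) \<longleftrightarrow> m = ap (xf f) j"
proof -
  have fd: "dseq P le f" using f unfolding gnr_def by blast
  let ?D = "%j. sep P (%B. \<exists>m\<in>ext omega. ext B \<subseteq> ext (F (bs (opair j m))))"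
  have FD: "F1 ?D" by (intro dfi)
  have "?D j \<in> ext DJ" unfolding DJ_def ext_img[OF FD] using j by blast
  then obtain n B where n: "n \<in> ext omega" "B \<in> ext (?D j)" "opair (ap f n) B \<in> ext le" using f unfolding gnr_def mts_def by blast
  have D: "B \<in> ext (?D j) \<longleftrightarrow> B \<in> ext P \<and> (\<exists>m\<in>ext omega. ext B \<subseteq> ext (F (bs (opair j m))))" for B j by (subst ext_sep) (intro dfi, simp)
  obtain m0 where m0: "m0 \<in> ext omega" "ext B \<subseteq> ext (F (bs (opair j m0)))" using n(2) unfolding D by blast
  have c0: "cn f (F (bs (opair j m0)))" unfolding cn_def using n(1,3) m0(2) unfolding le by blast
  have d: "D1 (%m. cn f (F (bs (opair j m))))" by (intro dfi)
  have F: "F1 (%j. lst (%m. cn f (F (bs (opair j m)))))" by (intro dfi)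
  have e: "ap (xf f) j = lst (%m. cn f (F (bs (opair j m))))" unfolding xf_def by (rule ap_lam[OF F j])
  note l = lst(1,2)[OF d, OF m0(1) c0]
  show "ap (xf f) j \<in> ext omega" unfolding e by (rule l(1))
  show "cn f (F (bs (opair j m))) \<longleftrightarrow> m = ap (xf f) j"
  proof
    assume c: "cn f (F (bs (opair j m)))"
    show "m = ap (xf f) j"
    proof (rule ccontr)
      assume "m \<noteq> ap (xf f) j"
      then show False using cn_meet[OF fd c l(2)] F_bs_disj unfolding e by blast
    qed
  next
    assume "m = ap (xf f) j" then show "cn f (F (bs (opair j m)))" using l(2) unfolding e by simp
  qed
qed
lemma xf_real: assumes f: "gnr P le DJ f" shows "xf f \<in> ext reals"
proof -
  have F: "F1 (%j. lst (%m. cn f (F (bs (opair j m)))))" by (intro dfi)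
  have "func (xf f) omega (img (%j. lst (%m. cn f (F (bs (opair j m))))) omega)" unfolding xf_def by (rule lam_func_img[OF F])
  then show ?thesis unfolding ext_reals by (rule func_change) (rule xf_iff(1)[OF f])
qed

lemma frcP: assumes "cdf P le D" "frc P le p W"
    "\<And>f. dseq P le f ==> gnr P le DJ f ==> gnr P le D f ==> blw le f p ==> f \<in> ext W ==> f \<in> ext U"
  shows "frc P le p U"
proof -
  obtain E where E: "cdf P le E" "\<And>f. gnr P le E f ==> blw le f p ==> f \<in> ext W" using assms(2) unfolding frc_def by blast
  have "f \<in> ext U" if f: "gnr P le (bun E (bun DJ D)) f" "blw le f p" for f
  proof -
    have g: "gnr P le E f" "gnr P le DJ f" "gnr P le D f" using f(1) unfolding gnr_bun by blast+
    show ?thesis using assms(3)[OF _ g(2,3) f(2) E(2)[OF g(1) f(2)]] g(1) unfolding gnr_def by blast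
  qed
  then show ?thesis unfolding frc_def using cdf_bun[OF E(1) cdf_bun[OF cdf_DJ assms(1)]] by blast
qed

definition Gd :: "'a => 'a" where "Gd A = sep (funs omega P) (%f. xf f \<in> ext A)"
lemma F1_Gd: "F1 Gd" by (intro F1I, unfold Gd_def, intro dfi)
lemmas [dfi] = F1D[OF F1_Gd]
lemma Gd: "f \<in> ext (Gd A) \<longleftrightarrow> func f omega P \<and> xf f \<in> ext A" unfolding Gd_def by (subst ext_sep) (intro dfi, simp)
lemma inv_Gd: "inv P le (Gd A)" unfolding inv_def Gd using eqv_xf dseq_func by metis
text \<open>Instance at \<open>f\<close> of a truth lemma that links the new order with
  \<open>Q\<close>: the right-hand side says that the filter has a member all of whose elements
  force \<open>A\<close> in the sense of \<open>Q\<close>.\<close>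

definition Tr :: "'a => 'a" where "Tr A = sep (funs omega P) (%f. xf f \<in> ext A \<longleftrightarrow> cn f (F A))"
lemma F1_Tr: "F1 Tr" by (intro F1I, unfold Tr_def, intro dfi)
lemmas [dfi] = F1D[OF F1_Tr]
lemma Tr: "f \<in> ext (Tr A) \<longleftrightarrow> func f omega P \<and> (xf f \<in> ext A \<longleftrightarrow> cn f (F A))" unfolding Tr_def by (subst ext_sep) (intro dfi, simp)
lemma inv_Tr: "inv P le (Tr A)" unfolding inv_def Tr
proof (intro allI impI)
  fix f g assume h: "dseq P le f \<and> dseq P le g \<and> eqv le f g \<and> func f omega P \<and> (xf f \<in> ext A \<longleftrightarrow> cn f (F A))"
  then show "func g omega P \<and> (xf g \<in> ext A \<longleftrightarrow> cn g (F A))" using eqv_xf[of f g] eqv_cn[of f g] dseq_func[of P le g] by simp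
qed

definition Dec :: "'a => 'a" where "Dec A = sep P (%B. ext B \<subseteq> ext (F A) \<or> ext B \<subseteq> ext (F (rc A)))"
lemma Dec: "B \<in> ext (Dec A) \<longleftrightarrow> B \<in> ext P \<and> (ext B \<subseteq> ext (F A) \<or> ext B \<subseteq> ext (F (rc A)))"
  unfolding Dec_def by (subst ext_sep) (intro dfi, simp)
lemma Dec_dense: assumes A: "A \<in> ext X" and B: "B \<in> ext P" shows "\<exists>B'\<in>ext (Dec A). opair B' B \<in> ext le"
proof -
  obtain s where s: "s \<in> ext B" using P_ne[OF B] by blast
  have "\<exists>B'\<in>ext P. ext B' \<subseteq> ext B \<and> (ext B' \<subseteq> ext (F A) \<or> ext B' \<subseteq> ext (F (rc A)))"
  proof (cases "s \<in> ext (F A)")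
    case True
    show ?thesis by (rule meet[OF B A s True]) blast
  next
    case False
    obtain t where t: "t \<in> ext (F (rc A))" "ext s \<subseteq> ext t" using F_dense[OF _ False] P_Q[OF B] s by blast
    have tB: "t \<in> ext B" using P_up[OF B s _ t(2)] t(1) F_sub by blast
    show ?thesis by (rule meet[OF B X_rc[OF A] tB t(1)]) blast
  qed
  then show ?thesis using B unfolding le by (auto simp: Dec)
qed
lemma cdf_Dec: assumes A: "A \<in> ext X" and p: "p \<in> ext P" shows "cdf P le (up (Dec A) (Dec A))"
proof -
  have "dns P le (Dec A)" unfolding dns_def using Dec_dense[OF A] Dec by blast
  moreover have "ctb (up (Dec A) (Dec A))"
  proof (rule ctb_surj[OF ctb_omega])
    show "F1 (%_. Dec A)" by (intro dfi)
    show "\<And>y. y \<in> ext (up (Dec A) (Dec A)) ==> \<exists>x\<in>ext omega. Dec A = y" by simp (blast intro: omega0)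
  qed simp
  ultimately show ?thesis unfolding cdf_def by simp
qed
lemma gnr_Dec: "gnr P le (up (Dec A) (Dec A)) f ==> cn f (F A) \<or> cn f (F (rc A))"
proof -
  assume "gnr P le (up (Dec A) (Dec A)) f"
  then obtain n d where "n \<in> ext omega" "d \<in> ext (Dec A)" "opair (ap f n) d \<in> ext le" unfolding gnr_def mts_def by auto
  then show ?thesis unfolding Dec le cn_def by blast
qed

text \<open>The family to which \<open>Y_L\<close> is applied: the sets in \<open>X\<close> whose
  truth lemma is forced by every condition.\<close>

definition LL :: 'a where "LL = sep X (%A. ext A \<subseteq> ext reals \<and> (\<forall>p\<in>ext P. frc P le p (Tr A)))"
lemma LL: "A \<in> ext LL \<longleftrightarrow> A \<in> ext X \<and> ext A \<subseteq> ext reals \<and> (\<forall>p\<in>ext P. frc P le p (Tr A))"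
  unfolding LL_def by (subst ext_sep) (intro dfi, simp)

text \<open>Suppose \<open>q1\<close> forces the failure of \<open>Tr A\<close> and decides
  \<open>A\<close> in the sense of \<open>Q\<close>. If \<open>q1\<close> lies inside
  \<open>F A\<close>, the real is outside \<open>A\<close>, so additivity gives one \<open>B\<close>
  in \<open>Z\<close> that the real avoids below some \<open>q2\<close>; but \<open>q2\<close> lies
  inside \<open>F B\<close>, against \<open>Tr B\<close>. If \<open>q1\<close> lies inside
  \<open>F (rc A)\<close>, then \<open>F_int\<close> gives a \<open>B\<close> in \<open>Z\<close>
  and a \<open>q2\<close> inside \<open>F (rc B)\<close>; by \<open>Tr B\<close> the real is outside
  \<open>B\<close>, hence outside \<open>A\<close>, and \<open>Tr A\<close> holds after all.\<close>

lemma LL_int: assumes Z: "ext Z \<subseteq> ext LL" and A: "A \<in> ext X" and Ae: "ext A = {x \<in> ext reals. \<forall>B\<in>ext Z. x \<in> ext B}"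
  shows "A \<in> ext LL"
proof -
  have ZX: "ext Z \<subseteq> ext X" using Z LL by blast
  have "frc P le p (Tr A)" if p: "p \<in> ext P" for p
  proof -
    have no: False if q: "q \<in> ext P" "frc P le q (cmp P (Tr A))" for q
    proof -
      obtain q1 where q1: "q1 \<in> ext (Dec A)" "opair q1 q \<in> ext le" using Dec_dense[OF A q(1)] by blast
      have q1P: "q1 \<in> ext P" using q1(1) Dec by blast
      have f1: "frc P le q1 (cmp P (Tr A))" by (rule frc_mono[OF pos_P q1P q(1) q1(2) q(2)])
      consider "ext q1 \<subseteq> ext (F A)" | "ext q1 \<subseteq> ext (F (rc A))" using q1(1) Dec by blast
      then show False
      proof cases
        case 1
        have "frc P le q1 (Gd (rc A))"
        proof (rule frcP[OF cdf_DJ f1])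
          fix f assume f: "dseq P le f" "gnr P le DJ f" "blw le f q1" "f \<in> ext (cmp P (Tr A))"
          have "cn f (F A)" by (rule blw_cn[OF f(3) 1])
          then show "f \<in> ext (Gd (rc A))" using f(4) xf_real[OF f(2)] unfolding cmp Tr Gd rc by blast
        qed
        moreover have "WO w Z" using wo ZX unfolding WO_def by blast
        moreover have "F1 (%B. Gd (rc B))" by (intro dfi)
        moreover have "\<exists>B\<in>ext Z. f \<in> ext (Gd (rc B))" if "f \<in> ext (Gd (rc A))" for f using that unfolding Gd rc Ae by blast
        ultimately obtain q2 B where q2: "q2 \<in> ext P" "B \<in> ext Z" "opair q2 q1 \<in> ext le" "frc P le q2 (Gd (rc B))"
          using wo_additivity[OF det pos_P ctb_P q1P, of w Z "%B. Gd (rc B)" "Gd (rc A)"] inv_Gd by blast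
        have tb: "frc P le q2 (Tr B)" using Z q2(1,2) LL by blast
        have rf: "opair q2 q2 \<in> ext le" by (rule pos_refl[OF pos_P q2(1)])
        obtain f where f: "gnr P le DJ f" "ap f empty = q2" "f \<in> ext (Gd (rc B))" "f \<in> ext (Tr B)"
          by (rule frc_gen[OF pos_P ctb_P q2(4) tb cdf_DJ q2(1) q2(1) q2(1) rf rf])
        have "ext A \<subseteq> ext B" using Ae q2(2) by blast
        then have "ext q2 \<subseteq> ext (F B)" using q2(3) 1 F_mono unfolding le by blast
        then have "cn f (F B)" unfolding cn_def using f(2) omega0 by blast
        then show False using f(3,4) unfolding Gd Tr rc by blast
      next
        case 2
        obtain s where s: "s \<in> ext q1" using P_ne[OF q1P] by blast
        have sQ: "s \<in> ext Q" using s P_Q[OF q1P] by blast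
        have "s \<notin> ext (F A)" using s 2 F_rc_disj by blast
        then obtain B where B: "B \<in> ext Z" "s \<notin> ext (F B)" using F_int[OF wo ZX Ae sQ] by blast
        have BX: "B \<in> ext X" using B(1) ZX by blast
        obtain t where t: "t \<in> ext (F (rc B))" "ext s \<subseteq> ext t" using F_dense[OF sQ B(2)] by blast
        have tq: "t \<in> ext q1" using P_up[OF q1P s _ t(2)] t(1) F_sub by blast
        obtain q2 where q2: "q2 \<in> ext P" "ext q2 \<subseteq> ext q1" "ext q2 \<subseteq> ext (F (rc B))" by (rule meet[OF q1P X_rc[OF BX] tq t(1)])
        have l: "opair q2 q1 \<in> ext le" unfolding le using q2 q1P by blast
        have rf: "opair q2 q2 \<in> ext le" by (rule pos_refl[OF pos_P q2(1)])
        have tb: "frc P le q2 (Tr B)" using Z q2(1) B(1) LL by blast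
        obtain f where f: "gnr P le DJ f" "ap f empty = q2" "f \<in> ext (cmp P (Tr A))" "f \<in> ext (Tr B)"
          by (rule frc_gen[OF pos_P ctb_P f1 tb cdf_DJ q2(1) q1P q2(1) l rf])
        have fd: "dseq P le f" using f(1) unfolding gnr_def by blast
        have "cn f (F (rc B))" "cn f (F (rc A))" unfolding cn_def using f(2) omega0 q2(2,3) 2 by blast+
        then have "\<not> cn f (F B)" "\<not> cn f (F A)" using cn_rc[OF fd] by blast+
        then have "xf f \<notin> ext B" "f \<in> ext (Tr A)" using f(4) B(1) unfolding Tr Ae by blast+
        then show False using f(3) unfolding cmp by blast
      qed
    qed
    have "(\<exists>q\<in>ext P. opair q p \<in> ext le \<and> frc P le q (cmp P (Tr A))) \<or> frc P le p (cmp P (cmp P (Tr A)))"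
      by (rule baire[OF det pos_P ctb_P p inv_cmp[OF inv_Tr]])
    then have "frc P le p (cmp P (cmp P (Tr A)))" using no by blast
    then show ?thesis by (rule frc_imp) (use dseq_func in \<open>unfold cmp, blast\<close>)
  qed
  then show ?thesis unfolding LL using A Ae by blast
qed

lemma Y_LL: "Y \<in> ext LL"
proof (rule Y_L, unfold bclosed_def, intro conjI ballI allI impI)
  show "ext LL \<subseteq> {A. ext A \<subseteq> ext reals}" using LL by blast
  have triv: "frc P le p (funs omega P)" if "p \<in> ext P" for p by (rule frcI[OF pos_P that]) (simp add: dseq_func)
  fix i j assume ij: "i \<in> ext omega" "j \<in> ext omega"
  have "frc P le p (Tr (bs (opair i j)))" if p: "p \<in> ext P" for p
  proof (rule frcP[OF cdf_DJ triv[OF p]])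
    fix f assume f: "dseq P le f" "gnr P le DJ f"
    have r: "func (xf f) omega omega" using xf_real[OF f(2)] unfolding ext_reals .
    show "f \<in> ext (Tr (bs (opair i j)))" unfolding Tr bs func_opair_iff[OF r] xf_iff(2)[OF f(2) ij(1)]
      using dseq_func[OF f(1)] xf_real[OF f(2)] ij(1) by blast
  qed
  then show "bs (opair i j) \<in> ext LL" unfolding LL using X_bs[OF ij] bs_R by blast
next
  fix A assume A: "A \<in> ext LL"
  have "frc P le p (Tr (rc A))" if p: "p \<in> ext P" for p
  proof (rule frcP[where D="up (Dec A) (Dec A)" and W="Tr A"])
    show "cdf P le (up (Dec A) (Dec A))" "frc P le p (Tr A)" using cdf_Dec[OF _ p] A p LL by blast+
    fix f assume f: "dseq P le f" "gnr P le DJ f" "gnr P le (up (Dec A) (Dec A)) f" "f \<in> ext (Tr A)"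
    show "f \<in> ext (Tr (rc A))" using f(4) gnr_Dec[OF f(3)] cn_rc[OF f(1)] xf_real[OF f(2)] unfolding Tr rc by blast
  qed
  then show "rc A \<in> ext LL" using A X_rc rc_R unfolding LL by blast
next
  fix A B assume A: "A \<in> ext LL" and B: "B \<in> ext LL"
  have "frc P le p (Tr (ri A B))" if p: "p \<in> ext P" for p
  proof (rule frc_imp2)
    show "frc P le p (Tr A)" "frc P le p (Tr B)" using A B p LL by blast+
    fix f assume f: "dseq P le f" "f \<in> ext (Tr A)" "f \<in> ext (Tr B)"
    have "cn f (F (ri A B)) \<longleftrightarrow> cn f (F A) \<and> cn f (F B)"
    proof
      assume "cn f (F (ri A B))" then show "cn f (F A) \<and> cn f (F B)" unfolding cn_def subset_iff F_ri by blast
    next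
      assume "cn f (F A) \<and> cn f (F B)"
      then obtain k where "k \<in> ext omega" "ext (ap f k) \<subseteq> ext (F A)" "ext (ap f k) \<subseteq> ext (F B)" using cn_two[OF f(1)] by blast
      then show "cn f (F (ri A B))" unfolding cn_def subset_iff F_ri by blast
    qed
    moreover have "ext A \<subseteq> ext reals" using A LL by blast
    ultimately show "f \<in> ext (Tr (ri A B))" using f(2,3) unfolding Tr ri by blast
  qed
  then show "ri A B \<in> ext LL" using A B X_ri ri_R unfolding LL by blast
qed (rule LL_int)

lemma forced_Y: assumes p: "p \<in> ext P" shows "frc P le p (Gd Y)"
proof -
  have "frc P le p (Tr Y)" using Y_LL p LL by blast
  then show ?thesis
  proof (rule frc_imp)
    fix f assume f: "dseq P le f" "f \<in> ext (Tr Y)"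
    have "cn f (F Y)" unfolding cn_def Y_F using P_Q[OF dseq_in[OF f(1) omega0]] omega0 by blast
    then show "f \<in> ext (Gd Y)" using f(2) unfolding Tr Gd by blast
  qed
qed

text \<open>Each \<open>a\<close> in \<open>K\<close> yields a dense set of conditions that make
  some digit of column 0 differ from that of \<open>a\<close>: by \<open>undecided\<close> every
  condition contains a sequence with a first entry other than \<open>a\<close>. As \<open>K\<close>
  is countable, one generic sequence meets all these dense sets.\<close>

lemma generic_avoids: assumes K: "ctb K" "ext K \<subseteq> ext reals" and p: "p \<in> ext P" "frc P le p (Gd A)"
    and A: "\<And>x. x \<in> ext A ==> x \<in> ext reals ==> col x empty \<in> ext K"
  shows False
proof -
  let ?D = "%a. sep P (%B. \<exists>m\<in>ext omega. \<exists>n\<in>ext omega. n \<noteq> ap a m \<and> ext B \<subseteq> ext (F (bs (opair (pr empty m) n))))"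
  have FD: "F1 ?D" by (intro dfi)
  have D: "B \<in> ext (?D a) \<longleftrightarrow> B \<in> ext P \<and> (\<exists>m\<in>ext omega. \<exists>n\<in>ext omega. n \<noteq> ap a m \<and> ext B \<subseteq> ext (F (bs (opair (pr empty m) n))))" for B a
    by (subst ext_sep) (intro dfi, simp)
  have "dns P le (?D a)" if a: "a \<in> ext K" for a
    unfolding dns_def
  proof (intro conjI ballI)
    show "ext (?D a) \<subseteq> ext P" using D by blast
    fix B assume B: "B \<in> ext P"
    obtain A' where A': "A' \<in> ext X" "ext A' \<subseteq> ext reals" "B = F A'" "F A' \<noteq> empty" using B unfolding P by blast
    obtain c where c: "c \<in> ext C" using C_ne by blast
    have "\<exists>s\<in>ext B. dom s \<noteq> empty \<and> ap s empty \<noteq> a"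
    proof (cases "a \<in> ext C")
      case True then show ?thesis using undecided[OF A'(1,2,4) True] A'(3) by simp
    next
      case False
      \<comment> \<open>For \<open>a\<close> outside \<open>C\<close> any first entry will do, being
        an element of \<open>C\<close>; \<open>undecided\<close> at an arbitrary \<open>c\<close>
        supplies a nonempty sequence.\<close>
      then have "a \<noteq> ap s empty" if s: "s \<in> ext B" "dom s \<noteq> empty" for s
      proof -
        obtain n where n: "n \<in> ext omega" "func s n C" using s(1) P_Q[OF B] unfolding ext_fin_seqs by blast
        have "empty \<in> ext n" using ord_linear[OF ord_empty omega_ord[OF n(1)]] s(2) func_dom[OF n(2)] by auto
        from func_ap_in[OF n(2) this] show ?thesis using False by blast
      qed
      then show ?thesis using undecided[OF A'(1,2,4) c] A'(3) by metis
    qed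
    then obtain s where s: "s \<in> ext B" "dom s \<noteq> empty" "ap s empty \<noteq> a" by blast
    have sQ: "s \<in> ext Q" using s(1) P_Q[OF B] by blast
    obtain n where n: "n \<in> ext omega" "func s n C" using sQ unfolding ext_fin_seqs by blast
    have z: "empty \<in> ext n" using ord_linear[OF ord_empty omega_ord[OF n(1)]] s(2) func_dom[OF n(2)] by auto
    have b: "func (ap s empty) omega omega" using func_ap_in[OF n(2) z] CR unfolding ext_reals[symmetric] by blast
    have af: "func a omega omega" using a K(2) unfolding ext_reals[symmetric] by blast
    obtain m where m: "m \<in> ext omega" "ap (ap s empty) m \<noteq> ap a m" using func_eqI[OF b af] s(3) by blast
    note q = pr[OF omega0 m(1)]
    have "s \<in> ext (F (bs (opair (pr empty m) (ap (ap s (lf (pr empty m))) (rt (pr empty m))))))"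
      by (rule F_bsI[OF sQ _ q(1)]) (use z func_dom[OF n(2)] q(2) in simp)
    then have sb: "s \<in> ext (F (bs (opair (pr empty m) (ap (ap s empty) m))))" unfolding q(2,3) .
    have no: "ap (ap s empty) m \<in> ext omega" by (rule func_ap_in[OF b m(1)])
    obtain B' where B': "B' \<in> ext P" "ext B' \<subseteq> ext B" "ext B' \<subseteq> ext (F (bs (opair (pr empty m) (ap (ap s empty) m))))"
      by (rule meet[OF B X_bs[OF q(1) no] s(1) sb])
    then have "B' \<in> ext (?D a)" unfolding D using m no by blast
    then show "\<exists>d\<in>ext (?D a). opair d B \<in> ext le" unfolding le using B B' by blast
  qed
  then have cd: "cdf P le (img ?D K)" unfolding cdf_def ext_img[OF FD] using ctb_img[OF K(1) FD] by blast
  have rf: "opair p p \<in> ext le" by (rule pos_refl[OF pos_P p(1)])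
  obtain f where f: "gnr P le (bun DJ (img ?D K)) f" "f \<in> ext (Gd A)"
    by (rule frc_gen[OF pos_P ctb_P p(2) p(2) cdf_bun[OF cdf_DJ cd] p(1) p(1) p(1) rf rf])
  have g: "gnr P le DJ f" "gnr P le (img ?D K) f" using f(1) unfolding gnr_bun by blast+
  let ?a = "col (xf f) empty"
  have aK: "?a \<in> ext K" using A f(2) xf_real[OF g(1)] unfolding Gd by blast
  then have "?D ?a \<in> ext (img ?D K)" unfolding ext_img[OF FD] by blast
  then obtain i B where B: "i \<in> ext omega" "B \<in> ext (?D ?a)" "opair (ap f i) B \<in> ext le" using g(2) unfolding gnr_def mts_def by blast
  obtain m n where mn: "m \<in> ext omega" "n \<noteq> ap ?a m" "ext B \<subseteq> ext (F (bs (opair (pr empty m) n)))" using B(2) unfolding D by blast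
  have "cn f (F (bs (opair (pr empty m) n)))" unfolding cn_def using B(1,3) mn(3) unfolding le by blast
  then show False using mn(2) unfolding xf_iff(2)[OF g(1) pr(1)[OF omega0 mn(1)]] ap_col[OF mn(1)] by blast
qed

lemma pl_P: assumes k: "k \<in> ext omega" and B: "B \<in> ext P" shows "pl k B \<in> ext P" "pl k (pl k B) = B"
proof -
  obtain A where A: "A \<in> ext X" "ext A \<subseteq> ext reals" "B = F A" using B unfolding P by blast
  have e: "pl k B = F (Ta k A)" unfolding A(3) F_Ta[OF k] ..
  show i: "pl k (pl k B) = B" unfolding e F_Ta[OF k, symmetric] F_Ta_Ta[OF k] A(3) ..
  have "pl k B \<noteq> empty"
  proof
    assume h: "pl k B = empty"
    obtain s where s: "s \<in> ext B" using P_ne[OF B] by blast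
    then have s': "s \<in> ext (pl k empty)" using i h by simp
    obtain c where c: "c \<in> ext C" using C_ne by blast
    obtain t where t: "t \<in> ext Q" "ext s \<subseteq> ext t" "ext (addn k k) \<subseteq> ext (dom t)"
      using fin_extend[OF c _ addn_in[OF k k]] s P_Q[OF B] by blast
    then show False using s' unfolding pl by auto
  qed
  then show "pl k B \<in> ext P" unfolding P using e X_Ta[OF k A(1)] Ta_R by blast
qed
text \<open>\<open>pl k\<close> is an order automorphism of \<open>P\<close>, so it carries generic
  sequences to generic sequences. By \<open>F_Ta\<close> the filter of the image enters
  \<open>F A'\<close> iff the original one enters \<open>F (Ta k A')\<close>, which for basic sets
  shows that the real of the image is the exchanged real.\<close>

lemma frc_pl: assumes k: "k \<in> ext omega" and B: "B \<in> ext P" "frc P le B (Gd A)" shows "frc P le (pl k B) (Gd (Ta k A))"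
proof -
  obtain D where D: "cdf P le D" "\<And>f. gnr P le D f ==> blw le f B ==> f \<in> ext (Gd A)" using B(2) unfolding frc_def by blast
  have Fp: "F1 (pl k)" by (intro dfi)
  have FI: "F1 (img (pl k))" by (intro dfi)
  have "dns P le (img (pl k) E)" if E: "dns P le E" for E
    unfolding dns_def
  proof (intro conjI ballI)
    show "ext (img (pl k) E) \<subseteq> ext P" unfolding ext_img[OF Fp] using E pl_P(1)[OF k] unfolding dns_def by blast
    fix p assume p: "p \<in> ext P"
    obtain d where d: "d \<in> ext E" "opair d (pl k p) \<in> ext le" using E pl_P(1)[OF k p] unfolding dns_def by blast
    have "ext (pl k d) \<subseteq> ext p" using pl_mono[of d "pl k p" k] d(2) pl_P(2)[OF k p] unfolding le by simp
    then have "opair (pl k d) p \<in> ext le" unfolding le using p d(2) pl_P(1)[OF k] unfolding le by blast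
    then show "\<exists>d\<in>ext (img (pl k) E). opair d p \<in> ext le" unfolding ext_img[OF Fp] using d(1) by blast
  qed
  then have cd: "cdf P le (img (img (pl k)) D)" using D(1) ctb_img[OF _ FI] unfolding cdf_def ext_img[OF FI] by blast
  have "f \<in> ext (Gd (Ta k A))" if f: "gnr P le (bun DJ (img (img (pl k)) D)) f" "blw le f (pl k B)" for f
  proof -
    have g: "gnr P le DJ f" "gnr P le (img (img (pl k)) D) f" using f(1) unfolding gnr_bun by blast+
    have fd: "dseq P le f" using g(1) unfolding gnr_def by blast
    have Fh: "F1 (%n. pl k (ap f n))" by (intro dfi)
    define h where "h = lam omega (%n. pl k (ap f n))"
    have hn: "ap h n = pl k (ap f n)" if "n \<in> ext omega" for n unfolding h_def by (rule ap_lam[OF Fh that])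
    have hP: "ap h n \<in> ext P" if n: "n \<in> ext omega" for n unfolding hn[OF n] by (rule pl_P(1)[OF k dseq_in[OF fd n]])
    have hle: "opair (ap h n) B' \<in> ext le" if n: "n \<in> ext omega" and b: "opair (ap f n) (pl k B') \<in> ext le" "B' \<in> ext P" for n B'
    proof -
      have "ext (pl k (ap f n)) \<subseteq> ext (pl k (pl k B'))" by (rule pl_mono) (use b(1) le in blast)
      then show ?thesis unfolding le hn[OF n] pl_P(2)[OF k b(2)] using b(2) hP[OF n] hn[OF n] by simp
    qed
    have hd: "dseq P le h" unfolding dseq_def
    proof (intro conjI ballI)
      show "func h omega P" unfolding h_def by (rule lam_func[OF Fh]) (rule pl_P(1)[OF k dseq_in[OF fd]])
      fix n assume n: "n \<in> ext omega"
      have "ext (ap f (succ n)) \<subseteq> ext (ap f n)" using fd n unfolding dseq_def le by blast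
      from pl_mono[OF this, of k] show "opair (ap h (succ n)) (ap h n) \<in> ext le"
        unfolding le using hP[OF n] hP[OF omegaS[OF n]] unfolding hn[OF n] hn[OF omegaS[OF n]] by blast
    qed
    have "mts le h E" if E: "E \<in> ext D" for E
    proof -
      have EP: "ext E \<subseteq> ext P" using D(1) E unfolding cdf_def dns_def by blast
      have "img (pl k) E \<in> ext (img (img (pl k)) D)" unfolding ext_img[OF FI] using E by blast
      then have "mts le f (img (pl k) E)" using g(2) unfolding gnr_def by blast
      then obtain n d where n: "n \<in> ext omega" "d \<in> ext E" "opair (ap f n) (pl k d) \<in> ext le"
        unfolding mts_def ext_img[OF Fp] by blast
      have "d \<in> ext P" using n(2) EP by blast
      from hle[OF n(1,3) this] show ?thesis unfolding mts_def using n by blast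
    qed
    then have hg: "gnr P le D h" unfolding gnr_def using hd by blast
    have "blw le h B" using f(2) hle B(1) unfolding blw_def by blast
    then have hA: "xf h \<in> ext A" using D(2)[OF hg] unfolding Gd by blast
    have c: "cn h (F A') \<longleftrightarrow> cn f (F (Ta k A'))" for A'
    proof -
      have "ext (pl k (ap f n)) \<subseteq> ext (F A') \<longleftrightarrow> ext (ap f n) \<subseteq> ext (pl k (F A'))" if n: "n \<in> ext omega" for n
      proof
        assume "ext (pl k (ap f n)) \<subseteq> ext (F A')"
        from pl_mono[OF this, of k] show "ext (ap f n) \<subseteq> ext (pl k (F A'))" unfolding pl_P(2)[OF k dseq_in[OF fd n]] .
      next
        assume "ext (ap f n) \<subseteq> ext (pl k (F A'))"
        from pl_mono[OF this, of k] show "ext (pl k (ap f n)) \<subseteq> ext (F A')" unfolding F_Ta[OF k, symmetric] F_Ta_Ta[OF k] .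
      qed
      then show ?thesis unfolding cn_def F_Ta[OF k] using hn by auto
    qed
    have r: "xf f \<in> ext reals" by (rule xf_real[OF g(1)])
    have F1': "F1 (%j. lst (%m. cn g' (F (bs (opair j m)))))" for g' by (intro dfi)
    have "xf h = xT k (xf f)"
    proof (rule func_eqI)
      show "func (xf h) omega (img (%j. lst (%m. cn h (F (bs (opair j m))))) omega)" unfolding xf_def by (rule lam_func_img[OF F1'])
      show "func (xT k (xf f)) omega omega" using xT_real[OF k r] unfolding ext_reals .
      fix j assume j: "j \<in> ext omega"
      have "ap (xf h) j = lst (%m. cn h (F (bs (opair j m))))" unfolding xf_def by (rule ap_lam[OF F1' j])
      also have "\<dots> = lst (%m. cn f (F (bs (opair (pr (tsw k (lf j)) (rt j)) m))))" unfolding c Ta_bs[OF k j] ..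
      also have "\<dots> = ap (xf f) (pr (tsw k (lf j)) (rt j))" unfolding xf_def by (rule ap_lam[OF F1' pr_tsw[OF k j], symmetric])
      also have "\<dots> = ap (xT k (xf f)) j" by (rule ap_xT[OF j, symmetric])
      finally show "ap (xf h) j = ap (xT k (xf f)) j" .
    qed
    then show ?thesis unfolding Gd Ta using hA r dseq_func[OF fd] by simp
  qed
  then show ?thesis unfolding frc_def using cdf_bun[OF cdf_DJ cd] by blast
qed

end

section \<open>Choosing an element of each class\<close>

context zf_model
begin

lemma F2_eq_class: "F2 eq_class" by (intro F2I, unfold eq_class_def, intro dfi)
lemmas [dfi] = F2D[OF F2_eq_class]
lemma ext_eq_class: assumes "equiv_rel a r" shows "ext (eq_class r x) = {y. opair x y \<in> ext r}"
proof -
  have "{y. opair x y \<in> ext r} \<subseteq> ext a"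
  proof
    fix y assume "y \<in> {y. opair x y \<in> ext r}"
    then have "opair x y \<in> ext (cprod a a)" using assms unfolding equiv_rel_def by blast
    then show "y \<in> ext a" unfolding opair_mem_cprod by blast
  qed
  then have "is_set {y. opair x y \<in> ext r}" by (rule is_set_subset) (simp, intro dfi)
  then show ?thesis unfolding eq_class_def by (rule ext_coll)
qed
lemma quot_img: "quot a r = img (eq_class r) a"
proof -
  have "eq_class r ` ext a = {y. \<exists>x\<in>ext a. y = eq_class r x}" by blast
  then show ?thesis unfolding quot_def img_def by simp
qed
lemma ext_quot: "ext (quot a r) = eq_class r ` ext a"
  unfolding quot_img by (rule ext_img) (intro dfi)
lemma DT_quot[dfi]: assumes "DT t" "DT u" shows "DT (%e. quot (t e) (u e))"
  unfolding quot_img by (rule DT2[where F="%a r. img (eq_class r) a", OF _ assms]) (intro dfi)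

end

section \<open>The contradiction from two amalgamated conditions\<close>

context poset_forcing
begin

text \<open>\<open>k\<close> exceeds the lengths of a member \<open>s1\<close> of \<open>B1\<close>
  and a member \<open>s2\<close> of \<open>B2\<close>. The sequence \<open>s3\<close> of length
  \<open>2 * k\<close> starts with \<open>s1\<close> and repeats \<open>s2\<close> from place
  \<open>k\<close> on, with \<open>c\<close> as filler; so it lies in \<open>B1\<close>, its
  exchange lies in \<open>B2\<close>, and it witnesses the compatibility of \<open>B1\<close> with
  \<open>pl k B2\<close>.\<close>

lemma amalgamate:
  assumes B: "B1 \<in> ext P" "B2 \<in> ext P"
  obtains k B3 where "k \<in> ext omega" "empty \<in> ext k" "B3 \<in> ext P" "ext B3 \<subseteq> ext B1" "ext B3 \<subseteq> ext (pl k B2)"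
proof -
  obtain A1 A2 where A: "A1 \<in> ext X" "B1 = F A1" "A2 \<in> ext X" "B2 = F A2" using B unfolding P by blast
  obtain s1 s2 where s: "s1 \<in> ext B1" "s2 \<in> ext B2" using P_ne B by blast
  obtain c where c: "c \<in> ext C" using C_ne by blast
  obtain n1 where n1: "n1 \<in> ext omega" "func s1 n1 C" using s(1) P_Q[OF B(1)] unfolding ext_fin_seqs by blast
  obtain n2 where n2: "n2 \<in> ext omega" "func s2 n2 C" using s(2) P_Q[OF B(2)] unfolding ext_fin_seqs by blast
  obtain k0 where k0: "k0 \<in> ext omega" "n1 \<in> ext (succ k0)" "n2 \<in> ext (succ k0)" by (rule omega_max[OF n1(1) n2(1)])
  \<comment> \<open>The successor makes \<open>k\<close> positive, so that column 0 is really moved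
    by the exchange.\<close>
  define k where "k = succ k0"
  have k: "k \<in> ext omega" unfolding k_def by (rule omegaS[OF k0(1)])
  have nk: "ext n1 \<subseteq> ext k" "ext n2 \<subseteq> ext k" using ord_sub[OF omega_ord[OF k]] k0(2,3) unfolding k_def by blast+
  have zk: "empty \<in> ext k" unfolding k_def using ord_linear[OF ord_empty omega_ord[OF k0(1)]] by auto
  note kk = addn_in[OF k k]
  let ?G = "%i. if i \<in> ext n1 then ap s1 i else if tsw k i \<in> ext n2 then ap s2 (tsw k i) else c"
  have G: "F1 ?G" by (intro dfi)
  define s3 where "s3 = lam (addn k k) ?G"
  have f3: "func s3 (addn k k) C" unfolding s3_def
    by (rule lam_func[OF G]) (use func_ap_in[OF n1(2)] func_ap_in[OF n2(2)] c in auto)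
  have d3: "dom s3 = addn k k" by (rule func_dom[OF f3])
  have Q3: "s3 \<in> ext Q" unfolding ext_fin_seqs using f3 kk by blast
  have a3: "ap s3 i = ?G i" if "i \<in> ext (addn k k)" for i unfolding s3_def by (rule ap_lam[OF G that])
  have i1: "i \<in> ext (addn k k)" if "i \<in> ext k" for i using addn_ge[OF k, of k] that by blast
  have "opair i (ap s1 i) \<in> ext s3" if i: "i \<in> ext n1" for i
    unfolding func_opair_iff[OF f3] using a3[of i] i1[of i] i nk(1) by auto
  then have "ext s1 \<subseteq> ext s3" unfolding func_ext_eq[OF n1(2)] by blast
  then have m1: "s3 \<in> ext B1" by (rule P_up[OF B(1) s(1) Q3])
  have d3': "ext (addn k k) \<subseteq> ext (dom s3)" using d3 by simp
  note t3 = tw[OF k Q3 d3']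
  obtain n3 where n3: "func (tw k s3) n3 C" using t3(1) unfolding ext_fin_seqs by blast
  have n3e: "n3 = addn k k" using func_dom[OF n3] t3(2) d3 by simp
  have "opair i (ap s2 i) \<in> ext (tw k s3)" if i: "i \<in> ext n2" for i
  proof -
    have ik: "i \<in> ext k" using i nk(2) by blast
    have io: "i \<in> ext omega" by (rule omega_trans[OF k ik])
    have "addn k i \<notin> ext k" using addn_ge[OF io, of k] mem_irrefl[of "addn k i"] by blast
    then have "addn k i \<notin> ext n1" using nk(1) by blast
    moreover have "addn k i \<in> ext (addn k k)" by (rule addn_mono[OF k ik])
    ultimately have "ap s3 (addn k i) = ap s2 i" using a3 tsw_hi[OF k ik] i by simp
    then have "ap (tw k s3) i = ap s2 i" using t3(3)[of i] d3 i1[OF ik] tsw_lo[OF ik] by simp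
    then show ?thesis unfolding func_opair_iff[OF n3] n3e using i1[OF ik] by simp
  qed
  then have "ext s2 \<subseteq> ext (tw k s3)" unfolding func_ext_eq[OF n2(2)] by blast
  then have "tw k s3 \<in> ext B2" by (rule P_up[OF B(2) s(2) t3(1)])
  then have m2: "s3 \<in> ext (F (Ta k A2))" unfolding A(4) by (rule F_transfer[OF k Q3 d3'])
  obtain B3 where "B3 \<in> ext P" "ext B3 \<subseteq> ext B1" "ext B3 \<subseteq> ext (F (Ta k A2))" by (rule meet[OF B(1) X_Ta[OF k A(3)] m1 m2])
  then show thesis using that[OF k zk] unfolding A(4) F_Ta[OF k] by blast
qed

lemma forced_cases: assumes A: "ext A \<subseteq> ext reals" and p: "p \<in> ext P" and n: "\<And>q. q \<in> ext P ==> ext q \<subseteq> ext p ==> frc P le q (Gd (rc A)) ==> False"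
  shows "frc P le p (Gd A)"
proof -
  have "(\<exists>q\<in>ext P. opair q p \<in> ext le \<and> frc P le q (Gd (rc A))) \<or> frc P le p (cmp P (Gd (rc A)))"
    by (rule baire[OF det pos_P ctb_P p inv_Gd])
  then have "frc P le p (cmp P (Gd (rc A)))" using n unfolding le by blast
  then show ?thesis
  proof (rule frcP[OF cdf_DJ])
    fix f assume f: "dseq P le f" "gnr P le DJ f" "f \<in> ext (cmp P (Gd (rc A)))"
    show "f \<in> ext (Gd A)" using f(3) xf_real[OF f(2)] unfolding cmp Gd rc by blast
  qed
qed
lemma forced_reals: assumes p: "p \<in> ext P" shows "frc P le p (Gd reals)"
proof (rule forced_cases[OF subset_refl p])
  fix q assume q: "q \<in> ext P" "frc P le q (Gd (rc reals))"
  have rf: "opair q q \<in> ext le" by (rule pos_refl[OF pos_P q(1)])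
  obtain f where "f \<in> ext (Gd (rc reals))" by (rule frc_gen[OF pos_P ctb_P q(2) q(2) cdf_DJ q(1) q(1) q(1) rf rf])
  then show False unfolding Gd rc by blast
qed
lemma forced_union: assumes "p \<in> ext P" "frc P le p (Gd U)" "WO v I" "F1 A" "\<And>x. x \<in> ext U ==> \<exists>i\<in>ext I. x \<in> ext (A i)"
  obtains q i where "q \<in> ext P" "i \<in> ext I" "ext q \<subseteq> ext p" "frc P le q (Gd (A i))"
proof -
  have F: "F1 (%i. Gd (A i))" by (intro dfi F1D[OF assms(4)])
  have "\<exists>i\<in>ext I. f \<in> ext (Gd (A i))" if "f \<in> ext (Gd U)" for f using that assms(5) unfolding Gd by blast
  then obtain q i where "q \<in> ext P" "i \<in> ext I" "opair q p \<in> ext le" "frc P le q (Gd (A i))"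
    using wo_additivity[OF det pos_P ctb_P assms(1,3) F inv_Gd assms(2)] by blast
  then show thesis using that unfolding le by blast
qed
lemma forced_both: assumes "p \<in> ext P" "frc P le p (Gd A)" "frc P le p (Gd B)"
  obtains x where "x \<in> ext reals" "x \<in> ext A" "x \<in> ext B"
proof -
  have rf: "opair p p \<in> ext le" by (rule pos_refl[OF pos_P assms(1)])
  obtain f where "gnr P le DJ f" "f \<in> ext (Gd A)" "f \<in> ext (Gd B)"
    by (rule frc_gen[OF pos_P ctb_P assms(2,3) cdf_DJ assms(1) assms(1) assms(1) rf rf])
  then show thesis using that xf_real unfolding Gd by blast
qed
lemma forced_mono: "q \<in> ext P ==> p \<in> ext P ==> ext q \<subseteq> ext p ==> frc P le p W ==> frc P le q W"
  using frc_mono[OF pos_P] le by blast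

lemma undecided_False:
  assumes \<kappa>: "ordinal \<kappa>" and er: "\<And>b. b \<in> ext \<kappa> ==> equiv_rel reals (ap E b)"
    and bij: "\<And>b. b \<in> ext \<kappa> ==> \<exists>h. bijection h (quot reals (ap E b)) reals"
    and cls: "\<And>b c. b \<in> ext \<kappa> ==> c \<in> ext (quot reals (ap E b)) ==> countable c"
    and Y: "ext Y = {x \<in> ext reals. \<exists>b\<in>ext \<kappa>. \<forall>i\<in>ext omega. \<forall>j\<in>ext omega. opair (col x i) (col x j) \<in> ext (ap E b)}"
  shows False
proof -
  let ?Yb = "%b. sep reals (%x. \<forall>i\<in>ext omega. \<forall>j\<in>ext omega. opair (col x i) (col x j) \<in> ext (ap E b))"
  have YbF: "F1 ?Yb" by (intro dfi)
  have Yb: "x \<in> ext (?Yb b) \<longleftrightarrow> x \<in> ext reals \<and> (\<forall>i\<in>ext omega. \<forall>j\<in>ext omega. opair (col x i) (col x j) \<in> ext (ap E b))" for x b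
    by (subst ext_sep) (intro dfi, simp)
  obtain q0 where "q0 \<in> ext Q" using ctb_ne[OF cQ] by blast
  then obtain p0 where p0: "p0 \<in> ext P" using PI[OF Y_X Y_R] Y_F by blast
  have Yu: "\<exists>b\<in>ext \<kappa>. x \<in> ext (?Yb b)" if "x \<in> ext Y" for x using that unfolding Y Yb by blast
  obtain B0 b where B0: "B0 \<in> ext P" and b: "b \<in> ext \<kappa>" and fY: "frc P le B0 (Gd (?Yb b))"
    by (rule forced_union[OF p0 forced_Y[OF p0] WO_ordinal[OF \<kappa>] YbF Yu])
  define R where "R = ap E b"
  have eR: "equiv_rel reals R" unfolding R_def by (rule er[OF b])
  obtain h where h: "bijection h (quot reals R) reals" using bij[OF b] unfolding R_def by blast
  have hf: "func h (quot reals R) reals" and hb: "bij_betw (app h) (ext (quot reals R)) (ext reals)" using h unfolding bijection_def by blast+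
  note ec = ext_eq_class[OF eR]
  have Rrefl: "\<And>x. x \<in> ext reals ==> opair x x \<in> ext R" and Rsym: "\<And>x y. opair x y \<in> ext R ==> opair y x \<in> ext R"
    and Rtr: "\<And>x y z. opair x y \<in> ext R ==> opair y z \<in> ext R ==> opair x z \<in> ext R" using eR unfolding equiv_rel_def by blast+
  have cl_eq: "eq_class R x = eq_class R y" if "opair x y \<in> ext R" for x y
    by (rule ext_inject, unfold ec) (use that Rsym Rtr in blast)
  \<comment> \<open>Here the bijection with the reals enters: \<open>ph\<close> is constant on
    equivalence classes and separates them, and its values are reals whose digits can be decided one
    at a time.\<close>
  define ph where "ph = (%y. ap h (eq_class R y))"
  have phF: "F1 ph" unfolding ph_def by (intro dfi)
  have qin: "eq_class R y \<in> ext (quot reals R)" if "y \<in> ext reals" for y unfolding ext_quot using that by blast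
  have phR: "ph y \<in> ext reals" if "y \<in> ext reals" for y unfolding ph_def by (rule func_ap_in[OF hf qin[OF that]])
  have ph_eq: "opair x y \<in> ext R" if xy: "x \<in> ext reals" "y \<in> ext reals" "ph x = ph y" for x y
  proof -
    have "app h (eq_class R x) = app h (eq_class R y)" using xy(3) func_app[OF hf qin] xy(1,2) unfolding ph_def by simp
    then have "eq_class R x = eq_class R y" using hb qin xy(1,2) unfolding bij_betw_def inj_on_def by blast
    then have "ext (eq_class R x) = ext (eq_class R y)" by simp
    then have "y \<in> ext (eq_class R x)" unfolding ec using Rrefl[OF xy(2)] by blast
    then show ?thesis unfolding ec by blast
  qed
  let ?A = "%n m. sep reals (%x. ap (ph (col x empty)) n = m)"
  have A: "x \<in> ext (?A n m) \<longleftrightarrow> x \<in> ext reals \<and> ap (ph (col x empty)) n = m" for x n m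
    by (subst ext_sep) (intro dfi F1D[OF phF], simp)
  have AR: "ext (?A n m) \<subseteq> ext reals" for n m using A by blast
  have cR: "col x empty \<in> ext reals" if "x \<in> ext reals" for x by (rule col_real[OF that omega0])
  have phf: "func (ph (col x empty)) omega omega" if "x \<in> ext reals" for x using phR[OF cR[OF that]] unfolding ext_reals .
  have "\<exists>n\<in>ext omega. \<exists>m. \<exists>B1\<in>ext P. \<exists>B2\<in>ext P. ext B1 \<subseteq> ext B0 \<and> ext B2 \<subseteq> ext B0 \<and> frc P le B1 (Gd (?A n m)) \<and> frc P le B2 (Gd (rc (?A n m)))"
  proof (rule ccontr)
    assume "\<not> ?thesis"
    then have ns: False if "n \<in> ext omega" "B1 \<in> ext P" "B2 \<in> ext P" "ext B1 \<subseteq> ext B0" "ext B2 \<subseteq> ext B0"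
      "frc P le B1 (Gd (?A n m))" "frc P le B2 (Gd (rc (?A n m)))" for n m B1 B2 using that by blast
    have AF: "F1 (?A n)" for n by (intro dfi F1D[OF phF])
    \<comment> \<open>In the absence of two conflicting conditions below \<open>B0\<close>, a digit
      forced by some condition below \<open>B0\<close> is already forced by \<open>B0\<close>
      itself.\<close>
    have ex: "\<exists>m\<in>ext omega. frc P le B0 (Gd (?A n m))" if n: "n \<in> ext omega" for n
    proof -
      have u: "\<exists>m\<in>ext omega. x \<in> ext (?A n m)" if "x \<in> ext reals" for x unfolding A using func_ap_in[OF phf[OF that] n] that by blast
      obtain q m where q: "q \<in> ext P" "m \<in> ext omega" "ext q \<subseteq> ext B0" "frc P le q (Gd (?A n m))"
        by (rule forced_union[OF B0 forced_reals[OF B0] WO_ordinal[OF ord_omega] AF u])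
      have "frc P le B0 (Gd (?A n m))"
        by (rule forced_cases[OF AR B0]) (rule ns[OF n q(1) _ q(3) _ q(4)])
      then show ?thesis using q(2) by blast
    qed
    let ?z = "%n. lst (%m. frc P le B0 (Gd (?A n m)))"
    have zF: "F1 ?z" by (intro dfi F1D[OF phF])
    define z where "z = lam omega ?z"
    have zn: "?z n \<in> ext omega \<and> frc P le B0 (Gd (?A n (?z n)))" if n: "n \<in> ext omega" for n
    proof -
      obtain m where m: "m \<in> ext omega" "frc P le B0 (Gd (?A n m))" using ex[OF n] by blast
      have d: "D1 (%m. frc P le B0 (Gd (?A n m)))" by (intro dfi F1D[OF phF])
      show ?thesis using lst(1,2)[OF d, OF m] by (rule conjI)
    qed
    have az: "ap z n = ?z n" if "n \<in> ext omega" for n unfolding z_def by (rule ap_lam[OF zF that])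
    have zf: "func z omega omega" unfolding z_def by (rule lam_func[OF zF]) (use zn in blast)
    have fz: "frc P le B0 (Gd (?A n (ap z n)))" if n: "n \<in> ext omega" for n unfolding az[OF n] using zn[OF n] by blast
    let ?Z = "sep reals (%x. ph (col x empty) = z)"
    have Z: "x \<in> ext ?Z \<longleftrightarrow> x \<in> ext reals \<and> ph (col x empty) = z" for x
      by (subst ext_sep) (intro dfi F1D[OF phF], simp)
    have fZ: "frc P le B0 (Gd ?Z)"
    proof (rule forced_cases[OF _ B0])
      show "ext ?Z \<subseteq> ext reals" using Z by blast
      fix q assume q: "q \<in> ext P" "ext q \<subseteq> ext B0" "frc P le q (Gd (rc ?Z))"
      have AF': "F1 (%n. rc (?A n (ap z n)))" by (intro dfi F1D[OF phF])
      have u: "\<exists>n\<in>ext omega. x \<in> ext (rc (?A n (ap z n)))" if x: "x \<in> ext (rc ?Z)" for x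
      proof -
        have xr: "x \<in> ext reals" "ph (col x empty) \<noteq> z" using x unfolding rc Z by blast+
        then obtain n where "n \<in> ext omega" "ap (ph (col x empty)) n \<noteq> ap z n" using func_eqI[OF phf[OF xr(1)] zf] by blast
        then show ?thesis unfolding rc A using xr(1) by blast
      qed
      obtain q' n where q': "q' \<in> ext P" "n \<in> ext omega" "ext q' \<subseteq> ext q" "frc P le q' (Gd (rc (?A n (ap z n))))"
        by (rule forced_union[OF q(1,3) WO_ordinal[OF ord_omega] AF' u])
      have "frc P le q' (Gd (?A n (ap z n)))" by (rule forced_mono[OF q'(1) B0 _ fz[OF q'(2)]]) (use q(2) q'(3) in blast)
      from forced_both[OF q'(1) this q'(4)] show False unfolding rc by blast
    qed
    \<comment> \<open>By surjectivity of \<open>h\<close> the real \<open>z\<close> of decided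
      digits belongs to the class of some \<open>y0\<close>, so \<open>B0\<close> forces column 0
      into this countable class.\<close>
    have "z \<in> app h ` ext (quot reals R)" using hb zf unfolding bij_betw_def ext_reals[symmetric] by blast
    then obtain y0 where y0: "y0 \<in> ext reals" "z = app h (eq_class R y0)" unfolding ext_quot by blast
    have zy: "z = ph y0" unfolding ph_def y0(2) by (rule func_app[OF hf qin[OF y0(1)]])
    let ?K = "eq_class R y0"
    have "countable ?K" using cls[OF b] qin[OF y0(1)] unfolding R_def by blast
    then have "ctb ?K" by (rule ctb_of_countable[where ?x0.0=y0]) (use Rrefl[OF y0(1)] in \<open>simp add: ec\<close>)
    moreover have "ext ?K \<subseteq> ext reals"
    proof
      fix y assume "y \<in> ext ?K"
      then have "opair y0 y \<in> ext (cprod reals reals)" using eR unfolding ec equiv_rel_def by blast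
      then show "y \<in> ext reals" unfolding opair_mem_cprod by blast
    qed
    moreover have "col x empty \<in> ext ?K" if "x \<in> ext ?Z" "x \<in> ext reals" for x
      unfolding ec using ph_eq[OF y0(1) cR[OF that(2)]] that(1) zy unfolding Z by simp
    ultimately show False using generic_avoids[OF _ _ B0 fZ] by blast
  qed
  then obtain n m B1 B2 where n: "n \<in> ext omega" and B1: "B1 \<in> ext P" "ext B1 \<subseteq> ext B0" "frc P le B1 (Gd (?A n m))"
    and B2: "B2 \<in> ext P" "frc P le B2 (Gd (rc (?A n m)))" by blast
  obtain k B3 where k: "k \<in> ext omega" "empty \<in> ext k" and B3: "B3 \<in> ext P" "ext B3 \<subseteq> ext B1" "ext B3 \<subseteq> ext (pl k B2)"
    by (rule amalgamate[OF B1(1) B2(1)])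
  \<comment> \<open>\<open>B3\<close> forces three statements: digit \<open>n\<close> assigned to
    column 0 is \<open>m\<close>, digit \<open>n\<close> assigned to column \<open>k\<close> is not
    \<open>m\<close>, and the two columns are equivalent. A single real satisfying all three is then
    extracted.\<close>
  have 1: "frc P le B3 (Gd (?A n m))" by (rule forced_mono[OF B3(1) B1(1) B3(2) B1(3)])
  have 2: "frc P le B3 (Gd (Ta k (rc (?A n m))))" by (rule forced_mono[OF B3(1) pl_P(1)[OF k(1) B2(1)] B3(3) frc_pl[OF k(1) B2]])
  have 3: "frc P le B3 (Gd (?Yb b))" by (rule forced_mono[OF B3(1) B0 _ fY]) (use B3(2) B1(2) in blast)
  have 4: "frc P le B3 (Gd (ri (?A n m) (?Yb b)))" by (rule frc_imp2[OF 1 3]) (use A in \<open>unfold Gd ri, blast\<close>)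
  obtain x where x: "x \<in> ext reals" "x \<in> ext (ri (?A n m) (?Yb b))" "x \<in> ext (Ta k (rc (?A n m)))" by (rule forced_both[OF B3(1) 4 2])
  have "ap (ph (col x empty)) n = m" using x(2) unfolding ri A by blast
  moreover have "ap (ph (col x k)) n \<noteq> m" using x(3) col_xT[OF k x(1)] unfolding Ta rc A by auto
  moreover have "opair (col x empty) (col x k) \<in> ext R" using x(2) k(1) omega0 unfolding ri Yb R_def by blast
  then have "ph (col x empty) = ph (col x k)" unfolding ph_def by (simp add: cl_eq)
  ultimately show False by simp
qed

end

section \<open>The selection and the injection\<close>

context zf_model
begin

text \<open>\<open>X\<close> and its well-order come from a code of \<open>Y\<close>, which mentions
  the relations but no particular class. So \<open>sel\<close> is one definable operation, applied
  to the class alone.\<close>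

lemma well_ordered_choice:
  assumes "AD_plus" and \<kappa>: "ordinal \<kappa>" and E: "func E \<kappa> b"
    and er: "\<And>a. a \<in> ext \<kappa> ==> equiv_rel reals (ap E a)"
    and bij: "\<And>a. a \<in> ext \<kappa> ==> \<exists>h. bijection h (quot reals (ap E a)) reals"
    and cls: "\<And>a c. a \<in> ext \<kappa> ==> c \<in> ext (quot reals (ap E a)) ==> countable c"
  obtains sel where "F1 sel" "\<And>a c. a \<in> ext \<kappa> ==> c \<in> ext (quot reals (ap E a)) ==> sel c \<in> ext c"
proof -
  have det: Det by (rule Det_of_AD_plus[OF assms(1)])
  let ?y = "%x. \<exists>a\<in>ext \<kappa>. \<forall>i\<in>ext omega. \<forall>j\<in>ext omega. opair (col x i) (col x j) \<in> ext (ap E a)"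
  define Y where "Y = sep reals ?y"
  have dY: "D1 ?y" by (intro dfi)
  have Y: "ext Y = {x \<in> ext reals. ?y x}" unfolding Y_def by (rule ext_sep[OF dY])
  have YR: "ext Y \<subseteq> ext reals" unfolding Y by blast
  obtain S \<phi> where code: "infinity_Borel_code S \<phi> Y" using assms(1) YR unfolding AD_plus_def by blast
  have Gs: "F1 G" if "G \<in> set [%d. Ta (pfst d) (psnd d)]" for G
  proof -
    have "G = (%d. Ta (pfst d) (psnd d))" using that by simp
    moreover have "F1 (%d. Ta (pfst d) (psnd d))" by (intro dfi)
    ultimately show ?thesis by simp
  qed
  obtain X w where X: "WO w X" "omega \<in> ext X" "\<And>c. c \<in> ext X ==> ordinal c ==> ext c \<subseteq> ext X"
    "\<And>a b. a \<in> ext X ==> b \<in> ext X ==> opair a b \<in> ext X"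
    "\<And>G a. G \<in> set [%d. Ta (pfst d) (psnd d)] ==> a \<in> ext X ==> G a \<in> ext X"
    "\<And>a. a \<in> ext X ==> rc a \<in> ext X" "\<And>a b. a \<in> ext X ==> b \<in> ext X ==> ri a b \<in> ext X"
    "\<And>i j. i \<in> ext omega ==> j \<in> ext omega ==> bs (opair i j) \<in> ext X" "Y \<in> ext X"
    "\<And>L. bclosed X L ==> Y \<in> ext L"
    by (rule borel_closure[OF code, where Gs="[%d. Ta (pfst d) (psnd d)]", OF Gs]) (assumption, rule that)
  have TaX: "Ta k A \<in> ext X" if "k \<in> ext omega" "A \<in> ext X" for k A
  proof -
    have "opair k A \<in> ext X" using X(3)[OF X(2) ord_omega] that by (intro X(4)) blast+
    from X(5)[OF _ this, of "%d. Ta (pfst d) (psnd d)"] show ?thesis by simp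
  qed
  let ?dec = "%C A a. \<forall>s\<in>ext (FF C A). dom s \<noteq> empty --> ap s empty = a"
  let ?good = "%C A. ext A \<subseteq> ext reals \<and> FF C A \<noteq> empty \<and> (\<exists>a\<in>ext C. ?dec C A a)"
  define SA where "SA = (%C. lw w (sep X (?good C)))"
  have SAF: "F1 SA" unfolding SA_def by (intro dfi)
  define sel where "sel = (%C. dsc (%a. a \<in> ext C \<and> ?dec C (SA C) a))"
  have selF: "F1 sel" unfolding sel_def by (intro dfi F1D[OF SAF])
  have "sel C \<in> ext C" if a: "a \<in> ext \<kappa>" and C: "C \<in> ext (quot reals (ap E a))" for a C
  proof -
    have eR: "equiv_rel reals (ap E a)" by (rule er[OF a])
    obtain y where y: "y \<in> ext reals" "C = eq_class (ap E a) y" using C unfolding ext_quot by blast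
    note ec = ext_eq_class[OF eR]
    have yC: "y \<in> ext C" unfolding y(2) ec using eR y(1) unfolding equiv_rel_def by blast
    have cC: "ctb C" by (rule ctb_of_countable[OF cls[OF a C] yC])
    have eq2: "opair u v \<in> ext (ap E a)" if "u \<in> ext C" "v \<in> ext C" for u v
      using that eR unfolding y(2) ec equiv_rel_def by blast
    have CR: "ext C \<subseteq> ext reals"
    proof
      fix u assume "u \<in> ext C"
      then have "opair y u \<in> ext (cprod reals reals)" using eR unfolding y(2) ec equiv_rel_def by blast
      then show "u \<in> ext reals" unfolding opair_mem_cprod by blast
    qed
    interpret cf: col_forcing mem C by unfold_locales (rule det cC CR)+
    have "\<exists>A\<in>ext X. ?good C A"
    proof (rule ccontr)
      assume n: "\<not> ?thesis"
      have FY: "ext (FF C Y) = ext (fin_seqs C)"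
      proof (rule cf.F_all)
        fix g assume g: "func g omega C"
        have "opair (col (xg g) i) (col (xg g) j) \<in> ext (ap E a)" if "i \<in> ext omega" "j \<in> ext omega" for i j
          unfolding cf.col_xg[OF g that(1)] cf.col_xg[OF g that(2)] using eq2 func_ap_in[OF g] that by blast
        then show "xg g \<in> ext Y" unfolding Y using cf.xg_real[OF g] a by blast
      qed
      have und: "\<exists>s\<in>ext (FF C A). dom s \<noteq> empty \<and> ap s empty \<noteq> c"
        if "A \<in> ext X" "ext A \<subseteq> ext reals" "FF C A \<noteq> empty" "c \<in> ext C" for A c using n that by blast
      interpret pf: poset_forcing mem C X w Y
        by unfold_locales (rule X(1) YR X(9) FY | erule X(10) | erule (3) und | erule (1) X(7) X(8) TaX | erule X(6))+
      show False by (rule pf.undecided_False[OF \<kappa> er bij cls Y])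
    qed
    then obtain A where A: "A \<in> ext X" "?good C A" by blast
    have dg: "D1 (?good C)" by (intro dfi)
    have "SA C \<in> ext (sep X (?good C))" unfolding SA_def by (rule lw(1)[OF X(1), where x=A]) (use A in \<open>auto simp: ext_sep[OF dg]\<close>)
    then have g: "?good C (SA C)" unfolding ext_sep[OF dg] by blast
    then obtain c where c: "c \<in> ext C" "?dec C (SA C) c" by blast
    obtain s where s: "s \<in> ext (FF C (SA C))" using g empty_iff by blast
    have sQ: "s \<in> ext (fin_seqs C)" using s cf.F_sub by blast
    \<comment> \<open>The decision clause in \<open>?good\<close> is vacuous for the empty sequence;
      an extension of positive length makes the decided element unique.\<close>
    obtain t where t: "t \<in> ext (fin_seqs C)" "ext s \<subseteq> ext t" "ext (succ empty) \<subseteq> ext (dom t)" using fin_extend[OF yC sQ omegaS[OF omega0]] by blast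
    have tF: "t \<in> ext (FF C (SA C))" by (rule cf.F_up[OF s t(1,2)])
    have td: "dom t \<noteq> empty" using t(3) by auto
    have "sel C = c" unfolding sel_def
    proof (rule dsc_eq)
      show "c \<in> ext C \<and> ?dec C (SA C) c" using c by blast
      fix c' assume "c' \<in> ext C \<and> ?dec C (SA C) c'"
      then show "c' = c" using c(2) tF td by blast
    qed
    then show ?thesis using c(1) by simp
  qed
  then show thesis using that[OF selF] by blast
qed

text \<open>The second coordinate of the image returns the index \<open>a\<close>, and two classes
  of the same equivalence relation that share their selected element coincide.\<close>

lemma disjoint_union_injects:
  assumes "AD_plus" and \<kappa>: "ordinal \<kappa>" and E: "func E \<kappa> b"
    and er: "\<And>a. a \<in> ext \<kappa> ==> equiv_rel reals (app E a)"
    and bij: "\<And>a. a \<in> ext \<kappa> ==> \<exists>h. bijection h (quot reals (app E a)) reals"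
    and cls: "\<And>a c. a \<in> ext \<kappa> ==> c \<in> ext (quot reals (app E a)) ==> countable c"
  shows "\<exists>f. injection f (disjoint_union_quot \<kappa> E) (cprod reals \<kappa>)"
proof -
  have e: "app E a = ap E a" if "a \<in> ext \<kappa>" for a by (rule func_app[OF E that])
  have er': "equiv_rel reals (ap E a)" if "a \<in> ext \<kappa>" for a using er[OF that] e[OF that] by simp
  obtain sel where sF: "F1 sel" and sel: "\<And>a c. a \<in> ext \<kappa> ==> c \<in> ext (quot reals (ap E a)) ==> sel c \<in> ext c"
  proof (rule well_ordered_choice[OF assms(1) \<kappa> E er'])
    show "\<exists>h. bijection h (quot reals (ap E a)) reals" if "a \<in> ext \<kappa>" for a using bij[OF that] e[OF that] by simp
    show "countable c" if "a \<in> ext \<kappa>" "c \<in> ext (quot reals (ap E a))" for a c using cls[of a c] that e[OF that(1)] by simp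
  qed (assumption, rule that)
  have cR: "ext c \<subseteq> ext reals" if a: "a \<in> ext \<kappa>" and c: "c \<in> ext (quot reals (ap E a))" for a c
  proof
    fix u assume u: "u \<in> ext c"
    obtain y where "y \<in> ext reals" "c = eq_class (ap E a) y" using c unfolding ext_quot by blast
    then have "opair y u \<in> ext (cprod reals reals)" using u er'[OF a] ext_eq_class[OF er'[OF a]] unfolding equiv_rel_def by blast
    then show "u \<in> ext reals" unfolding opair_mem_cprod by blast
  qed
  let ?q = "%p. psnd p \<in> ext (quot reals (ap E (pfst p)))"
  have dq: "D1 ?q" by (intro dfi)
  define U where "U = sep (cprod \<kappa> (pow reals)) ?q"
  have U: "ext U = {opair a c | a c. a \<in> ext \<kappa> \<and> c \<in> ext (quot reals (ap E a))}"
    unfolding U_def ext_sep[OF dq] using cR by (auto simp: ext_pow)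
  have "{opair a c | a c. a \<in> ext \<kappa> \<and> c \<in> ext (quot reals (app E a))} = ext U" unfolding U using e by auto
  then have DU: "disjoint_union_quot \<kappa> E = U" unfolding disjoint_union_quot_def by simp
  let ?g = "%p. opair (sel (psnd p)) (pfst p)"
  have gF: "F1 ?g" by (intro dfi F1D[OF sF])
  have f: "func (lam U ?g) U (cprod reals \<kappa>)"
  proof (rule lam_func[OF gF])
    fix p assume "p \<in> ext U"
    then obtain a c where p: "p = opair a c" "a \<in> ext \<kappa>" "c \<in> ext (quot reals (ap E a))" unfolding U by blast
    show "?g p \<in> ext (cprod reals \<kappa>)" unfolding opair_mem_cprod p(1) using sel[OF p(2,3)] cR[OF p(2,3)] p(2) by auto
  qed
  have "inj_on (app (lam U ?g)) (ext U)"
  proof (rule inj_onI)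
    fix p p' assume p: "p \<in> ext U" "p' \<in> ext U" "app (lam U ?g) p = app (lam U ?g) p'"
    have eq: "?g p = ?g p'" using p(3) func_app[OF f p(1)] func_app[OF f p(2)] ap_lam[OF gF p(1)] ap_lam[OF gF p(2)] by simp
    obtain a c where pc: "p = opair a c" "a \<in> ext \<kappa>" "c \<in> ext (quot reals (ap E a))" using p(1) unfolding U by blast
    obtain a' c' where pc': "p' = opair a' c'" "a' \<in> ext \<kappa>" "c' \<in> ext (quot reals (ap E a'))" using p(2) unfolding U by blast
    have aa: "a' = a" and ss: "sel c = sel c'" using eq unfolding pc(1) pc'(1) by simp_all
    note ec = ext_eq_class[OF er'[OF pc(2)]]
    obtain y y' where y: "c = eq_class (ap E a) y" "c' = eq_class (ap E a) y'" using pc(3) pc'(3) unfolding aa ext_quot by blast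
    have s: "sel c \<in> ext c" "sel c \<in> ext c'" using sel[OF pc(2,3)] sel[OF pc'(2,3)] ss by simp_all
    have yy: "opair y (sel c) \<in> ext (ap E a)" "opair y' (sel c) \<in> ext (ap E a)" using s unfolding y ec by blast+
    have sy: "\<And>u v. opair u v \<in> ext (ap E a) ==> opair v u \<in> ext (ap E a)"
      and tr: "\<And>u v t. opair u v \<in> ext (ap E a) ==> opair v t \<in> ext (ap E a) ==> opair u t \<in> ext (ap E a)"
      using er'[OF pc(2)] unfolding equiv_rel_def by blast+
    have "c = c'" unfolding y by (rule ext_inject, unfold ec) (use yy sy tr in blast)
    then show "p = p'" using aa pc(1) pc'(1) by simp
  qed
  then show ?thesis unfolding DU injection_def using f by blast
qed

end

theorem theorem5p4:
  fixes mem :: "'a \<Rightarrow> 'a \<Rightarrow> bool" and \<kappa> E :: 'a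
  assumes "zf_model mem"
    and "set_structure.AD_plus mem"
    and "set_structure.V_eq_L_Pow_reals mem"
    and "set_structure.ordinal mem \<kappa>"
    and "\<exists>b. set_structure.func mem E \<kappa> b"
    and "\<And>\<alpha>. mem \<alpha> \<kappa> \<Longrightarrow>
      set_structure.equiv_rel mem (set_structure.reals mem) (set_structure.app mem E \<alpha>)"
    and "\<And>\<alpha>. mem \<alpha> \<kappa> \<Longrightarrow>
      \<exists>f. set_structure.bijection mem f
        (set_structure.quot mem (set_structure.reals mem) (set_structure.app mem E \<alpha>))
        (set_structure.reals mem)"
    and "\<And>\<alpha> c. mem \<alpha> \<kappa> \<Longrightarrow>
      mem c (set_structure.quot mem (set_structure.reals mem) (set_structure.app mem E \<alpha>)) \<Longrightarrow>
      set_structure.countable mem c"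
  shows "\<exists>f. set_structure.injection mem f
    (set_structure.disjoint_union_quot mem \<kappa> E)
    (set_structure.cprod mem (set_structure.reals mem) \<kappa>)"
proof -
  interpret zf_model mem by (rule assms(1))
  obtain b where b: "func E \<kappa> b" using assms(5) by blast
  show ?thesis
  proof (rule disjoint_union_injects[OF assms(2,4) b])
    show "equiv_rel reals (app E a)" if "a \<in> ext \<kappa>" for a using assms(6) that unfolding ext_def by simp
    show "\<exists>h. bijection h (quot reals (app E a)) reals" if "a \<in> ext \<kappa>" for a using assms(7) that unfolding ext_def by simp
    show "countable c" if "a \<in> ext \<kappa>" "c \<in> ext (quot reals (app E a))" for a c using assms(8) that unfolding ext_def by simp
  qed
qed

end
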